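(* Let $(a_i)_{i\ge1}$ be i.i.d. real random variables, almost surely nonzero, with $\sigma^2=\mathrm{Var}\,\log|a_i|<\infty$, and let $H_n$ be the restriction to an interval of length $n+1$ of the random Schroedinger operator $(Hf)(i)=a_{i-1}f(i-1)+a_if(i+1)$. For $t,\eta>0$ let $\Lambda_n(t,\eta)$ be the number of eigenvalues of $H_{\lfloor tn\rfloor}$ in the interval $(0,e^{-\eta\sqrt n})$, and let $\Lambda(t,\eta)$ be the maximal number of pairwise disjoint $\eta$-wells that a Brownian motion with variance $\sigma^2$ (the same Brownian motion for all $(t,\eta)$) makes inside the interval $[0,t]$. Then, along subsequences of $n$ for which $\lfloor tn\rfloor$ is odd, the process $\Lambda_n$ converges to the process $\Lambda$ in the sense of finite-dimensional distributions: for all $(t_1,\eta_1),\dots,(t_k,\eta_k)\in(0,\infty)^2$, as $n\to\infty$ along any infinite set of $n$ such that $\lfloor t_jn\rfloor$ is odd for every $j=1,\dots,k$, the vector $(\Lambda_n(t_1,\eta_1),\dots,\Lambda_n(t_k,\eta_k))$ converges in distribution to $(\Lambda(t_1,\eta_1),\dots,\Lambda(t_k,\eta_k))$.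
   Context: $H_m$ is the symmetric $(m+1)\times(m+1)$ matrix indexed by $\{1,\dots,m+1\}$ with $(H_m)_{i,i+1}=(H_m)_{i+1,i}=a_i$ for $1\le i\le m$ and all other entries $0$. Brownian motion with variance $\sigma^2$: $X(s)=\sigma B(s)$, $B$ standard Brownian motion started at $0$. Wells: for a function $X$ on $[0,T]$ and $s>0$, an interval $[a,b]\subseteq[0,T]$ is an $s$-well of $X$ if (1) $b=T$ or $X(a)=X(b)$; and (2) $X(a)>X(x)$ for all $x\in(a,b)$ and $X(a)-X(x)\ge s$ for some $x\in(a,b)$. The wells of $X$ inside $[0,t]$ are those of $X$ restricted to $[0,t]$ (so $T=t$). *)

theory Defs
  imports "HOL-Probability.Probability" "Jordan_Normal_Form.Char_Poly"
begin

(* Rows and columns are numbered from 0 here, so the entry in position (i, i+1) of the usual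
   1-based numbering sits at (i-1, i); the sequence a is only used at indices 1, ..., m. *)
definition schroedinger_mat :: "(nat \<Rightarrow> real) \<Rightarrow> nat \<Rightarrow> real mat" where
  "schroedinger_mat a m = mat (m + 1) (m + 1)
     (\<lambda>(i, j). if j = i + 1 then a j else if i = j + 1 then a i else 0)"

(* Eigenvalues are counted with multiplicity. For a symmetric matrix the algebraic and the
   geometric multiplicities agree, and for schroedinger_mat with nonzero a all of them are 1. *)
definition num_eigenvalues_in :: "real mat \<Rightarrow> real set \<Rightarrow> nat" where
  "num_eigenvalues_in A S = (\<Sum>x \<in> {x \<in> S. eigenvalue A x}. order x (char_poly A))"

definition eigenvalue_count :: "(nat \<Rightarrow> real) \<Rightarrow> nat \<Rightarrow> real \<Rightarrow> real \<Rightarrow> nat" where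
  "eigenvalue_count a n t \<eta> =
     num_eigenvalues_in (schroedinger_mat a (nat \<lfloor>t * real n\<rfloor>)) {0<..<exp (- \<eta> * sqrt (real n))}"

definition is_well :: "real \<Rightarrow> real \<Rightarrow> (real \<Rightarrow> real) \<Rightarrow> real \<Rightarrow> real \<Rightarrow> bool" where
  "is_well s T X a b \<longleftrightarrow> {a..b} \<subseteq> {0..T} \<and> (b = T \<or> X a = X b) \<and>
     (\<forall>x\<in>{a<..<b}. X a > X x) \<and> (\<exists>x\<in>{a<..<b}. X a - X x \<ge> s)"

definition wells :: "real \<Rightarrow> real \<Rightarrow> (real \<Rightarrow> real) \<Rightarrow> real set set" where
  "wells s T X = {{a..b} | a b. is_well s T X a b}"

(* For s > 0 and X continuous on {0..T} the supremum is an attained maximum,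
   see disjoint_wells_bounded below. *)
definition max_disjoint_wells :: "(real \<Rightarrow> real) \<Rightarrow> real \<Rightarrow> real \<Rightarrow> nat" where
  "max_disjoint_wells X t \<eta> = (SUP W \<in> {W. W \<subseteq> wells \<eta> t X \<and> finite W \<and> disjoint W}. card W)"

definition standard_brownian_motion :: "'b measure \<Rightarrow> (real \<Rightarrow> 'b \<Rightarrow> real) \<Rightarrow> bool" where
  "standard_brownian_motion N B \<longleftrightarrow>
     prob_space N \<and>
     (\<forall>s\<ge>0. B s \<in> borel_measurable N) \<and>
     (AE \<omega> in N. B 0 \<omega> = 0) \<and>
     (\<forall>n (\<tau> :: nat \<Rightarrow> real). 0 \<le> \<tau> 0 \<and> (\<forall>i<n. \<tau> i < \<tau> (Suc i)) \<longrightarrow>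
        prob_space.indep_vars N (\<lambda>_. borel) (\<lambda>i \<omega>. B (\<tau> (Suc i)) \<omega> - B (\<tau> i) \<omega>) {..<n}) \<and>
     (\<forall>s u. 0 \<le> s \<and> s < u \<longrightarrow>
        distributed N lborel (\<lambda>\<omega>. B u \<omega> - B s \<omega>) (normal_density 0 (sqrt (u - s)))) \<and>
     (\<forall>\<omega>\<in>space N. continuous_on {0..} (\<lambda>s. B s \<omega>))"

(* The library's weak convergence only covers measures on the real line. The X n and the limit Y
   may live on different probability spaces. Measurability is part of the claim,
   as the Bochner integral of a non-measurable function is 0. *)
definition converges_in_distribution ::
  "'a measure \<Rightarrow> ('i \<Rightarrow> 'a \<Rightarrow> 'c::topological_space) \<Rightarrow> 'b measure \<Rightarrow> ('b \<Rightarrow> 'c) \<Rightarrow> 'i filter \<Rightarrow> bool"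
  where
  "converges_in_distribution M X N Y F \<longleftrightarrow>
     (\<forall>n. X n \<in> borel_measurable M) \<and> Y \<in> borel_measurable N \<and>
     (\<forall>f :: 'c \<Rightarrow> real. continuous_on UNIV f \<and> bounded (range f) \<longrightarrow>
        ((\<lambda>n. \<integral>\<omega>. f (X n \<omega>) \<partial>M) \<longlongrightarrow> (\<integral>\<omega>. f (Y \<omega>) \<partial>N)) F)"

lemma disjoint_wells_bounded:
  fixes X :: "real \<Rightarrow> real"
  assumes "continuous_on {0..T} X" "s > 0"
  shows "bdd_above (card ` {W. W \<subseteq> wells s T X \<and> finite W \<and> disjoint W})"
proof -
  have "uniformly_continuous_on {0..T} X"
    using assms by (intro compact_uniformly_continuous) auto
  then obtain d where d: "d > 0"
    "\<And>x y. x \<in> {0..T} \<Longrightarrow> y \<in> {0..T} \<Longrightarrow> dist y x < d \<Longrightarrow> dist (X y) (X x) < s"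
    using assms(2) unfolding uniformly_continuous_on_def by metis
  have len: "d \<le> measure lborel A" "A \<in> sets lborel" "A \<subseteq> {0..T}" if "A \<in> wells s T X" for A
  proof -
    from that obtain a b where A: "A = {a..b}" and w: "is_well s T X a b"
      by (auto simp: wells_def)
    from w obtain x where x: "a < x" "x < b" "X a - X x \<ge> s" "{a..b} \<subseteq> {0..T}"
      by (auto simp: is_well_def)
    have "a \<in> {0..T}" "x \<in> {0..T}" using x by auto
    from d(2)[OF this] x(3) have "\<not> dist x a < d"
      by (auto simp: dist_real_def)
    thus "d \<le> measure lborel A" using x by (auto simp: A dist_real_def)
    show "A \<in> sets lborel" "A \<subseteq> {0..T}" using x by (auto simp: A)
  qed
  have "card W \<le> nat \<lceil>\<bar>T\<bar> / d\<rceil>" if W: "W \<subseteq> wells s T X" "finite W" "disjoint W" for W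
  proof -
    have fin: "emeasure lborel A \<noteq> \<infinity>" if "A \<in> W" for A
    proof -
      have "emeasure lborel A \<le> emeasure lborel {0..T}"
        using len(3)[of A] W that by (intro emeasure_mono) auto
      also have "\<dots> < \<infinity>" by (cases "0 \<le> T") auto
      finally show ?thesis by simp
    qed
    have "real (card W) * d \<le> (\<Sum>A\<in>W. measure lborel A)"
      using sum_mono[of W "\<lambda>_. d" "measure lborel"] len(1) W by auto
    also have "\<dots> = measure lborel (\<Union>A\<in>W. A)"
      using W len(2) fin
      by (intro measure_finite_Union[symmetric])
         (auto simp: disjoint_family_on_def disjoint_def)
    also have "\<dots> \<le> measure lborel {0..T}"
    proof (rule measure_mono_fmeasurable)
      show "(\<Union>A\<in>W. A) \<subseteq> {0..T}" using W len(3) by blast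
      show "(\<Union>A\<in>W. A) \<in> sets lborel" using W len(2) by (intro sets.finite_UN) auto
      show "{0..T} \<in> fmeasurable lborel" by (cases "0 \<le> T") (auto simp: fmeasurable_def)
    qed
    also have "\<dots> \<le> \<bar>T\<bar>" by (cases "0 \<le> T") auto
    finally have "real (card W) \<le> \<bar>T\<bar> / d" using d(1) by (simp add: field_simps)
    thus ?thesis by linarith
  qed
  thus ?thesis by (auto simp: bdd_above_def)
qed

end

theory Submission
  imports Defs
begin

text \<open>
  The matrix is a Jacobi matrix with zero diagonal, so the characteristic
  polynomials of its leading blocks satisfy a three-term recursion, and the blocks of even (odd) size
  have even (odd) polynomials. Writing them as \<open>F\<^sub>j\<close> and \<open>x G\<^sub>j\<close> in the variable \<open>y = x\<^sup>2\<close> and normalising,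
  the recursion becomes

    \<open>F\<^bsub>j+1\<^esub> = F\<^sub>j - y \<beta>\<^sub>j G\<^sub>j\<close>  and  \<open>G\<^bsub>j+1\<^esub> = G\<^sub>j + \<alpha>\<^bsub>j+1\<^esub> F\<^bsub>j+1\<^esub>\<close>,

  where \<open>\<alpha>\<^sub>j = exp (2 S\<^sub>j)\<close>, \<open>\<beta>\<^sub>j\<close> is \<open>exp (- 2 S\<^sub>j)\<close> up to one factor \<open>a\<^sup>2\<close>, and \<open>S\<close> is the random walk
  with steps \<open>ln |a\<^bsub>2i+1\<^esub>| - ln |a\<^bsub>2i+2\<^esub>|\<close>. The zeros of these polynomials are positive, simple and
  interlacing (\<open>sturm_interlacing\<close>), so the number of zeros of \<open>F\<^sub>N\<close> below \<open>exp (- 2 L)\<close>, which is the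
  number of eigenvalues in \<open>(0, exp (- L))\<close>, can be followed along the recursion like a Sturm sequence.
  One more zero of \<open>F\<close> needs a descent of \<open>S\<close> by about \<open>L\<close>, and the next zero of \<open>G\<close> needs an ascent by
  about \<open>L\<close>; up to an error \<open>ln N + max |ln |a||\<close>, which is negligible against \<open>\<surd>n\<close>, the eigenvalue count
  is therefore the largest number \<open>k\<close> of descents by \<open>L\<close> that \<open>S\<close> makes with ascents by \<open>L\<close> between them
  (\<open>num_eigenvalues_ge_of_alternates\<close>, \<open>alternates_of_num_eigenvalues\<close>; the predicate \<open>alternates\<close>).

  On the Brownian side, at least \<open>k\<close> disjoint \<open>\<eta>\<close>-wells force such an alternation with level \<open>\<eta>\<close>, and an
  alternation with a slightly larger level produces \<open>k\<close> disjoint \<open>\<eta>\<close>-wells (\<open>alternates_of_wells\<close>,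
  \<open>wells_of_alternates\<close>). The time change \<open>S\<^bsub>nt/2\<^esub> \<approx> \<surd>n \<sigma> B\<^sub>t\<close> is right because the steps of \<open>S\<close> have variance
  \<open>2 \<sigma>\<^sup>2\<close> and there are \<open>n t / 2\<close> of them.

  What remains is an invariance principle for the alternation events. It is proved by hand:
  the walk is observed at the ends of long blocks, the finitely many block increments are coupled with
  Gaussian ones (\<open>weak_conv_product_coupling\<close>, from the central limit theorem and the Skorohod
  representation), and the oscillation inside the blocks is controlled by Ottaviani's inequality.
  Each comparison loses a factor slightly different from \<open>1\<close> in the levels. Diffusive scaling moves such
  factors into the time horizons, where they do no harm: the Brownian alternation probability is
  continuous in time, because a given time is almost surely not a strict minimum of the path from the left
  (\<open>brownian_alternates_time_continuity\<close>).

  Finally, convergence of all joint survival functions \<open>P (\<forall>j. k\<^sub>j \<le> V\<^sub>j)\<close> of vectors of natural numbers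
  is convergence in distribution (\<open>converges_in_distribution_nat_vector\<close>).
\<close>

section \<open>Characteristic polynomials of Jacobi matrices with zero diagonal\<close>

fun jacobi_poly :: "(nat \<Rightarrow> real) \<Rightarrow> nat \<Rightarrow> real poly" where
  "jacobi_poly a 0 = 1"
| "jacobi_poly a (Suc 0) = [:0, 1:]"
| "jacobi_poly a (Suc (Suc n)) =
     [:0, 1:] * jacobi_poly a (Suc n) - Polynomial.smult ((a (Suc n))\<^sup>2) (jacobi_poly a n)"

text \<open>The matrix \<open>x I - H\<close>, written with polynomial entries so that its determinant can
  be expanded.\<close>
definition jacobi_mat :: "(nat \<Rightarrow> real) \<Rightarrow> nat \<Rightarrow> real poly mat" where
  "jacobi_mat a n = mat n n (\<lambda>(i, j). if i = j then [:0, 1:] else if j = Suc i then [:- a j:]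
     else if i = Suc j then [:- a i:] else 0)"

lemma jacobi_mat_carrier [simp]: "jacobi_mat a n \<in> carrier_mat n n"
  by (simp add: jacobi_mat_def)

text \<open>Expansion along the last row leaves two minors; the off-diagonal one has a single nonzero entry
  in its last column and is expanded again.\<close>
lemma det_jacobi_mat_Suc_Suc:
  "det (jacobi_mat a (Suc (Suc n))) =
     [:0, 1:] * det (jacobi_mat a (Suc n)) - Polynomial.smult ((a (Suc n))\<^sup>2) (det (jacobi_mat a n))"
proof -
  let ?T = "jacobi_mat a (Suc (Suc n))"
  define C where "C = mat_delete ?T (Suc n) n"
  have C: "C \<in> carrier_mat (Suc n) (Suc n)"
    by (simp add: C_def mat_delete_def jacobi_mat_def)
  have C1: "C $$ (i, n) = (if i = n then [:- a (Suc n):] else 0)" if "i < Suc n" for i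
    using that by (auto simp: C_def mat_delete_def jacobi_mat_def)
  have C2: "mat_delete C n n = jacobi_mat a n"
    by (rule eq_matI) (auto simp: C_def mat_delete_def jacobi_mat_def)
  have "det C = (\<Sum>i<Suc n. C $$ (i, n) * cofactor C i n)"
    by (rule laplace_expansion_column[OF C]) simp
  also have "\<dots> = (\<Sum>i<Suc n. if i = n then [:- a (Suc n):] * cofactor C n n else 0)"
    by (rule sum.cong) (auto simp: C1)
  also have "\<dots> = [:- a (Suc n):] * det (jacobi_mat a n)"
    by (simp add: cofactor_def C2)
  finally have detC: "det C = [:- a (Suc n):] * det (jacobi_mat a n)" .
  have D: "mat_delete ?T (Suc n) (Suc n) = jacobi_mat a (Suc n)"
    by (rule eq_matI) (auto simp: mat_delete_def jacobi_mat_def)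
  have "det ?T = (\<Sum>j<Suc (Suc n). ?T $$ (Suc n, j) * cofactor ?T (Suc n) j)"
    by (rule laplace_expansion_row[where i = "Suc n"]) auto
  also have "\<dots> = (\<Sum>j<n. ?T $$ (Suc n, j) * cofactor ?T (Suc n) j) +
      ?T $$ (Suc n, n) * cofactor ?T (Suc n) n + ?T $$ (Suc n, Suc n) * cofactor ?T (Suc n) (Suc n)"
    by simp
  also have "(\<Sum>j<n. ?T $$ (Suc n, j) * cofactor ?T (Suc n) j) = 0"
    by (rule sum.neutral) (auto simp: jacobi_mat_def)
  also have "cofactor ?T (Suc n) n = - det C"
    by (simp add: cofactor_def C_def)
  also have "cofactor ?T (Suc n) (Suc n) = det (jacobi_mat a (Suc n))"
    by (simp add: cofactor_def D)
  also have "?T $$ (Suc n, n) = [:- a (Suc n):]"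
    by (simp add: jacobi_mat_def)
  also have "?T $$ (Suc n, Suc n) = [:0, 1:]"
    by (simp add: jacobi_mat_def)
  finally show ?thesis
    by (simp add: detC power2_eq_square)
qed

lemma det_jacobi_mat: "det (jacobi_mat a n) = jacobi_poly a n"
proof (induction a n rule: jacobi_poly.induct)
  case (1 a)
  then show ?case by (simp add: jacobi_mat_def)
next
  case (2 a)
  have "det (jacobi_mat a (Suc 0)) = (\<Sum>j<Suc 0. jacobi_mat a (Suc 0) $$ (0, j) * cofactor (jacobi_mat a (Suc 0)) 0 j)"
    by (rule laplace_expansion_row) auto
  then show ?case by (simp add: jacobi_mat_def cofactor_def mat_delete_def)
next
  case (3 a n)
  then show ?case by (simp add: det_jacobi_mat_Suc_Suc)
qed

lemma char_poly_schroedinger_mat: "char_poly (schroedinger_mat a m) = jacobi_poly a (Suc m)"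
proof -
  have "char_poly_matrix (schroedinger_mat a m) = jacobi_mat a (Suc m)"
    by (rule eq_matI) (auto simp: char_poly_matrix_def schroedinger_mat_def jacobi_mat_def)
  then show ?thesis by (simp add: char_poly_def det_jacobi_mat)
qed

lemma jacobi_poly_Suc_nonzero: "jacobi_poly a (Suc m) \<noteq> 0"
proof -
  have "schroedinger_mat a m \<in> carrier_mat (Suc m) (Suc m)"
    by (simp add: schroedinger_mat_def)
  from degree_monic_char_poly[OF this] show ?thesis
    by (auto simp: char_poly_schroedinger_mat)
qed

section \<open>Simple positive zeros, signs and interlacing\<close>

text \<open>The product form, normalised at \<open>0\<close>, gives the sign of \<open>f\<close> anywhere in
  terms of the number of smaller zeros, and makes sense for functions as well as polynomials.\<close>
definition simple_pos_roots :: "(real \<Rightarrow> real) \<Rightarrow> nat \<Rightarrow> (nat \<Rightarrow> real) \<Rightarrow> bool" where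
  "simple_pos_roots f d r \<longleftrightarrow> strict_mono_on {..<d} r \<and> (\<forall>i<d. 0 < r i) \<and>
     (\<exists>C>0. \<forall>y. f y = C * (\<Prod>i<d. 1 - y / r i))"

definition root_count :: "(real \<Rightarrow> real) \<Rightarrow> real \<Rightarrow> nat" where
  "root_count f y = card {z. 0 < z \<and> z < y \<and> f z = 0}"

lemma simple_pos_roots_count:
  assumes "simple_pos_roots f d r"
  shows "root_count f y = card {i. i < d \<and> r i < y}"
proof -
  from assms obtain C where C: "C > 0" "\<And>y. f y = C * (\<Prod>i<d. 1 - y / r i)"
    and sm: "strict_mono_on {..<d} r" and pos: "\<And>i. i < d \<Longrightarrow> 0 < r i"
    by (auto simp: simple_pos_roots_def)
  have "{z. 0 < z \<and> z < y \<and> f z = 0} = r ` {i. i < d \<and> r i < y}"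
  proof (intro Set.set_eqI iffI)
    fix z assume z: "z \<in> {z. 0 < z \<and> z < y \<and> f z = 0}"
    then obtain i where "i < d" "1 - z / r i = 0" using C by auto
    then show "z \<in> r ` {i. i < d \<and> r i < y}"
      using pos[of i] z by (auto simp: field_simps)
  next
    fix z assume "z \<in> r ` {i. i < d \<and> r i < y}"
    then obtain i where i: "i < d" "z = r i" "r i < y" by auto
    then have "(\<Prod>i<d. 1 - z / r i) = 0" using pos[of i] by (auto intro!: bexI[of _ i])
    then show "z \<in> {z. 0 < z \<and> z < y \<and> f z = 0}" using i pos[of i] by (simp add: C(2))
  qed
  moreover have "inj_on r {i. i < d \<and> r i < y}"
    using sm by (auto simp: inj_on_def strict_mono_on_def) (metis linorder_neqE order.irrefl)
  ultimately show ?thesis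
    by (simp add: root_count_def card_image)
qed

lemma sign_prod_roots:
  fixes r :: "nat \<Rightarrow> real"
  assumes "\<forall>i<d. 0 < r i"
  shows "0 \<le> (-1) ^ card {i. i < d \<and> r i < y} * (\<Prod>i<d. 1 - y / r i)"
  using assms
proof (induction d)
  case (Suc d)
  have IH: "0 \<le> (-1) ^ card {i. i < d \<and> r i < y} * (\<Prod>i<d. 1 - y / r i)" (is "0 \<le> ?e * ?P")
    using Suc by simp
  show ?case
  proof (cases "r d < y")
    case True
    have "{i. i < Suc d \<and> r i < y} = insert d {i. i < d \<and> r i < y}"
      using True by auto
    then have 1: "(-1) ^ card {i. i < Suc d \<and> r i < y} * (\<Prod>i<Suc d. 1 - y / r i)
        = (?e * ?P) * (y / r d - 1)"
      by (simp add: algebra_simps)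
    have 2: "0 \<le> y / r d - 1" using True Suc.prems by (simp add: field_simps)
    show ?thesis unfolding 1 by (rule mult_nonneg_nonneg[OF IH 2])
  next
    case False
    then have "{i. i < Suc d \<and> r i < y} = {i. i < d \<and> r i < y}"
      by (auto simp: less_Suc_eq)
    then have 1: "(-1) ^ card {i. i < Suc d \<and> r i < y} * (\<Prod>i<Suc d. 1 - y / r i)
        = (?e * ?P) * (1 - y / r d)"
      by (simp only: prod.lessThan_Suc mult.assoc)
    have 2: "0 \<le> 1 - y / r d" using False Suc.prems by (simp add: field_simps)
    show ?thesis unfolding 1 by (rule mult_nonneg_nonneg[OF IH 2])
  qed
qed simp

text \<open>Each zero passed on the way from \<open>0\<close> to \<open>y\<close> flips one factor of the
  product. The inequality is weak because \<open>y\<close> may be a zero itself.\<close>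
lemma simple_pos_roots_sign:
  assumes "simple_pos_roots f d r"
  shows "0 \<le> (-1) ^ root_count f y * f y"
proof -
  from assms obtain C where C: "C > 0" "\<And>y. f y = C * (\<Prod>i<d. 1 - y / r i)"
    by (auto simp: simple_pos_roots_def)
  have "0 \<le> C * ((-1) ^ root_count f y * (\<Prod>i<d. 1 - y / r i))"
    using sign_prod_roots[of d r y] assms C(1)
    unfolding simple_pos_roots_count[OF assms] by (auto simp: simple_pos_roots_def)
  then show ?thesis by (simp add: C(2) algebra_simps)
qed

text \<open>The tool that propagates interlacing: \<open>d\<close> sign changes at prescribed points, the
  last one between \<open>p (d - 1)\<close> and infinity, locate all the zeros of a polynomial of degree
  \<open>d\<close>.\<close>
lemma poly_roots_between:
  fixes f :: "real poly"
  assumes deg: "degree f = d" and d: "0 < d" and p: "strict_mono_on {..<d} p" "0 \<le> p 0"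
    and sgn: "\<And>i. i < d \<Longrightarrow> 0 < (-1) ^ i * poly f (p i)"
    and lead: "0 < (-1) ^ d * lead_coeff f" and f0: "0 < poly f 0"
  obtains r where "simple_pos_roots (poly f) d r" "\<And>i. i < d \<Longrightarrow> p i < r i"
    "\<And>i. Suc i < d \<Longrightarrow> r i < p (Suc i)"
proof -
  define g where "g = Polynomial.smult ((-1) ^ d) f"
  obtain Y where Y: "\<And>y. Y \<le> y \<Longrightarrow> 0 < poly g y"
  proof -
    have "lead_coeff g > 0" using lead by (simp add: g_def)
    then have "\<exists>n. \<forall>x\<ge>n. lead_coeff g \<le> poly g x" by (rule poly_pinfty_gt_lc)
    then show ?thesis using \<open>lead_coeff g > 0\<close> that by (meson less_le_trans)
  qed
  define q where "q i = (if i < d then p i else max Y (p (d - 1)) + 1)" for i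
  have q_mono: "q i < q (Suc i)" if "i < d" for i
  proof (cases "Suc i < d")
    case True
    then show ?thesis using p(1) by (auto simp: q_def strict_mono_on_def)
  next
    case False
    then have "i = d - 1" using that by simp
    then show ?thesis using that by (auto simp: q_def max_def)
  qed
  have q_sgn: "0 < (-1) ^ i * poly f (q i)" if "i \<le> d" for i
    using that sgn Y[of "q d"] by (cases "i < d") (auto simp: q_def g_def)
  have "\<exists>z. q i < z \<and> z < q (Suc i) \<and> poly f z = 0" if "i < d" for i
  proof -
    have "poly f (q i) * poly f (q (Suc i)) < 0"
      using q_sgn[of i] q_sgn[of "Suc i"] that
      by (cases "even i") (auto simp: mult_less_0_iff)
    then show ?thesis using poly_IVT[OF q_mono[OF that]] by blast
  qed
  then obtain r where r: "\<And>i. i < d \<Longrightarrow> q i < r i" "\<And>i. i < d \<Longrightarrow> r i < q (Suc i)"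
    "\<And>i. i < d \<Longrightarrow> poly f (r i) = 0" by metis
  have rmono: "strict_mono_on {..<d} r"
  proof (rule strict_mono_onI)
    fix i j assume ij: "i \<in> {..<d}" "j \<in> {..<d}" "i < j"
    have "q (Suc i) \<le> q j"
      using ij p(1) by (cases "Suc i = j") (auto simp: q_def strict_mono_on_def intro!: less_imp_le)
    then show "r i < r j" using r(2)[of i] r(1)[of j] ij by simp
  qed
  have rpos: "0 < r i" if "i < d" for i
  proof -
    have "0 \<le> q i"
      using that p(2) d less_imp_le[OF strict_mono_onD[OF p(1), of 0 i]]
      by (cases "i = 0") (auto simp: q_def)
    then show ?thesis using r(1)[OF that] by simp
  qed
  define h where "h = (\<Prod>i<d. [:1, - 1 / r i:])"
  have inj: "inj_on r {..<d}"
    using rmono by (rule strict_mono_on_imp_inj_on)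
  have hz: "poly h (r i) = 0" if "i < d" for i
    using that rpos[OF that] by (auto simp: h_def poly_prod intro!: bexI[of _ i])
  have h0: "poly h 0 = 1" by (simp add: h_def poly_prod)
  have hdeg: "degree h \<le> d"
  proof -
    have "degree h \<le> (\<Sum>i<d. degree [:1, - 1 / r i:])"
      unfolding h_def using degree_prod_sum_le[of "{..<d}" "\<lambda>i. [:1, - 1 / r i:]"] by (simp add: o_def)
    also have "\<dots> \<le> (\<Sum>i<d. 1)" by (intro sum_mono) auto
    finally show ?thesis by simp
  qed
  have f_eq: "f = Polynomial.smult (poly f 0) h"
  proof (rule poly_eqI_degree[where A = "insert 0 (r ` {..<d})"])
    fix x assume "x \<in> insert 0 (r ` {..<d})"
    then show "poly f x = poly (Polynomial.smult (poly f 0) h) x"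
      using r(3) hz h0 by auto
  next
    have "0 \<notin> r ` {..<d}" using rpos by force
    then have "card (insert 0 (r ` {..<d})) = Suc d"
      using inj by (simp add: card_image)
    then show "degree f < card (insert 0 (r ` {..<d}))"
      "degree (Polynomial.smult (poly f 0) h) < card (insert 0 (r ` {..<d}))"
      using deg hdeg by (auto intro: le_less_trans[OF degree_smult_le])
  qed
  have "poly f y = poly f 0 * (\<Prod>i<d. 1 - y / r i)" for y
  proof -
    have "poly f y = poly (Polynomial.smult (poly f 0) h) y"
      by (rule arg_cong[OF f_eq])
    also have "\<dots> = poly f 0 * (\<Prod>i<d. 1 - y / r i)"
      by (simp add: h_def poly_prod)
    finally show ?thesis .
  qed
  then have "simple_pos_roots (poly f) d r"
    using rmono rpos f0 unfolding simple_pos_roots_def by blast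
  moreover have "p i < r i" if "i < d" for i using r(1)[OF that] that by (simp add: q_def)
  moreover have "r i < p (Suc i)" if "Suc i < d" for i using r(2)[of i] that by (simp add: q_def)
  ultimately show ?thesis using that by blast
qed

text \<open>Two interlacing families have nearly the same number of members below any point.\<close>
lemma interlacing_count:
  fixes p r :: "nat \<Rightarrow> real"
  assumes "\<And>i. i < d \<Longrightarrow> p i < r i" "\<And>i. Suc i < d \<Longrightarrow> r i < p (Suc i)"
  shows "card {i. i < d \<and> r i < y} \<le> card {i. i < d \<and> p i < y}"
    and "card {i. i < d \<and> p i < y} \<le> Suc (card {i. i < d \<and> r i < y})"
proof -
  show "card {i. i < d \<and> r i < y} \<le> card {i. i < d \<and> p i < y}"
    using assms(1) by (intro card_mono) (auto intro: less_trans)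
  have "{i. i < d \<and> p i < y} \<subseteq> insert 0 (Suc ` {i. i < d \<and> r i < y})"
  proof
    fix i assume i: "i \<in> {i. i < d \<and> p i < y}"
    show "i \<in> insert 0 (Suc ` {i. i < d \<and> r i < y})"
    proof (cases i)
      case (Suc k)
      then have "r k < y" using assms(2)[of k] i by (auto intro: less_trans)
      then show ?thesis using Suc i by auto
    qed simp
  qed
  then have "card {i. i < d \<and> p i < y} \<le> card (insert 0 (Suc ` {i. i < d \<and> r i < y}))"
    by (intro card_mono) auto
  also have "\<dots> \<le> Suc (card (Suc ` {i. i < d \<and> r i < y}))"
    by (rule card_insert_le_m1) auto
  also have "\<dots> = Suc (card {i. i < d \<and> r i < y})" by (simp add: card_image)
  finally show "card {i. i < d \<and> p i < y} \<le> Suc (card {i. i < d \<and> r i < y})" .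
qed

section \<open>Zero counts along the two-term recursion at a fixed point\<close>

lemma between_mono:
  fixes h :: "nat \<Rightarrow> real"
  assumes "i \<le> j" "\<And>n. i \<le> n \<Longrightarrow> n < j \<Longrightarrow> h n \<le> h (Suc n)"
  shows "h i \<le> h j"
  using assms
proof (induction j rule: dec_induct)
  case (step n)
  then have "h i \<le> h n" by simp
  also have "h n \<le> h (Suc n)" using step by simp
  finally show ?case .
qed simp

lemma between_sum:
  fixes h :: "nat \<Rightarrow> real"
  assumes "i \<le> j"
  shows "h j = h i + (\<Sum>n=i..<j. h (Suc n) - h n)"
  using assms by (induction j rule: dec_induct) auto

text \<open>The reason for the error \<open>ln N\<close>: if each of at most \<open>N\<^sup>2\<close>
  products is below \<open>1 / N\<^sup>2\<close>, their sum stays below \<open>1\<close>.\<close>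
lemma sum_pairs_less_one:
  fixes x y :: "nat \<Rightarrow> real"
  assumes N: "0 < N"
    and small: "\<And>i j. j \<in> A \<Longrightarrow> i \<in> B j \<Longrightarrow> (real N)\<^sup>2 * (y i * x j) < 1"
    and fin: "\<And>j. j \<in> A \<Longrightarrow> B j \<subseteq> {..<N}" "A \<subseteq> {..<N}" "A \<noteq> {}" "\<And>j. j \<in> A \<Longrightarrow> B j \<noteq> {}"
  shows "(\<Sum>j\<in>A. x j * (\<Sum>i\<in>B j. y i)) < 1"
proof -
  have finA: "finite A" using fin(2) finite_subset by blast
  have "(\<Sum>j\<in>A. x j * (\<Sum>i\<in>B j. y i)) < (\<Sum>j\<in>A. 1 / real N)"
  proof (rule sum_strict_mono[OF finA fin(3)])
    fix j assume j: "j \<in> A"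
    have finB: "finite (B j)" using fin(1)[OF j] finite_subset by blast
    have "x j * (\<Sum>i\<in>B j. y i) = (\<Sum>i\<in>B j. y i * x j)" by (simp add: sum_distrib_left mult.commute)
    also have "\<dots> < (\<Sum>i\<in>B j. 1 / (real N)\<^sup>2)"
    proof (rule sum_strict_mono[OF finB fin(4)[OF j]])
      fix i assume "i \<in> B j"
      then have "(real N)\<^sup>2 * (y i * x j) < 1" using small j by blast
      then show "y i * x j < 1 / (real N)\<^sup>2" using N by (simp add: field_simps)
    qed
    also have "\<dots> = real (card (B j)) / (real N)\<^sup>2" by simp
    also have "\<dots> \<le> real N / (real N)\<^sup>2"
      using card_mono[of "{..<N}" "B j"] fin(1)[OF j] by (intro divide_right_mono) auto
    finally show "x j * (\<Sum>i\<in>B j. y i) < 1 / real N" using N by (simp add: power2_eq_square)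
  qed
  also have "\<dots> = real (card A) / real N" by simp
  also have "\<dots> \<le> 1" using card_mono[of "{..<N}" A] fin(2) N by (simp add: field_simps)
  finally show ?thesis .
qed

text \<open>The values of \<open>F\<^sub>j\<close> and \<open>G\<^sub>j\<close> at one point
  \<open>y\<close> (with \<open>b j = y \<beta>\<^sub>j\<close>), together with the numbers of their zeros
  in \<open>(0, y)\<close>. Only the signs forced by these numbers and the interlacing bounds between them
  enter the counting argument.\<close>
locale sturm_counts =
  fixes \<alpha> b f g :: "nat \<Rightarrow> real" and cF cG :: "nat \<Rightarrow> nat"
  assumes \<alpha>_pos: "0 < \<alpha> j" and b_pos: "0 < b j"
    and f_0: "f 0 = 1" and g_0: "g 0 = \<alpha> 0"
    and f_Suc: "f (Suc j) = f j - b j * g j"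
    and g_Suc: "g (Suc j) = g j + \<alpha> (Suc j) * f (Suc j)"
    and cF_sign: "0 \<le> (-1) ^ cF j * f j" and cG_sign: "0 \<le> (-1) ^ cG j * g j"
    and cG_le_cF: "cG j \<le> cF j" and cF_le_cG: "cF j \<le> Suc (cG j)"
    and cG_le_cF_Suc: "cG j \<le> cF (Suc j)" and cF_Suc_le_cG: "cF (Suc j) \<le> Suc (cG j)"
    and cF_0: "cF 0 = 0"
begin

text \<open>The recursion runs backwards, so a common zero would spread down to \<open>f 0 =
  1\<close>.\<close>
lemma no_common_zero: "\<not> (f j = 0 \<and> g j = 0)" and no_common_zero_Suc: "\<not> (g j = 0 \<and> f (Suc j) = 0)"
proof -
  have *: "\<not> (f j = 0 \<and> g j = 0)" for j
  proof (induction j)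
    case 0
    then show ?case by (simp add: f_0)
  next
    case (Suc j)
    then show ?case using f_Suc[of j] g_Suc[of j] by auto
  qed
  show "\<not> (f j = 0 \<and> g j = 0)" by (rule *)
  show "\<not> (g j = 0 \<and> f (Suc j) = 0)" using *[of j] f_Suc[of j] by auto
qed

text \<open>Losing a zero would need \<open>f\<close> to change its sign against the direction in which
  \<open>g\<close> pushes it; here \<open>e\<close> is the sign that \<open>g j\<close> has by its
  count.\<close>
lemma cF_Suc_mono: "cF j \<le> cF (Suc j)"
proof (rule ccontr)
  assume "\<not> cF j \<le> cF (Suc j)"
  then have c: "cF j = Suc (cG j)" "cF (Suc j) = cG j"
    using cG_le_cF_Suc[of j] cF_le_cG[of j] by auto
  define e :: real where "e = (-1) ^ cG j"
  have "0 \<le> - (e * f j)" "0 \<le> e * g j" "0 \<le> e * f (Suc j)"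
    using cF_sign[of j] cG_sign[of j] cF_sign[of "Suc j"] by (simp_all add: c e_def)
  moreover have "e * f (Suc j) = e * f j - b j * (e * g j)" by (simp add: f_Suc algebra_simps)
  moreover have "0 \<le> b j * (e * g j)" using calculation(2) b_pos[of j] by simp
  ultimately have "e * f j = 0" "b j * (e * g j) = 0" by linarith+
  then show False using no_common_zero[of j] b_pos[of j] by (simp add: e_def)
qed

lemma cG_Suc_mono: "cG j \<le> cG (Suc j)"
proof (rule ccontr)
  assume "\<not> cG j \<le> cG (Suc j)"
  then have c: "cG j = Suc (cG (Suc j))" "cF (Suc j) = cG j"
    using cG_le_cF_Suc[of j] cF_le_cG[of "Suc j"] by auto
  define e :: real where "e = (-1) ^ cG j"
  have "0 \<le> e * f (Suc j)" "0 \<le> e * g j" "0 \<le> - (e * g (Suc j))"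
    using cF_sign[of "Suc j"] cG_sign[of j] cG_sign[of "Suc j"]
    by (simp_all add: c(2) e_def) (simp add: c(1))
  moreover have "e * g (Suc j) = e * g j + \<alpha> (Suc j) * (e * f (Suc j))"
    by (simp add: g_Suc algebra_simps)
  moreover have "0 \<le> \<alpha> (Suc j) * (e * f (Suc j))" using calculation(1) \<alpha>_pos[of "Suc j"] by simp
  ultimately have "e * g j = 0" "\<alpha> (Suc j) * (e * f (Suc j)) = 0" by linarith+
  then show False using no_common_zero_Suc[of j] \<alpha>_pos[of "Suc j"] by (simp add: e_def)
qed

lemma cF_mono: "i \<le> j \<Longrightarrow> cF i \<le> cF j"
  by (rule lift_Suc_mono_le[of cF]) (rule cF_Suc_mono)

lemma cG_mono: "i \<le> j \<Longrightarrow> cG i \<le> cG j"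
  by (rule lift_Suc_mono_le[of cG]) (rule cG_Suc_mono)

lemma e_f_Suc: "e * f (Suc j) = e * f j - b j * (e * g j)"
  by (simp add: f_Suc algebra_simps)

lemma e_g_Suc: "e * g (Suc j) = e * g j + \<alpha> (Suc j) * (e * f (Suc j))"
  by (simp add: g_Suc algebra_simps)

text \<open>A large product \<open>\<alpha> i * b j\<close> with \<open>i \<le> j\<close> forces a new zero
  of \<open>f\<close>: while both counts stay at \<open>l\<close>, the signed \<open>f\<close> only
  decreases and the signed \<open>g\<close> only increases, so after \<open>\<alpha> i\<close> has made
  \<open>g\<close> large relative to \<open>f\<close>, subtracting \<open>b j * g j\<close> drives
  \<open>f\<close> through zero. The half-weight inequality is the form in which this largeness is handed on
  from one phase to the next; halving leaves room for the old value, and two halves account for the constant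
  \<open>4\<close>.\<close>
lemma valley_step:
  assumes ij: "i \<le> j" and big: "4 \<le> \<alpha> i * b j" and l: "l \<le> cG i"
    and half: "cF i = l \<Longrightarrow> cG i = l \<Longrightarrow> \<alpha> i / 2 * ((-1) ^ l * f i) \<le> (-1) ^ l * g i"
  shows "Suc l \<le> cF (Suc j)"
    and "cG j = l \<Longrightarrow> cF (Suc j) = Suc l \<Longrightarrow> b j / 2 * ((-1) ^ l * g j) \<le> - ((-1) ^ l * f (Suc j))"
proof -
  define e :: real where "e = (-1) ^ l"
  have *: "Suc l \<le> cF (Suc j) \<and> b j / 2 * (e * g j) \<le> - (e * f (Suc j))" if cGj: "cG j = l"
  proof -
    have cG: "cG n = l" if "i \<le> n" "n \<le> j" for n
      using cG_mono[of i n] cG_mono[of n j] that l cGj by simp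
    have g_pos: "0 \<le> e * g n" if "i \<le> n" "n \<le> j" for n
      using cG_sign[of n] by (simp add: cG that e_def)
    show ?thesis
    proof (cases "cF j = l")
      case False
      then have "cF j = Suc l" using cF_le_cG[of j] cG_le_cF[of j] cGj by simp
      then have "e * f j \<le> 0" using cF_sign[of j] by (simp add: e_def)
      moreover have "Suc l \<le> cF (Suc j)" using \<open>cF j = Suc l\<close> cF_Suc_mono[of j] by simp
      moreover have "0 \<le> b j * (e * g j)" using g_pos[of j] ij b_pos[of j] by simp
      moreover have "b j / 2 * (e * g j) = b j * (e * g j) / 2" by simp
      ultimately show ?thesis using e_f_Suc[of e j] by linarith
    next
      case True
      have cF: "cF n = l" if "i \<le> n" "n \<le> j" for n
        using cG_le_cF[of n] cG[OF that] cF_mono[of n j] that True by simp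
      have f_pos: "0 \<le> e * f n" if "i \<le> n" "n \<le> j" for n
        using cF_sign[of n] by (simp add: cF that e_def)
      have "- (e * f i) \<le> - (e * f j)"
      proof (rule between_mono[OF ij])
        fix n assume "i \<le> n" "n < j"
        then show "- (e * f n) \<le> - (e * f (Suc n))"
          using g_pos[of n] b_pos[of n] by (simp add: e_f_Suc)
      qed
      moreover have "e * g i \<le> e * g j"
      proof (rule between_mono[OF ij])
        fix n assume "i \<le> n" "n < j"
        then show "e * g n \<le> e * g (Suc n)"
          using f_pos[of "Suc n"] \<alpha>_pos[of "Suc n"] by (simp add: e_g_Suc)
      qed
      moreover have "\<alpha> i / 2 * (e * f i) \<le> e * g i"
        using half cF[of i] cG[of i] ij by (simp add: e_def)
      moreover have "\<alpha> i / 2 * (e * f j) \<le> \<alpha> i / 2 * (e * f i)"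
        using calculation(1) \<alpha>_pos[of i] by simp
      ultimately have "\<alpha> i / 2 * (e * f j) \<le> e * g j" by linarith
      then have "b j / 2 * (\<alpha> i / 2 * (e * f j)) \<le> b j / 2 * (e * g j)"
        using b_pos[of j] by (intro mult_left_mono) auto
      moreover have "4 * (e * f j) \<le> (\<alpha> i * b j) * (e * f j)"
        using big f_pos[of j] ij by (intro mult_right_mono) auto
      ultimately have fj: "e * f j \<le> b j / 2 * (e * g j)" by (simp add: algebra_simps)
      moreover have "b j / 2 * (e * g j) = b j * (e * g j) / 2" by simp
      ultimately have le: "b j / 2 * (e * g j) \<le> - (e * f (Suc j))"
        using e_f_Suc[of e j] by linarith
      have "cF (Suc j) \<noteq> l"
      proof
        assume "cF (Suc j) = l"
        then have "0 \<le> e * f (Suc j)" using cF_sign[of "Suc j"] by (simp add: e_def)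
        then have "b j / 2 * (e * g j) \<le> 0" using le by simp
        then have "\<not> 0 < e * g j"
          using mult_pos_pos[of "b j / 2" "e * g j"] b_pos[of j] by linarith
        then have gj: "e * g j = 0" using g_pos[OF ij order_refl] by linarith
        moreover have "e * f j \<le> 0" using fj by (simp only: gj mult_zero_right)
        then have "e * f j = 0" using f_pos[OF ij order_refl] by simp
        ultimately show False using no_common_zero[of j] by (simp add: e_def)
      qed
      then have "Suc l \<le> cF (Suc j)" using cG_le_cF_Suc[of j] cGj by simp
      then show ?thesis using le by simp
    qed
  qed
  show "Suc l \<le> cF (Suc j)"
  proof (cases "cG j = l")
    case False
    then have "Suc l \<le> cG j" using cG_mono[OF ij] l by simp
    then show ?thesis using cG_le_cF_Suc[of j] by simp
  qed (use * in simp)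
  show "b j / 2 * ((-1) ^ l * g j) \<le> - ((-1) ^ l * f (Suc j))" if "cG j = l"
    using *[OF that] by (simp add: e_def)
qed

text \<open>The mirror image of \<open>valley_step\<close>, with the roles of \<open>f\<close> and
  \<open>g\<close> exchanged: now \<open>f\<close> drives \<open>g\<close> through zero.\<close>
lemma peak_step:
  assumes ij: "j < i" and big: "4 \<le> \<alpha> i * b j" and l: "Suc l \<le> cF (Suc j)"
    and half: "cG j = l \<Longrightarrow> cF (Suc j) = Suc l \<Longrightarrow>
      b j / 2 * ((-1) ^ l * g j) \<le> - ((-1) ^ l * f (Suc j))"
  shows "Suc l \<le> cG i"
    and "cF i = Suc l \<Longrightarrow> cG i = Suc l \<Longrightarrow>
      \<alpha> i / 2 * ((-1) ^ Suc l * f i) \<le> (-1) ^ Suc l * g i"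
proof -
  define e :: real where "e = (-1) ^ Suc l"
  from ij obtain i' where i': "i = Suc i'" "j \<le> i'" by (metis Suc_le_D Suc_le_eq Suc_le_mono)
  have *: "Suc l \<le> cG i \<and> \<alpha> i / 2 * (e * f i) \<le> e * g i" if cFi: "cF i = Suc l"
  proof -
    have cF: "cF n = Suc l" if "j < n" "n \<le> i" for n
      using cF_mono[of "Suc j" n] cF_mono[of n i] that l cFi by simp
    have f_pos: "0 \<le> e * f n" if "j < n" "n \<le> i" for n
      using cF_sign[of n] by (simp add: cF that e_def)
    have Gi: "e * g i = e * g i' + \<alpha> i * (e * f i)" using e_g_Suc[of e i'] i' by simp
    show ?thesis
    proof (cases "cG i' = l")
      case False
      then have "cG i' = Suc l" using cG_le_cF_Suc[of i'] cF_Suc_le_cG[of i'] cFi i' by simp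
      then have "0 \<le> e * g i'" using cG_sign[of i'] by (simp add: e_def)
      moreover have "Suc l \<le> cG i" using \<open>cG i' = Suc l\<close> cG_Suc_mono[of i'] i' by simp
      moreover have "0 \<le> \<alpha> i * (e * f i)" using f_pos[of i] ij \<alpha>_pos[of i] by simp
      moreover have "\<alpha> i / 2 * (e * f i) = \<alpha> i * (e * f i) / 2" by simp
      ultimately show ?thesis using Gi by linarith
    next
      case True
      have cG: "cG n = l" if "j \<le> n" "n \<le> i'" for n
        using cF_Suc_le_cG[of n] cF[of "Suc n"] cG_mono[of n i'] that True i' by simp
      have g_pos: "0 \<le> - (e * g n)" if "j \<le> n" "n \<le> i'" for n
        using cG_sign[of n] by (simp add: cG that e_def)
      have "e * f (Suc j) \<le> e * f i"
      proof (rule between_mono)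
        show "Suc j \<le> i" using ij by simp
        fix n assume "Suc j \<le> n" "n < i"
        then show "e * f n \<le> e * f (Suc n)"
          using g_pos[of n] b_pos[of n] i' by (simp add: e_f_Suc mult_le_0_iff)
      qed
      moreover have gmono: "e * g j \<le> e * g i'"
      proof (rule between_mono[OF i'(2)])
        fix n assume "j \<le> n" "n < i'"
        then show "e * g n \<le> e * g (Suc n)"
          using f_pos[of "Suc n"] \<alpha>_pos[of "Suc n"] i' by (simp add: e_g_Suc)
      qed
      moreover have "b j / 2 * - (e * g j) \<le> e * f (Suc j)"
        using half cF[of "Suc j"] cG[of j] ij i' by (simp add: e_def)
      moreover have "b j / 2 * - (e * g i') \<le> b j / 2 * - (e * g j)"
        using gmono b_pos[of j] by (intro mult_left_mono) auto
      ultimately have "b j / 2 * - (e * g i') \<le> e * f i" by linarith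
      then have "\<alpha> i / 2 * (b j / 2 * - (e * g i')) \<le> \<alpha> i / 2 * (e * f i)"
        using \<alpha>_pos[of i] by (intro mult_left_mono) auto
      moreover have "4 * - (e * g i') \<le> (\<alpha> i * b j) * - (e * g i')"
        using big g_pos[of i'] i' by (intro mult_right_mono) auto
      ultimately have gi: "- (e * g i') \<le> \<alpha> i / 2 * (e * f i)" by (simp add: algebra_simps)
      moreover have "\<alpha> i / 2 * (e * f i) = \<alpha> i * (e * f i) / 2" by simp
      ultimately have le: "\<alpha> i / 2 * (e * f i) \<le> e * g i" using Gi by linarith
      have "cG i \<noteq> l"
      proof
        assume "cG i = l"
        then have "0 \<le> - (e * g i)" using cG_sign[of i] by (simp add: e_def)
        then have "\<alpha> i / 2 * (e * f i) \<le> 0" using le by simp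
        then have "\<not> 0 < e * f i"
          using mult_pos_pos[of "\<alpha> i / 2" "e * f i"] \<alpha>_pos[of i] by linarith
        then have fi: "e * f i = 0" using f_pos[OF ij order_refl] by linarith
        moreover have "- (e * g i') \<le> 0" using gi by (simp only: fi mult_zero_right)
        then have "e * g i' = 0" using g_pos[OF i'(2)] i' by simp
        ultimately show False using no_common_zero_Suc[of i'] i' by (simp add: e_def)
      qed
      then have "Suc l \<le> cG i" using cF_le_cG[of i] cFi by simp
      then show ?thesis using le by simp
    qed
  qed
  show "Suc l \<le> cG i"
  proof (cases "cF i = Suc l")
    case False
    then have "Suc (Suc l) \<le> cF i" using cF_mono[of "Suc j" i] l ij by simp
    then show ?thesis using cF_le_cG[of i] by simp
  qed (use * in simp)
  show "\<alpha> i / 2 * ((-1) ^ Suc l * f i) \<le> (-1) ^ Suc l * g i" if "cF i = Suc l"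
    using *[OF that] by (simp add: e_def)
qed

text \<open>Alternating \<open>valley_step\<close> and \<open>peak_step\<close> along \<open>u 0 \<le> v 0 <
  u 1 \<le> v 1 < \<dots>\<close> gains one zero in each round.\<close>
lemma count_ge_alternation:
  assumes uv: "\<And>l. l < k \<Longrightarrow> u l \<le> v l" "\<And>l. l < k \<Longrightarrow> 4 \<le> \<alpha> (u l) * b (v l)"
    and vu: "\<And>l. Suc l < k \<Longrightarrow> v l < u (Suc l)" "\<And>l. Suc l < k \<Longrightarrow> 4 \<le> \<alpha> (u (Suc l)) * b (v l)"
    and k: "l < k"
  shows "Suc l \<le> cF (Suc (v l))"
proof -
  have "l \<le> cG (u l) \<and> (cF (u l) = l \<longrightarrow> cG (u l) = l \<longrightarrow>
      \<alpha> (u l) / 2 * ((-1) ^ l * f (u l)) \<le> (-1) ^ l * g (u l))"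
    using k
  proof (induction l)
    case 0
    have "\<alpha> (u 0) / 2 * f (u 0) \<le> g (u 0)" if "cF (u 0) = 0" "cG (u 0) = 0"
    proof -
      have f: "0 \<le> f (u 0)" using cF_sign[of "u 0"] that by simp
      have "\<alpha> (u 0) * f (u 0) \<le> g (u 0)"
      proof (cases "u 0")
        case 0
        then show ?thesis by (simp add: f_0 g_0)
      next
        case (Suc n)
        have "cG n = 0" using cG_mono[of n "u 0"] that Suc by simp
        then show ?thesis using cG_sign[of n] by (simp add: Suc g_Suc)
      qed
      moreover have "\<alpha> (u 0) / 2 * f (u 0) \<le> \<alpha> (u 0) * f (u 0)"
        using f \<alpha>_pos[of "u 0"] by (intro mult_right_mono) auto
      ultimately show ?thesis by simp
    qed
    then show ?case by simp
  next
    case (Suc l)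
    note IH = Suc.IH[OF Suc_lessD[OF Suc.prems]]
    have l: "l < k" using Suc.prems by simp
    note V = valley_step[OF uv(1)[OF l] uv(2)[OF l], of l]
    note P = peak_step[OF vu(1)[OF Suc.prems] vu(2)[OF Suc.prems], of l]
    show ?case using IH V P by blast
  qed
  then show ?thesis using valley_step(1)[OF uv(1)[OF k] uv(2)[OF k], of l] by blast
qed

text \<open>The indices at which the counts reach a new value for the first time; they cut the recursion
  into descent and ascent phases.\<close>
definition first_G :: "nat \<Rightarrow> nat" where "first_G l = (LEAST i. l \<le> cG i)"
definition first_F :: "nat \<Rightarrow> nat" where "first_F l = (LEAST j. Suc l \<le> cF (Suc j))"

text \<open>Between the first \<open>l\<close>-th zero of \<open>g\<close> and the first \<open>(l +
  1)\<close>-st zero of \<open>f\<close> both counts are constant, so all signs are known. If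
  \<open>f\<close> is to lose all its initial value \<open>f I\<close>, the double sum of the products
  \<open>\<alpha> i * b j\<close> must reach \<open>1\<close>, hence one of them is at least \<open>1 /
  N\<^sup>2\<close>.\<close>
lemma descent_phase:
  assumes J: "Suc l \<le> cF N" and N: "0 < N"
  shows "\<exists>i j. first_G l \<le> i \<and> i \<le> j \<and> j \<le> first_F l \<and> first_F l < N \<and> 1 \<le> (real N)\<^sup>2 * (\<alpha> i * b j)"
proof -
  define I where "I = first_G l"
  define J where "J = first_F l"
  define e :: real where "e = (-1) ^ l"
  from N J obtain n where n: "N = Suc n" "Suc l \<le> cF (Suc n)" by (cases N) auto
  have J1: "Suc l \<le> cF (Suc J)" unfolding J_def first_F_def by (rule LeastI[of _ n]) (rule n)
  have J2: "cF (Suc j) \<le> l" if "j < J" for j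
    using not_less_Least[of j "\<lambda>j. Suc l \<le> cF (Suc j)"] that by (simp add: J_def first_F_def not_less_eq_eq)
  have JN: "J < N" unfolding J_def first_F_def using n by (metis Least_le le_imp_less_Suc)
  have GJ: "l \<le> cG J" using cF_Suc_le_cG[of J] J1 by simp
  have I1: "l \<le> cG I" unfolding I_def first_G_def by (rule LeastI[of _ J]) (rule GJ)
  have IJ: "I \<le> J" unfolding I_def first_G_def by (rule Least_le) (rule GJ)
  have I2: "cG i < l" if "i < I" for i
    using not_less_Least[of i "\<lambda>i. l \<le> cG i"] that by (simp add: I_def first_G_def)
  have cF: "cF i = l" if "I \<le> i" "i \<le> J" for i
  proof -
    have "l \<le> cF i" using cG_mono[OF that(1)] I1 cG_le_cF[of i] by simp
    moreover have "cF i \<le> l" using J2[of "i - 1"] that cF_0 by (cases i) auto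
    ultimately show ?thesis by simp
  qed
  have cG: "cG i = l" if "I \<le> i" "i \<le> J" for i
    using cF[OF that] cG_le_cF[of i] cG_mono[OF that(1)] I1 by simp
  have f_pos: "0 \<le> e * f i" and g_pos: "0 \<le> e * g i" if "I \<le> i" "i \<le> J" for i
    using cF_sign[of i] cG_sign[of i] by (simp_all add: cF cG that e_def)
  have f_anti: "e * f i \<le> e * f I" if "I \<le> i" "i \<le> J" for i
  proof -
    have "- (e * f I) \<le> - (e * f i)"
    proof (rule between_mono[OF that(1)])
      fix n assume "I \<le> n" "n < i"
      then show "- (e * f n) \<le> - (e * f (Suc n))"
        using g_pos[of n] b_pos[of n] that by (simp add: e_f_Suc)
    qed
    then show ?thesis by simp
  qed
  have gI: "e * g I \<le> \<alpha> I * (e * f I)"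
  proof (cases I)
    case 0
    then show ?thesis by (simp add: f_0 g_0)
  next
    case (Suc n)
    have "cG n < l" by (rule I2) (simp add: Suc)
    moreover have "l \<le> Suc (cG n)" using cF_Suc_le_cG[of n] cF[of I] IJ Suc by simp
    ultimately have "l = Suc (cG n)" by simp
    then have "e * g n \<le> 0" using cG_sign[of n] by (simp add: e_def)
    then show ?thesis by (simp add: Suc e_g_Suc)
  qed
  have g_le: "e * g j \<le> (e * f I) * (\<Sum>i\<in>{I..j}. \<alpha> i)" if "I \<le> j" "j \<le> J" for j
    using that
  proof (induction j rule: dec_induct)
    case base
    then show ?case using gI by (simp add: mult.commute)
  next
    case (step n)
    have "\<alpha> (Suc n) * (e * f (Suc n)) \<le> \<alpha> (Suc n) * (e * f I)"
      using f_anti[of "Suc n"] step \<alpha>_pos[of "Suc n"] by simp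
    moreover have "e * g n \<le> (e * f I) * (\<Sum>i\<in>{I..n}. \<alpha> i)" using step by simp
    moreover have "(\<Sum>i\<in>{I..Suc n}. \<alpha> i) = (\<Sum>i\<in>{I..n}. \<alpha> i) + \<alpha> (Suc n)"
      using step by simp
    ultimately show ?case by (simp add: e_g_Suc algebra_simps)
  qed
  have cFJ: "cF (Suc J) = Suc l" using J1 cF_Suc_le_cG[of J] cG[of J] IJ by simp
  have fJ: "e * f (Suc J) \<le> 0" using cF_sign[of "Suc J"] by (simp add: cFJ e_def)
  have "e * f (Suc J) = e * f I + (\<Sum>n=I..<Suc J. e * f (Suc n) - e * f n)"
    using between_sum[of I "Suc J" "\<lambda>n. e * f n"] IJ by simp
  also have "(\<Sum>n=I..<Suc J. e * f (Suc n) - e * f n) = - (\<Sum>n\<in>{I..J}. b n * (e * g n))"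
    by (simp add: e_f_Suc sum_negf atLeastLessThanSuc_atLeastAtMost)
  finally have fI: "e * f I \<le> (\<Sum>n\<in>{I..J}. b n * (e * g n))" using fJ by simp
  also have "\<dots> \<le> (\<Sum>n\<in>{I..J}. b n * ((e * f I) * (\<Sum>i\<in>{I..n}. \<alpha> i)))"
    using g_le b_pos by (intro sum_mono mult_left_mono) (auto simp: less_imp_le)
  also have "\<dots> = (e * f I) * (\<Sum>n\<in>{I..J}. b n * (\<Sum>i\<in>{I..n}. \<alpha> i))"
    by (simp add: sum_distrib_left algebra_simps)
  finally have key: "e * f I \<le> (e * f I) * (\<Sum>n\<in>{I..J}. b n * (\<Sum>i\<in>{I..n}. \<alpha> i))" .
  have fI_pos: "0 < e * f I"
  proof (rule ccontr)
    assume "\<not> 0 < e * f I"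
    then have "e * f I = 0" using f_pos[of I] IJ by simp
    moreover have "e * g I \<le> 0" using gI by (simp only: \<open>e * f I = 0\<close>)
    then have "e * g I = 0" using g_pos[of I] IJ by simp
    ultimately show False using no_common_zero[of I] by (simp add: e_def)
  qed
  show ?thesis
  proof (rule ccontr)
    assume neg: "\<not> ?thesis"
    have "(\<Sum>n\<in>{I..J}. b n * (\<Sum>i\<in>{I..n}. \<alpha> i)) < 1"
    proof (rule sum_pairs_less_one[OF N])
      fix i j assume "j \<in> {I..J}" "i \<in> {I..j}"
      then have "I \<le> i \<and> i \<le> j \<and> j \<le> J" by simp
      then show "(real N)\<^sup>2 * (\<alpha> i * b j) < 1"
        using neg JN unfolding I_def J_def by (meson not_le)
    qed (use JN IJ in auto)
    then have "(e * f I) * (\<Sum>n\<in>{I..J}. b n * (\<Sum>i\<in>{I..n}. \<alpha> i)) < (e * f I) * 1"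
      using fI_pos by (intro mult_strict_left_mono) auto
    then show False using key by simp
  qed
qed

text \<open>The mirror image of \<open>descent_phase\<close>: here \<open>g\<close> has to lose its value at
  the start \<open>J\<close> of the phase.\<close>
lemma ascent_phase:
  assumes J: "Suc (Suc l) \<le> cF N" and N: "0 < N"
  shows "\<exists>j i. first_F l \<le> j \<and> j < i \<and> i \<le> first_G (Suc l) \<and> first_G (Suc l) < N \<and>
    1 \<le> (real N)\<^sup>2 * (\<alpha> i * b j)"
proof -
  define I where "I = first_G (Suc l)"
  define J where "J = first_F l"
  define e :: real where "e = (-1) ^ Suc l"
  from N J obtain n where n: "N = Suc n" "Suc (Suc l) \<le> cF (Suc n)" by (cases N) auto
  have Gn: "Suc l \<le> cG n" using cF_Suc_le_cG[of n] n by simp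
  have I1: "Suc l \<le> cG I" unfolding I_def first_G_def by (rule LeastI[of _ n]) (rule Gn)
  have IN: "I < N" unfolding I_def first_G_def using n Gn by (metis Least_le le_imp_less_Suc)
  have I2: "cG i \<le> l" if "i < I" for i
    using not_less_Least[of i "\<lambda>i. Suc l \<le> cG i"] that by (simp add: I_def first_G_def not_less_eq_eq)
  have FI: "Suc l \<le> cF I" using I1 cG_le_cF[of I] by simp
  then obtain I' where I': "I = Suc I'" using cF_0 by (cases I) auto
  have FI': "Suc l \<le> cF (Suc I')" using FI I' by simp
  have J1: "Suc l \<le> cF (Suc J)" unfolding J_def first_F_def by (rule LeastI[of _ I']) (rule FI')
  have JI: "J < I" unfolding J_def first_F_def I' using FI' by (metis Least_le le_imp_less_Suc)
  have J2: "cF (Suc j) \<le> l" if "j < J" for j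
    using not_less_Least[of j "\<lambda>j. Suc l \<le> cF (Suc j)"] that by (simp add: J_def first_F_def not_less_eq_eq)
  have cG: "cG i = l" if "J \<le> i" "i < I" for i
  proof -
    have "Suc l \<le> cF (Suc i)" using cF_mono[of "Suc J" "Suc i"] that J1 by simp
    then show ?thesis using I2[OF that(2)] cF_Suc_le_cG[of i] by simp
  qed
  have cF: "cF i = Suc l" if "J < i" "i \<le> I" for i
  proof -
    have "Suc l \<le> cF i" using cF_mono[of "Suc J" i] that J1 by simp
    moreover have "cF i \<le> Suc (cG (i - 1))" using cF_Suc_le_cG[of "i - 1"] that by (cases i) auto
    moreover have "cG (i - 1) = l" using that by (intro cG) auto
    ultimately show ?thesis by simp
  qed
  have cGI: "cG I = Suc l" using I1 cG_le_cF[of I] cF[of I] JI by simp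
  have f_pos: "0 \<le> e * f i" if "J < i" "i \<le> I" for i
    using cF_sign[of i] by (simp add: cF that e_def)
  have g_neg: "0 \<le> - (e * g i)" if "J \<le> i" "i < I" for i
    using cG_sign[of i] by (simp add: cG that e_def)
  have gI: "0 \<le> e * g I" using cG_sign[of I] by (simp add: cGI e_def)
  have g_mono: "e * g J \<le> e * g i" if "J \<le> i" "i < I" for i
  proof (rule between_mono[OF that(1)])
    fix n assume "J \<le> n" "n < i"
    then show "e * g n \<le> e * g (Suc n)"
      using f_pos[of "Suc n"] \<alpha>_pos[of "Suc n"] that by (simp add: e_g_Suc)
  qed
  have cFJ: "cF J \<le> l" using J2[of "J - 1"] cF_0 by (cases J) auto
  have fJ: "e * f J \<le> 0"
  proof -
    have "cF J = l" using cFJ cG_le_cF[of J] cG[of J] JI by simp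
    then show ?thesis using cF_sign[of J] by (simp add: e_def)
  qed
  have f_le: "e * f i \<le> - (e * g J) * (\<Sum>j\<in>{J..<i}. b j)" if "J \<le> i" "i \<le> I" for i
    using that
  proof (induction i rule: dec_induct)
    case base
    then show ?case using fJ by simp
  next
    case (step n)
    have "b n * - (e * g n) \<le> b n * - (e * g J)"
      using g_mono[of n] step b_pos[of n] by (intro mult_left_mono) auto
    moreover have "e * f n \<le> - (e * g J) * (\<Sum>j\<in>{J..<n}. b j)" using step by simp
    moreover have "(\<Sum>j\<in>{J..<Suc n}. b j) = (\<Sum>j\<in>{J..<n}. b j) + b n" using step by simp
    ultimately show ?case by (simp add: e_f_Suc algebra_simps)
  qed
  have "e * g I = e * g J + (\<Sum>n=J..<I. e * g (Suc n) - e * g n)"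
    using between_sum[of J I "\<lambda>n. e * g n"] JI by simp
  also have "(\<Sum>n=J..<I. e * g (Suc n) - e * g n) = (\<Sum>n=J..<I. \<alpha> (Suc n) * (e * f (Suc n)))"
    by (rule sum.cong) (simp_all add: e_g_Suc)
  finally have "- (e * g J) \<le> (\<Sum>n=J..<I. \<alpha> (Suc n) * (e * f (Suc n)))" using gI by simp
  also have "\<dots> \<le> (\<Sum>n=J..<I. \<alpha> (Suc n) * (- (e * g J) * (\<Sum>j\<in>{J..<Suc n}. b j)))"
    by (intro sum_mono mult_left_mono f_le) (auto simp: less_imp_le \<alpha>_pos)
  also have "\<dots> = - (e * g J) * (\<Sum>n=J..<I. \<alpha> (Suc n) * (\<Sum>j\<in>{J..<Suc n}. b j))"
    by (simp add: sum_distrib_left algebra_simps)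
  also have "(\<Sum>n=J..<I. \<alpha> (Suc n) * (\<Sum>j\<in>{J..<Suc n}. b j)) = (\<Sum>i=Suc J..I. \<alpha> i * (\<Sum>j\<in>{J..<i}. b j))"
    using sum.shift_bounds_Suc_ivl[of "\<lambda>i. \<alpha> i * (\<Sum>j\<in>{J..<i}. b j)" J I]
    by (simp only: atLeastLessThanSuc_atLeastAtMost)
  finally have key: "- (e * g J) \<le> - (e * g J) * (\<Sum>i=Suc J..I. \<alpha> i * (\<Sum>j\<in>{J..<i}. b j))" .
  have gJ_pos: "0 < - (e * g J)"
  proof (rule ccontr)
    assume "\<not> 0 < - (e * g J)"
    then have gJ: "e * g J = 0" using g_neg[of J] JI by simp
    moreover have "e * f (Suc J) \<le> - (e * g J) * (\<Sum>j\<in>{J..<Suc J}. b j)"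
      using JI by (intro f_le) auto
    then have "e * f (Suc J) \<le> 0" by (simp only: gJ minus_zero mult_zero_left)
    then have "e * f (Suc J) = 0" using f_pos[of "Suc J"] JI by simp
    ultimately show False using no_common_zero_Suc[of J] by (simp add: e_def)
  qed
  show ?thesis
  proof (rule ccontr)
    assume neg: "\<not> ?thesis"
    have "(\<Sum>i=Suc J..I. \<alpha> i * (\<Sum>j\<in>{J..<i}. b j)) < 1"
    proof (rule sum_pairs_less_one[OF N])
      fix j i assume "i \<in> {Suc J..I}" "j \<in> {J..<i}"
      then have "J \<le> j \<and> j < i \<and> i \<le> I" by simp
      then have "(real N)\<^sup>2 * (\<alpha> i * b j) < 1"
        using neg IN unfolding I_def J_def by (meson not_le)
      then show "(real N)\<^sup>2 * (b j * \<alpha> i) < 1" by (simp add: mult.commute)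
    qed (use JI IN in auto)
    then have "- (e * g J) * (\<Sum>i=Suc J..I. \<alpha> i * (\<Sum>j\<in>{J..<i}. b j)) < - (e * g J) * 1"
      using gJ_pos by (intro mult_strict_left_mono) auto
    then show False using key by simp
  qed
qed

end

section \<open>Interlacing of the zeros of the recursion polynomials\<close>

lemma simple_pos_roots_root:
  assumes "simple_pos_roots f d r" "i < d"
  shows "f (r i) = 0"
proof -
  from assms obtain C where "0 < r i" "\<And>y. f y = C * (\<Prod>i<d. 1 - y / r i)"
    by (auto simp: simple_pos_roots_def)
  moreover from this have "(\<Prod>k<d. 1 - r i / r k) = 0"
    using assms(2) by (intro prod_zero) (auto intro!: bexI[of _ i])
  ultimately show ?thesis by simp
qed

text \<open>The pair \<open>(F\<^sub>j, G\<^sub>j)\<close>; multiplication by the variable is \<open>pCons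
  0\<close>.\<close>
primrec sturm_pair :: "(nat \<Rightarrow> real) \<Rightarrow> (nat \<Rightarrow> real) \<Rightarrow> nat \<Rightarrow> real poly \<times> real poly" where
  "sturm_pair \<alpha> \<beta> 0 = (1, [:\<alpha> 0:])"
| "sturm_pair \<alpha> \<beta> (Suc j) =
     (let F = fst (sturm_pair \<alpha> \<beta> j) - pCons 0 (Polynomial.smult (\<beta> j) (snd (sturm_pair \<alpha> \<beta> j)))
      in (F, snd (sturm_pair \<alpha> \<beta> j) + Polynomial.smult (\<alpha> (Suc j)) F))"

definition sturm_F :: "(nat \<Rightarrow> real) \<Rightarrow> (nat \<Rightarrow> real) \<Rightarrow> nat \<Rightarrow> real poly" where
  "sturm_F \<alpha> \<beta> j = fst (sturm_pair \<alpha> \<beta> j)"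

definition sturm_G :: "(nat \<Rightarrow> real) \<Rightarrow> (nat \<Rightarrow> real) \<Rightarrow> nat \<Rightarrow> real poly" where
  "sturm_G \<alpha> \<beta> j = snd (sturm_pair \<alpha> \<beta> j)"

lemma sturm_F_0: "sturm_F \<alpha> \<beta> 0 = 1" and sturm_G_0: "sturm_G \<alpha> \<beta> 0 = [:\<alpha> 0:]"
  by (simp_all add: sturm_F_def sturm_G_def)

lemma sturm_F_Suc:
  "sturm_F \<alpha> \<beta> (Suc j) = sturm_F \<alpha> \<beta> j - pCons 0 (Polynomial.smult (\<beta> j) (sturm_G \<alpha> \<beta> j))"
  by (simp add: sturm_F_def sturm_G_def Let_def)

lemma sturm_G_Suc:
  "sturm_G \<alpha> \<beta> (Suc j) = sturm_G \<alpha> \<beta> j + Polynomial.smult (\<alpha> (Suc j)) (sturm_F \<alpha> \<beta> (Suc j))"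
  by (simp add: sturm_F_def sturm_G_def Let_def)

context
  fixes \<alpha> \<beta> :: "nat \<Rightarrow> real"
  assumes \<alpha>: "\<And>j. 0 < \<alpha> j" and \<beta>: "\<And>j. 0 < \<beta> j"
begin

lemma sturm_degrees:
  "degree (sturm_F \<alpha> \<beta> j) = j \<and> 0 < (-1) ^ j * lead_coeff (sturm_F \<alpha> \<beta> j) \<and>
   degree (sturm_G \<alpha> \<beta> j) = j \<and> 0 < (-1) ^ j * lead_coeff (sturm_G \<alpha> \<beta> j)"
proof (induction j)
  case 0
  then show ?case using \<alpha> by (simp add: sturm_F_0 sturm_G_0)
next
  case (Suc j)
  let ?F = "sturm_F \<alpha> \<beta>" and ?G = "sturm_G \<alpha> \<beta>"
  have dG: "degree (?G j) = j" and dF: "degree (?F j) = j" using Suc by auto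
  have G_pos: "0 < (-1) ^ j * coeff (?G j) j" using Suc dG by simp
  have cF: "coeff (?F (Suc j)) (Suc j) = - (\<beta> j * coeff (?G j) j)"
    using dF by (simp add: sturm_F_Suc coeff_eq_0)
  have posF: "0 < (-1) ^ Suc j * coeff (?F (Suc j)) (Suc j)"
    using mult_pos_pos[OF \<beta>[of j] G_pos] by (simp add: cF algebra_simps)
  have degF: "degree (?F (Suc j)) = Suc j"
  proof (rule antisym)
    show "degree (?F (Suc j)) \<le> Suc j"
      unfolding sturm_F_Suc using Suc by (intro degree_diff_le) (auto intro: order.trans[OF degree_pCons_le])
    show "Suc j \<le> degree (?F (Suc j))" using posF by (intro le_degree) auto
  qed
  have "coeff (?G (Suc j)) (Suc j) = \<alpha> (Suc j) * coeff (?F (Suc j)) (Suc j)"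
    using Suc by (simp add: sturm_G_Suc coeff_eq_0)
  then have posG: "0 < (-1) ^ Suc j * coeff (?G (Suc j)) (Suc j)"
    using posF \<alpha>[of "Suc j"] mult_pos_pos[of "\<alpha> (Suc j)" "(-1) ^ Suc j * coeff (?F (Suc j)) (Suc j)"]
    by (simp add: algebra_simps)
  have degG: "degree (?G (Suc j)) = Suc j"
  proof (rule antisym)
    show "degree (?G (Suc j)) \<le> Suc j"
      unfolding sturm_G_Suc using Suc degF by (intro degree_add_le) auto
    show "Suc j \<le> degree (?G (Suc j))" using posG by (intro le_degree) auto
  qed
  show ?case using degF degG posF posG by simp
qed

lemma sturm_at_0: "poly (sturm_F \<alpha> \<beta> j) 0 = 1 \<and> 0 < poly (sturm_G \<alpha> \<beta> j) 0"
  using \<alpha> by (induction j) (auto simp: sturm_F_0 sturm_G_0 sturm_F_Suc sturm_G_Suc intro: add_pos_pos)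

lemma sturm_no_common_zero:
  "\<not> (poly (sturm_F \<alpha> \<beta> j) y = 0 \<and> poly (sturm_G \<alpha> \<beta> j) y = 0)"
  "\<not> (poly (sturm_G \<alpha> \<beta> j) y = 0 \<and> poly (sturm_F \<alpha> \<beta> (Suc j)) y = 0)"
proof -
  have *: "\<not> (poly (sturm_F \<alpha> \<beta> j) y = 0 \<and> poly (sturm_G \<alpha> \<beta> j) y = 0)" for j
    by (induction j) (auto simp: sturm_F_0 sturm_F_Suc sturm_G_Suc)
  show "\<not> (poly (sturm_F \<alpha> \<beta> j) y = 0 \<and> poly (sturm_G \<alpha> \<beta> j) y = 0)" by (rule *)
  show "\<not> (poly (sturm_G \<alpha> \<beta> j) y = 0 \<and> poly (sturm_F \<alpha> \<beta> (Suc j)) y = 0)"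
    using *[of j] by (auto simp: sturm_F_Suc)
qed

text \<open>At the zeros \<open>s i\<close> of \<open>G\<^sub>n\<close> the new \<open>F\<close> agrees with
  the old one, whose signs there alternate by interlacing; with the sign at \<open>0\<close> and at infinity
  this fixes all \<open>n + 1\<close> zeros.\<close>
lemma sturm_F_step:
  assumes r: "simple_pos_roots (poly (sturm_F \<alpha> \<beta> n)) n r"
    and s: "simple_pos_roots (poly (sturm_G \<alpha> \<beta> n)) n s"
    and rs: "\<And>i. i < n \<Longrightarrow> r i < s i" "\<And>i. Suc i < n \<Longrightarrow> s i < r (Suc i)"
  obtains r' where "simple_pos_roots (poly (sturm_F \<alpha> \<beta> (Suc n))) (Suc n) r'"
    "\<And>i. i < n \<Longrightarrow> r' i < s i" "\<And>i. i < n \<Longrightarrow> s i < r' (Suc i)"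
proof -
  let ?F = "sturm_F \<alpha> \<beta>" and ?G = "sturm_G \<alpha> \<beta>"
  have s_mono: "strict_mono_on {..<n} s" and s_pos: "\<And>i. i < n \<Longrightarrow> 0 < s i"
    using s by (auto simp: simple_pos_roots_def)
  have s_root: "poly (?G n) (s i) = 0" if "i < n" for i
    using simple_pos_roots_root[OF s that] .
  define p where "p i = (case i of 0 \<Rightarrow> 0 | Suc i \<Rightarrow> s i)" for i
  obtain r' where r': "simple_pos_roots (poly (?F (Suc n))) (Suc n) r'"
    "\<And>i. i < Suc n \<Longrightarrow> p i < r' i" "\<And>i. Suc i < Suc n \<Longrightarrow> r' i < p (Suc i)"
  proof (rule poly_roots_between[of "?F (Suc n)" "Suc n" p])
    show "strict_mono_on {..<Suc n} p"
      using s_mono s_pos by (auto simp: strict_mono_on_def p_def split: nat.splits)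
    show "0 < (-1) ^ i * poly (?F (Suc n)) (p i)" if i: "i < Suc n" for i
    proof (cases i)
      case 0
      then show ?thesis using sturm_at_0[of "Suc n"] by (simp add: p_def)
    next
      case (Suc k)
      then have k: "k < n" using i by simp
      have "{l. l < n \<and> r l < s k} = {..k}"
      proof (intro Set.set_eqI iffI)
        fix l assume l: "l \<in> {l. l < n \<and> r l < s k}"
        show "l \<in> {..k}"
        proof (rule ccontr)
          assume "l \<notin> {..k}"
          then obtain l' where l': "l = Suc l'" "k \<le> l'" by (cases l) auto
          then have "s l' < s k" using rs(2)[of l'] l by simp
          moreover have "s k \<le> s l'" using s_mono l' l k
            by (cases "k = l'") (auto simp: strict_mono_on_def intro!: less_imp_le)
          ultimately show False by simp
        qed
      next
        fix l assume l: "l \<in> {..k}"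
        then have "s l \<le> s k" using s_mono k
          by (cases "l = k") (auto simp: strict_mono_on_def intro!: less_imp_le)
        then show "l \<in> {l. l < n \<and> r l < s k}" using rs(1)[of l] l k by auto
      qed
      then have "root_count (poly (?F n)) (s k) = Suc k"
        by (simp add: simple_pos_roots_count[OF r])
      then have "0 \<le> (-1) ^ Suc k * poly (?F n) (s k)"
        using simple_pos_roots_sign[OF r, of "s k"] by simp
      moreover have "poly (?F n) (s k) \<noteq> 0"
        using sturm_no_common_zero(1)[of n "s k"] s_root[OF k] by auto
      ultimately have "0 < (-1) ^ Suc k * poly (?F n) (s k)"
        by (cases "even k") auto
      then show ?thesis using s_root[OF k] by (simp add: Suc p_def sturm_F_Suc)
    qed
  qed (use sturm_degrees[of "Suc n"] sturm_at_0[of "Suc n"] in \<open>auto simp: p_def\<close>)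
  have "s i < r' (Suc i)" if "i < n" for i using r'(2)[of "Suc i"] that by (simp add: p_def)
  moreover have "r' i < s i" if "i < n" for i using r'(3)[of i] that by (simp add: p_def)
  ultimately show ?thesis using that r'(1) by blast
qed

text \<open>At the zeros of \<open>F\<^bsub>n+1\<^esub>\<close> the new \<open>G\<close> agrees with the old
  one.\<close>
lemma sturm_G_step:
  assumes r: "simple_pos_roots (poly (sturm_F \<alpha> \<beta> (Suc n))) (Suc n) r"
    and s: "simple_pos_roots (poly (sturm_G \<alpha> \<beta> n)) n s"
    and rs: "\<And>i. i < n \<Longrightarrow> r i < s i" "\<And>i. i < n \<Longrightarrow> s i < r (Suc i)"
  obtains s' where "simple_pos_roots (poly (sturm_G \<alpha> \<beta> (Suc n))) (Suc n) s'"
    "\<And>i. i < Suc n \<Longrightarrow> r i < s' i" "\<And>i. Suc i < Suc n \<Longrightarrow> s' i < r (Suc i)"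
proof (rule poly_roots_between[of "sturm_G \<alpha> \<beta> (Suc n)" "Suc n" r])
  let ?F = "sturm_F \<alpha> \<beta>" and ?G = "sturm_G \<alpha> \<beta>"
  have r_mono: "strict_mono_on {..<Suc n} r" and r_pos: "\<And>i. i < Suc n \<Longrightarrow> 0 < r i"
    using r by (auto simp: simple_pos_roots_def)
  show "strict_mono_on {..<Suc n} r" by (rule r_mono)
  show "0 \<le> r 0" using r_pos[of 0] by simp
  show "0 < (-1) ^ i * poly (?G (Suc n)) (r i)" if i: "i < Suc n" for i
  proof -
    have r_root: "poly (?F (Suc n)) (r i) = 0"
      using simple_pos_roots_root[OF r i] .
    have "{l. l < n \<and> s l < r i} = {..<i}"
    proof (intro Set.set_eqI iffI)
      fix l assume l: "l \<in> {l. l < n \<and> s l < r i}"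
      show "l \<in> {..<i}"
      proof (rule ccontr)
        assume "l \<notin> {..<i}"
        then have "i \<le> l" by simp
        then have "r i \<le> r l" using r_mono l i
          by (cases "i = l") (auto simp: strict_mono_on_def intro!: less_imp_le)
        then show False using rs(1)[of l] l by simp
      qed
    next
      fix l assume l: "l \<in> {..<i}"
      then have "r (Suc l) \<le> r i" using r_mono i
        by (cases "Suc l = i") (auto simp: strict_mono_on_def intro!: less_imp_le)
      then show "l \<in> {l. l < n \<and> s l < r i}" using rs(2)[of l] l i by auto
    qed
    then have "root_count (poly (?G n)) (r i) = i"
      by (simp add: simple_pos_roots_count[OF s])
    then have "0 \<le> (-1) ^ i * poly (?G n) (r i)"
      using simple_pos_roots_sign[OF s, of "r i"] by simp
    moreover have "poly (?G n) (r i) \<noteq> 0"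
      using sturm_no_common_zero(2)[of n "r i"] r_root by auto
    ultimately have "0 < (-1) ^ i * poly (?G n) (r i)"
      by (cases "even i") auto
    then show ?thesis using r_root by (simp add: sturm_G_Suc)
  qed
qed (use sturm_degrees[of "Suc n"] sturm_at_0[of "Suc n"] that in auto)

lemma sturm_interlacing:
  "\<exists>r s. simple_pos_roots (poly (sturm_F \<alpha> \<beta> n)) n r \<and> simple_pos_roots (poly (sturm_G \<alpha> \<beta> n)) n s \<and>
     (\<forall>i<n. r i < s i) \<and> (\<forall>i. Suc i < n \<longrightarrow> s i < r (Suc i))"
proof (induction n)
  case 0
  have "\<exists>C>0. \<forall>y. poly (sturm_G \<alpha> \<beta> 0) y = C"
    using \<alpha>[of 0] by (auto simp: sturm_G_0)
  then show ?case by (auto simp: simple_pos_roots_def sturm_F_0 strict_mono_on_def intro!: exI[of _ "1::real"])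
next
  case (Suc n)
  then obtain r s where rs: "simple_pos_roots (poly (sturm_F \<alpha> \<beta> n)) n r"
    "simple_pos_roots (poly (sturm_G \<alpha> \<beta> n)) n s"
    "\<And>i. i < n \<Longrightarrow> r i < s i" "\<And>i. Suc i < n \<Longrightarrow> s i < r (Suc i)" by blast
  obtain r' where r': "simple_pos_roots (poly (sturm_F \<alpha> \<beta> (Suc n))) (Suc n) r'"
    "\<And>i. i < n \<Longrightarrow> r' i < s i" "\<And>i. i < n \<Longrightarrow> s i < r' (Suc i)"
    using sturm_F_step[OF rs] by blast
  obtain s' where "simple_pos_roots (poly (sturm_G \<alpha> \<beta> (Suc n))) (Suc n) s'"
    "\<And>i. i < Suc n \<Longrightarrow> r' i < s' i" "\<And>i. Suc i < Suc n \<Longrightarrow> s' i < r' (Suc i)"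
    using sturm_G_step[OF r'(1) rs(2) r'(2,3)] by blast
  then show ?case using r'(1) by blast
qed

text \<open>The interlacing of zeros gives the four inequalities between the counts. The bounds for
  \<open>F\<^bsub>j+1\<^esub>\<close> against \<open>G\<^sub>j\<close> use the shifted family that starts
  with the extra point \<open>0\<close>.\<close>
lemma sturm_counts_poly:
  assumes y: "0 < y"
  shows "sturm_counts \<alpha> (\<lambda>j. y * \<beta> j) (\<lambda>j. poly (sturm_F \<alpha> \<beta> j) y) (\<lambda>j. poly (sturm_G \<alpha> \<beta> j) y)
    (\<lambda>j. root_count (poly (sturm_F \<alpha> \<beta> j)) y) (\<lambda>j. root_count (poly (sturm_G \<alpha> \<beta> j)) y)"
proof
  fix j
  obtain r s where rs: "simple_pos_roots (poly (sturm_F \<alpha> \<beta> j)) j r"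
    "simple_pos_roots (poly (sturm_G \<alpha> \<beta> j)) j s"
    "\<And>i. i < j \<Longrightarrow> r i < s i" "\<And>i. Suc i < j \<Longrightarrow> s i < r (Suc i)"
    using sturm_interlacing[of j] by blast
  obtain r' where r': "simple_pos_roots (poly (sturm_F \<alpha> \<beta> (Suc j))) (Suc j) r'"
    "\<And>i. i < j \<Longrightarrow> r' i < s i" "\<And>i. i < j \<Longrightarrow> s i < r' (Suc i)"
    using sturm_F_step[OF rs] by blast
  show "0 \<le> (-1) ^ root_count (poly (sturm_F \<alpha> \<beta> j)) y * poly (sturm_F \<alpha> \<beta> j) y"
    using simple_pos_roots_sign[OF rs(1)] .
  show "0 \<le> (-1) ^ root_count (poly (sturm_G \<alpha> \<beta> j)) y * poly (sturm_G \<alpha> \<beta> j) y"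
    using simple_pos_roots_sign[OF rs(2)] .
  note cnt = simple_pos_roots_count[OF rs(1)] simple_pos_roots_count[OF rs(2)] simple_pos_roots_count[OF r'(1)]
  show "root_count (poly (sturm_G \<alpha> \<beta> j)) y \<le> root_count (poly (sturm_F \<alpha> \<beta> j)) y"
    "root_count (poly (sturm_F \<alpha> \<beta> j)) y \<le> Suc (root_count (poly (sturm_G \<alpha> \<beta> j)) y)"
    unfolding cnt using interlacing_count[of j r s y] rs(3,4) by auto
  define p where "p i = (case i of 0 \<Rightarrow> 0 | Suc i \<Rightarrow> s i)" for i
  have "{i. i < Suc j \<and> p i < y} = insert 0 (Suc ` {i. i < j \<and> s i < y})"
  proof (rule Set.set_eqI)
    show "i \<in> {i. i < Suc j \<and> p i < y} \<longleftrightarrow> i \<in> insert 0 (Suc ` {i. i < j \<and> s i < y})" for i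
      using y by (cases i) (auto simp: p_def)
  qed
  then have "card {i. i < Suc j \<and> p i < y} = Suc (card {i. i < j \<and> s i < y})"
    by (simp add: card_image)
  moreover have "p i < r' i" if "i < Suc j" for i
    using r'(3)[of "i - 1"] r'(1) that by (cases i) (auto simp: p_def simple_pos_roots_def)
  moreover have "r' i < p (Suc i)" if "Suc i < Suc j" for i
    using r'(2)[of i] that by (simp add: p_def)
  ultimately show "root_count (poly (sturm_G \<alpha> \<beta> j)) y \<le> root_count (poly (sturm_F \<alpha> \<beta> (Suc j))) y"
    "root_count (poly (sturm_F \<alpha> \<beta> (Suc j))) y \<le> Suc (root_count (poly (sturm_G \<alpha> \<beta> j)) y)"
    unfolding cnt using interlacing_count[of "Suc j" p r' y] by auto
next
  show "root_count (poly (sturm_F \<alpha> \<beta> 0)) y = 0" by (simp add: root_count_def sturm_F_0)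
qed (use \<alpha> \<beta> y in \<open>simp_all add: sturm_F_0 sturm_G_0 sturm_F_Suc sturm_G_Suc mult.assoc\<close>)

end

section \<open>Eigenvalues as zeros of the recursion polynomials\<close>

text \<open>One step of the walk combines two consecutive entries, because the three-term recursion is read
  two rows at a time.\<close>
definition log_walk :: "(nat \<Rightarrow> real) \<Rightarrow> nat \<Rightarrow> real" where
  "log_walk a j = (\<Sum>i<j. ln \<bar>a (2 * i + 1)\<bar> - ln \<bar>a (2 * i + 2)\<bar>)"

definition peak_weight :: "(nat \<Rightarrow> real) \<Rightarrow> nat \<Rightarrow> real" where
  "peak_weight a j = exp (2 * log_walk a j)"

definition valley_weight :: "(nat \<Rightarrow> real) \<Rightarrow> nat \<Rightarrow> real" where
  "valley_weight a j = exp (- 2 * (log_walk a j + ln \<bar>a (2 * j + 1)\<bar>))"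

lemma exp_2_ln_abs: "x \<noteq> 0 \<Longrightarrow> exp (2 * ln \<bar>x :: real\<bar>) = x\<^sup>2"
  by (simp add: exp_double)

lemma peak_weight_Suc:
  assumes "a (2 * j + 1) \<noteq> 0" "a (2 * j + 2) \<noteq> 0"
  shows "peak_weight a (Suc j) * (a (2 * j + 2))\<^sup>2 = peak_weight a j * (a (2 * j + 1))\<^sup>2"
proof -
  have "peak_weight a (Suc j) = peak_weight a j * exp (2 * ln \<bar>a (2 * j + 1)\<bar>) / exp (2 * ln \<bar>a (2 * j + 2)\<bar>)"
    by (simp add: peak_weight_def log_walk_def distrib_left right_diff_distrib exp_add exp_diff)
  then have "peak_weight a (Suc j) = peak_weight a j * (a (2 * j + 1))\<^sup>2 / (a (2 * j + 2))\<^sup>2"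
    by (simp only: exp_2_ln_abs[OF assms(1)] exp_2_ln_abs[OF assms(2)])
  then show ?thesis using assms(2) by simp
qed

lemma valley_weight_eq:
  assumes "a (2 * j + 1) \<noteq> 0"
  shows "valley_weight a j * peak_weight a j * (a (2 * j + 1))\<^sup>2 = 1"
  using assms unfolding valley_weight_def peak_weight_def exp_2_ln_abs[OF assms, symmetric]
  by (simp add: exp_add[symmetric] algebra_simps)

text \<open>Only the zeros matter, so the constant \<open>C\<close> may depend on \<open>j\<close>; the
  weights are chosen such that all the coefficients of the three-term recursion are absorbed in it.\<close>
lemma jacobi_poly_sturm:
  assumes "\<And>i. 1 \<le> i \<Longrightarrow> i \<le> 2 * j \<Longrightarrow> a i \<noteq> 0"
  shows "\<exists>C\<noteq>0. (\<forall>x. poly (jacobi_poly a (2 * j)) x = C * poly (sturm_F (peak_weight a) (valley_weight a) j) (x\<^sup>2)) \<and>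
    (\<forall>x. poly (jacobi_poly a (2 * j + 1)) x = C / peak_weight a j * x * poly (sturm_G (peak_weight a) (valley_weight a) j) (x\<^sup>2))"
  using assms
proof (induction j)
  case 0
  have "peak_weight a 0 \<noteq> 0" by (simp add: peak_weight_def)
  then show ?case by (intro exI[of _ 1]) (simp add: sturm_F_0 sturm_G_0)
next
  case (Suc j)
  let ?F = "sturm_F (peak_weight a) (valley_weight a)" and ?G = "sturm_G (peak_weight a) (valley_weight a)"
  have "a i \<noteq> 0" if "1 \<le> i" "i \<le> 2 * j" for i
    using Suc.prems[of i] that by simp
  from Suc.IH[OF this] obtain C where C12: "C \<noteq> 0"
      "\<And>x. poly (jacobi_poly a (2 * j)) x = C * poly (?F j) (x\<^sup>2)"
    and C3: "\<And>x. poly (jacobi_poly a (2 * j + 1)) x = C / peak_weight a j * x * poly (?G j) (x\<^sup>2)"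
    by blast
  note C = C12 C3[unfolded Suc_eq_plus1[symmetric]]
  have a: "a (2 * j + 1) \<noteq> 0" "a (2 * j + 2) \<noteq> 0" using Suc.prems by auto
  have pw: "peak_weight a j \<noteq> 0" "peak_weight a (Suc j) \<noteq> 0" by (simp_all add: peak_weight_def)
  note vw = valley_weight_eq[of a j, OF a(1)]
  note pS = peak_weight_Suc[of a j, OF a]
  define D where "D = - C * (a (2 * j + 1))\<^sup>2"
  have even: "poly (jacobi_poly a (2 * Suc j)) x = D * poly (?F (Suc j)) (x\<^sup>2)" for x
  proof -
    have 1: "C / peak_weight a j = C * (valley_weight a j * (a (2 * j + 1))\<^sup>2)"
      using vw pw by (simp add: field_simps)
    have "poly (jacobi_poly a (2 * Suc j)) x = x * poly (jacobi_poly a (Suc (2 * j))) x -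
        (a (2 * j + 1))\<^sup>2 * poly (jacobi_poly a (2 * j)) x"
      by simp
    also have "\<dots> = x * (C * (valley_weight a j * (a (2 * j + 1))\<^sup>2) * x * poly (?G j) (x\<^sup>2)) -
        (a (2 * j + 1))\<^sup>2 * (C * poly (?F j) (x\<^sup>2))"
      by (simp only: C 1)
    also have "\<dots> = D * poly (?F (Suc j)) (x\<^sup>2)"
      by (simp add: D_def sturm_F_Suc algebra_simps power2_eq_square)
    finally show ?thesis .
  qed
  have odd: "poly (jacobi_poly a (2 * Suc j + 1)) x = D / peak_weight a (Suc j) * x * poly (?G (Suc j)) (x\<^sup>2)" for x
  proof -
    have 1: "D / peak_weight a (Suc j) = - (a (2 * j + 2))\<^sup>2 * (C / peak_weight a j)"
      using pS pw by (simp add: D_def field_simps)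
    have "poly (jacobi_poly a (2 * Suc j + 1)) x = x * poly (jacobi_poly a (2 * Suc j)) x -
        (a (2 * j + 2))\<^sup>2 * poly (jacobi_poly a (Suc (2 * j))) x"
      by (simp add: numeral_2_eq_2)
    also have "\<dots> = x * (D * poly (?F (Suc j)) (x\<^sup>2)) - (a (2 * j + 2))\<^sup>2 * (C / peak_weight a j * x * poly (?G j) (x\<^sup>2))"
      by (simp only: even C)
    also have "\<dots> = D / peak_weight a (Suc j) * x * poly (?G j) (x\<^sup>2) + x * (D * poly (?F (Suc j)) (x\<^sup>2))"
      by (simp add: 1)
    also have "\<dots> = D / peak_weight a (Suc j) * x * poly (?G (Suc j)) (x\<^sup>2)"
      using pw by (simp add: sturm_G_Suc field_simps)
    finally show ?thesis .
  qed
  show ?case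
    using even odd C(1) a(1) by (intro exI[of _ D]) (simp add: D_def)
qed

lemma order_prod_linear:
  fixes R :: "real set"
  assumes "finite R" "C \<noteq> 0"
  shows "order x (Polynomial.smult C (\<Prod>r\<in>R. [:- r, 1:])) = (if x \<in> R then 1 else 0)"
proof -
  have nz: "(\<Prod>r\<in>R. [:- r, 1:]) \<noteq> 0" for R :: "real set" by (cases "finite R") auto
  have lin: "order x [:- r, 1:] = (if x = r then 1 else 0)" for r :: real
    by (auto simp: order_linear order_0I)
  have "order x (\<Prod>r\<in>R. [:- r, 1:]) = (if x \<in> R then 1 else 0)"
    using assms(1)
  proof (induction R rule: finite_induct)
    case (insert r R)
    have eq: "(\<Prod>r\<in>insert r R. [:- r, 1:]) = [:- r, 1:] * (\<Prod>r\<in>R. [:- r, 1:])"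
      using insert.hyps by (rule prod.insert)
    then have "[:- r, 1:] * (\<Prod>r\<in>R. [:- r, 1:]) \<noteq> 0" using nz[of "insert r R"] by (simp only:) simp
    then have "order x (\<Prod>r\<in>insert r R. [:- r, 1:]) = order x [:- r, 1:] + order x (\<Prod>r\<in>R. [:- r, 1:])"
      unfolding eq by (rule order_mult)
    then show ?case using insert by (auto simp: lin)
  qed (auto intro: order_0I)
  then show ?thesis using assms(2) by (simp add: order_smult)
qed

text \<open>The characteristic polynomial of the matrix of even size is \<open>F\<^sub>j (x\<^sup>2)\<close>
  up to a constant, with the zeros \<open>\<plusminus> sqrt (r i)\<close>, all simple; so counting with
  multiplicity is counting zeros of \<open>F\<^sub>j\<close>.\<close>
lemma count_eq_root_count:
  assumes a: "\<And>i. 1 \<le> i \<Longrightarrow> i \<le> 2 * j \<Longrightarrow> a i \<noteq> 0" and m: "Suc m = 2 * j" and eps: "0 < \<epsilon>"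
  shows "num_eigenvalues_in (schroedinger_mat a m) {0<..<\<epsilon>} =
    root_count (poly (sturm_F (peak_weight a) (valley_weight a) j)) (\<epsilon>\<^sup>2)"
proof -
  let ?F = "sturm_F (peak_weight a) (valley_weight a)"
  have w: "\<And>j. 0 < peak_weight a j" "\<And>j. 0 < valley_weight a j"
    by (simp_all add: peak_weight_def valley_weight_def)
  obtain C where C: "C \<noteq> 0" "\<And>x. poly (jacobi_poly a (2 * j)) x = C * poly (?F j) (x\<^sup>2)"
    using jacobi_poly_sturm[of j a] a by auto
  obtain r where r: "simple_pos_roots (poly (?F j)) j r" using sturm_interlacing[where \<alpha> = "peak_weight a" and \<beta> = "valley_weight a" and n = j, OF w] by blast
  then obtain D where D: "D > 0" "\<And>y. poly (?F j) y = D * (\<Prod>i<j. 1 - y / r i)"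
    and rpos: "\<And>i. i < j \<Longrightarrow> 0 < r i" and rmono: "strict_mono_on {..<j} r"
    by (auto simp: simple_pos_roots_def)
  have rinj: "inj_on r {..<j}" using rmono by (rule strict_mono_on_imp_inj_on)
  define s where "s i = sqrt (r i)" for i
  have spos: "0 < s i" "(s i)\<^sup>2 = r i" if "i < j" for i using rpos[OF that] by (simp_all add: s_def)
  have sinj: "inj_on s {..<j}" using rinj by (auto simp: inj_on_def s_def)
  define R where "R = s ` {..<j} \<union> (\<lambda>i. - s i) ` {..<j}"
  have disj: "s ` {..<j} \<inter> (\<lambda>i. - s i) ` {..<j} = {}"
  proof -
    have "s i \<noteq> - s i'" if "i < j" "i' < j" for i i'
      using spos(1)[OF that(1)] spos(1)[OF that(2)] by simp
    then show ?thesis by auto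
  qed
  have nsinj: "inj_on (\<lambda>i. - s i) {..<j}" using sinj by (auto simp: inj_on_def)
  define E where "E = C * D * (\<Prod>i<j. - 1 / r i)"
  have rnz: "r i \<noteq> 0" if "i < j" for i using rpos[OF that] by simp
  have E: "E \<noteq> 0" using C(1) D(1) rnz by (auto simp: E_def)
  have "poly (jacobi_poly a (2 * j)) x = poly (Polynomial.smult E (\<Prod>z\<in>R. [:- z, 1:])) x" for x
  proof -
    have "(\<Prod>z\<in>R. x - z) = (\<Prod>i<j. x - s i) * (\<Prod>i<j. x + s i)"
      unfolding R_def using disj sinj nsinj by (subst prod.union_disjoint) (auto simp: prod.reindex)
    also have "\<dots> = (\<Prod>i<j. x\<^sup>2 - r i)"
      unfolding prod.distrib[symmetric] using spos(2) by (intro prod.cong) (auto simp: power2_eq_square algebra_simps)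
    finally have 1: "(\<Prod>z\<in>R. x - z) = (\<Prod>i<j. x\<^sup>2 - r i)" .
    have "(\<Prod>i<j. 1 - x\<^sup>2 / r i) = (\<Prod>i<j. (- 1 / r i) * (x\<^sup>2 - r i))"
    proof (rule prod.cong[OF refl])
      fix i assume "i \<in> {..<j}"
      then show "1 - x\<^sup>2 / r i = (- 1 / r i) * (x\<^sup>2 - r i)" using rpos[of i] by (simp add: field_simps)
    qed
    also have "\<dots> = (\<Prod>i<j. - 1 / r i) * (\<Prod>i<j. x\<^sup>2 - r i)" by (rule prod.distrib)
    finally show ?thesis by (simp add: C(2) D(2) E_def poly_prod 1)
  qed
  then have cp: "char_poly (schroedinger_mat a m) = Polynomial.smult E (\<Prod>z\<in>R. [:- z, 1:])"
    by (simp add: char_poly_schroedinger_mat m poly_eq_poly_eq_iff[symmetric] fun_eq_iff)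
  have finR: "finite R" by (simp add: R_def)
  have carr: "schroedinger_mat a m \<in> carrier_mat (Suc m) (Suc m)" by (simp add: schroedinger_mat_def)
  have ev: "eigenvalue (schroedinger_mat a m) x \<longleftrightarrow> x \<in> R" for x
  proof -
    have "eigenvalue (schroedinger_mat a m) x \<longleftrightarrow> poly (char_poly (schroedinger_mat a m)) x = 0"
      by (rule eigenvalue_root_char_poly[OF carr])
    also have "\<dots> \<longleftrightarrow> x \<in> R" using E finR by (auto simp: cp poly_prod)
    finally show ?thesis .
  qed
  have "num_eigenvalues_in (schroedinger_mat a m) {0<..<\<epsilon>} = (\<Sum>x\<in>{x \<in> {0<..<\<epsilon>}. x \<in> R}. 1)"
    unfolding num_eigenvalues_in_def ev cp using order_prod_linear[OF finR E] by (intro sum.cong) auto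
  also have "\<dots> = card {x \<in> {0<..<\<epsilon>}. x \<in> R}" by simp
  also have "{x \<in> {0<..<\<epsilon>}. x \<in> R} = s ` {i. i < j \<and> r i < \<epsilon>\<^sup>2}"
  proof -
    have "s i < \<epsilon> \<longleftrightarrow> r i < \<epsilon>\<^sup>2" if "i < j" for i
      using spos[OF that] eps by (metis less_le power2_less_imp_less power_strict_mono zero_less_numeral)
    moreover have "\<not> 0 < - s i" if "i < j" for i using spos(1)[OF that] by simp
    ultimately show ?thesis using spos(1) by (auto simp: R_def)
  qed
  also have "card \<dots> = card {i. i < j \<and> r i < \<epsilon>\<^sup>2}"
    by (intro card_image inj_on_subset[OF sinj]) auto
  also have "\<dots> = root_count (poly (?F j)) (\<epsilon>\<^sup>2)" by (simp add: simple_pos_roots_count[OF r])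
  finally show ?thesis .
qed

section \<open>Alternations of a path\<close>

text \<open>The points \<open>p 0 \<le> p 1 \<le> \<dots>\<close> bound \<open>k\<close> descents of height
  at least \<open>L\<close>, separated by \<open>k - 1\<close> ascents of height at least \<open>L\<close>.
  The index type is arbitrary so that walks and continuous paths can be compared directly.\<close>
definition alternates :: "real \<Rightarrow> ('t::linorder \<Rightarrow> real) \<Rightarrow> 't set \<Rightarrow> nat \<Rightarrow> bool" where
  "alternates L X I k \<longleftrightarrow> (\<exists>p. (\<forall>i<2 * k. p i \<in> I) \<and>
     (\<forall>i. Suc i < 2 * k \<longrightarrow> p i \<le> p (Suc i) \<and> L \<le> (-1) ^ i * (X (p i) - X (p (Suc i)))))"

lemma alternatesI:
  assumes "\<And>i. i < 2 * k \<Longrightarrow> p i \<in> I" "\<And>i. Suc i < 2 * k \<Longrightarrow> p i \<le> p (Suc i)"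
    "\<And>i. Suc i < 2 * k \<Longrightarrow> L \<le> (-1) ^ i * (X (p i) - X (p (Suc i)))"
  shows "alternates L X I k"
  using assms unfolding alternates_def by blast

lemma alternatesE:
  assumes "alternates L X I k"
  obtains p where "\<And>i. i < 2 * k \<Longrightarrow> p i \<in> I" "\<And>i. Suc i < 2 * k \<Longrightarrow> p i \<le> p (Suc i)"
    "\<And>i. Suc i < 2 * k \<Longrightarrow> L \<le> (-1) ^ i * (X (p i) - X (p (Suc i)))"
  using assms unfolding alternates_def by blast

lemma alternates_0 [simp]: "alternates L X I 0"
  by (auto simp: alternates_def)

lemma alternates_mono:
  assumes "alternates L X I k" "L' \<le> L" "I \<subseteq> J"
  shows "alternates L' X J k"
proof -
  obtain p where "\<And>i. i < 2 * k \<Longrightarrow> p i \<in> I" "\<And>i. Suc i < 2 * k \<Longrightarrow> p i \<le> p (Suc i)"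
    "\<And>i. Suc i < 2 * k \<Longrightarrow> L \<le> (-1) ^ i * (X (p i) - X (p (Suc i)))"
    using alternatesE[OF assms(1)] by blast
  then show ?thesis using assms(2,3) by (intro alternatesI[of k p]) (auto intro: order.trans)
qed

lemma abs_power_minus_one_mult:
  "\<bar>(-1) ^ i * x\<bar> = \<bar>x :: real\<bar>"
  by (simp add: abs_mult power_abs)

text \<open>All comparisons of paths below are instances: a monotone change of time and a uniform error
  \<open>d\<close> cost \<open>2 * d\<close> in the level.\<close>
lemma alternates_transfer:
  fixes X :: "'t::linorder \<Rightarrow> real" and Y :: "'u::linorder \<Rightarrow> real"
  assumes alt: "alternates L X I k"
    and f: "\<And>s. s \<in> I \<Longrightarrow> f s \<in> J" "\<And>s s'. s \<in> I \<Longrightarrow> s' \<in> I \<Longrightarrow> s \<le> s' \<Longrightarrow> f s \<le> f s'"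
    and c: "0 \<le> c" and XY: "\<And>s. s \<in> I \<Longrightarrow> \<bar>c * X s - Y (f s)\<bar> \<le> d"
  shows "alternates (c * L - 2 * d) Y J k"
proof -
  obtain p where p: "\<And>i. i < 2 * k \<Longrightarrow> p i \<in> I" "\<And>i. Suc i < 2 * k \<Longrightarrow> p i \<le> p (Suc i)"
    "\<And>i. Suc i < 2 * k \<Longrightarrow> L \<le> (-1) ^ i * (X (p i) - X (p (Suc i)))"
    using alternatesE[OF alt] by blast
  show ?thesis
  proof (rule alternatesI[of k "\<lambda>i. f (p i)"])
    show "f (p i) \<in> J" if "i < 2 * k" for i using f(1) p(1) that by blast
  next
    fix i assume i: "Suc i < 2 * k"
    then have pi: "p i \<in> I" "p (Suc i) \<in> I" using p(1) by auto
    show "f (p i) \<le> f (p (Suc i))" using f(2) pi p(2)[OF i] by blast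
    have "c * L \<le> c * ((-1) ^ i * (X (p i) - X (p (Suc i))))"
      using p(3)[OF i] c by (intro mult_left_mono)
    then show "c * L - 2 * d \<le> (-1) ^ i * (Y (f (p i)) - Y (f (p (Suc i))))"
      using XY[OF pi(1)] XY[OF pi(2)] by (cases "even i") (auto simp: algebra_simps abs_le_iff)
  qed
qed

lemma alternates_scale:
  assumes "0 < c"
  shows "alternates L (\<lambda>s. c * X s) I k \<longleftrightarrow> alternates (L / c) X I k"
proof
  assume "alternates L (\<lambda>s. c * X s) I k"
  from alternates_transfer[OF this, of "\<lambda>s. s" I "1 / c" X 0] show "alternates (L / c) X I k"
    using assms by simp
next
  assume "alternates (L / c) X I k"
  from alternates_transfer[OF this, of "\<lambda>s. s" I c "\<lambda>s. c * X s" 0] show "alternates L (\<lambda>s. c * X s) I k"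
    using assms by simp
qed

text \<open>Descents and ascents found in consecutive intervals need not share their end points. At each
  junction the better of the two candidates (the lower one at a valley, the higher one at a peak) serves
  both neighbours.\<close>
lemma alternates_of_pairs:
  fixes X :: "'t::linorder \<Rightarrow> real"
  assumes k: "0 < k"
    and uv: "\<And>i. i < 2 * k - 1 \<Longrightarrow> u i \<in> I" "\<And>i. i < 2 * k - 1 \<Longrightarrow> v i \<in> I"
      "\<And>i. i < 2 * k - 1 \<Longrightarrow> u i \<le> v i" "\<And>i. i < 2 * k - 1 \<Longrightarrow> L \<le> (-1) ^ i * (X (u i) - X (v i))"
    and vu: "\<And>i. Suc i < 2 * k - 1 \<Longrightarrow> v i \<le> u (Suc i)"
  shows "alternates L X I k"
proof -
  define n where "n = 2 * k - 1"
  define p where "p i = (if i = 0 then u 0 else if n \<le> i then v (n - 1)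
    else if (-1) ^ i * X (u i) \<le> (-1) ^ i * X (v (i - 1)) then v (i - 1) else u i)" for i
  have n: "0 < n" "2 * k = Suc n" using k by (auto simp: n_def)
  have 1: "p i \<le> u i \<and> (-1) ^ i * X (u i) \<le> (-1) ^ i * X (p i)" if "i < n" for i
    using that vu[of "i - 1"] by (cases i) (auto simp: p_def n_def)
  have 2: "v i \<le> p (Suc i) \<and> (-1) ^ Suc i * X (v i) \<le> (-1) ^ Suc i * X (p (Suc i))" if "i < n" for i
  proof (cases "Suc i < n")
    case True
    then show ?thesis using vu[of i] by (auto simp: p_def n_def not_le)
  next
    case False
    then have "Suc i = n" using that by simp
    then show ?thesis by (auto simp: p_def)
  qed
  show ?thesis
  proof (rule alternatesI[of k p])
    fix i assume "i < 2 * k"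
    then have i: "i \<le> n" using n by simp
    have I: "u i \<in> I" if "i < n" for i using uv(1) that by (simp add: n_def)
    have J: "v i \<in> I" if "i < n" for i using uv(2) that by (simp add: n_def)
    show "p i \<in> I"
    proof (cases "i = 0")
      case True
      then show ?thesis using I[of 0] n by (simp add: p_def)
    next
      case False
      then have "v (i - 1) \<in> I" "n \<le> i \<Longrightarrow> v (n - 1) \<in> I" using J[of "i - 1"] J[of "n - 1"] i n by auto
      then show ?thesis using I[of i] False by (simp add: p_def)
    qed
  next
    fix i assume "Suc i < 2 * k"
    then have i: "i < n" using n by simp
    have "u i \<le> v i" using uv(3)[of i] i by (simp add: n_def)
    then show "p i \<le> p (Suc i)" using 1[OF i] 2[OF i] by (meson order.trans)
    have "L \<le> (-1) ^ i * X (u i) - (-1) ^ i * X (v i)"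
      using uv(4)[of i] i by (simp add: n_def right_diff_distrib)
    then show "L \<le> (-1) ^ i * (X (p i) - X (p (Suc i)))"
      using 1[OF i] 2[OF i] by (simp add: right_diff_distrib)
  qed
qed

section \<open>Eigenvalue counts are alternation counts\<close>

text \<open>A product of weights is the exponential of twice a difference of walk values; its size against
  \<open>1 / N\<^sup>2\<close> (or against \<open>4\<close>, with \<open>N = 1\<close>) is a statement about
  descents of the walk.\<close>
lemma weights_level:
  "(real N)\<^sup>2 * (peak_weight a i * (exp (- 2 * L) * valley_weight a j)) =
     exp (2 * (ln (real N) + (log_walk a i - log_walk a j - ln \<bar>a (2 * j + 1)\<bar>) - L))" if "0 < N"
proof -
  have "(real N)\<^sup>2 = exp (2 * ln (real N))" using that by (simp add: exp_double)
  then show ?thesis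
    by (simp add: peak_weight_def valley_weight_def exp_add[symmetric] algebra_simps)
qed

context
  fixes a :: "nat \<Rightarrow> real" and m N :: nat and L d :: real
  assumes nz: "\<And>i. 1 \<le> i \<Longrightarrow> i \<le> 2 * N \<Longrightarrow> a i \<noteq> 0" and m: "Suc m = 2 * N"
    and d: "\<And>i. i < N \<Longrightarrow> \<bar>ln \<bar>a (2 * i + 1)\<bar>\<bar> \<le> d"
begin

text \<open>The counts at the point \<open>exp (- 2 * L)\<close>, the square of the upper end of the
  spectral window.\<close>
abbreviation (input) "cF \<equiv> (\<lambda>j. root_count (poly (sturm_F (peak_weight a) (valley_weight a) j)) (exp (- 2 * L)))"
abbreviation (input) "cG \<equiv> (\<lambda>j. root_count (poly (sturm_G (peak_weight a) (valley_weight a) j)) (exp (- 2 * L)))"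

lemma N_pos: "0 < N" using m by simp

lemma sturm_counts_schroedinger:
  "sturm_counts (peak_weight a) (\<lambda>j. exp (- 2 * L) * valley_weight a j)
     (\<lambda>j. poly (sturm_F (peak_weight a) (valley_weight a) j) (exp (- 2 * L)))
     (\<lambda>j. poly (sturm_G (peak_weight a) (valley_weight a) j) (exp (- 2 * L))) cF cG"
  by (rule sturm_counts_poly) (simp_all add: peak_weight_def valley_weight_def)

lemma num_eigenvalues_eq_cF: "num_eigenvalues_in (schroedinger_mat a m) {0<..<exp (- L)} = cF N"
proof -
  have "num_eigenvalues_in (schroedinger_mat a m) {0<..<exp (- L)} =
      root_count (poly (sturm_F (peak_weight a) (valley_weight a) N)) ((exp (- L))\<^sup>2)"
    by (rule count_eq_root_count[OF nz m]) auto
  also have "(exp (- L))\<^sup>2 = exp (- 2 * L)" by (simp add: exp_double[symmetric])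
  finally show ?thesis .
qed

text \<open>A walk descent by \<open>L + ln 2 + d\<close> makes the product of weights at least
  \<open>4\<close>, which is what \<open>count_ge_alternation\<close> needs.\<close>
theorem num_eigenvalues_ge_of_alternates:
  assumes alt: "alternates (L + ln 2 + d) (log_walk a) {..<N} k" and L: "0 \<le> L"
  shows "k \<le> num_eigenvalues_in (schroedinger_mat a m) {0<..<exp (- L)}"
proof (cases k)
  case (Suc k')
  interpret sturm_counts "peak_weight a" "\<lambda>j. exp (- 2 * L) * valley_weight a j"
    "\<lambda>j. poly (sturm_F (peak_weight a) (valley_weight a) j) (exp (- 2 * L))"
    "\<lambda>j. poly (sturm_G (peak_weight a) (valley_weight a) j) (exp (- 2 * L))" cF cG
    by (rule sturm_counts_schroedinger)
  let ?S = "log_walk a"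
  obtain p where p: "\<And>i. i < 2 * k \<Longrightarrow> p i \<in> {..<N}" "\<And>i. Suc i < 2 * k \<Longrightarrow> p i \<le> p (Suc i)"
    "\<And>i. Suc i < 2 * k \<Longrightarrow> L + ln 2 + d \<le> (-1) ^ i * (?S (p i) - ?S (p (Suc i)))"
    using alternatesE[OF alt] by blast
  have d0: "0 \<le> d" using d[of 0] N_pos by simp
  have big: "4 \<le> peak_weight a i * (exp (- 2 * L) * valley_weight a j)"
    if "j < N" "L + ln 2 + d \<le> ?S i - ?S j" for i j
  proof -
    have "(4::real) = exp (2 * ln 2)" by (simp add: exp_double)
    also have "\<dots> \<le> exp (2 * ((?S i - ?S j - ln \<bar>a (2 * j + 1)\<bar>) - L))"
      using d[of j] that by simp
    also have "\<dots> = peak_weight a i * (exp (- 2 * L) * valley_weight a j)"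
      using weights_level[of 1 a i L j] by simp
    finally show ?thesis .
  qed
  have uv: "p (2 * l) \<le> p (2 * l + 1)"
    "4 \<le> peak_weight a (p (2 * l)) * (exp (- 2 * L) * valley_weight a (p (2 * l + 1)))" if "l < k" for l
    using p(2)[of "2 * l"] p(3)[of "2 * l"] p(1)[of "2 * l + 1"] that
      big[of "p (2 * l + 1)" "p (2 * l)"] by auto
  have vu: "p (2 * l + 1) < p (2 * Suc l)"
    "4 \<le> peak_weight a (p (2 * Suc l)) * (exp (- 2 * L) * valley_weight a (p (2 * l + 1)))" if "Suc l < k" for l
  proof -
    have 1: "L + ln 2 + d \<le> ?S (p (2 * Suc l)) - ?S (p (2 * l + 1))"
      using p(3)[of "2 * l + 1"] that by simp
    moreover have "0 < L + ln 2 + d" using L d0 by (simp add: add_nonneg_pos add_pos_nonneg)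
    ultimately have "p (2 * l + 1) \<noteq> p (2 * Suc l)" by auto
    then show "p (2 * l + 1) < p (2 * Suc l)" using p(2)[of "2 * l + 1"] that by simp
    show "4 \<le> peak_weight a (p (2 * Suc l)) * (exp (- 2 * L) * valley_weight a (p (2 * l + 1)))"
      using p(1)[of "2 * l + 1"] that 1 by (intro big) auto
  qed
  have "Suc k' \<le> cF (Suc (p (2 * k' + 1)))"
    by (rule count_ge_alternation[where k = k and u = "\<lambda>l. p (2 * l)" and v = "\<lambda>l. p (2 * l + 1)"])
      (use uv vu Suc in auto)
  also have "\<dots> \<le> cF N" using p(1)[of "2 * k' + 1"] Suc by (intro cF_mono) auto
  finally show ?thesis using Suc by (simp add: num_eigenvalues_eq_cF)
qed simp

text \<open>The phases of the recursion are disjoint in time, and each contains a product of weights of size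
  at least \<open>1 / N\<^sup>2\<close>, that is, a walk increment of size nearly \<open>L\<close>.\<close>
theorem alternates_of_num_eigenvalues:
  assumes k: "k \<le> num_eigenvalues_in (schroedinger_mat a m) {0<..<exp (- L)}"
  shows "alternates (L - ln (real N) - d) (log_walk a) {..<N} k"
proof (cases "k = 0")
  case False
  interpret sturm_counts "peak_weight a" "\<lambda>j. exp (- 2 * L) * valley_weight a j"
    "\<lambda>j. poly (sturm_F (peak_weight a) (valley_weight a) j) (exp (- 2 * L))"
    "\<lambda>j. poly (sturm_G (peak_weight a) (valley_weight a) j) (exp (- 2 * L))" cF cG
    by (rule sturm_counts_schroedinger)
  let ?S = "log_walk a"
  have kN: "k \<le> cF N" using k by (simp add: num_eigenvalues_eq_cF)
  have level: "L - ln (real N) - d \<le> ?S i - ?S j"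
    if "j < N" "1 \<le> (real N)\<^sup>2 * (peak_weight a i * (exp (- 2 * L) * valley_weight a j))" for i j
  proof -
    have "0 \<le> ln (real N) + (?S i - ?S j - ln \<bar>a (2 * j + 1)\<bar>) - L"
      using that(2) unfolding weights_level[OF N_pos] by simp
    then show ?thesis using d[of j] that(1) by simp
  qed
  \<comment> \<open>even \<open>i\<close> stands for descent phases, odd \<open>i\<close> for ascent
    phases\<close>
  define Q where "Q i u v \<longleftrightarrow> u \<le> v \<and> v < N \<and> L - ln (real N) - d \<le> (-1) ^ i * (?S u - ?S v) \<and>
    (if even i then first_G (i div 2) \<le> u \<and> v \<le> first_F (i div 2)
     else first_F (i div 2) \<le> u \<and> v \<le> first_G (Suc (i div 2)))" for i u v
  have "\<exists>u v. Q i u v" if i: "i < 2 * k - 1" for i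
  proof (cases "even i")
    case True
    then have "Suc (i div 2) \<le> cF N" using i kN by auto
    then obtain u v where "first_G (i div 2) \<le> u" "u \<le> v" "v \<le> first_F (i div 2)" "first_F (i div 2) < N"
      "1 \<le> (real N)\<^sup>2 * (peak_weight a u * (exp (- 2 * L) * valley_weight a v))"
      using descent_phase[OF _ N_pos] by blast
    then have "Q i u v" using True level[of v u] by (simp add: Q_def)
    then show ?thesis by blast
  next
    case False
    then have "Suc (Suc (i div 2)) \<le> cF N" using i kN by (auto elim!: oddE)
    then obtain v u where "first_F (i div 2) \<le> v" "v < u" "u \<le> first_G (Suc (i div 2))"
      "first_G (Suc (i div 2)) < N"
      "1 \<le> (real N)\<^sup>2 * (peak_weight a u * (exp (- 2 * L) * valley_weight a v))"
      using ascent_phase[OF _ N_pos] by blast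
    then have "Q i v u" using False level[of v u] by (simp add: Q_def)
    then show ?thesis by blast
  qed
  then obtain u v where Q: "\<And>i. i < 2 * k - 1 \<Longrightarrow> Q i (u i) (v i)" by metis
  have uN: "u i < N" "v i < N" if "i < 2 * k - 1" for i
    using Q[OF that] by (auto simp: Q_def)
  show ?thesis
  proof (rule alternates_of_pairs[of k u "{..<N}" v])
    fix i assume i: "Suc i < 2 * k - 1"
    show "v i \<le> u (Suc i)"
      using Q[of i] Q[of "Suc i"] i by (cases "even i") (auto simp: Q_def elim!: oddE evenE)
  qed (use False Q uN in \<open>auto simp: Q_def\<close>)
qed simp

end

section \<open>Wells and alternations of a continuous path\<close>

text \<open>The well is cut out at the level \<open>c = X x + \<eta>\<close>: from the last time before
  \<open>x\<close> at which the path is that high to the first such time after \<open>x\<close>, or to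
  \<open>T\<close> if there is none.\<close>
lemma well_between:
  fixes X :: "real \<Rightarrow> real"
  assumes cont: "continuous_on {0..T} X" and \<eta>: "0 < \<eta>"
    and u: "0 \<le> u" "u \<le> x" "x < v" "v \<le> T"
    and Xu: "\<eta> \<le> X u - X x" and Xv: "\<eta> \<le> X v - X x \<or> v = T"
  shows "\<exists>a b. u \<le> a \<and> b \<le> v \<and> is_well \<eta> T X a b"
proof -
  define c where "c = X x + \<eta>"
  have sub: "continuous_on {s..s'} X" if "0 \<le> s" "s' \<le> T" for s s'
    using that by (intro continuous_on_subset[OF cont]) auto
  have comp: "compact ({s..s'} \<inter> {r. c \<le> X r})" if "0 \<le> s" "s' \<le> T" for s s'
  proof -
    have "closed ({s..s'} \<inter> X -` {c..})"
      using sub[OF that] by (intro continuous_closed_preimage) auto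
    then have "compact ({s..s'} \<inter> (X -` {c..}))"
      by (metis Int_left_absorb compact_Icc compact_Int_closed)
    moreover have "X -` {c..} = {r. c \<le> X r}" by auto
    ultimately show ?thesis by simp
  qed
  have "compact ({u..x} \<inter> {r. c \<le> X r})" using u by (intro comp) auto
  moreover have "u \<in> {u..x} \<inter> {r. c \<le> X r}" using u Xu by (simp add: c_def)
  ultimately obtain a where a: "a \<in> {u..x}" "c \<le> X a" "\<And>s. s \<in> {u..x} \<Longrightarrow> c \<le> X s \<Longrightarrow> s \<le> a"
    using compact_attains_sup[of "{u..x} \<inter> {r. c \<le> X r}"] by blast
  have "X x < c" using \<eta> by (simp add: c_def)
  have "\<exists>s\<ge>a. s \<le> x \<and> X s = c"
    using a u \<open>X x < c\<close> by (intro IVT2' sub) auto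
  then obtain s where s: "a \<le> s" "s \<le> x" "X s = c" by blast
  then have "s = a" using a(1) a(3)[of s] by simp
  then have Xa: "X a = c" using s by simp
  have "a < x" using Xa \<open>X x < c\<close> a(1) by (cases "a = x") auto
  have left: "X s < c" if "a < s" "s \<le> x" for s
    using a(1) a(3)[of s] that by (auto simp: not_le[symmetric])
  show ?thesis
  proof (cases "{x..v} \<inter> {r. c \<le> X r} = {}")
    case True
    then have right: "X s < c" if "x \<le> s" "s \<le> v" for s
      using that by (metis (mono_tags) Int_iff atLeastAtMost_iff empty_iff mem_Collect_eq not_le)
    from this[of v] have "v = T" using Xv u by (auto simp: c_def)
    have "is_well \<eta> T X a T"
      unfolding is_well_def
    proof (intro conjI ballI bexI[of _ x])
      show "X s < X a" if "s \<in> {a<..<T}" for s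
        using left[of s] right[of s] that \<open>v = T\<close> Xa by (cases "s \<le> x") auto
    qed (use a u \<open>a < x\<close> \<open>v = T\<close> Xa in \<open>auto simp: c_def\<close>)
    then show ?thesis using a u \<open>v = T\<close> by (intro exI[of _ a] exI[of _ T]) auto
  next
    case False
    moreover have "compact ({x..v} \<inter> {r. c \<le> X r})" using u by (intro comp) auto
    ultimately obtain b where b: "b \<in> {x..v}" "c \<le> X b" "\<And>s. s \<in> {x..v} \<Longrightarrow> c \<le> X s \<Longrightarrow> b \<le> s"
      using compact_attains_inf[of "{x..v} \<inter> {r. c \<le> X r}"] by blast
    have "\<exists>s\<ge>x. s \<le> b \<and> X s = c"
      using b u \<open>X x < c\<close> by (intro IVT' sub) auto
    then obtain s where s: "x \<le> s" "s \<le> b" "X s = c" by blast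
    then have "s = b" using b(1) b(3)[of s] by simp
    then have Xb: "X b = c" using s by simp
    have "x < b" using Xb \<open>X x < c\<close> b(1) by (cases "x = b") auto
    have right: "X s < c" if "x \<le> s" "s < b" for s
      using b(1) b(3)[of s] that by (auto simp: not_le[symmetric])
    have "is_well \<eta> T X a b"
      unfolding is_well_def
    proof (intro conjI ballI bexI[of _ x])
      show "X s < X a" if "s \<in> {a<..<b}" for s
        using left[of s] right[of s] that Xa by (cases "s \<le> x") auto
    qed (use a u b \<open>a < x\<close> \<open>x < b\<close> Xa Xb in \<open>auto simp: c_def\<close>)
    then show ?thesis using a b by (intro exI[of _ a] exI[of _ b]) auto
  qed
qed

text \<open>The supremum of a bounded set of naturals is attained, and subfamilies of disjoint families are
  disjoint.\<close>
lemma max_disjoint_wells_ge_iff: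
  assumes "continuous_on {0..T} X" "0 < \<eta>"
  shows "k \<le> max_disjoint_wells X T \<eta> \<longleftrightarrow> (\<exists>W. W \<subseteq> wells \<eta> T X \<and> finite W \<and> disjoint W \<and> card W = k)"
proof -
  let ?C = "card ` {W. W \<subseteq> wells \<eta> T X \<and> finite W \<and> disjoint W}"
  have bdd: "bdd_above ?C" by (rule disjoint_wells_bounded[OF assms])
  have ne: "0 \<in> ?C" by (intro image_eqI[of _ _ "{}"]) (auto simp: disjoint_def)
  show ?thesis
  proof
    assume k: "k \<le> max_disjoint_wells X T \<eta>"
    define C where "C = ?C"
    have "finite C" "C \<noteq> {}" using bdd ne by (auto simp: C_def bdd_above_nat)
    then have "Sup C \<in> C" using Max_in[of C] by (simp add: Sup_nat_def)
    then obtain W where W: "W \<subseteq> wells \<eta> T X" "finite W" "disjoint W" "card W = max_disjoint_wells X T \<eta>"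
      unfolding max_disjoint_wells_def C_def by (elim imageE) auto
    then obtain V where V: "V \<subseteq> W" "card V = k" "finite V"
      using obtain_subset_with_card_n[of k W] k by auto
    have "disjoint V" using W(3) V(1) by (rule pairwise_subset)
    then show "\<exists>W. W \<subseteq> wells \<eta> T X \<and> finite W \<and> disjoint W \<and> card W = k"
      using W(1) V by (intro exI[of _ V]) auto
  next
    assume "\<exists>W. W \<subseteq> wells \<eta> T X \<and> finite W \<and> disjoint W \<and> card W = k"
    then have "k \<in> ?C" by auto
    then show "k \<le> max_disjoint_wells X T \<eta>"
      unfolding max_disjoint_wells_def by (rule cSup_upper[OF _ bdd])
  qed
qed

text \<open>Disjoint wells expressed through finitely many path values only: a left wall \<open>a l\<close>,
  a bottom \<open>x l\<close> and, except for the last well, a right wall \<open>b l\<close> strictly before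
  the next left wall.\<close>
definition well_pattern :: "real \<Rightarrow> real \<Rightarrow> (real \<Rightarrow> real) \<Rightarrow> nat \<Rightarrow> (nat \<Rightarrow> real) \<Rightarrow> (nat \<Rightarrow> real) \<Rightarrow> (nat \<Rightarrow> real) \<Rightarrow> bool" where
  "well_pattern \<eta> T X k a x b \<longleftrightarrow>
     (\<forall>l<k. 0 \<le> a l \<and> a l \<le> x l \<and> x l < T \<and> \<eta> \<le> X (a l) - X (x l)) \<and>
     (\<forall>l. Suc l < k \<longrightarrow> x l \<le> b l \<and> b l < a (Suc l) \<and> \<eta> \<le> X (b l) - X (x l))"

text \<open>Sort the wells by their left ends. Only the last one can end at \<open>T\<close> without
  returning to its starting level, which is why the pattern asks for no right wall there.\<close>
lemma well_pattern_of_wells: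
  assumes W: "W \<subseteq> wells \<eta> T X" "finite W" "disjoint W" and \<eta>: "0 < \<eta>"
  shows "\<exists>a x b. well_pattern \<eta> T X (card W) a x b"
proof -
  have "\<forall>A\<in>W. \<exists>l r. A = {l..r} \<and> is_well \<eta> T X l r" using W(1) by (auto simp: wells_def)
  then obtain l r where lr: "\<And>A. A \<in> W \<Longrightarrow> A = {l A..r A}" "\<And>A. A \<in> W \<Longrightarrow> is_well \<eta> T X (l A) (r A)"
    by metis
  have less: "l A < r A" if "A \<in> W" for A
    using lr(2)[OF that] by (auto simp: is_well_def)
  have inj: "inj_on l W"
  proof (rule inj_onI)
    fix A B assume AB: "A \<in> W" "B \<in> W" "l A = l B"
    then have "l A \<in> A" "l A \<in> B" using lr(1)[of A] lr(1)[of B] less[of A] less[of B] by auto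
    then show "A = B" using W(3) AB by (auto simp: disjoint_def)
  qed
  define xs where "xs = sorted_list_of_set (l ` W)"
  have xs: "set xs = l ` W" "length xs = card W" "sorted_wrt (<) xs"
    using W(2) inj by (auto simp: xs_def card_image strict_sorted_iff)
  define A where "A i = inv_into W l (xs ! i)" for i
  have A: "A i \<in> W" "l (A i) = xs ! i" if "i < card W" for i
  proof -
    have "xs ! i \<in> l ` W" using that xs by (metis nth_mem)
    then show "A i \<in> W" "l (A i) = xs ! i" by (auto simp: A_def inv_into_into f_inv_into_f)
  qed
  have wA: "is_well \<eta> T X (xs ! i) (r (A i))" if "i < card W" for i
    using lr(2)[OF A(1)[OF that]] A(2)[OF that] by simp
  have "\<exists>x. xs ! i < x \<and> x < r (A i) \<and> \<eta> \<le> X (xs ! i) - X x" if "i < card W" for i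
    using wA[OF that] unfolding is_well_def by (elim conjE bexE) auto
  then obtain x where x: "\<And>i. i < card W \<Longrightarrow> xs ! i < x i"  "\<And>i. i < card W \<Longrightarrow> x i < r (A i)"
    "\<And>i. i < card W \<Longrightarrow> \<eta> \<le> X (xs ! i) - X (x i)" by metis
  have range: "0 \<le> xs ! i" "r (A i) \<le> T" if "i < card W" for i
    using wA[OF that] x(1,2)[OF that] by (auto simp: is_well_def)
  have gap: "r (A i) < xs ! Suc i" if i: "Suc i < card W" for i
  proof (rule ccontr)
    assume "\<not> r (A i) < xs ! Suc i"
    moreover have lt: "xs ! i < xs ! Suc i" using xs i by (auto simp: sorted_wrt_iff_nth_less)
    moreover have "l (A (Suc i)) \<le> r (A (Suc i))" using less[OF A(1)[OF i]] by simp
    moreover have "A i = {xs ! i..r (A i)}" using lr(1)[OF A(1)[of i]] A(2)[of i] i by simp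
    moreover have "A (Suc i) = {xs ! Suc i..r (A (Suc i))}" using lr(1)[OF A(1)[OF i]] A(2)[OF i] by simp
    ultimately have "xs ! Suc i \<in> A i \<inter> A (Suc i)" using A(2)[OF i] by auto
    moreover have "A i \<noteq> A (Suc i)" using lt A(2)[of i] A(2)[of "Suc i"] i by auto
    ultimately show False using W(3) A(1)[of i] A(1)[of "Suc i"] i by (auto simp: disjoint_def)
  qed
  have "well_pattern \<eta> T X (card W) (\<lambda>i. xs ! i) x (\<lambda>i. r (A i))"
    unfolding well_pattern_def
  proof (intro conjI allI impI)
    fix i assume i: "Suc i < card W"
    then have i': "i < card W" by simp
    have "r (A i) \<noteq> T" using gap[OF i] x[OF i] range[OF i] by simp
    then have "X (xs ! i) = X (r (A i))" using wA[OF i'] by (simp add: is_well_def)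
    then show "\<eta> \<le> X (r (A i)) - X (x i)" using x(3)[OF i'] by simp
    show "x i \<le> r (A i)" using x(2)[OF i'] by simp
    show "r (A i) < xs ! Suc i" by (rule gap[OF i])
  next
    fix i assume i: "i < card W"
    show "0 \<le> xs ! i" "xs ! i \<le> x i" "x i < T" "\<eta> \<le> X (xs ! i) - X (x i)"
      using range[OF i] x[OF i] by auto
  qed
  then show ?thesis by blast
qed

lemma wells_of_well_pattern:
  assumes cont: "continuous_on {0..T} X" and \<eta>: "0 < \<eta>" and p: "well_pattern \<eta> T X k a x b"
  shows "\<exists>W. W \<subseteq> wells \<eta> T X \<and> finite W \<and> disjoint W \<and> card W = k"
proof -
  have p1: "0 \<le> a l" "a l \<le> x l" "x l < T" "\<eta> \<le> X (a l) - X (x l)" if "l < k" for l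
    using p that by (auto simp: well_pattern_def)
  have p2: "x l \<le> b l" "b l < a (Suc l)" "\<eta> \<le> X (b l) - X (x l)" if "Suc l < k" for l
    using p that by (auto simp: well_pattern_def)
  have "\<exists>c d. a l \<le> c \<and> d \<le> (if Suc l < k then b l else T) \<and> is_well \<eta> T X c d" if l: "l < k" for l
  proof (rule well_between[OF cont \<eta>])
    show "x l < (if Suc l < k then b l else T)"
      using p1[OF l] p2[of l] \<eta> by (auto simp: less_le)
    show "(if Suc l < k then b l else T) \<le> T"
      using p1[of "Suc l"] p2[of l] by auto
    show "\<eta> \<le> X (if Suc l < k then b l else T) - X (x l) \<or> (if Suc l < k then b l else T) = T"
      using p2[of l] by auto
  qed (use p1[OF l] in auto)
  then obtain c d where cd: "\<And>l. l < k \<Longrightarrow> a l \<le> c l" "\<And>l. l < k \<Longrightarrow> is_well \<eta> T X (c l) (d l)"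
    "\<And>l. l < k \<Longrightarrow> d l \<le> (if Suc l < k then b l else T)" by metis
  have cd_less: "c l < d l" if "l < k" for l
    using cd(2)[OF that] by (auto simp: is_well_def)
  have dc1: "d l < c (Suc l)" if "Suc l < k" for l
    using cd(3)[of l] cd(1)[of "Suc l"] p2(2)[of l] that by simp
  have dc: "d l < c l'" if "l < l'" "l' < k" for l l'
  proof -
    have "d l < c (Suc (l + n))" if "Suc (l + n) < k" for n
      using that
    proof (induction n)
      case 0
      then show ?case using dc1 by simp
    next
      case (Suc n)
      then have "d l < c (Suc (l + n))" by simp
      also have "\<dots> < d (Suc (l + n))" using Suc.prems by (intro cd_less) simp
      also have "\<dots> < c (Suc (Suc (l + n)))" using Suc.prems by (intro dc1) simp
      finally show ?case by simp
    qed
    from this[of "l' - l - 1"] show ?thesis using that by simp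
  qed
  have disj: "{c l..d l} \<inter> {c l'..d l'} = {}" if "l < k" "l' < k" "l \<noteq> l'" for l l'
    using dc[of l l'] dc[of l' l] that by (cases "l < l'") auto
  define W where "W = (\<lambda>l. {c l..d l}) ` {..<k}"
  have ne: "c l \<in> {c l..d l}" if "l < k" for l using cd_less[OF that] by simp
  have inj: "inj_on (\<lambda>l. {c l..d l}) {..<k}"
  proof (rule inj_onI)
    fix l l' assume "l \<in> {..<k}" "l' \<in> {..<k}" "{c l..d l} = {c l'..d l'}"
    then show "l = l'" using disj[of l l'] ne[of l] by auto
  qed
  have "disjoint W"
    using disj by (auto simp: W_def disjoint_def)
  moreover have "W \<subseteq> wells \<eta> T X" using cd(2) by (auto simp: W_def wells_def)
  moreover have "card W = k" using inj by (simp add: W_def card_image)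
  moreover have "finite W" by (simp add: W_def)
  ultimately show ?thesis by blast
qed

lemma max_disjoint_wells_ge_iff_pattern:
  assumes "continuous_on {0..T} X" "0 < \<eta>"
  shows "k \<le> max_disjoint_wells X T \<eta> \<longleftrightarrow> (\<exists>a x b. well_pattern \<eta> T X k a x b)"
proof
  assume "k \<le> max_disjoint_wells X T \<eta>"
  then obtain W where W: "W \<subseteq> wells \<eta> T X" "finite W" "disjoint W" "card W = k"
    using max_disjoint_wells_ge_iff[OF assms] by blast
  show "\<exists>a x b. well_pattern \<eta> T X k a x b"
    using well_pattern_of_wells[OF W(1-3) assms(2)] W(4) by simp
next
  assume "\<exists>a x b. well_pattern \<eta> T X k a x b"
  then obtain a x b where "well_pattern \<eta> T X k a x b" by blast
  from wells_of_well_pattern[OF assms this] show "k \<le> max_disjoint_wells X T \<eta>"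
    by (simp add: max_disjoint_wells_ge_iff[OF assms])
qed

text \<open>Left wall to bottom is a descent and bottom to right wall an ascent.\<close>
lemma alternates_of_wells:
  assumes cont: "continuous_on {0..T} X" and \<eta>: "0 < \<eta>" and k: "k \<le> max_disjoint_wells X T \<eta>"
  shows "alternates \<eta> X {0..T} k"
proof (cases "k = 0")
  case False
  obtain a x b where p: "well_pattern \<eta> T X k a x b"
    using k max_disjoint_wells_ge_iff_pattern[OF cont \<eta>] by blast
  have p1: "0 \<le> a l" "a l \<le> x l" "x l < T" "\<eta> \<le> X (a l) - X (x l)" if "l < k" for l
    using p that by (auto simp: well_pattern_def)
  have p2: "x l \<le> b l" "b l < a (Suc l)" "\<eta> \<le> X (b l) - X (x l)" if "Suc l < k" for l
    using p that by (auto simp: well_pattern_def)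
  define u where "u i = (if even i then a (i div 2) else x (i div 2))" for i
  define v where "v i = (if even i then x (i div 2) else b (i div 2))" for i
  have in_range: "u i \<in> {0..T} \<and> v i \<in> {0..T} \<and> u i \<le> v i \<and> \<eta> \<le> (-1) ^ i * (X (u i) - X (v i))"
    if i: "i < 2 * k - 1" for i
  proof (cases "even i")
    case True
    then have "i div 2 < k" using i by auto
    then show ?thesis using p1[of "i div 2"] True by (simp add: u_def v_def)
  next
    case False
    then have l: "Suc (i div 2) < k" using i by (auto elim!: oddE)
    then show ?thesis using p1[of "i div 2"] p1[of "Suc (i div 2)"] p2[OF l] False
      by (simp add: u_def v_def)
  qed
  show ?thesis
  proof (rule alternates_of_pairs[of k u _ v])
    fix i assume i: "Suc i < 2 * k - 1"
    show "v i \<le> u (Suc i)"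
    proof (cases "even i")
      case False
      then have l: "Suc (i div 2) < k" using i by (auto elim!: oddE)
      then show ?thesis using p2[OF l] False by (simp add: u_def v_def)
    qed (simp add: u_def v_def)
  qed (use False in_range in auto)
qed simp

lemma left_approximation:
  fixes X :: "real \<Rightarrow> real"
  assumes cont: "continuous_on {0..T} X" and st: "0 \<le> s" "s < t" "t \<le> T" and e: "0 < e"
  shows "\<exists>s'. s \<le> s' \<and> s' < t \<and> \<bar>X s' - X t\<bar> < e"
proof -
  have "t \<in> {0..T}" using st by simp
  then obtain \<delta> where \<delta>: "0 < \<delta>" "\<And>r. r \<in> {0..T} \<Longrightarrow> dist r t < \<delta> \<Longrightarrow> dist (X r) (X t) < e"
    using cont e unfolding continuous_on_iff by blast
  define s' where "s' = max s (t - \<delta> / 2)"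
  have "s \<le> s'" "s' < t" "s' \<in> {0..T}" "dist s' t < \<delta>"
    using st \<delta>(1) by (auto simp: s'_def dist_real_def max_def)
  then show ?thesis using \<delta>(2)[of s'] by (auto simp: dist_real_def)
qed

text \<open>An alternation lets a peak serve both its neighbours, whereas disjoint wells need two separate
  points there. By continuity a point just before the peak is nearly as high, and the gap between
  \<open>\<eta>\<close> and \<open>\<eta>'\<close> pays for the difference.\<close>
lemma wells_of_alternates:
  assumes cont: "continuous_on {0..T} X" and \<eta>: "0 < \<eta>" "\<eta> < \<eta>'" and alt: "alternates \<eta>' X {0..T} k"
  shows "k \<le> max_disjoint_wells X T \<eta>"
proof -
  obtain p where p: "\<And>i. i < 2 * k \<Longrightarrow> p i \<in> {0..T}" "\<And>i. Suc i < 2 * k \<Longrightarrow> p i \<le> p (Suc i)"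
    "\<And>i. Suc i < 2 * k \<Longrightarrow> \<eta>' \<le> (-1) ^ i * (X (p i) - X (p (Suc i)))"
    using alternatesE[OF alt] by blast
  have pless: "p i < p (Suc i)" if "Suc i < 2 * k" for i
    using p(2)[OF that] p(3)[OF that] \<eta> by (cases "p i = p (Suc i)") auto
  have "\<exists>s'. p i \<le> s' \<and> s' < p (Suc i) \<and> \<bar>X s' - X (p (Suc i))\<bar> < \<eta>' - \<eta>" if "Suc i < 2 * k" for i
    using p(1)[of i] p(1)[of "Suc i"] pless[OF that] \<eta> that by (intro left_approximation[OF cont]) auto
  then obtain q where q: "\<And>i. Suc i < 2 * k \<Longrightarrow> p i \<le> q i" "\<And>i. Suc i < 2 * k \<Longrightarrow> q i < p (Suc i)"
    "\<And>i. Suc i < 2 * k \<Longrightarrow> \<bar>X (q i) - X (p (Suc i))\<bar> < \<eta>' - \<eta>" by metis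
  have "well_pattern \<eta> T X k (\<lambda>l. p (2 * l)) (\<lambda>l. if Suc l < k then p (2 * l + 1) else q (2 * l))
     (\<lambda>l. q (2 * l + 1))"
    unfolding well_pattern_def
  proof (intro conjI allI impI)
    fix l assume l: "l < k"
    have i: "Suc (2 * l) < 2 * k" using l by simp
    show "0 \<le> p (2 * l)" using p(1)[of "2 * l"] l by simp
    show "p (2 * l) \<le> (if Suc l < k then p (2 * l + 1) else q (2 * l))"
      using p(2)[OF i] q(1)[OF i] by simp
    show "(if Suc l < k then p (2 * l + 1) else q (2 * l)) < T"
    proof (cases "Suc l < k")
      case True
      then show ?thesis using pless[of "Suc (2 * l)"] p(1)[of "Suc (Suc (2 * l))"] by simp
    next
      case False
      then show ?thesis using q(2)[OF i] p(1)[OF i] by simp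
    qed
    show "\<eta> \<le> X (p (2 * l)) - X (if Suc l < k then p (2 * l + 1) else q (2 * l))"
      using p(3)[OF i] q(3)[OF i] \<eta> by (auto simp: abs_less_iff)
  next
    fix l assume l: "Suc l < k"
    then have i: "Suc (2 * l + 1) < 2 * k" by simp
    show "(if Suc l < k then p (2 * l + 1) else q (2 * l)) \<le> q (2 * l + 1)" using l q(1)[OF i] by simp
    show "q (2 * l + 1) < p (2 * Suc l)" using q(2)[OF i] by simp
    show "\<eta> \<le> X (q (2 * l + 1)) - X (if Suc l < k then p (2 * l + 1) else q (2 * l))"
      using l p(3)[OF i] q(3)[OF i] by (auto simp: abs_less_iff)
  qed
  then show ?thesis using max_disjoint_wells_ge_iff_pattern[OF cont \<eta>(1)] by blast
qed

section \<open>Measurability of alternation events\<close>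

lemma compact_function_box:
  fixes C :: "nat \<Rightarrow> real set"
  assumes "\<And>i. compact (C i)"
  shows "compact {p. \<forall>i. p i \<in> C i}"
proof -
  have "compactin (product_topology (\<lambda>i. euclidean) UNIV) (Pi\<^sub>E UNIV C)"
    using assms by (simp add: compactin_PiE)
  then have "compact (Pi\<^sub>E UNIV C)" by (simp add: euclidean_product_topology)
  moreover have "Pi\<^sub>E UNIV C = {p. \<forall>i. p i \<in> C i}" by (auto simp: PiE_def)
  ultimately show ?thesis by simp
qed

lemma exists_nonneg_on_compact:
  fixes K :: "'p::metric_space set"
  assumes K: "compact K" and g: "continuous_on K g"
    and ex: "\<And>n::nat. \<exists>p\<in>K. - (1 / real (Suc n)) < g p"
  shows "\<exists>p\<in>K. (0::real) \<le> g p"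
proof -
  have "K \<noteq> {}" using ex[of 0] by auto
  then obtain p where p: "p \<in> K" "\<And>q. q \<in> K \<Longrightarrow> g q \<le> g p"
    using continuous_attains_sup[OF K _ g] by blast
  have "0 \<le> g p"
  proof (rule ccontr)
    assume "\<not> 0 \<le> g p"
    then obtain n where "inverse (real (Suc n)) < - g p" using reals_Archimedean[of "- g p"] by auto
    moreover obtain q where "q \<in> K" "- (1 / real (Suc n)) < g q" using ex by blast
    ultimately show False using p(2)[of q] by (simp add: inverse_eq_divide)
  qed
  then show ?thesis using p by blast
qed

text \<open>An uncountable existential quantifier over a compact set is reduced to a countable dense subset;
  compactness supplies the limit point at which the value \<open>0\<close> is attained.\<close>
lemma measurable_exists_nonneg_on_compact:
  fixes K :: "'p::{metric_space, second_countable_topology} set" and g :: "'w \<Rightarrow> 'p \<Rightarrow> real"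
  assumes K: "compact K" and meas: "\<And>p. p \<in> K \<Longrightarrow> (\<lambda>\<omega>. g \<omega> p) \<in> borel_measurable M"
    and cont: "\<And>\<omega>. \<omega> \<in> space M \<Longrightarrow> continuous_on K (g \<omega>)"
  shows "{\<omega> \<in> space M. \<exists>p\<in>K. 0 \<le> g \<omega> p} \<in> sets M"
proof -
  obtain D where D: "countable D" "D \<subseteq> K" "K \<subseteq> closure D" using separable[of K] .
  have "{\<omega> \<in> space M. \<exists>p\<in>K. 0 \<le> g \<omega> p} =
    {\<omega> \<in> space M. \<forall>n::nat. \<exists>p\<in>D. - (1 / real (Suc n)) < g \<omega> p}"
  proof (intro Collect_cong conj_cong refl iffI allI)
    fix \<omega> n assume \<omega>: "\<omega> \<in> space M" and "\<exists>p\<in>K. 0 \<le> g \<omega> p"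
    then obtain p where p: "p \<in> K" "0 \<le> g \<omega> p" by blast
    have "0 < 1 / real (Suc n)" by simp
    with cont[OF \<omega>] p(1) obtain \<delta> where \<delta>: "0 < \<delta>"
      "\<And>q. q \<in> K \<Longrightarrow> dist q p < \<delta> \<Longrightarrow> dist (g \<omega> q) (g \<omega> p) < 1 / real (Suc n)"
      unfolding continuous_on_iff by metis
    obtain q where "q \<in> D" "dist q p < \<delta>"
      using D(3) p(1) \<delta>(1) by (meson closure_approachable subsetD)
    moreover from this have "dist (g \<omega> q) (g \<omega> p) < 1 / real (Suc n)" using D(2) by (intro \<delta>(2)) auto
    then have "- (1 / real (Suc n)) < g \<omega> q" using p(2) by (simp add: dist_real_def abs_less_iff)
    ultimately show "\<exists>p\<in>D. - (1 / real (Suc n)) < g \<omega> p" by blast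
  next
    fix \<omega> assume \<omega>: "\<omega> \<in> space M" and "\<forall>n::nat. \<exists>p\<in>D. - (1 / real (Suc n)) < g \<omega> p"
    then show "\<exists>p\<in>K. 0 \<le> g \<omega> p"
      using exists_nonneg_on_compact[OF K cont[OF \<omega>]] D(2) by blast
  qed
  also have "\<dots> = (\<Inter>n::nat. \<Union>p\<in>D. {\<omega> \<in> space M. - (1 / real (Suc n)) < g \<omega> p}) \<inter> space M"
    by auto
  also have "\<dots> \<in> sets M"
  proof -
    have "(\<Union>p\<in>D. {\<omega> \<in> space M. - (1 / real (Suc n)) < g \<omega> p}) \<in> sets M" for n
    proof (rule sets.countable_UN'[OF D(1)], rule image_subsetI)
      fix p assume "p \<in> D"
      then have [measurable]: "(\<lambda>\<omega>. g \<omega> p) \<in> borel_measurable M" using meas D(2) by blast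
      show "{\<omega> \<in> space M. - (1 / real (Suc n)) < g \<omega> p} \<in> sets M" by measurable
    qed
    then show ?thesis by (intro sets.Int sets.top sets.countable_INT') auto
  qed
  finally show ?thesis .
qed

lemma sum_min_0_nonneg_iff:
  fixes h :: "'i \<Rightarrow> real"
  assumes "finite I"
  shows "0 \<le> (\<Sum>i\<in>I. min 0 (h i)) \<longleftrightarrow> (\<forall>i\<in>I. 0 \<le> h i)"
proof
  assume "0 \<le> (\<Sum>i\<in>I. min 0 (h i))"
  moreover have "(\<Sum>i\<in>I. min 0 (h i)) \<le> 0" by (intro sum_nonpos) auto
  ultimately have "(\<Sum>i\<in>I. - min 0 (h i)) = 0" by (simp add: sum_negf)
  then have "\<forall>i\<in>I. - min 0 (h i) = 0" using assms by (subst (asm) sum_nonneg_eq_0_iff) auto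
  then show "\<forall>i\<in>I. 0 \<le> h i" by (auto simp: min_def split: if_splits)
qed (auto intro!: sum_nonneg)

text \<open>Infinite sequences of times, so that one set, compact by Tychonoff, serves all
  \<open>k\<close>.\<close>
definition alternation_points :: "real \<Rightarrow> (nat \<Rightarrow> real) set" where
  "alternation_points T = {p. \<forall>i. p i \<in> {0..T}} \<inter> {p. \<forall>i. p i \<le> p (Suc i)}"

text \<open>Vanishes exactly if all the height conditions hold, is negative otherwise, and is continuous in
  the points.\<close>
definition alternation_slack :: "real \<Rightarrow> nat \<Rightarrow> (real \<Rightarrow> real) \<Rightarrow> (nat \<Rightarrow> real) \<Rightarrow> real" where
  "alternation_slack L k X p = (\<Sum>i<2 * k - 1. min 0 ((-1) ^ i * (X (p i) - X (p (Suc i))) - L))"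

lemma compact_alternation_points: "compact (alternation_points T)"
  unfolding alternation_points_def
proof (rule compact_Int_closed)
  show "compact {p :: nat \<Rightarrow> real. \<forall>i. p i \<in> {0..T}}" by (rule compact_function_box) simp
  show "closed {p :: nat \<Rightarrow> real. \<forall>i. p i \<le> p (Suc i)}"
    by (intro closed_Collect_all closed_Collect_le continuous_on_product_coordinates)
qed

lemma continuous_on_eval_coordinate:
  assumes "continuous_on {0..T} X" "\<And>p. p \<in> K \<Longrightarrow> f p \<in> {0..T}" "continuous_on K f"
  shows "continuous_on K (\<lambda>p. X (f p))"
  using continuous_on_compose2[OF assms(1) assms(3)] assms(2) by blast

lemma continuous_on_alternation_slack:
  assumes "continuous_on {0..T} X"
  shows "continuous_on (alternation_points T) (alternation_slack L k X)"
proof -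
  have "continuous_on (alternation_points T) (\<lambda>p. X (p i))" for i
    by (rule continuous_on_eval_coordinate[OF assms])
      (auto simp: alternation_points_def intro: continuous_on_subset[OF continuous_on_product_coordinates])
  then show ?thesis unfolding alternation_slack_def by (intro continuous_intros)
qed

lemma alternates_iff_slack:
  assumes "0 \<le> T" "0 < k"
  shows "alternates L X {0..T} k \<longleftrightarrow> (\<exists>p\<in>alternation_points T. 0 \<le> alternation_slack L k X p)"
proof
  assume "alternates L X {0..T} k"
  then obtain p where p: "\<And>i. i < 2 * k \<Longrightarrow> p i \<in> {0..T}" "\<And>i. Suc i < 2 * k \<Longrightarrow> p i \<le> p (Suc i)"
    "\<And>i. Suc i < 2 * k \<Longrightarrow> L \<le> (-1) ^ i * (X (p i) - X (p (Suc i)))"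
    using alternatesE by blast
  define q where "q i = p (min i (2 * k - 1))" for i
  have "q i \<in> {0..T}" for i using p(1)[of "min i (2 * k - 1)"] assms by (simp add: q_def)
  moreover have "q i \<le> q (Suc i)" for i
  proof (cases "Suc i < 2 * k")
    case True
    then have "min i (2 * k - 1) = i" "min (Suc i) (2 * k - 1) = Suc i" by auto
    then show ?thesis using p(2)[OF True] by (simp add: q_def)
  next
    case False
    then have "min i (2 * k - 1) = min (Suc i) (2 * k - 1)" by auto
    then show ?thesis by (simp add: q_def)
  qed
  ultimately have "q \<in> alternation_points T" by (auto simp: alternation_points_def)
  moreover have "0 \<le> alternation_slack L k X q"
    unfolding alternation_slack_def
  proof (subst sum_min_0_nonneg_iff, simp, intro ballI)
    fix i assume "i \<in> {..<2 * k - 1}"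
    then have i: "Suc i < 2 * k" by auto
    then have "min i (2 * k - 1) = i" "min (Suc i) (2 * k - 1) = Suc i" by auto
    then show "0 \<le> (-1) ^ i * (X (q i) - X (q (Suc i))) - L"
      using p(3)[OF i] by (simp add: q_def)
  qed
  ultimately show "\<exists>p\<in>alternation_points T. 0 \<le> alternation_slack L k X p" by blast
next
  assume "\<exists>p\<in>alternation_points T. 0 \<le> alternation_slack L k X p"
  then obtain p where p: "p \<in> alternation_points T" "0 \<le> alternation_slack L k X p" by blast
  have "0 \<le> (-1) ^ i * (X (p i) - X (p (Suc i))) - L" if "Suc i < 2 * k" for i
  proof -
    have "i \<in> {..<2 * k - 1}" using that by auto
    then show ?thesis using p(2) unfolding alternation_slack_def sum_min_0_nonneg_iff[OF finite_lessThan]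
      by blast
  qed
  then show "alternates L X {0..T} k"
    using p(1) by (intro alternatesI[of k p]) (auto simp: alternation_points_def)
qed

lemma alternates_closed_level:
  fixes T :: real
  assumes T: "0 \<le> T" and cont: "continuous_on {0..T} X" and alt: "\<And>e. 0 < e \<Longrightarrow> alternates (L - e) X {0..T} k"
  shows "alternates L X {0..T} k"
proof (cases "k = 0")
  case False
  have "\<exists>p\<in>alternation_points T. 0 \<le> alternation_slack L k X p"
  proof (rule exists_nonneg_on_compact[OF compact_alternation_points continuous_on_alternation_slack[OF cont]])
    fix n :: nat
    define e where "e = 1 / real (Suc n) / real (2 * k)"
    have e: "0 < e" using False by (simp add: e_def)
    obtain p where p: "p \<in> alternation_points T" "0 \<le> alternation_slack (L - e) k X p"
      using alt[OF e] alternates_iff_slack[OF T, of k] False by blast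
    have "- e \<le> min 0 ((-1) ^ i * (X (p i) - X (p (Suc i))) - L)" if "i < 2 * k - 1" for i
    proof -
      have "0 \<le> (-1) ^ i * (X (p i) - X (p (Suc i))) - (L - e)"
        using p(2) that unfolding alternation_slack_def sum_min_0_nonneg_iff[OF finite_lessThan] by blast
      then show ?thesis using e by simp
    qed
    then have "(\<Sum>i<2 * k - 1. - e) \<le> alternation_slack L k X p"
      unfolding alternation_slack_def by (intro sum_mono) auto
    moreover have "- (1 / real (Suc n)) < (\<Sum>i<2 * k - 1. - e)"
    proof -
      have "real (2 * k - 1) * e < real (2 * k) * e" using e False by (intro mult_strict_right_mono) auto
      also have "\<dots> = 1 / real (Suc n)" using False by (simp add: e_def)
      finally show ?thesis by simp
    qed
    ultimately show "\<exists>p\<in>alternation_points T. - (1 / real (Suc n)) < alternation_slack L k X p"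
      using p(1) by (intro bexI[of _ p]) auto
  qed
  then show ?thesis using alternates_iff_slack[OF T] False by blast
qed simp

lemma measurable_alternates:
  fixes T :: real
  assumes T: "0 \<le> T" and meas: "\<And>s. 0 \<le> s \<Longrightarrow> X s \<in> borel_measurable M"
    and cont: "\<And>\<omega>. \<omega> \<in> space M \<Longrightarrow> continuous_on {0..T} (\<lambda>s. X s \<omega>)"
  shows "{\<omega> \<in> space M. alternates L (\<lambda>s. X s \<omega>) {0..T} k} \<in> sets M"
proof (cases "k = 0")
  case False
  have "{\<omega> \<in> space M. \<exists>p\<in>alternation_points T. 0 \<le> alternation_slack L k (\<lambda>s. X s \<omega>) p} \<in> sets M"
  proof (rule measurable_exists_nonneg_on_compact[OF compact_alternation_points])
    fix p assume "p \<in> alternation_points T"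
    then have "X (p i) \<in> borel_measurable M" for i by (intro meas) (auto simp: alternation_points_def)
    note this[measurable]
    show "(\<lambda>\<omega>. alternation_slack L k (\<lambda>s. X s \<omega>) p) \<in> borel_measurable M"
      unfolding alternation_slack_def by measurable
  qed (rule continuous_on_alternation_slack[OF cont])
  then show ?thesis using alternates_iff_slack[OF T] False by simp
qed simp

section \<open>Measurability of eigenvalue and well counts\<close>

lemma sum_order_linear_mult:
  fixes q :: "real poly"
  assumes q: "q \<noteq> 0" and r: "r \<in> S"
  shows "(\<Sum>x\<in>{x \<in> S. poly ([:- r, 1:] * q) x = 0}. order x ([:- r, 1:] * q)) =
    Suc (\<Sum>x\<in>{x \<in> S. poly q x = 0}. order x q)"
proof -
  have nz: "[:- r, 1:] * q \<noteq> 0" using q by (metis mult_eq_0_iff pCons_eq_0_iff one_neq_zero)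
  have fin: "finite {x. poly ([:- r, 1:] * q) x = 0}" by (rule poly_roots_finite[OF nz])
  define R where "R = {x \<in> S. poly ([:- r, 1:] * q) x = 0}"
  have R: "finite R" "r \<in> R" "{x \<in> S. poly q x = 0} \<subseteq> R"
    using fin r by (auto simp: R_def)
  have "(\<Sum>x\<in>R. order x ([:- r, 1:] * q)) = (\<Sum>x\<in>R. order x [:- r, 1:]) + (\<Sum>x\<in>R. order x q)"
    unfolding order_mult[OF nz] sum.distrib ..
  also have "(\<Sum>x\<in>R. order x [:- r, 1:]) = (\<Sum>x\<in>R. if x = r then 1 else 0)"
    by (intro sum.cong) (auto simp: order_linear order_0I)
  also have "\<dots> = 1" using R by simp
  also have "(\<Sum>x\<in>R. order x q) = (\<Sum>x\<in>{x \<in> S. poly q x = 0}. order x q)"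
    using R q by (intro sum.mono_neutral_right) (auto simp: R_def order_root)
  finally show ?thesis by (simp add: R_def)
qed

text \<open>Counting zeros with multiplicity through divisibility: this replaces orders, which do not depend
  measurably on the coefficients in any evident way, by an existential statement.\<close>
lemma sum_order_ge_iff:
  fixes p :: "real poly"
  assumes "p \<noteq> 0"
  shows "k \<le> (\<Sum>x\<in>{x \<in> S. poly p x = 0}. order x p) \<longleftrightarrow>
    (\<exists>r. (\<forall>i<k. r i \<in> S) \<and> (\<Prod>i<k. [:- r i, 1:]) dvd p)"
  using assms
proof (induction k arbitrary: p)
  case 0
  then show ?case by simp
next
  case (Suc k)
  show ?case
  proof
    assume le: "Suc k \<le> (\<Sum>x\<in>{x \<in> S. poly p x = 0}. order x p)"
    then have "{x \<in> S. poly p x = 0} \<noteq> {}" by (metis sum.empty not_less_eq_eq le0)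
    then obtain z where z: "z \<in> S" "poly p z = 0" by blast
    from z(2) have "[:- z, 1:] dvd p" by (simp add: poly_eq_0_iff_dvd)
    then obtain q where q: "p = [:- z, 1:] * q" by (rule dvdE)
    have "q \<noteq> 0" using q Suc.prems by auto
    then have "k \<le> (\<Sum>x\<in>{x \<in> S. poly q x = 0}. order x q)"
      using le unfolding q sum_order_linear_mult[OF \<open>q \<noteq> 0\<close> z(1)] by simp
    then obtain r where r: "\<forall>i<k. r i \<in> S" "(\<Prod>i<k. [:- r i, 1:]) dvd q"
      using Suc.IH[OF \<open>q \<noteq> 0\<close>] by blast
    have "(\<Prod>i<Suc k. [:- (r(k := z)) i, 1:]) = (\<Prod>i<k. [:- r i, 1:]) * [:- z, 1:]"
      by (simp only: prod.lessThan_Suc fun_upd_same) (intro arg_cong2[where f = "(*)"] prod.cong, auto)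
    also have "\<dots> dvd q * [:- z, 1:]" by (rule mult_dvd_mono[OF r(2) dvd_refl])
    also have "q * [:- z, 1:] = p" unfolding q by (rule mult.commute)
    finally show "\<exists>r. (\<forall>i<Suc k. r i \<in> S) \<and> (\<Prod>i<Suc k. [:- r i, 1:]) dvd p"
      using r(1) z(1) by (intro exI[of _ "r(k := z)"]) auto
  next
    assume "\<exists>r. (\<forall>i<Suc k. r i \<in> S) \<and> (\<Prod>i<Suc k. [:- r i, 1:]) dvd p"
    then obtain r where r1: "\<forall>i<Suc k. r i \<in> S" "(\<Prod>i<Suc k. [:- r i, 1:]) dvd p" by blast
    from r1(2) obtain s where "p = (\<Prod>i<Suc k. [:- r i, 1:]) * s" by (rule dvdE)
    note r = r1(1) this
    define q where "q = (\<Prod>i<k. [:- r i, 1:]) * s"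
    have p: "p = [:- r k, 1:] * q"
      unfolding r(2) q_def prod.lessThan_Suc by (simp only: ac_simps)
    have "q \<noteq> 0" using p Suc.prems by auto
    then have "k \<le> (\<Sum>x\<in>{x \<in> S. poly q x = 0}. order x q)"
      using Suc.IH[of q] r(1) q_def by (metis dvd_triv_left less_SucI)
    moreover have "r k \<in> S" using r(1) by simp
    ultimately show "Suc k \<le> (\<Sum>x\<in>{x \<in> S. poly p x = 0}. order x p)"
      unfolding p sum_order_linear_mult[OF \<open>q \<noteq> 0\<close> \<open>r k \<in> S\<close>] by simp
  qed
qed

lemma num_eigenvalues_ge_iff:
  "k \<le> num_eigenvalues_in (schroedinger_mat a m) S \<longleftrightarrow>
    (\<exists>r. (\<forall>i<k. r i \<in> S) \<and> (\<Prod>i<k. [:- r i, 1:]) dvd jacobi_poly a (Suc m))"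
proof -
  have "schroedinger_mat a m \<in> carrier_mat (Suc m) (Suc m)" by (simp add: schroedinger_mat_def)
  then have "num_eigenvalues_in (schroedinger_mat a m) S =
    (\<Sum>x\<in>{x \<in> S. poly (jacobi_poly a (Suc m)) x = 0}. order x (jacobi_poly a (Suc m)))"
    unfolding num_eigenvalues_in_def by (simp add: eigenvalue_root_char_poly char_poly_schroedinger_mat)
  then show ?thesis using sum_order_ge_iff[OF jacobi_poly_Suc_nonzero] by simp
qed

lemma degree_jacobi_poly_Suc: "degree (jacobi_poly a (Suc m)) = Suc m"
proof -
  have "schroedinger_mat a m \<in> carrier_mat (Suc m) (Suc m)"
    by (simp add: schroedinger_mat_def)
  from degree_monic_char_poly[OF this] show ?thesis
    by (auto simp: char_poly_schroedinger_mat)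
qed

text \<open>The distance between \<open>p\<close> and the product of \<open>k\<close> linear factors with a
  cofactor, measured at enough points to determine polynomials of degree \<open>k + d\<close>. The first
  \<open>k\<close> entries of \<open>q\<close> are the zeros, the next ones the coefficients of the
  cofactor.\<close>
definition factor_defect :: "nat \<Rightarrow> nat \<Rightarrow> (real \<Rightarrow> real) \<Rightarrow> (nat \<Rightarrow> real) \<Rightarrow> real" where
  "factor_defect k d p q = (\<Sum>x\<le>k + d. \<bar>p (real x) - (\<Prod>i<k. real x - q i) * (\<Sum>j\<le>d. q (k + j) * real x ^ j)\<bar>)"

lemma dvd_iff_factor_defect:
  fixes p :: "real poly"
  assumes p: "degree p \<le> d"
  shows "(\<Prod>i<k. [:- q i, 1:]) * (\<Sum>j\<le>d. monom (q (k + j)) j) = p \<longleftrightarrow> factor_defect k d (poly p) q = 0"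
proof -
  let ?P = "(\<Prod>i<k. [:- q i, 1:]) * (\<Sum>j\<le>d. monom (q (k + j)) j)"
  have ev: "poly ?P x = (\<Prod>i<k. x - q i) * (\<Sum>j\<le>d. q (k + j) * x ^ j)" for x
    by (simp add: poly_prod poly_sum poly_monom)
  have "degree (\<Prod>i<k. [:- q i, 1:]) \<le> k"
    using degree_prod_sum_le[of "{..<k}" "\<lambda>i. [:- q i, 1:]"] by (simp add: o_def)
  moreover have "degree (\<Sum>j\<le>d. monom (q (k + j)) j) \<le> d"
    by (intro degree_sum_le) (auto intro: order.trans[OF degree_monom_le])
  ultimately have deg: "degree ?P \<le> k + d" by (intro order.trans[OF degree_mult_le]) simp
  have "?P = p \<longleftrightarrow> (\<forall>x\<in>{..k + d}. poly p (real x) = poly ?P (real x))"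
  proof
    assume *: "\<forall>x\<in>{..k + d}. poly p (real x) = poly ?P (real x)"
    show "?P = p"
    proof (rule poly_eqI_degree[where A = "real ` {..k + d}"])
      have "card (real ` {..k + d}) = Suc (k + d)" by (simp add: card_image)
      then show "degree ?P < card (real ` {..k + d})" "degree p < card (real ` {..k + d})"
        using deg p by simp_all
    qed (use * in auto)
  qed auto
  also have "\<dots> \<longleftrightarrow> factor_defect k d (poly p) q = 0"
    unfolding factor_defect_def ev by (subst sum_nonneg_eq_0_iff) auto
  finally show ?thesis .
qed

text \<open>Setting the unused coordinates to \<open>0\<close> keeps the search space inside a compact box
  once the coefficients are bounded.\<close>
lemma num_eigenvalues_ge_iff_defect:
  "k \<le> num_eigenvalues_in (schroedinger_mat a m) S \<longleftrightarrow>
    (\<exists>q. (\<forall>i<k. q i \<in> S) \<and> (\<forall>i>k + Suc m. q i = 0) \<and> factor_defect k (Suc m) (poly (jacobi_poly a (Suc m))) q = 0)"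
  unfolding num_eigenvalues_ge_iff
proof
  assume "\<exists>r. (\<forall>i<k. r i \<in> S) \<and> (\<Prod>i<k. [:- r i, 1:]) dvd jacobi_poly a (Suc m)"
  then obtain r where r1: "\<forall>i<k. r i \<in> S" "(\<Prod>i<k. [:- r i, 1:]) dvd jacobi_poly a (Suc m)" by blast
  from r1(2) obtain s where "jacobi_poly a (Suc m) = (\<Prod>i<k. [:- r i, 1:]) * s" by (rule dvdE)
  note r = r1(1) this
  define q where "q i = (if i < k then r i else if i \<le> k + Suc m then coeff s (i - k) else 0)" for i
  have "s \<noteq> 0" using r(2) jacobi_poly_Suc_nonzero[of a m] by auto
  moreover have nz: "(\<Prod>i<k. [:- r i, 1:]) \<noteq> 0" by simp
  ultimately have "degree s \<le> Suc m"
    using degree_jacobi_poly_Suc[of a m] degree_mult_eq[of "\<Prod>i<k. [:- r i, 1:]" s] r(2) by simp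
  then have "s = (\<Sum>j\<le>Suc m. monom (coeff s j) j)"
    by (intro poly_as_sum_of_monoms'[symmetric])
  also have "\<dots> = (\<Sum>j\<le>Suc m. monom (q (k + j)) j)" by (intro sum.cong) (auto simp: q_def)
  finally have s: "s = (\<Sum>j\<le>Suc m. monom (q (k + j)) j)" .
  have "(\<Prod>i<k. [:- r i, 1:]) = (\<Prod>i<k. [:- q i, 1:])" by (intro prod.cong) (auto simp: q_def)
  then have "(\<Prod>i<k. [:- q i, 1:]) * (\<Sum>j\<le>Suc m. monom (q (k + j)) j) = jacobi_poly a (Suc m)"
    using r(2) s by simp
  then have "factor_defect k (Suc m) (poly (jacobi_poly a (Suc m))) q = 0"
    by (subst (asm) dvd_iff_factor_defect) (simp_all add: degree_jacobi_poly_Suc)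
  moreover have "\<forall>i<k. q i \<in> S" "\<forall>i>k + Suc m. q i = 0" using r(1) by (auto simp: q_def)
  ultimately show "\<exists>q. (\<forall>i<k. q i \<in> S) \<and> (\<forall>i>k + Suc m. q i = 0) \<and> factor_defect k (Suc m) (poly (jacobi_poly a (Suc m))) q = 0"
    by blast
next
  assume "\<exists>q. (\<forall>i<k. q i \<in> S) \<and> (\<forall>i>k + Suc m. q i = 0) \<and> factor_defect k (Suc m) (poly (jacobi_poly a (Suc m))) q = 0"
  then obtain q where q: "\<forall>i<k. q i \<in> S" "factor_defect k (Suc m) (poly (jacobi_poly a (Suc m))) q = 0" by blast
  then have "(\<Prod>i<k. [:- q i, 1:]) * (\<Sum>j\<le>Suc m. monom (q (k + j)) j) = jacobi_poly a (Suc m)"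
    by (subst dvd_iff_factor_defect) (simp_all add: degree_jacobi_poly_Suc)
  then have "(\<Prod>i<k. [:- q i, 1:]) dvd jacobi_poly a (Suc m)" by (metis dvd_triv_left)
  then show "\<exists>r. (\<forall>i<k. r i \<in> S) \<and> (\<Prod>i<k. [:- r i, 1:]) dvd jacobi_poly a (Suc m)" using q(1) by blast
qed

lemma measurable_jacobi_poly:
  assumes "\<And>i. 1 \<le> i \<Longrightarrow> a i \<in> borel_measurable M"
  shows "(\<lambda>\<omega>. poly (jacobi_poly (\<lambda>i. a i \<omega>) n) x) \<in> borel_measurable M"
proof (induction n rule: induct_nat_012)
  case (ge2 n)
  have [measurable]: "a (Suc n) \<in> borel_measurable M" by (rule assms) simp
  note ge2[measurable]
  show ?case by simp
qed simp_all

lemma borel_measurable_real_of_nat_ge: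
  assumes "\<And>k. {\<omega> \<in> space M. k \<le> f \<omega>} \<in> sets M"
  shows "(\<lambda>\<omega>. real (f \<omega>)) \<in> borel_measurable M"
proof (rule borel_measurableI_ge)
  fix y
  have "{\<omega> \<in> space M. y \<le> real (f \<omega>)} = {\<omega> \<in> space M. nat \<lceil>y\<rceil> \<le> f \<omega>}"
    by (simp add: nat_ceiling_le_eq)
  also have "\<dots> \<in> sets M" by (rule assms)
  finally show "{\<omega> \<in> space M. y \<le> real (f \<omega>)} \<in> sets M" .
qed

text \<open>The strict inequalities of a well pattern are replaced by a margin \<open>\<delta>\<close>,
  which makes the set compact; the margin is then taken from a countable set.\<close>
definition pattern_points :: "real \<Rightarrow> real \<Rightarrow> nat \<Rightarrow> ((nat \<Rightarrow> real) \<times> (nat \<Rightarrow> real) \<times> (nat \<Rightarrow> real)) set" where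
  "pattern_points \<delta> T k = {p. \<forall>i. p i \<in> {0..T}} \<times> {p. \<forall>i. p i \<in> {0..T}} \<times> {p. \<forall>i. p i \<in> {0..T}} \<inter>
     ((\<Inter>l\<in>{..<k}. {z. fst z l \<le> fst (snd z) l} \<inter> {z. fst (snd z) l + \<delta> \<le> T}) \<inter>
      (\<Inter>l\<in>{..<k - 1}. {z. fst (snd z) l \<le> snd (snd z) l} \<inter> {z. snd (snd z) l + \<delta> \<le> fst z (Suc l)}))"

definition pattern_slack :: "real \<Rightarrow> nat \<Rightarrow> (real \<Rightarrow> real) \<Rightarrow> (nat \<Rightarrow> real) \<times> (nat \<Rightarrow> real) \<times> (nat \<Rightarrow> real) \<Rightarrow> real" where
  "pattern_slack \<eta> k X z = (\<Sum>l<k. min 0 (min (X (fst z l) - X (fst (snd z) l) - \<eta>)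
     (if Suc l < k then X (snd (snd z) l) - X (fst (snd z) l) - \<eta> else 0)))"

lemma continuous_on_triple_coordinates:
  "continuous_on S (\<lambda>z. fst z l :: real)" "continuous_on S (\<lambda>z. fst (snd z) l :: real)" "continuous_on S (\<lambda>z. snd (snd z) l :: real)"
  by (rule continuous_on_product_then_coordinatewise[OF continuous_on_fst[OF continuous_on_id]]
      continuous_on_product_then_coordinatewise[OF continuous_on_fst[OF continuous_on_snd[OF continuous_on_id]]]
      continuous_on_product_then_coordinatewise[OF continuous_on_snd[OF continuous_on_snd[OF continuous_on_id]]])+

lemma compact_pattern_points: "compact (pattern_points \<delta> T k)"
proof -
  note c = continuous_on_triple_coordinates[where S = UNIV]
  have box: "compact {p :: nat \<Rightarrow> real. \<forall>i. p i \<in> {0..T}}" by (rule compact_function_box) simp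
  have 1: "closed {z :: (nat \<Rightarrow> real) \<times> (nat \<Rightarrow> real) \<times> (nat \<Rightarrow> real). fst z l \<le> fst (snd z) l}" for l
    by (rule closed_Collect_le[OF c(1) c(2)])
  have 2: "closed {z :: (nat \<Rightarrow> real) \<times> (nat \<Rightarrow> real) \<times> (nat \<Rightarrow> real). fst (snd z) l + \<delta> \<le> T}" for l
    by (rule closed_Collect_le[OF continuous_on_add[OF c(2) continuous_on_const] continuous_on_const])
  have 3: "closed {z :: (nat \<Rightarrow> real) \<times> (nat \<Rightarrow> real) \<times> (nat \<Rightarrow> real). fst (snd z) l \<le> snd (snd z) l}" for l
    by (rule closed_Collect_le[OF c(2) c(3)])
  have 4: "closed {z :: (nat \<Rightarrow> real) \<times> (nat \<Rightarrow> real) \<times> (nat \<Rightarrow> real). snd (snd z) l + \<delta> \<le> fst z (Suc l)}" for l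
    by (rule closed_Collect_le[OF continuous_on_add[OF c(3) continuous_on_const] c(1)])
  have 5: "closed (\<Inter>l\<in>A. {z :: (nat \<Rightarrow> real) \<times> (nat \<Rightarrow> real) \<times> (nat \<Rightarrow> real).
      fst z l \<le> fst (snd z) l} \<inter> {z. fst (snd z) l + \<delta> \<le> T})" for A
    by (rule closed_INT, rule ballI, rule closed_Int[OF 1 2])
  have 6: "closed (\<Inter>l\<in>A. {z :: (nat \<Rightarrow> real) \<times> (nat \<Rightarrow> real) \<times> (nat \<Rightarrow> real).
      fst (snd z) l \<le> snd (snd z) l} \<inter> {z. snd (snd z) l + \<delta> \<le> fst z (Suc l)})" for A
    by (rule closed_INT, rule ballI, rule closed_Int[OF 3 4])
  show ?thesis
    unfolding pattern_points_def
    by (rule compact_Int_closed[OF compact_Times[OF box compact_Times[OF box box]] closed_Int[OF 5 6]])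
qed

lemma pattern_points_coordinates:
  assumes "z \<in> pattern_points \<delta> T k"
  shows "fst z l \<in> {0..T}" "fst (snd z) l \<in> {0..T}" "snd (snd z) l \<in> {0..T}"
  using assms by (auto simp: pattern_points_def)

lemma continuous_on_pattern_slack:
  assumes "continuous_on {0..T} X"
  shows "continuous_on (pattern_points \<delta> T k) (pattern_slack \<eta> k X)"
proof -
  have 1: "continuous_on (pattern_points \<delta> T k) (\<lambda>z. X (fst z l))" for l
  proof (rule continuous_on_eval_coordinate[OF assms])
    show "fst z l \<in> {0..T}" if "z \<in> pattern_points \<delta> T k" for z
      using pattern_points_coordinates[OF that] by blast
  qed (rule continuous_on_triple_coordinates)
  have 2: "continuous_on (pattern_points \<delta> T k) (\<lambda>z. X (fst (snd z) l))" for l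
  proof (rule continuous_on_eval_coordinate[OF assms])
    show "fst (snd z) l \<in> {0..T}" if "z \<in> pattern_points \<delta> T k" for z
      using pattern_points_coordinates[OF that] by blast
  qed (rule continuous_on_triple_coordinates)
  have 3: "continuous_on (pattern_points \<delta> T k) (\<lambda>z. X (snd (snd z) l))" for l
  proof (rule continuous_on_eval_coordinate[OF assms])
    show "snd (snd z) l \<in> {0..T}" if "z \<in> pattern_points \<delta> T k" for z
      using pattern_points_coordinates[OF that] by blast
  qed (rule continuous_on_triple_coordinates)
  have "continuous_on (pattern_points \<delta> T k) (\<lambda>z. min 0 (min (X (fst z l) - X (fst (snd z) l) - \<eta>)
     (if Suc l < k then X (snd (snd z) l) - X (fst (snd z) l) - \<eta> else 0)))" for l
    using 1[of l] 2[of l] 3[of l]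
    by (cases "Suc l < k") (simp_all add: continuous_on_min continuous_on_diff continuous_on_const)
  note 4 = this
  show ?thesis unfolding pattern_slack_def
  proof (rule continuous_on_sum)
    fix l
    show "continuous_on (pattern_points \<delta> T k) (\<lambda>z. min 0 (min (X (fst z l) - X (fst (snd z) l) - \<eta>)
      (if Suc l < k then X (snd (snd z) l) - X (fst (snd z) l) - \<eta> else 0)))" by (rule 4)
  qed
qed

lemma eventually_inverse_Suc_le:
  assumes "0 < (e :: real)"
  shows "\<forall>\<^sub>F n in sequentially. 1 / real (Suc n) \<le> e"
proof -
  have "\<forall>\<^sub>F n in sequentially. inverse (real (Suc n)) < e"
    by (rule order_tendstoD(2)[OF LIMSEQ_inverse_real_of_nat assms])
  then show ?thesis by (rule eventually_mono) (simp add: inverse_eq_divide)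
qed

lemma well_pattern_iff_slack:
  assumes T: "0 \<le> T"
  shows "(\<exists>a x b. well_pattern \<eta> T X k a x b) \<longleftrightarrow>
    (\<exists>n. \<exists>z\<in>pattern_points (1 / real (Suc n)) T k. 0 \<le> pattern_slack \<eta> k X z)"
proof
  assume "\<exists>a x b. well_pattern \<eta> T X k a x b"
  then obtain a x b where p: "well_pattern \<eta> T X k a x b" by (elim exE)
  have p1: "0 \<le> a l" "a l \<le> x l" "x l < T" "\<eta> \<le> X (a l) - X (x l)" if "l < k" for l
    using p that by (auto simp: well_pattern_def)
  have p2: "x l \<le> b l" "b l < a (Suc l)" "\<eta> \<le> X (b l) - X (x l)" if "Suc l < k" for l
    using p that by (auto simp: well_pattern_def)
  have "\<forall>\<^sub>F n in sequentially. (\<forall>l\<in>{..<k}. 1 / real (Suc n) \<le> T - x l) \<and>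
      (\<forall>l\<in>{..<k - 1}. 1 / real (Suc n) \<le> a (Suc l) - b l)"
    using p1(3) p2(2)
    by (intro eventually_conj eventually_ball_finite ballI eventually_inverse_Suc_le) auto
  then obtain n where n0: "\<forall>l\<in>{..<k}. 1 / real (Suc n) \<le> T - x l"
      "\<forall>l\<in>{..<k - 1}. 1 / real (Suc n) \<le> a (Suc l) - b l"
    using eventually_happens'[OF sequentially_bot] by blast
  define \<delta> where "\<delta> = 1 / real (Suc n)"
  have n1: "x l + \<delta> \<le> T" if "l < k" for l
    using n0(1)[rule_format, of l] that by (simp add: \<delta>_def algebra_simps)
  have n2: "b l + \<delta> \<le> a (Suc l)" if "Suc l < k" for l
  proof -
    have "l \<in> {..<k - 1}" using that by auto
    from n0(2)[rule_format, OF this] show ?thesis by (simp add: \<delta>_def algebra_simps)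
  qed
  define z where "z = (\<lambda>l. if l < k then a l else 0, \<lambda>l. if l < k then x l else 0, \<lambda>l. if Suc l < k then b l else 0)"
  have "z \<in> pattern_points \<delta> T k"
  proof -
    have 1: "(if l < k then a l else 0) \<in> {0..T}" "(if l < k then x l else 0) \<in> {0..T}" for l
      using p1[of l] T by auto
    have 2: "(if Suc l < k then b l else 0) \<in> {0..T}" for l
      using p2[of l] p1[of l] p1[of "Suc l"] T by auto
    have 3: "Suc l < k" if "l \<in> {..<k - 1}" for l using that by auto
    have "fst z l \<le> fst (snd z) l \<and> fst (snd z) l + \<delta> \<le> T" if "l \<in> {..<k}" for l
      using that p1(2)[of l] n1[of l] by (simp add: z_def)
    moreover have "fst (snd z) l \<le> snd (snd z) l \<and> snd (snd z) l + \<delta> \<le> fst z (Suc l)" if "l \<in> {..<k - 1}" for l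
      using 3[OF that] p2(1)[of l] n2[of l] by (simp add: z_def)
    moreover have "z \<in> {p. \<forall>i. p i \<in> {0..T}} \<times> {p. \<forall>i. p i \<in> {0..T}} \<times> {p. \<forall>i. p i \<in> {0..T}}"
      unfolding z_def using 1 2 by blast
    ultimately show ?thesis
      unfolding pattern_points_def by (intro IntI INT_I) simp_all
  qed
  moreover have "0 \<le> pattern_slack \<eta> k X z"
    unfolding pattern_slack_def sum_min_0_nonneg_iff[OF finite_lessThan]
    using p1(4) p2(3) by (auto simp: z_def)
  ultimately show "\<exists>n. \<exists>z\<in>pattern_points (1 / real (Suc n)) T k. 0 \<le> pattern_slack \<eta> k X z"
    unfolding \<delta>_def by blast
next
  assume "\<exists>n. \<exists>z\<in>pattern_points (1 / real (Suc n)) T k. 0 \<le> pattern_slack \<eta> k X z"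
  then obtain n z where z: "z \<in> pattern_points (1 / real (Suc n)) T k" "0 \<le> pattern_slack \<eta> k X z" by blast
  define \<delta> where "\<delta> = 1 / real (Suc n)"
  have \<delta>: "0 < \<delta>" by (simp add: \<delta>_def)
  have s: "0 \<le> min (X (fst z l) - X (fst (snd z) l) - \<eta>)
     (if Suc l < k then X (snd (snd z) l) - X (fst (snd z) l) - \<eta> else 0)" if "l < k" for l
    using z(2) that unfolding pattern_slack_def sum_min_0_nonneg_iff[OF finite_lessThan] by blast
  have "well_pattern \<eta> T X k (fst z) (fst (snd z)) (snd (snd z))"
    unfolding well_pattern_def
  proof (intro conjI allI impI)
    fix l assume l: "l < k"
    show "0 \<le> fst z l" using pattern_points_coordinates(1)[OF z(1)] by simp
    have "fst z l \<le> fst (snd z) l \<and> fst (snd z) l + \<delta> \<le> T"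
      using z(1) l unfolding pattern_points_def \<delta>_def by blast
    then show "fst z l \<le> fst (snd z) l" "fst (snd z) l < T" using \<delta> by auto
    show "\<eta> \<le> X (fst z l) - X (fst (snd z) l)" using s[OF l] by simp
  next
    fix l assume l: "Suc l < k"
    then have "l \<in> {..<k - 1}" by auto
    then have "fst (snd z) l \<le> snd (snd z) l \<and> snd (snd z) l + \<delta> \<le> fst z (Suc l)"
      using z(1) unfolding pattern_points_def \<delta>_def by blast
    then show "fst (snd z) l \<le> snd (snd z) l" "snd (snd z) l < fst z (Suc l)" using \<delta> by auto
    show "\<eta> \<le> X (snd (snd z) l) - X (fst (snd z) l)" using s[of l] l by simp
  qed
  then show "\<exists>a x b. well_pattern \<eta> T X k a x b" by blast
qed

text \<open>A countable union over the margin of events of the form treated in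
  \<open>measurable_exists_nonneg_on_compact\<close>.\<close>
lemma measurable_max_disjoint_wells_ge:
  assumes T: "0 \<le> T" and \<eta>: "0 < \<eta>" and meas: "\<And>s. 0 \<le> s \<Longrightarrow> X s \<in> borel_measurable M"
    and cont: "\<And>\<omega>. \<omega> \<in> space M \<Longrightarrow> continuous_on {0..T} (\<lambda>s. X s \<omega>)"
  shows "{\<omega> \<in> space M. k \<le> max_disjoint_wells (\<lambda>s. X s \<omega>) T \<eta>} \<in> sets M"
proof -
  have "{\<omega> \<in> space M. k \<le> max_disjoint_wells (\<lambda>s. X s \<omega>) T \<eta>} =
    (\<Union>n. {\<omega> \<in> space M. \<exists>z\<in>pattern_points (1 / real (Suc n)) T k. 0 \<le> pattern_slack \<eta> k (\<lambda>s. X s \<omega>) z})"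
    using max_disjoint_wells_ge_iff_pattern[OF cont \<eta>] well_pattern_iff_slack[OF T] by auto
  also have "\<dots> \<in> sets M"
  proof (intro sets.countable_UN' image_subsetI measurable_exists_nonneg_on_compact compact_pattern_points)
    fix n z assume z: "z \<in> pattern_points (1 / real (Suc n)) T k"
    have [measurable]: "X (fst z l) \<in> borel_measurable M" "X (fst (snd z) l) \<in> borel_measurable M"
      "X (snd (snd z) l) \<in> borel_measurable M" for l
      using pattern_points_coordinates[OF z, of l] by (auto intro: meas)
    show "(\<lambda>\<omega>. pattern_slack \<eta> k (\<lambda>s. X s \<omega>) z) \<in> borel_measurable M"
      unfolding pattern_slack_def by measurable
  qed (auto intro: continuous_on_pattern_slack[OF cont])
  finally show ?thesis .
qed

lemma continuous_on_factor_defect: "continuous_on S (factor_defect k d p)"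
proof -
  have [continuous_intros]: "continuous_on S (\<lambda>q :: nat \<Rightarrow> real. q i)" for i
    by (rule continuous_on_subset[OF continuous_on_product_coordinates]) simp
  show ?thesis unfolding factor_defect_def by (intro continuous_intros)
qed

text \<open>The open window and the unbounded coefficients are exhausted by countably many compact boxes,
  and on each of them \<open>measurable_exists_nonneg_on_compact\<close> applies to the negative
  defect.\<close>
lemma measurable_num_eigenvalues_ge:
  assumes "\<And>i. 1 \<le> i \<Longrightarrow> a i \<in> borel_measurable M"
  shows "{\<omega> \<in> space M. k \<le> num_eigenvalues_in (schroedinger_mat (\<lambda>i. a i \<omega>) m) {0<..<e}} \<in> sets M"
proof -
  let ?p = "\<lambda>\<omega>. poly (jacobi_poly (\<lambda>i. a i \<omega>) (Suc m))"
  define C :: "nat \<Rightarrow> nat \<Rightarrow> real set" where "C n i = (if i < k then {1 / real (Suc n)..e - 1 / real (Suc n)}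
     else if i \<le> k + Suc m then {- real n..real n} else {0})" for n i
  have "{\<omega> \<in> space M. k \<le> num_eigenvalues_in (schroedinger_mat (\<lambda>i. a i \<omega>) m) {0<..<e}} =
    (\<Union>n. {\<omega> \<in> space M. \<exists>q\<in>{q. \<forall>i. q i \<in> C n i}. 0 \<le> - factor_defect k (Suc m) (?p \<omega>) q})"
  proof (intro Set.set_eqI iffI)
    fix \<omega> assume "\<omega> \<in> {\<omega> \<in> space M. k \<le> num_eigenvalues_in (schroedinger_mat (\<lambda>i. a i \<omega>) m) {0<..<e}}"
    then obtain q where \<omega>: "\<omega> \<in> space M" and q: "\<forall>i<k. q i \<in> {0<..<e}" "\<forall>i>k + Suc m. q i = 0"
      "factor_defect k (Suc m) (?p \<omega>) q = 0"
      unfolding num_eigenvalues_ge_iff_defect mem_Collect_eq by blast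
    have "\<forall>\<^sub>F n in sequentially. q i \<in> C n i" if "i \<in> {..k + Suc m}" for i
    proof (cases "i < k")
      case True
      then have "0 < q i" "0 < e - q i" using q(1) by auto
      from eventually_inverse_Suc_le[OF this(1)] eventually_inverse_Suc_le[OF this(2)] show ?thesis
        by eventually_elim (use True in \<open>auto simp: C_def\<close>)
    next
      case False
      have "\<forall>\<^sub>F n in sequentially. \<bar>q i\<bar> \<le> real n"
        using eventually_ge_at_top[of "nat \<lceil>\<bar>q i\<bar>\<rceil>"] by eventually_elim linarith
      then show ?thesis by eventually_elim (use False that in \<open>auto simp: C_def\<close>)
    qed
    then have "\<forall>\<^sub>F n in sequentially. \<forall>i\<in>{..k + Suc m}. q i \<in> C n i" by (intro eventually_ball_finite) auto
    then obtain n where n: "\<And>i. i \<le> k + Suc m \<Longrightarrow> q i \<in> C n i"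
      using eventually_happens'[OF sequentially_bot] by fastforce
    have "q i \<in> C n i" for i using n[of i] q(2) by (cases "i \<le> k + Suc m") (auto simp: C_def)
    then show "\<omega> \<in> (\<Union>n. {\<omega> \<in> space M. \<exists>q\<in>{q. \<forall>i. q i \<in> C n i}. 0 \<le> - factor_defect k (Suc m) (?p \<omega>) q})"
      using \<omega> q(3) by (auto intro!: exI[of _ n] exI[of _ q])
  next
    fix \<omega> assume "\<omega> \<in> (\<Union>n. {\<omega> \<in> space M. \<exists>q\<in>{q. \<forall>i. q i \<in> C n i}. 0 \<le> - factor_defect k (Suc m) (?p \<omega>) q})"
    then obtain n q where \<omega>: "\<omega> \<in> space M" and q: "\<forall>i. q i \<in> C n i" "0 \<le> - factor_defect k (Suc m) (?p \<omega>) q" by blast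
    have "0 \<le> factor_defect k (Suc m) (?p \<omega>) q" unfolding factor_defect_def by (intro sum_nonneg) auto
    then have "factor_defect k (Suc m) (?p \<omega>) q = 0" using q(2) by simp
    moreover have "q i \<in> {0<..<e}" if "i < k" for i
    proof -
      have "0 < 1 / real (Suc n)" by simp
      moreover have "q i \<in> {1 / real (Suc n)..e - 1 / real (Suc n)}" using q(1)[rule_format, of i] that by (simp add: C_def)
      ultimately show ?thesis unfolding atLeastAtMost_iff greaterThanLessThan_iff by linarith
    qed
    moreover have "q i = 0" if "i > k + Suc m" for i using q(1)[rule_format, of i] that by (simp add: C_def)
    ultimately show "\<omega> \<in> {\<omega> \<in> space M. k \<le> num_eigenvalues_in (schroedinger_mat (\<lambda>i. a i \<omega>) m) {0<..<e}}"
      using \<omega> unfolding num_eigenvalues_ge_iff_defect by blast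
  qed
  also have "\<dots> \<in> sets M"
  proof (intro sets.countable_UN' image_subsetI measurable_exists_nonneg_on_compact compact_function_box)
    fix q :: "nat \<Rightarrow> real"
    have [measurable]: "(\<lambda>\<omega>. ?p \<omega> x) \<in> borel_measurable M" for x by (rule measurable_jacobi_poly[OF assms])
    show "(\<lambda>\<omega>. - factor_defect k (Suc m) (?p \<omega>) q) \<in> borel_measurable M"
      unfolding factor_defect_def by measurable
  qed (auto simp: C_def intro!: continuous_intros continuous_on_factor_defect)
  finally show ?thesis .
qed

section \<open>Random walks with standardized steps\<close>

locale standardized_walk = prob_space +
  fixes \<xi> :: "nat \<Rightarrow> 'a \<Rightarrow> real" and \<mu> :: "real measure"
  assumes indep: "indep_vars (\<lambda>_. borel) \<xi> UNIV"
    and law: "\<And>i. distr M borel (\<xi> i) = \<mu>"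
    and mean: "\<And>i. expectation (\<xi> i) = 0"
    and square_integrable: "\<And>i. integrable M (\<lambda>\<omega>. (\<xi> i \<omega>)\<^sup>2)"
    and second_moment: "\<And>i. expectation (\<lambda>\<omega>. (\<xi> i \<omega>)\<^sup>2) = 1"
begin

definition block :: "nat \<Rightarrow> nat \<Rightarrow> 'a \<Rightarrow> real" where
  "block c n \<omega> = (\<Sum>i\<in>{c..<c + n}. \<xi> i \<omega>)"

definition walk :: "nat \<Rightarrow> 'a \<Rightarrow> real" where
  "walk n \<omega> = (\<Sum>i<n. \<xi> i \<omega>)"

lemma rv_\<xi> [measurable]: "\<xi> i \<in> borel_measurable M"
  using indep by (auto simp: indep_vars_def)

lemma rv_block [measurable]: "block c n \<in> borel_measurable M"
  unfolding block_def[abs_def] by measurable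

lemma rv_walk [measurable]: "walk n \<in> borel_measurable M"
  unfolding walk_def[abs_def] by measurable

lemma walk_add: "walk (c + n) \<omega> = walk c \<omega> + block c n \<omega>"
proof -
  have "{..<c + n} = {..<c} \<union> {c..<c + n}" by auto
  moreover have "(\<Sum>i\<in>{..<c} \<union> {c..<c + n}. \<xi> i \<omega>) = (\<Sum>i<c. \<xi> i \<omega>) + (\<Sum>i\<in>{c..<c + n}. \<xi> i \<omega>)"
    by (rule sum.union_disjoint) auto
  ultimately show ?thesis by (simp only: walk_def block_def)
qed

lemma block_add: "block c (m + n) \<omega> = block c m \<omega> + block (c + m) n \<omega>"
  using walk_add[of c "m + n" \<omega>] walk_add[of c m \<omega>] walk_add[of "c + m" n \<omega>] by (simp add: add.assoc)

lemma block_Suc: "block c (Suc n) \<omega> = \<xi> (c + n) \<omega> + block c n \<omega>"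
  by (simp add: block_def)

lemma integrable_\<xi>: "integrable M (\<xi> i)"
  by (rule square_integrable_imp_integrable[OF _ square_integrable]) simp

lemma block_moments:
  "integrable M (block c n) \<and> integrable M (\<lambda>\<omega>. (block c n \<omega>)\<^sup>2) \<and>
   expectation (block c n) = 0 \<and> expectation (\<lambda>\<omega>. (block c n \<omega>)\<^sup>2) = real n"
proof (induction n)
  case 0
  have "block c 0 = (\<lambda>\<omega>. 0)" by (simp add: block_def[abs_def])
  then show ?case by simp
next
  case (Suc n)
  have ind: "indep_var borel (\<xi> (c + n)) borel (block c n)"
    unfolding block_def[abs_def]
    by (rule indep_vars_sum[OF _ _ indep_vars_subset[OF indep]]) auto
  have IH: "integrable M (block c n)" "integrable M (\<lambda>\<omega>. (block c n \<omega>)\<^sup>2)"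
    "expectation (block c n) = 0" "expectation (\<lambda>\<omega>. (block c n \<omega>)\<^sup>2) = real n"
    using Suc by auto
  have int: "integrable M (\<lambda>\<omega>. \<xi> (c + n) \<omega> * block c n \<omega>)"
    by (rule indep_var_integrable[OF ind integrable_\<xi> IH(1)])
  have prod: "expectation (\<lambda>\<omega>. \<xi> (c + n) \<omega> * block c n \<omega>) = 0"
    using indep_var_lebesgue_integral[OF ind integrable_\<xi> IH(1)] by (simp add: mean)
  have eq: "block c (Suc n) = (\<lambda>\<omega>. \<xi> (c + n) \<omega> + block c n \<omega>)"
    by (simp add: fun_eq_iff block_Suc)
  have sq: "(\<lambda>\<omega>. (block c (Suc n) \<omega>)\<^sup>2) =
      (\<lambda>\<omega>. (\<xi> (c + n) \<omega>)\<^sup>2 + 2 * (\<xi> (c + n) \<omega> * block c n \<omega>) + (block c n \<omega>)\<^sup>2)"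
    by (simp add: fun_eq_iff block_Suc power2_sum algebra_simps)
  show ?case
    unfolding sq unfolding eq
    using int IH square_integrable[of "c + n"] integrable_\<xi>[of "c + n"]
    by (simp add: prod mean second_moment)
qed

lemma block_tail:
  assumes "0 < t"
  shows "prob {\<omega> \<in> space M. t \<le> \<bar>block c n \<omega>\<bar>} \<le> real n / t\<^sup>2"
proof -
  have "integrable M (\<lambda>x. block c n x ^ 2)" using block_moments by blast
  from Chebyshev_inequality[OF rv_block this assms] show ?thesis
    using block_moments[of c n] by simp
qed

lemma block_law: "distr M borel (block c n) = distr M borel (walk n)"
proof (rule Levy_uniqueness)
  show "real_distribution (distr M borel (block c n))" "real_distribution (distr M borel (walk n))"
    by (auto intro: real_distribution_distr)
  have "char (distr M borel (block c n)) t = char (distr M borel (walk n)) t" for t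
    unfolding block_def[abs_def] walk_def[abs_def]
    by (subst (1 2) char_distr_sum) (auto intro: indep_vars_subset[OF indep] simp: law)
  then show "char (distr M borel (block c n)) = char (distr M borel (walk n))" by blast
qed

lemma prob_block_eq_walk:
  assumes "A \<in> sets borel"
  shows "prob {\<omega> \<in> space M. block c n \<omega> \<in> A} = prob {\<omega> \<in> space M. walk n \<omega> \<in> A}"
proof -
  have "measure (distr M borel (block c n)) A = prob {\<omega> \<in> space M. block c n \<omega> \<in> A}"
    using assms by (subst measure_distr) (auto intro!: arg_cong[where f = prob])
  moreover have "measure (distr M borel (walk n)) A = prob {\<omega> \<in> space M. walk n \<omega> \<in> A}"
    using assms by (subst measure_distr) (auto intro!: arg_cong[where f = prob])
  ultimately show ?thesis by (simp add: block_law)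
qed

text \<open>Ottaviani's inequality. At the first time \<open>i\<close> at which the partial sum exceeds
  \<open>2 * t\<close>, the remaining sum is independent of the past and, by Chebyshev, at most
  \<open>t\<close> with probability at least \<open>1 / 2\<close>; then the full sum still exceeds
  \<open>t\<close>.\<close>
lemma ottaviani:
  assumes t: "0 < t" and b: "real b \<le> t\<^sup>2 / 2"
  shows "prob {\<omega> \<in> space M. \<exists>i\<le>b. 2 * t < \<bar>block c i \<omega>\<bar>} \<le> 2 * prob {\<omega> \<in> space M. t < \<bar>block c b \<omega>\<bar>}"
proof -
  define E where "E i = {\<omega> \<in> space M. 2 * t < \<bar>block c i \<omega>\<bar> \<and> (\<forall>j<i. \<bar>block c j \<omega>\<bar> \<le> 2 * t)}" for i
  define F where "F i = {\<omega> \<in> space M. \<bar>block (c + i) (b - i) \<omega>\<bar> \<le> t}" for i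
  have [measurable]: "E i \<in> sets M" "F i \<in> sets M" for i
    unfolding E_def F_def by measurable
  have EF: "prob (E i \<inter> F i) = prob (E i) * prob (F i)" if "i \<le> b" for i
  proof -
    let ?A = "{c..<c + i}" and ?B = "{c + i..<c + b}"
    define XA where "XA = {x \<in> space (Pi\<^sub>M ?A (\<lambda>_. borel :: real measure)).
      2 * t < \<bar>\<Sum>k\<in>{c..<c + i}. x k\<bar> \<and> (\<forall>j<i. \<bar>\<Sum>k\<in>{c..<c + j}. x k\<bar> \<le> 2 * t)}"
    define XB where "XB = {x \<in> space (Pi\<^sub>M ?B (\<lambda>_. borel :: real measure)). \<bar>\<Sum>k\<in>?B. x k\<bar> \<le> t}"
    have [measurable]: "(\<lambda>x. \<Sum>k\<in>{c..<c + j}. x k) \<in> borel_measurable (Pi\<^sub>M ?A (\<lambda>_. borel :: real measure))"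
      if "j \<le> i" for j
      using that by (intro borel_measurable_sum measurable_component_singleton) auto
    have XA: "XA \<in> sets (Pi\<^sub>M ?A (\<lambda>_. borel))"
    proof -
      have "XA = {x \<in> space (Pi\<^sub>M ?A (\<lambda>_. borel :: real measure)). 2 * t < \<bar>\<Sum>k\<in>{c..<c + i}. x k\<bar>} \<inter>
        {x \<in> space (Pi\<^sub>M ?A (\<lambda>_. borel :: real measure)). \<forall>j\<in>{..<i}. \<bar>\<Sum>k\<in>{c..<c + j}. x k\<bar> \<le> 2 * t}"
        by (auto simp: XA_def)
      also have "\<dots> \<in> sets (Pi\<^sub>M ?A (\<lambda>_. borel))"
        by (intro sets.Int sets.sets_Collect_finite_All) measurable
      finally show ?thesis .
    qed
    have XB: "XB \<in> sets (Pi\<^sub>M ?B (\<lambda>_. borel))"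
      unfolding XB_def by measurable
    have ind: "indep_var (Pi\<^sub>M ?A (\<lambda>_. borel)) (\<lambda>\<omega>. restrict (\<lambda>i. \<xi> i \<omega>) ?A)
        (Pi\<^sub>M ?B (\<lambda>_. borel)) (\<lambda>\<omega>. restrict (\<lambda>i. \<xi> i \<omega>) ?B)"
      by (rule indep_var_restrict[OF indep]) auto
    have sumA: "(\<Sum>k\<in>{c..<c + j}. restrict (\<lambda>i. \<xi> i \<omega>) ?A k) = block c j \<omega>" if "j \<le> i" for j \<omega>
      unfolding block_def using that by (intro sum.cong) auto
    have sumB: "(\<Sum>k\<in>?B. restrict (\<lambda>i. \<xi> i \<omega>) ?B k) = block (c + i) (b - i) \<omega>" for \<omega>
      unfolding block_def using \<open>i \<le> b\<close> by (intro sum.cong) auto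
    have 1: "(\<lambda>\<omega>. restrict (\<lambda>i. \<xi> i \<omega>) ?A) -` XA \<inter> space M = E i"
      unfolding XA_def E_def using sumA by (auto simp: space_PiM)
    have 2: "(\<lambda>\<omega>. restrict (\<lambda>i. \<xi> i \<omega>) ?B) -` XB \<inter> space M = F i"
      unfolding XB_def F_def using sumB by (auto simp: space_PiM)
    have "(\<lambda>\<omega>. (restrict (\<lambda>i. \<xi> i \<omega>) ?A, restrict (\<lambda>i. \<xi> i \<omega>) ?B)) -` (XA \<times> XB) \<inter> space M = E i \<inter> F i"
      unfolding 1[symmetric] 2[symmetric] by auto
    then show ?thesis using indep_varD[OF ind XA XB] by (simp add: 1 2)
  qed
  have F_half: "1 / 2 \<le> prob (F i)" if "i \<le> b" for i
  proof -
    have "prob (space M - F i) \<le> prob {\<omega> \<in> space M. t \<le> \<bar>block (c + i) (b - i) \<omega>\<bar>}"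
      by (intro finite_measure_mono) (auto simp: F_def)
    also have "\<dots> \<le> real (b - i) / t\<^sup>2" by (rule block_tail[OF t])
    also have "\<dots> \<le> real b / t\<^sup>2" by (intro divide_right_mono) auto
    also have "\<dots> \<le> 1 / 2" using b t by (simp add: field_simps)
    finally show ?thesis by (simp add: prob_compl)
  qed
  have disjE: "disjoint_family_on E {..b}"
  proof -
    have "E i \<inter> E j = {}" if "i < j" for i j
      using that by (auto simp: E_def not_less)
    then show ?thesis unfolding disjoint_family_on_def by (metis Int_commute linorder_neqE_nat)
  qed
  have union: "{\<omega> \<in> space M. \<exists>i\<le>b. 2 * t < \<bar>block c i \<omega>\<bar>} = (\<Union>i\<in>{..b}. E i)"
  proof (intro Set.set_eqI iffI)
    fix \<omega> assume "\<omega> \<in> {\<omega> \<in> space M. \<exists>i\<le>b. 2 * t < \<bar>block c i \<omega>\<bar>}"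
    then obtain i where i: "\<omega> \<in> space M" "i \<le> b" "2 * t < \<bar>block c i \<omega>\<bar>" by auto
    define i0 where "i0 = (LEAST i. 2 * t < \<bar>block c i \<omega>\<bar>)"
    have "2 * t < \<bar>block c i0 \<omega>\<bar>" unfolding i0_def by (rule LeastI[of _ i]) (rule i(3))
    moreover have "i0 \<le> i" unfolding i0_def by (rule Least_le) (rule i(3))
    moreover have "\<bar>block c j \<omega>\<bar> \<le> 2 * t" if "j < i0" for j
      using not_less_Least[of j "\<lambda>i. 2 * t < \<bar>block c i \<omega>\<bar>"] that by (simp add: i0_def not_less)
    ultimately have "\<omega> \<in> E i0" "i0 \<le> b" using i by (auto simp: E_def)
    then show "\<omega> \<in> (\<Union>i\<in>{..b}. E i)" by auto
  qed (auto simp: E_def)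
  have "prob (\<Union>i\<in>{..b}. E i) = (\<Sum>i\<in>{..b}. prob (E i))"
    by (intro finite_measure_finite_Union disjE) auto
  also have "\<dots> \<le> (\<Sum>i\<in>{..b}. 2 * prob (E i \<inter> F i))"
  proof (rule sum_mono)
    fix i assume "i \<in> {..b}"
    then have i: "i \<le> b" by simp
    have "prob (E i) * (1 / 2) \<le> prob (E i) * prob (F i)" by (intro mult_left_mono F_half[OF i]) simp
    then show "prob (E i) \<le> 2 * prob (E i \<inter> F i)" by (simp add: EF[OF i])
  qed
  also have "\<dots> = 2 * prob (\<Union>i\<in>{..b}. E i \<inter> F i)"
    unfolding sum_distrib_left[symmetric]
    by (subst finite_measure_finite_Union) (use disjE in \<open>auto simp: disjoint_family_on_def\<close>)
  also have "\<dots> \<le> 2 * prob {\<omega> \<in> space M. t < \<bar>block c b \<omega>\<bar>}"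
  proof -
    have "t < \<bar>block c b \<omega>\<bar>" if "i \<le> b" "\<omega> \<in> E i \<inter> F i" for i \<omega>
      using block_add[of c i "b - i" \<omega>] that by (auto simp: E_def F_def)
    then have "(\<Union>i\<in>{..b}. E i \<inter> F i) \<subseteq> {\<omega> \<in> space M. t < \<bar>block c b \<omega>\<bar>}"
      by (auto simp: E_def)
    then show ?thesis by (intro mult_left_mono finite_measure_mono) auto
  qed
  finally show ?thesis unfolding union .
qed

text \<open>A union bound over the \<open>K\<close> blocks of length \<open>b\<close>; each block has the
  law of the first one.\<close>
lemma walk_oscillation:
  assumes t: "0 < t" and b: "0 < b" "real b \<le> t\<^sup>2 / 2"
  shows "prob {\<omega> \<in> space M. \<exists>i<K * b. 2 * t < \<bar>walk i \<omega> - walk (b * (i div b)) \<omega>\<bar>} \<le>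
    2 * real K * prob {\<omega> \<in> space M. t < \<bar>walk b \<omega>\<bar>}"
proof -
  have "{\<omega> \<in> space M. \<exists>i<K * b. 2 * t < \<bar>walk i \<omega> - walk (b * (i div b)) \<omega>\<bar>} \<subseteq>
    (\<Union>j\<in>{..<K}. {\<omega> \<in> space M. \<exists>i\<le>b. 2 * t < \<bar>block (b * j) i \<omega>\<bar>})"
  proof
    fix \<omega> assume "\<omega> \<in> {\<omega> \<in> space M. \<exists>i<K * b. 2 * t < \<bar>walk i \<omega> - walk (b * (i div b)) \<omega>\<bar>}"
    then obtain i where i: "\<omega> \<in> space M" "i < K * b" "2 * t < \<bar>walk i \<omega> - walk (b * (i div b)) \<omega>\<bar>" by auto
    have "walk i \<omega> - walk (b * (i div b)) \<omega> = block (b * (i div b)) (i mod b) \<omega>"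
      using walk_add[of "b * (i div b)" "i mod b" \<omega>] by simp
    moreover have "i div b < K" using i(2) b(1) by (simp add: less_mult_imp_div_less)
    moreover have "i mod b \<le> b" using b(1) by (simp add: less_imp_le)
    ultimately show "\<omega> \<in> (\<Union>j\<in>{..<K}. {\<omega> \<in> space M. \<exists>i\<le>b. 2 * t < \<bar>block (b * j) i \<omega>\<bar>})"
      using i by auto
  qed
  then have "prob {\<omega> \<in> space M. \<exists>i<K * b. 2 * t < \<bar>walk i \<omega> - walk (b * (i div b)) \<omega>\<bar>} \<le>
    prob (\<Union>j\<in>{..<K}. {\<omega> \<in> space M. \<exists>i\<le>b. 2 * t < \<bar>block (b * j) i \<omega>\<bar>})"
    by (intro finite_measure_mono) auto
  also have "\<dots> \<le> (\<Sum>j\<in>{..<K}. prob {\<omega> \<in> space M. \<exists>i\<le>b. 2 * t < \<bar>block (b * j) i \<omega>\<bar>})"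
    by (intro finite_measure_subadditive_finite) auto
  also have "\<dots> \<le> (\<Sum>j\<in>{..<K}. 2 * prob {\<omega> \<in> space M. t < \<bar>walk b \<omega>\<bar>})"
  proof (rule sum_mono)
    fix j
    have "prob {\<omega> \<in> space M. \<exists>i\<le>b. 2 * t < \<bar>block (b * j) i \<omega>\<bar>} \<le> 2 * prob {\<omega> \<in> space M. t < \<bar>block (b * j) b \<omega>\<bar>}"
      by (rule ottaviani[OF t b(2)])
    also have "prob {\<omega> \<in> space M. t < \<bar>block (b * j) b \<omega>\<bar>} = prob {\<omega> \<in> space M. t < \<bar>walk b \<omega>\<bar>}"
      using prob_block_eq_walk[of "{x. t < \<bar>x\<bar>}" "b * j" b] by simp
    finally show "prob {\<omega> \<in> space M. \<exists>i\<le>b. 2 * t < \<bar>block (b * j) i \<omega>\<bar>} \<le> 2 * prob {\<omega> \<in> space M. t < \<bar>walk b \<omega>\<bar>}" .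
  qed
  also have "\<dots> = 2 * real K * prob {\<omega> \<in> space M. t < \<bar>walk b \<omega>\<bar>}" by simp
  finally show ?thesis .
qed

definition scaled_increment :: "nat \<Rightarrow> nat \<Rightarrow> 'a \<Rightarrow> real" where
  "scaled_increment b j \<omega> = block (j * b) b \<omega> / sqrt (real b)"

abbreviation walk_law :: "nat \<Rightarrow> real measure" where
  "walk_law b \<equiv> distr M borel (\<lambda>\<omega>. walk b \<omega> / sqrt (real b))"

lemma rv_scaled_increment [measurable]: "scaled_increment b j \<in> borel_measurable M"
  unfolding scaled_increment_def[abs_def] by measurable

lemma scaled_increment_law: "distr M borel (scaled_increment b j) = walk_law b"
proof -
  have "distr M borel (scaled_increment b j) = distr (distr M borel (block (j * b) b)) borel (\<lambda>x. x / sqrt (real b))"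
    by (subst distr_distr) (auto simp: scaled_increment_def[abs_def] o_def)
  also have "\<dots> = walk_law b"
    unfolding block_law by (subst distr_distr) (auto simp: o_def)
  finally show ?thesis .
qed

lemma scaled_increments_indep: "indep_vars (\<lambda>_. borel) (scaled_increment b) J"
proof -
  have "indep_vars (\<lambda>j. Pi\<^sub>M {j * b..<j * b + b} (\<lambda>_. borel)) (\<lambda>j \<omega>. restrict (\<lambda>i. \<xi> i \<omega>) {j * b..<j * b + b}) J"
  proof (rule indep_vars_restrict[OF indep])
    have "{j * b..<j * b + b} \<inter> {j' * b..<j' * b + b} = {}" if "j < j'" for j j'
    proof -
      have "j * b + b \<le> j' * b" using mult_le_mono1[of "Suc j" j' b] that by simp
      then show ?thesis by auto
    qed
    then show "disjoint_family_on (\<lambda>j. {j * b..<j * b + b}) J"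
      unfolding disjoint_family_on_def by (metis Int_commute linorder_neqE_nat)
  qed simp
  then have "indep_vars (\<lambda>_. borel) (\<lambda>j \<omega>. (\<Sum>i\<in>{j * b..<j * b + b}. restrict (\<lambda>i. \<xi> i \<omega>) {j * b..<j * b + b} i) / sqrt (real b)) J"
    by (rule indep_vars_compose2) measurable
  then show ?thesis by (simp add: scaled_increment_def[abs_def] block_def)
qed

lemma scaled_increments_joint_law:
  assumes "K > 0"
  shows "distr M (Pi\<^sub>M {..<K} (\<lambda>_. borel)) (\<lambda>\<omega>. \<lambda>j\<in>{..<K}. scaled_increment b j \<omega>) = Pi\<^sub>M {..<K} (\<lambda>_. walk_law b)"
proof -
  have "{..<K} \<noteq> {}" using assms by auto
  from indep_vars_iff_distr_eq_PiM[OF this, where M' = "\<lambda>_. borel" and X = "scaled_increment b"] show ?thesis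
    using scaled_increments_indep[of b "{..<K}"] by (simp add: scaled_increment_law)
qed

lemma walk_clt: "weak_conv_m walk_law std_normal_distribution"
  unfolding walk_def[abs_def]
  using central_limit_theorem_zero_mean[of \<xi> 1 \<mu>, OF indep mean _ square_integrable _ law]
  by (simp add: mean second_moment)

end

section \<open>Coupling of product measures under weak convergence\<close>

text \<open>A product of image measures is the image of the product; this moves events to the product of the
  coupling space.\<close>
lemma measure_PiM_distr:
  assumes \<Omega>: "prob_space \<Omega>" and f: "f \<in> borel_measurable \<Omega>" and J: "finite J"
    and Q: "{x \<in> space (Pi\<^sub>M J (\<lambda>_. borel)). Q x} \<in> sets (Pi\<^sub>M J (\<lambda>_. borel :: real measure))"
  shows "measure (Pi\<^sub>M J (\<lambda>_. distr \<Omega> borel f)) {x \<in> space (Pi\<^sub>M J (\<lambda>_. borel)). Q x} =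
     measure (Pi\<^sub>M J (\<lambda>_. \<Omega>)) {w \<in> space (Pi\<^sub>M J (\<lambda>_. \<Omega>)). Q (compose J f w)}"
    and "{w \<in> space (Pi\<^sub>M J (\<lambda>_. \<Omega>)). Q (compose J f w)} \<in> sets (Pi\<^sub>M J (\<lambda>_. \<Omega>))"
proof -
  let ?\<nu> = "distr \<Omega> borel f"
  let ?P = "Pi\<^sub>M J (\<lambda>_. \<Omega>)"
  have f': "f \<in> measurable \<Omega> ?\<nu>" using f by simp
  have "distr ?P (Pi\<^sub>M J (\<lambda>_. ?\<nu>)) (compose J f) = Pi\<^sub>M J (\<lambda>_. distr \<Omega> ?\<nu> f)"
    by (rule distr_PiM_finite_prob_space'[OF J]) (use \<Omega> f in \<open>auto intro: prob_space.prob_space_distr\<close>)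
  also have "distr \<Omega> ?\<nu> f = ?\<nu>" by (rule distr_cong) auto
  finally have eq: "Pi\<^sub>M J (\<lambda>_. ?\<nu>) = distr ?P (Pi\<^sub>M J (\<lambda>_. ?\<nu>)) (compose J f)" ..
  have sets: "sets (Pi\<^sub>M J (\<lambda>_. ?\<nu>)) = sets (Pi\<^sub>M J (\<lambda>_. borel))" by (rule sets_PiM_cong) auto
  have m: "compose J f \<in> measurable ?P (Pi\<^sub>M J (\<lambda>_. borel))"
    unfolding compose_def using f by measurable
  have pre: "compose J f -` {x \<in> space (Pi\<^sub>M J (\<lambda>_. borel)). Q x} \<inter> space ?P =
      {w \<in> space ?P. Q (compose J f w)}"
    using measurable_space[OF m] by auto
  show "{w \<in> space ?P. Q (compose J f w)} \<in> sets ?P"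
    unfolding pre[symmetric] using m Q by (rule measurable_sets)
  show "measure (Pi\<^sub>M J (\<lambda>_. ?\<nu>)) {x \<in> space (Pi\<^sub>M J (\<lambda>_. borel)). Q x} =
     measure ?P {w \<in> space ?P. Q (compose J f w)}"
    by (subst eq, subst measure_distr) (use m Q pre sets in \<open>auto simp: measurable_cong_sets[OF refl sets]\<close>)
qed

text \<open>Convergence of joint laws of independent coordinates, in the form needed for events that are
  neither open nor closed: the Skorohod representation couples one coordinate, its product couples all of
  them, and on the good set all coordinates are within \<open>\<delta>\<close>. The hypothesis on
  \<open>Q1\<close> and \<open>Q2\<close> says that such an error turns the first event into the
  second.\<close>
lemma weak_conv_product_coupling:
  fixes \<mu> :: "nat \<Rightarrow> real measure" and Q1 Q2 :: "(nat \<Rightarrow> real) \<Rightarrow> bool"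
  assumes \<mu>: "\<And>n. real_distribution (\<mu> n)" and \<nu>: "real_distribution \<nu>" and conv: "weak_conv_m \<mu> \<nu>"
    and Q: "{x \<in> space (Pi\<^sub>M {..<K} (\<lambda>_. borel)). Q1 x} \<in> sets (Pi\<^sub>M {..<K} (\<lambda>_. borel :: real measure))"
      "{x \<in> space (Pi\<^sub>M {..<K} (\<lambda>_. borel)). Q2 x} \<in> sets (Pi\<^sub>M {..<K} (\<lambda>_. borel :: real measure))"
    and \<delta>: "0 < \<delta>" "\<And>x y. (\<And>j. j < K \<Longrightarrow> \<bar>x j - y j\<bar> \<le> \<delta>) \<Longrightarrow> Q1 x \<Longrightarrow> Q2 y"
    and \<epsilon>: "0 < \<epsilon>"
  shows "\<forall>\<^sub>F n in sequentially. measure (Pi\<^sub>M {..<K} (\<lambda>_. \<mu> n)) {x \<in> space (Pi\<^sub>M {..<K} (\<lambda>_. borel)). Q1 x} \<le>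
      measure (Pi\<^sub>M {..<K} (\<lambda>_. \<nu>)) {x \<in> space (Pi\<^sub>M {..<K} (\<lambda>_. borel)). Q2 x} + \<epsilon>"
    and "\<forall>\<^sub>F n in sequentially. measure (Pi\<^sub>M {..<K} (\<lambda>_. \<nu>)) {x \<in> space (Pi\<^sub>M {..<K} (\<lambda>_. borel)). Q1 x} \<le>
      measure (Pi\<^sub>M {..<K} (\<lambda>_. \<mu> n)) {x \<in> space (Pi\<^sub>M {..<K} (\<lambda>_. borel)). Q2 x} + \<epsilon>"
proof -
  obtain \<Omega> :: "real measure" and Y :: "nat \<Rightarrow> real \<Rightarrow> real" and Z :: "real \<Rightarrow> real" where
    \<Omega>: "prob_space \<Omega>" and Y: "\<And>n. Y n \<in> borel_measurable \<Omega>" "\<And>n. distr \<Omega> borel (Y n) = \<mu> n"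
    and Z: "Z \<in> measurable \<Omega> lborel" "distr \<Omega> borel Z = \<nu>"
    and YZ: "\<And>x. x \<in> space \<Omega> \<Longrightarrow> (\<lambda>n. Y n x) \<longlonglongrightarrow> Z x"
    using Skorohod[OF \<mu> \<nu> conv] by blast
  have Z': "Z \<in> borel_measurable \<Omega>" using Z(1) by simp
  let ?P = "Pi\<^sub>M {..<K} (\<lambda>_. \<Omega>)"
  interpret P: prob_space ?P by (rule prob_space_PiM) (rule \<Omega>)
  note [measurable] = Y(1) Z'
  define D where "D n = {w \<in> space ?P. \<exists>j\<in>{..<K}. \<delta> < \<bar>Y n (w j) - Z (w j)\<bar>}" for n
  have D [measurable]: "D n \<in> sets ?P" for n
    unfolding D_def by measurable
  have "(\<lambda>n. \<integral>w. indicator (D n) w \<partial>?P) \<longlonglongrightarrow> (\<integral>w. (0 :: real) \<partial>?P)"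
  proof (rule integral_dominated_convergence[where w = "\<lambda>_. 1"])
    show "AE w in ?P. (\<lambda>n. indicator (D n) w :: real) \<longlonglongrightarrow> 0"
    proof (rule AE_I2)
      fix w assume w: "w \<in> space ?P"
      have "\<forall>\<^sub>F n in sequentially. \<forall>j\<in>{..<K}. \<bar>Y n (w j) - Z (w j)\<bar> < \<delta>"
      proof (rule eventually_ball_finite)
        show "\<forall>j\<in>{..<K}. \<forall>\<^sub>F n in sequentially. \<bar>Y n (w j) - Z (w j)\<bar> < \<delta>"
        proof
          fix j assume "j \<in> {..<K}"
          then have "w j \<in> space \<Omega>" using w by (auto simp: space_PiM)
          from tendstoD[OF YZ[OF this] \<delta>(1)] show "\<forall>\<^sub>F n in sequentially. \<bar>Y n (w j) - Z (w j)\<bar> < \<delta>"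
            by (simp add: dist_real_def)
        qed
      qed simp
      then have "\<forall>\<^sub>F n in sequentially. indicator (D n) w = (0 :: real)"
        by (rule eventually_mono) (auto simp: D_def indicator_def dest: less_asym)
      then show "(\<lambda>n. indicator (D n) w :: real) \<longlonglongrightarrow> 0" by (rule tendsto_eventually)
    qed
  qed (auto simp: indicator_def)
  then have "(\<lambda>n. P.prob (D n)) \<longlonglongrightarrow> 0" by simp
  then have small: "\<forall>\<^sub>F n in sequentially. P.prob (D n) < \<epsilon>" using order_tendstoD(2) \<epsilon> by blast
  have close: "\<bar>compose {..<K} (Y n) w j - compose {..<K} Z w j\<bar> \<le> \<delta>"
    if "w \<in> space ?P" "w \<notin> D n" "j < K" for w n j
    using that by (auto simp: D_def compose_def not_less)
  have m1: "measure (Pi\<^sub>M {..<K} (\<lambda>_. \<mu> n)) {x \<in> space (Pi\<^sub>M {..<K} (\<lambda>_. borel)). Q x} =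
      P.prob {w \<in> space ?P. Q (compose {..<K} (Y n) w)}"
    "{w \<in> space ?P. Q (compose {..<K} (Y n) w)} \<in> sets ?P"
    if "{x \<in> space (Pi\<^sub>M {..<K} (\<lambda>_. borel)). Q x} \<in> sets (Pi\<^sub>M {..<K} (\<lambda>_. borel :: real measure))" for Q n
    using measure_PiM_distr[OF \<Omega> Y(1) _ that] by (auto simp: Y(2))
  have m2: "measure (Pi\<^sub>M {..<K} (\<lambda>_. \<nu>)) {x \<in> space (Pi\<^sub>M {..<K} (\<lambda>_. borel)). Q x} =
      P.prob {w \<in> space ?P. Q (compose {..<K} Z w)}"
    "{w \<in> space ?P. Q (compose {..<K} Z w)} \<in> sets ?P"
    if "{x \<in> space (Pi\<^sub>M {..<K} (\<lambda>_. borel)). Q x} \<in> sets (Pi\<^sub>M {..<K} (\<lambda>_. borel :: real measure))" for Q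
    using measure_PiM_distr[OF \<Omega> Z' _ that] by (auto simp: Z(2))
  show "\<forall>\<^sub>F n in sequentially. measure (Pi\<^sub>M {..<K} (\<lambda>_. \<mu> n)) {x \<in> space (Pi\<^sub>M {..<K} (\<lambda>_. borel)). Q1 x} \<le>
      measure (Pi\<^sub>M {..<K} (\<lambda>_. \<nu>)) {x \<in> space (Pi\<^sub>M {..<K} (\<lambda>_. borel)). Q2 x} + \<epsilon>"
    using small
  proof (rule eventually_mono)
    fix n assume n: "P.prob (D n) < \<epsilon>"
    have "{w \<in> space ?P. Q1 (compose {..<K} (Y n) w)} \<subseteq> {w \<in> space ?P. Q2 (compose {..<K} Z w)} \<union> D n"
      using close \<delta>(2) by blast
    then have "P.prob {w \<in> space ?P. Q1 (compose {..<K} (Y n) w)} \<le> P.prob ({w \<in> space ?P. Q2 (compose {..<K} Z w)} \<union> D n)"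
      using m2(2)[OF Q(2)] D by (intro P.finite_measure_mono) auto
    also have "\<dots> \<le> P.prob {w \<in> space ?P. Q2 (compose {..<K} Z w)} + P.prob (D n)"
      using m2(2)[OF Q(2)] D by (intro measure_Un_le) auto
    finally show "measure (Pi\<^sub>M {..<K} (\<lambda>_. \<mu> n)) {x \<in> space (Pi\<^sub>M {..<K} (\<lambda>_. borel)). Q1 x} \<le>
      measure (Pi\<^sub>M {..<K} (\<lambda>_. \<nu>)) {x \<in> space (Pi\<^sub>M {..<K} (\<lambda>_. borel)). Q2 x} + \<epsilon>"
      using n by (simp add: m1(1)[OF Q(1)] m2(1)[OF Q(2)])
  qed
  show "\<forall>\<^sub>F n in sequentially. measure (Pi\<^sub>M {..<K} (\<lambda>_. \<nu>)) {x \<in> space (Pi\<^sub>M {..<K} (\<lambda>_. borel)). Q1 x} \<le>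
      measure (Pi\<^sub>M {..<K} (\<lambda>_. \<mu> n)) {x \<in> space (Pi\<^sub>M {..<K} (\<lambda>_. borel)). Q2 x} + \<epsilon>"
    using small
  proof (rule eventually_mono)
    fix n assume n: "P.prob (D n) < \<epsilon>"
    have "{w \<in> space ?P. Q1 (compose {..<K} Z w)} \<subseteq> {w \<in> space ?P. Q2 (compose {..<K} (Y n) w)} \<union> D n"
    proof -
      have "Q2 (compose {..<K} (Y n) w)" if "w \<in> space ?P" "w \<notin> D n" "Q1 (compose {..<K} Z w)" for w
        using close[OF that(1,2)] that(3) by (intro \<delta>(2)[of "compose {..<K} Z w"]) (auto simp: abs_minus_commute)
      then show ?thesis by blast
    qed
    then have "P.prob {w \<in> space ?P. Q1 (compose {..<K} Z w)} \<le> P.prob ({w \<in> space ?P. Q2 (compose {..<K} (Y n) w)} \<union> D n)"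
      using m1(2)[OF Q(2)] D by (intro P.finite_measure_mono) auto
    also have "\<dots> \<le> P.prob {w \<in> space ?P. Q2 (compose {..<K} (Y n) w)} + P.prob (D n)"
      using m1(2)[OF Q(2)] D by (intro measure_Un_le) auto
    finally show "measure (Pi\<^sub>M {..<K} (\<lambda>_. \<nu>)) {x \<in> space (Pi\<^sub>M {..<K} (\<lambda>_. borel)). Q1 x} \<le>
      measure (Pi\<^sub>M {..<K} (\<lambda>_. \<mu> n)) {x \<in> space (Pi\<^sub>M {..<K} (\<lambda>_. borel)). Q2 x} + \<epsilon>"
      using n by (simp add: m2(1)[OF Q(1)] m1(1)[OF Q(2)])
  qed
qed

lemma sets_alternates_finite:
  fixes X :: "'t::linorder \<Rightarrow> 'w \<Rightarrow> real"
  assumes I: "finite I" and X: "\<And>i. i \<in> I \<Longrightarrow> X i \<in> borel_measurable M"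
  shows "{\<omega> \<in> space M. alternates L (\<lambda>i. X i \<omega>) I k} \<in> sets M"
proof -
  define A where "A = {p \<in> Pi\<^sub>E {..<2 * k} (\<lambda>_. I). \<forall>i. Suc i < 2 * k \<longrightarrow> p i \<le> p (Suc i)}"
  have finA: "finite A" unfolding A_def by (rule finite_subset[OF _ finite_PiE[of "{..<2 * k}" "\<lambda>_. I"]]) (use I in auto)
  have "alternates L Y I k \<longleftrightarrow> (\<exists>p\<in>A. \<forall>i\<in>{..<2 * k - 1}. L \<le> (-1) ^ i * (Y (p i) - Y (p (Suc i))))" for Y :: "'t \<Rightarrow> real"
  proof
    assume "alternates L Y I k"
    then obtain p where p: "\<And>i. i < 2 * k \<Longrightarrow> p i \<in> I" "\<And>i. Suc i < 2 * k \<Longrightarrow> p i \<le> p (Suc i)"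
      "\<And>i. Suc i < 2 * k \<Longrightarrow> L \<le> (-1) ^ i * (Y (p i) - Y (p (Suc i)))"
      using alternatesE by blast
    have "restrict p {..<2 * k} \<in> A" using p(1,2) by (auto simp: A_def)
    moreover have "L \<le> (-1) ^ i * (Y (restrict p {..<2 * k} i) - Y (restrict p {..<2 * k} (Suc i)))"
      if "i \<in> {..<2 * k - 1}" for i
    proof -
      have "Suc i < 2 * k" using that by auto
      then show ?thesis using p(3)[of i] by simp
    qed
    ultimately show "\<exists>p\<in>A. \<forall>i\<in>{..<2 * k - 1}. L \<le> (-1) ^ i * (Y (p i) - Y (p (Suc i)))" by blast
  next
    assume "\<exists>p\<in>A. \<forall>i\<in>{..<2 * k - 1}. L \<le> (-1) ^ i * (Y (p i) - Y (p (Suc i)))"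
    then obtain p where p: "p \<in> A" "\<forall>i\<in>{..<2 * k - 1}. L \<le> (-1) ^ i * (Y (p i) - Y (p (Suc i)))" by blast
    show "alternates L Y I k"
      by (rule alternatesI[of k p]) (use p in \<open>auto simp: A_def\<close>)
  qed
  then have "{\<omega> \<in> space M. alternates L (\<lambda>i. X i \<omega>) I k} =
    {\<omega> \<in> space M. \<exists>p\<in>A. \<forall>i\<in>{..<2 * k - 1}. L \<le> (-1) ^ i * (X (p i) \<omega> - X (p (Suc i)) \<omega>)}" by simp
  also have "\<dots> \<in> sets M"
  proof (intro sets.sets_Collect_finite_Ex sets.sets_Collect_finite_All finA)
    fix p i assume "p \<in> A" "i \<in> {..<2 * k - 1}"
    then have "p i \<in> I" "p (Suc i) \<in> I" by (auto simp: A_def PiE_def Pi_def)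
    then have [measurable]: "X (p i) \<in> borel_measurable M" "X (p (Suc i)) \<in> borel_measurable M" using X by auto
    show "{\<omega> \<in> space M. L \<le> (-1) ^ i * (X (p i) \<omega> - X (p (Suc i)) \<omega>)} \<in> sets M" by measurable
  qed simp
  finally show ?thesis .
qed

section \<open>Walk and Brownian motion on a grid\<close>

lemma alternates_shift: "alternates L (\<lambda>s. X s - c) I k \<longleftrightarrow> alternates L X I k"
  by (simp add: alternates_def)

lemma alternates_cong:
  assumes "\<And>s. s \<in> I \<Longrightarrow> X s = Y s"
  shows "alternates L X I k \<longleftrightarrow> alternates L Y I k"
  using alternates_transfer[of L X I k "\<lambda>s. s" I 1 Y 0] alternates_transfer[of L Y I k "\<lambda>s. s" I 1 X 0] assms
  by auto

text \<open>The alternation event as a property of the vector \<open>x\<close> of increments.\<close>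
definition grid_alternates :: "('j \<Rightarrow> real) \<Rightarrow> ('j \<Rightarrow> nat) \<Rightarrow> ('j \<Rightarrow> nat) \<Rightarrow> (nat \<Rightarrow> real) \<Rightarrow> bool" where
  "grid_alternates L m k x \<longleftrightarrow> (\<forall>j. alternates (L j) (\<lambda>i. \<Sum>l<i. x l) {..m j} (k j))"

lemma sets_grid_alternates:
  fixes L :: "'j::finite \<Rightarrow> real"
  assumes "\<And>j. m j \<le> K"
  shows "{x \<in> space (Pi\<^sub>M {..<K} (\<lambda>_. borel)). grid_alternates L m k x} \<in> sets (Pi\<^sub>M {..<K} (\<lambda>_. borel :: real measure))"
proof -
  have "{x \<in> space (Pi\<^sub>M {..<K} (\<lambda>_. borel :: real measure)). \<forall>j\<in>UNIV. alternates (L j) (\<lambda>i. \<Sum>l<i. x l) {..m j} (k j)}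
      \<in> sets (Pi\<^sub>M {..<K} (\<lambda>_. borel :: real measure))"
  proof (intro sets.sets_Collect_finite_All sets_alternates_finite finite_atMost)
    fix j i assume "i \<in> {..m j}"
    then have "i \<le> K" using assms[of j] by simp
    then show "(\<lambda>x. \<Sum>l<i. x l) \<in> borel_measurable (Pi\<^sub>M {..<K} (\<lambda>_. borel :: real measure))"
      by (intro borel_measurable_sum measurable_component_singleton) auto
  qed simp
  then show ?thesis by (simp add: grid_alternates_def)
qed

lemma grid_alternates_transfer:
  assumes m: "\<And>j. m j \<le> K" and xy: "\<And>l. l < K \<Longrightarrow> \<bar>x l - y l\<bar> \<le> \<delta>"
    and x: "grid_alternates L m k x"
  shows "grid_alternates (\<lambda>j. L j - 2 * (real K * \<delta>)) m k y"
  unfolding grid_alternates_def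
proof
  fix j
  have "alternates (L j) (\<lambda>i. \<Sum>l<i. x l) {..m j} (k j)" using x by (simp add: grid_alternates_def)
  then have "alternates (1 * L j - 2 * (real K * \<delta>)) (\<lambda>i. \<Sum>l<i. y l) {..m j} (k j)"
  proof (rule alternates_transfer[where f = "\<lambda>i. i"])
    fix i assume "i \<in> {..m j}"
    then have i: "i \<le> K" using m[of j] by simp
    have "\<bar>(\<Sum>l<i. x l) - (\<Sum>l<i. y l)\<bar> \<le> (\<Sum>l<i. \<bar>x l - y l\<bar>)"
      unfolding sum_subtractf[symmetric] by (rule sum_abs)
    also have "\<dots> \<le> (\<Sum>l<K. \<bar>x l - y l\<bar>)" using i by (intro sum_mono2) auto
    also have "\<dots> \<le> (\<Sum>l<K. \<delta>)" using xy by (intro sum_mono) auto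
    finally show "\<bar>1 * (\<Sum>l<i. x l) - (\<Sum>l<i. y l)\<bar> \<le> real K * \<delta>" by simp
  qed auto
  then show "alternates (L j - 2 * (real K * \<delta>)) (\<lambda>i. \<Sum>l<i. y l) {..m j} (k j)" by simp
qed

lemma measure_joint_law:
  assumes X: "X \<in> measurable M (Pi\<^sub>M J (\<lambda>_. borel :: real measure))"
    and law: "distr M (Pi\<^sub>M J (\<lambda>_. borel)) X = Pi\<^sub>M J (\<lambda>_. \<nu>)"
    and Q: "{x \<in> space (Pi\<^sub>M J (\<lambda>_. borel)). Q x} \<in> sets (Pi\<^sub>M J (\<lambda>_. borel :: real measure))"
  shows "measure M {\<omega> \<in> space M. Q (X \<omega>)} = measure (Pi\<^sub>M J (\<lambda>_. \<nu>)) {x \<in> space (Pi\<^sub>M J (\<lambda>_. borel)). Q x}"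
proof -
  have "X -` {x \<in> space (Pi\<^sub>M J (\<lambda>_. borel)). Q x} \<inter> space M = {\<omega> \<in> space M. Q (X \<omega>)}"
    using measurable_space[OF X] by auto
  then show ?thesis unfolding law[symmetric] by (subst measure_distr[OF X Q]) simp
qed

lemma brownian_prob_space: "standard_brownian_motion N B \<Longrightarrow> prob_space N"
  and brownian_measurable: "standard_brownian_motion N B \<Longrightarrow> 0 \<le> s \<Longrightarrow> B s \<in> borel_measurable N"
  and brownian_continuous: "standard_brownian_motion N B \<Longrightarrow> \<omega> \<in> space N \<Longrightarrow> continuous_on {0..} (\<lambda>s. B s \<omega>)"
  by (auto simp: standard_brownian_motion_def)

lemma brownian_increment_law:
  assumes bm: "standard_brownian_motion N B" and s: "0 \<le> s" "0 < h"
  shows "distr N borel (\<lambda>\<omega>. (B (s + h) \<omega> - B s \<omega>) / sqrt h) = std_normal_distribution"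
proof -
  interpret N: prob_space N by (rule brownian_prob_space[OF bm])
  have "\<And>s u. 0 \<le> s \<and> s < u \<Longrightarrow>
      distributed N lborel (\<lambda>\<omega>. B u \<omega> - B s \<omega>) (normal_density 0 (sqrt (u - s)))"
    using bm unfolding standard_brownian_motion_def by blast
  from this[of s "s + h"] have "distributed N lborel (\<lambda>\<omega>. B (s + h) \<omega> - B s \<omega>) (normal_density 0 (sqrt (s + h - s)))"
    using s by simp
  then have "distributed N lborel (\<lambda>\<omega>. B (s + h) \<omega> - B s \<omega>) (normal_density 0 (sqrt h))" by simp
  from N.normal_density_affine[OF this, of "1 / sqrt h" 0] s
  have "distributed N lborel (\<lambda>\<omega>. (B (s + h) \<omega> - B s \<omega>) / sqrt h) std_normal_density" by simp
  then have "distr N lborel (\<lambda>\<omega>. (B (s + h) \<omega> - B s \<omega>) / sqrt h) = std_normal_distribution"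
    by (rule distributed_distr_eq_density)
  moreover have "distr N lborel (\<lambda>\<omega>. (B (s + h) \<omega> - B s \<omega>) / sqrt h) = distr N borel (\<lambda>\<omega>. (B (s + h) \<omega> - B s \<omega>) / sqrt h)"
    by (rule distr_cong) auto
  ultimately show ?thesis by simp
qed

definition brownian_increment :: "(real \<Rightarrow> 'b \<Rightarrow> real) \<Rightarrow> real \<Rightarrow> nat \<Rightarrow> 'b \<Rightarrow> real" where
  "brownian_increment B h j \<omega> = (B (real (Suc j) * h) \<omega> - B (real j * h) \<omega>) / sqrt h"

lemma brownian_increments_joint_law:
  assumes bm: "standard_brownian_motion N B" and h: "0 < h" and K: "0 < K"
  shows "(\<lambda>\<omega>. \<lambda>j\<in>{..<K}. brownian_increment B h j \<omega>) \<in> measurable N (Pi\<^sub>M {..<K} (\<lambda>_. borel))"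
    and "distr N (Pi\<^sub>M {..<K} (\<lambda>_. borel)) (\<lambda>\<omega>. \<lambda>j\<in>{..<K}. brownian_increment B h j \<omega>) =
      Pi\<^sub>M {..<K} (\<lambda>_. std_normal_distribution)"
proof -
  interpret N: prob_space N by (rule brownian_prob_space[OF bm])
  have rv [measurable]: "brownian_increment B h j \<in> borel_measurable N" for j
    unfolding brownian_increment_def[abs_def]
    using h by (intro borel_measurable_divide borel_measurable_diff brownian_measurable[OF bm]) auto
  show "(\<lambda>\<omega>. \<lambda>j\<in>{..<K}. brownian_increment B h j \<omega>) \<in> measurable N (Pi\<^sub>M {..<K} (\<lambda>_. borel))"
    by measurable
  have indep: "\<And>n (\<tau> :: nat \<Rightarrow> real). 0 \<le> \<tau> 0 \<and> (\<forall>i<n. \<tau> i < \<tau> (Suc i)) \<Longrightarrow>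
      N.indep_vars (\<lambda>_. borel) (\<lambda>i \<omega>. B (\<tau> (Suc i)) \<omega> - B (\<tau> i) \<omega>) {..<n}"
    using bm unfolding standard_brownian_motion_def by blast
  have "N.indep_vars (\<lambda>_. borel) (\<lambda>j \<omega>. B (real (Suc j) * h) \<omega> - B (real j * h) \<omega>) {..<K}"
    by (rule indep[of "\<lambda>j. real j * h" K]) (use h in auto)
  then have "N.indep_vars (\<lambda>_. borel) (\<lambda>j \<omega>. (B (real (Suc j) * h) \<omega> - B (real j * h) \<omega>) / sqrt h) {..<K}"
    by (rule N.indep_vars_compose2) measurable
  then have ind: "N.indep_vars (\<lambda>_. borel) (brownian_increment B h) {..<K}"
    by (simp add: brownian_increment_def[abs_def])
  have ne: "{..<K} \<noteq> {}" using K by auto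
  have law: "distr N borel (brownian_increment B h j) = std_normal_distribution" for j
    using brownian_increment_law[OF bm, of "real j * h" h] h
    by (simp add: brownian_increment_def[abs_def] algebra_simps)
  show "distr N (Pi\<^sub>M {..<K} (\<lambda>_. borel)) (\<lambda>\<omega>. \<lambda>j\<in>{..<K}. brownian_increment B h j \<omega>) =
      Pi\<^sub>M {..<K} (\<lambda>_. std_normal_distribution)"
    using N.indep_vars_iff_distr_eq_PiM[OF ne, where M' = "\<lambda>_. borel" and X = "brownian_increment B h"] ind rv
    by (simp add: law)
qed

lemma sum_brownian_increments:
  "i \<le> K \<Longrightarrow> (\<Sum>l<i. (\<lambda>j\<in>{..<K}. brownian_increment B h j \<omega>) l) = (B (real i * h) \<omega> - B 0 \<omega>) / sqrt h"
proof (induction i)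
  case (Suc i)
  then show ?case by (simp add: brownian_increment_def diff_divide_distrib)
qed simp

lemma grid_alternates_brownian:
  assumes "\<And>j. m j \<le> K" "0 < h"
  shows "grid_alternates L m k (\<lambda>j\<in>{..<K}. brownian_increment B h j \<omega>) \<longleftrightarrow>
    (\<forall>j. alternates (L j * sqrt h) (\<lambda>i. B (real i * h) \<omega>) {..m j} (k j))"
  unfolding grid_alternates_def
proof (intro all_cong1)
  fix j
  have "alternates (L j) (\<lambda>i. \<Sum>l<i. (\<lambda>j\<in>{..<K}. brownian_increment B h j \<omega>) l) {..m j} (k j) \<longleftrightarrow>
    alternates (L j) (\<lambda>i. (1 / sqrt h) * (B (real i * h) \<omega> - B 0 \<omega>)) {..m j} (k j)"
    by (rule alternates_cong, subst sum_brownian_increments[where K = K]) (use assms(1)[of j] in auto)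
  also have "\<dots> \<longleftrightarrow> alternates (L j / (1 / sqrt h)) (\<lambda>i. B (real i * h) \<omega> - B 0 \<omega>) {..m j} (k j)"
    by (rule alternates_scale) (use assms(2) in simp)
  also have "\<dots> \<longleftrightarrow> alternates (L j * sqrt h) (\<lambda>i. B (real i * h) \<omega>) {..m j} (k j)"
    by (simp add: alternates_shift)
  finally show "alternates (L j) (\<lambda>i. \<Sum>l<i. (\<lambda>j\<in>{..<K}. brownian_increment B h j \<omega>) l) {..m j} (k j) \<longleftrightarrow>
    alternates (L j * sqrt h) (\<lambda>i. B (real i * h) \<omega>) {..m j} (k j)" .
qed

context standardized_walk
begin

lemma sum_scaled_increments:
  "i \<le> K \<Longrightarrow> (\<Sum>l<i. (\<lambda>j\<in>{..<K}. scaled_increment b j \<omega>) l) = walk (i * b) \<omega> / sqrt (real b)"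
proof (induction i)
  case 0
  then show ?case by (simp add: walk_def)
next
  case (Suc i)
  then show ?case using walk_add[of "i * b" b \<omega>]
    by (simp add: scaled_increment_def add_divide_distrib add.commute)
qed

lemma grid_alternates_walk:
  assumes "\<And>j. m j \<le> K" "0 < b"
  shows "grid_alternates L m k (\<lambda>j\<in>{..<K}. scaled_increment b j \<omega>) \<longleftrightarrow>
    (\<forall>j. alternates (L j * sqrt (real b)) (\<lambda>i. walk (i * b) \<omega>) {..m j} (k j))"
  unfolding grid_alternates_def
proof (intro all_cong1)
  fix j
  have "alternates (L j) (\<lambda>i. \<Sum>l<i. (\<lambda>j\<in>{..<K}. scaled_increment b j \<omega>) l) {..m j} (k j) \<longleftrightarrow>
    alternates (L j) (\<lambda>i. (1 / sqrt (real b)) * walk (i * b) \<omega>) {..m j} (k j)"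
    by (rule alternates_cong, subst sum_scaled_increments[where K = K]) (use assms(1)[of j] in auto)
  also have "\<dots> \<longleftrightarrow> alternates (L j / (1 / sqrt (real b))) (\<lambda>i. walk (i * b) \<omega>) {..m j} (k j)"
    by (rule alternates_scale) (use assms(2) in simp)
  also have "\<dots> \<longleftrightarrow> alternates (L j * sqrt (real b)) (\<lambda>i. walk (i * b) \<omega>) {..m j} (k j)" by simp
  finally show "alternates (L j) (\<lambda>i. \<Sum>l<i. (\<lambda>j\<in>{..<K}. scaled_increment b j \<omega>) l) {..m j} (k j) \<longleftrightarrow>
    alternates (L j * sqrt (real b)) (\<lambda>i. walk (i * b) \<omega>) {..m j} (k j)" .
qed

text \<open>At block ends the walk and the Brownian motion are the same functional of their independent
  increments; a Skorohod coupling with accuracy \<open>\<delta> / (2 * K)\<close> per increment costs at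
  most \<open>\<delta>\<close> in the level.\<close>
lemma walk_grid_vs_brownian_grid:
  fixes L :: "'j::finite \<Rightarrow> real" and B :: "real \<Rightarrow> 'b \<Rightarrow> real"
  assumes bm: "standard_brownian_motion N B" and h: "0 < h" and \<delta>: "0 < \<delta>" and \<epsilon>: "0 < \<epsilon>"
  shows "\<forall>\<^sub>F b in sequentially.
      prob {\<omega> \<in> space M. \<forall>j. alternates (L j * sqrt (real b)) (\<lambda>i. walk (i * b) \<omega>) {..m j} (k j)} \<le>
      measure N {\<omega> \<in> space N. \<forall>j. alternates ((L j - \<delta>) * sqrt h) (\<lambda>i. B (real i * h) \<omega>) {..m j} (k j)} + \<epsilon>"
    and "\<forall>\<^sub>F b in sequentially.
      measure N {\<omega> \<in> space N. \<forall>j. alternates (L j * sqrt h) (\<lambda>i. B (real i * h) \<omega>) {..m j} (k j)} \<le>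
      prob {\<omega> \<in> space M. \<forall>j. alternates ((L j - \<delta>) * sqrt (real b)) (\<lambda>i. walk (i * b) \<omega>) {..m j} (k j)} + \<epsilon>"
proof -
  define K where "K = Suc (Max (range m))"
  have mK: "m j \<le> K" for j by (simp add: K_def le_SucI)
  have K: "0 < K" by (simp add: K_def)
  define \<delta>' where "\<delta>' = \<delta> / (2 * real K)"
  have \<delta>': "0 < \<delta>'" using \<delta> K by (simp add: \<delta>'_def)
  have \<delta>'K: "2 * (real K * \<delta>') = \<delta>" using K by (simp add: \<delta>'_def)
  let ?Q1 = "grid_alternates L m k" and ?Q2 = "grid_alternates (\<lambda>j. L j - \<delta>) m k"
  have trans: "?Q1 x \<Longrightarrow> ?Q2 y" if "\<And>l. l < K \<Longrightarrow> \<bar>x l - y l\<bar> \<le> \<delta>'" for x y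
    using grid_alternates_transfer[OF mK that] by (simp add: \<delta>'K)
  have rd: "real_distribution (walk_law b)" for b by (rule real_distribution_distr) simp
  have coupling1: "\<forall>\<^sub>F b in sequentially. measure (Pi\<^sub>M {..<K} (\<lambda>_. walk_law b)) {x \<in> space (Pi\<^sub>M {..<K} (\<lambda>_. borel)). ?Q1 x} \<le>
      measure (Pi\<^sub>M {..<K} (\<lambda>_. std_normal_distribution)) {x \<in> space (Pi\<^sub>M {..<K} (\<lambda>_. borel)). ?Q2 x} + \<epsilon>"
  proof (rule weak_conv_product_coupling(1)[OF rd real_dist_normal_dist walk_clt
        sets_grid_alternates[OF mK] sets_grid_alternates[OF mK] \<delta>' _ \<epsilon>])
    fix x y assume "\<And>l. l < K \<Longrightarrow> \<bar>x l - y l\<bar> \<le> \<delta>'" "?Q1 x"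
    then show "?Q2 y" by (rule trans)
  qed
  have coupling2: "\<forall>\<^sub>F b in sequentially. measure (Pi\<^sub>M {..<K} (\<lambda>_. std_normal_distribution)) {x \<in> space (Pi\<^sub>M {..<K} (\<lambda>_. borel)). ?Q1 x} \<le>
      measure (Pi\<^sub>M {..<K} (\<lambda>_. walk_law b)) {x \<in> space (Pi\<^sub>M {..<K} (\<lambda>_. borel)). ?Q2 x} + \<epsilon>"
  proof (rule weak_conv_product_coupling(2)[OF rd real_dist_normal_dist walk_clt
        sets_grid_alternates[OF mK] sets_grid_alternates[OF mK] \<delta>' _ \<epsilon>])
    fix x y assume "\<And>l. l < K \<Longrightarrow> \<bar>x l - y l\<bar> \<le> \<delta>'" "?Q1 x"
    then show "?Q2 y" by (rule trans)
  qed
  have W: "prob {\<omega> \<in> space M. \<forall>j. alternates (L j * sqrt (real b)) (\<lambda>i. walk (i * b) \<omega>) {..m j} (k j)} =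
      measure (Pi\<^sub>M {..<K} (\<lambda>_. walk_law b)) {x \<in> space (Pi\<^sub>M {..<K} (\<lambda>_. borel)). grid_alternates L m k x}"
    if "0 < b" for L :: "'j \<Rightarrow> real" and b
  proof -
    have "(\<lambda>\<omega>. \<lambda>j\<in>{..<K}. scaled_increment b j \<omega>) \<in> measurable M (Pi\<^sub>M {..<K} (\<lambda>_. borel))" by measurable
    from measure_joint_law[OF this scaled_increments_joint_law[OF K] sets_grid_alternates[OF mK]]
    show ?thesis by (simp add: grid_alternates_walk[OF mK that])
  qed
  have Bn: "measure N {\<omega> \<in> space N. \<forall>j. alternates (L j * sqrt h) (\<lambda>i. B (real i * h) \<omega>) {..m j} (k j)} =
      measure (Pi\<^sub>M {..<K} (\<lambda>_. std_normal_distribution)) {x \<in> space (Pi\<^sub>M {..<K} (\<lambda>_. borel)). grid_alternates L m k x}"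
    for L :: "'j \<Rightarrow> real"
    using measure_joint_law[OF brownian_increments_joint_law[OF bm h K] sets_grid_alternates[OF mK]]
    by (simp add: grid_alternates_brownian[OF mK h])
  show "\<forall>\<^sub>F b in sequentially.
      prob {\<omega> \<in> space M. \<forall>j. alternates (L j * sqrt (real b)) (\<lambda>i. walk (i * b) \<omega>) {..m j} (k j)} \<le>
      measure N {\<omega> \<in> space N. \<forall>j. alternates ((L j - \<delta>) * sqrt h) (\<lambda>i. B (real i * h) \<omega>) {..m j} (k j)} + \<epsilon>"
    using eventually_conj[OF coupling1 eventually_gt_at_top[of 0]]
    by (rule eventually_mono) (simp add: W Bn)
  show "\<forall>\<^sub>F b in sequentially.
      measure N {\<omega> \<in> space N. \<forall>j. alternates (L j * sqrt h) (\<lambda>i. B (real i * h) \<omega>) {..m j} (k j)} \<le>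
      prob {\<omega> \<in> space M. \<forall>j. alternates ((L j - \<delta>) * sqrt (real b)) (\<lambda>i. walk (i * b) \<omega>) {..m j} (k j)} + \<epsilon>"
    using eventually_conj[OF coupling2 eventually_gt_at_top[of 0]]
    by (rule eventually_mono) (simp add: W Bn)
qed

text \<open>The fourth moment of the Gaussian limit is used because the bound has to remain small after
  multiplication by a number of blocks of order \<open>\<theta>\<^sup>2\<close>.\<close>
lemma walk_tail:
  assumes \<theta>: "0 < \<theta>" and \<epsilon>: "0 < \<epsilon>"
  shows "\<forall>\<^sub>F b in sequentially. prob {\<omega> \<in> space M. \<theta> * sqrt (real b) < \<bar>walk b \<omega>\<bar>} \<le> 48 / \<theta> ^ 4 + \<epsilon>"
proof -
  interpret normal: real_distribution std_normal_distribution by (rule real_dist_normal_dist)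
  have rd: "real_distribution (walk_law b)" for b by (rule real_distribution_distr) simp
  let ?G = "Pi\<^sub>M {..<1::nat} (\<lambda>_. std_normal_distribution)"
  have meas: "{x \<in> space (Pi\<^sub>M {..<1::nat} (\<lambda>_. borel :: real measure)). c < \<bar>x 0\<bar>} \<in> sets (Pi\<^sub>M {..<1::nat} (\<lambda>_. borel :: real measure))" for c
    by measurable
  have ev: "\<forall>\<^sub>F b in sequentially. measure (Pi\<^sub>M {..<1} (\<lambda>_. walk_law b)) {x \<in> space (Pi\<^sub>M {..<1::nat} (\<lambda>_. borel)). \<theta> < \<bar>x 0\<bar>} \<le>
      measure ?G {x \<in> space (Pi\<^sub>M {..<1} (\<lambda>_. borel)). \<theta> / 2 < \<bar>x 0\<bar>} + \<epsilon>"
  proof (rule weak_conv_product_coupling(1)[OF rd real_dist_normal_dist walk_clt meas meas _ _ \<epsilon>, where \<delta> = "\<theta> / 4"])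
    fix x y :: "nat \<Rightarrow> real" assume "\<And>j. j < 1 \<Longrightarrow> \<bar>x j - y j\<bar> \<le> \<theta> / 4" "\<theta> < \<bar>x 0\<bar>"
    then have "\<bar>x 0 - y 0\<bar> \<le> \<theta> / 4" "\<theta> < \<bar>x 0\<bar>" by auto
    then show "\<theta> / 2 < \<bar>y 0\<bar>" using \<theta> by linarith
  qed (use \<theta> in auto)
  have G: "measure ?G {x \<in> space (Pi\<^sub>M {..<1} (\<lambda>_. borel)). \<theta> / 2 < \<bar>x 0\<bar>} \<le> 48 / \<theta> ^ 4"
  proof -
    have law: "distr ?G std_normal_distribution (\<lambda>x. x 0) = std_normal_distribution"
      by (rule distr_PiM_component) (auto intro: normal.prob_space_axioms)
    have c0: "(\<lambda>x. x 0) \<in> measurable ?G std_normal_distribution" by measurable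
    have S: "{x. \<theta> / 2 < \<bar>x\<bar>} \<in> sets std_normal_distribution" by simp
    have "measure (distr ?G std_normal_distribution (\<lambda>x. x 0)) {x. \<theta> / 2 < \<bar>x\<bar>} =
        measure ?G ((\<lambda>x. x 0) -` {x. \<theta> / 2 < \<bar>x\<bar>} \<inter> space ?G)"
      by (rule measure_distr[OF c0 S])
    also have "(\<lambda>x. x 0) -` {x. \<theta> / 2 < \<bar>x\<bar>} \<inter> space ?G =
        {x \<in> space (Pi\<^sub>M {..<1::nat} (\<lambda>_. borel :: real measure)). \<theta> / 2 < \<bar>x 0\<bar>}"
      by (auto simp: space_PiM)
    finally have "measure ?G {x \<in> space (Pi\<^sub>M {..<1} (\<lambda>_. borel)). \<theta> / 2 < \<bar>x 0\<bar>} =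
        measure std_normal_distribution {x. \<theta> / 2 < \<bar>x\<bar>}"
      by (simp only: law)
    also have "\<dots> \<le> measure std_normal_distribution {x \<in> space std_normal_distribution. (\<theta> / 2) ^ 4 \<le> x ^ 4}"
    proof (rule normal.finite_measure_mono)
      show "{x. \<theta> / 2 < \<bar>x\<bar>} \<subseteq> {x \<in> space std_normal_distribution. (\<theta> / 2) ^ 4 \<le> x ^ 4}"
      proof (safe)
        fix x :: real assume "\<theta> / 2 < \<bar>x\<bar>"
        then have "(\<theta> / 2) ^ 4 \<le> \<bar>x\<bar> ^ 4" using \<theta> by (intro power_mono) auto
        then show "(\<theta> / 2) ^ 4 \<le> x ^ 4" by simp
      qed simp
    qed simp
    also have "\<dots> \<le> (\<integral>x. x ^ 4 \<partial>std_normal_distribution) / (\<theta> / 2) ^ 4"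
      using std_normal_distribution_even_moments(2)[of 2] \<theta>
      by (intro integral_Markov_inequality_measure[where A = "space std_normal_distribution"]) auto
    also have "(\<integral>x. x ^ 4 \<partial>std_normal_distribution) = 3"
      using std_normal_distribution_even_moments(1)[of 2] by (simp add: fact_numeral)
    finally show ?thesis by (simp add: power_divide)
  qed
  have W: "prob {\<omega> \<in> space M. \<theta> * sqrt (real b) < \<bar>walk b \<omega>\<bar>} =
      measure (Pi\<^sub>M {..<1} (\<lambda>_. walk_law b)) {x \<in> space (Pi\<^sub>M {..<1::nat} (\<lambda>_. borel)). \<theta> < \<bar>x 0\<bar>}" if "0 < b" for b
  proof -
    have "(\<lambda>\<omega>. \<lambda>j\<in>{..<1}. scaled_increment b j \<omega>) \<in> measurable M (Pi\<^sub>M {..<1} (\<lambda>_. borel))" by measurable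
    from measure_joint_law[OF this scaled_increments_joint_law meas[of \<theta>]]
    have "measure (Pi\<^sub>M {..<1} (\<lambda>_. walk_law b)) {x \<in> space (Pi\<^sub>M {..<1::nat} (\<lambda>_. borel)). \<theta> < \<bar>x 0\<bar>} =
      prob {\<omega> \<in> space M. \<theta> < \<bar>scaled_increment b 0 \<omega>\<bar>}" by simp
    moreover have "scaled_increment b 0 \<omega> = walk b \<omega> / sqrt (real b)" for \<omega>
      by (simp add: scaled_increment_def block_def walk_def atLeast0LessThan)
    moreover have "\<theta> < \<bar>walk b \<omega> / sqrt (real b)\<bar> \<longleftrightarrow> \<theta> * sqrt (real b) < \<bar>walk b \<omega>\<bar>" for \<omega>
      using that by (simp add: abs_divide field_simps)
    ultimately show ?thesis by simp
  qed
  show ?thesis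
    using eventually_conj[OF ev eventually_gt_at_top[of 0]]
    by (rule eventually_mono) (use G W in \<open>force\<close>)
qed

end

section \<open>Alternations of the walk and of Brownian motion\<close>

text \<open>Rounding the block length to an integer changes it by a factor as close to \<open>1\<close> as
  desired.\<close>
lemma eventually_block_length:
  fixes h :: real
  assumes h: "0 < h" and \<rho>: "1 < \<rho>"
  shows "\<forall>\<^sub>F r in at_top. 0 < nat \<lfloor>r * h\<rfloor> \<and> real (nat \<lfloor>r * h\<rfloor>) \<le> r * h \<and> r * h \<le> \<rho> * real (nat \<lfloor>r * h\<rfloor>)"
  using eventually_ge_at_top[of "max 1 (\<rho> / (\<rho> - 1)) / h"]
proof eventually_elim
  case (elim r)
  then have rh: "1 \<le> r * h" "\<rho> / (\<rho> - 1) \<le> r * h" using h by (auto simp: field_simps)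
  have fl: "real (nat \<lfloor>r * h\<rfloor>) = of_int \<lfloor>r * h\<rfloor>" using rh(1) by simp
  have "\<rho> \<le> (r * h) * (\<rho> - 1)" using rh(2) \<rho> by (simp add: pos_divide_le_eq)
  then have "r * h \<le> \<rho> * (r * h - 1)" by (simp add: algebra_simps)
  also have "\<dots> \<le> \<rho> * of_int \<lfloor>r * h\<rfloor>" using \<rho> by (intro mult_left_mono) linarith+
  finally have "r * h \<le> \<rho> * of_int \<lfloor>r * h\<rfloor>" .
  then show ?case unfolding fl using rh(1) by auto
qed

lemma filterlim_block_length:
  fixes h :: real
  assumes h: "0 < h"
  shows "filterlim (\<lambda>r. nat \<lfloor>r * h\<rfloor>) sequentially at_top"
  unfolding filterlim_at_top
proof
  fix Z :: nat
  show "\<forall>\<^sub>F r in at_top. Z \<le> nat \<lfloor>r * h\<rfloor>"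
    using eventually_ge_at_top[of "real Z / h"]
  proof eventually_elim
    case (elim r)
    then have "real Z \<le> r * h" using h by (simp add: field_simps)
    then show ?case by (simp add: le_nat_floor)
  qed
qed

definition brownian_alternates :: "'b measure \<Rightarrow> (real \<Rightarrow> 'b \<Rightarrow> real) \<Rightarrow> ('j \<Rightarrow> real) \<Rightarrow> ('j \<Rightarrow> real) \<Rightarrow> ('j \<Rightarrow> nat) \<Rightarrow> 'b set" where
  "brownian_alternates N B \<eta> t k = {\<omega> \<in> space N. \<forall>j. alternates (\<eta> j) (\<lambda>s. B s \<omega>) {0..t j} (k j)}"

lemma sets_brownian_alternates:
  fixes \<eta> :: "'j::finite \<Rightarrow> real"
  assumes bm: "standard_brownian_motion N B" and t: "\<And>j. 0 \<le> t j"
  shows "brownian_alternates N B \<eta> t k \<in> sets N"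
proof -
  have "{\<omega> \<in> space N. \<forall>j\<in>UNIV. alternates (\<eta> j) (\<lambda>s. B s \<omega>) {0..t j} (k j)} \<in> sets N"
    by (intro sets.sets_Collect_finite_All measurable_alternates t)
      (auto intro: brownian_measurable[OF bm] continuous_on_subset[OF brownian_continuous[OF bm]])
  then show ?thesis by (simp add: brownian_alternates_def)
qed

lemma sets_brownian_grid:
  fixes L :: "'j::finite \<Rightarrow> real"
  assumes bm: "standard_brownian_motion N B" and h: "0 \<le> h"
  shows "{\<omega> \<in> space N. \<forall>j. alternates (L j) (\<lambda>i. B (real i * h) \<omega>) {..m j} (k j)} \<in> sets N"
proof -
  have "{\<omega> \<in> space N. \<forall>j\<in>UNIV. alternates (L j) (\<lambda>i. B (real i * h) \<omega>) {..m j} (k j)} \<in> sets N"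
    by (intro sets.sets_Collect_finite_All sets_alternates_finite)
      (use h in \<open>auto intro: brownian_measurable[OF bm]\<close>)
  then show ?thesis by simp
qed

lemma brownian_alternates_mono:
  assumes "\<And>j. t j \<le> t' j" "\<And>j. \<eta>' j \<le> \<eta> j"
  shows "brownian_alternates N B \<eta> t k \<subseteq> brownian_alternates N B \<eta>' t' k"
  unfolding brownian_alternates_def
proof safe
  fix \<omega> j assume "\<forall>j. alternates (\<eta> j) (\<lambda>s. B s \<omega>) {0..t j} (k j)"
  then have "alternates (\<eta> j) (\<lambda>s. B s \<omega>) {0..t j} (k j)" by blast
  then show "alternates (\<eta>' j) (\<lambda>s. B s \<omega>) {0..t' j} (k j)"
    using assms[of j] by (elim alternates_mono) auto
qed

text \<open>Dominated convergence for indicators.\<close>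
lemma (in prob_space) prob_tendsto_0:
  assumes D: "\<And>n. D n \<in> events" and ev: "AE \<omega> in M. \<forall>\<^sub>F n in sequentially. \<omega> \<notin> D n"
  shows "(\<lambda>n. prob (D n)) \<longlonglongrightarrow> 0"
proof -
  have "(\<lambda>n. \<integral>\<omega>. indicator (D n) \<omega> \<partial>M) \<longlonglongrightarrow> (\<integral>\<omega>. (0 :: real) \<partial>M)"
  proof (rule integral_dominated_convergence[where w = "\<lambda>_. 1"])
    show "AE \<omega> in M. (\<lambda>n. indicator (D n) \<omega> :: real) \<longlonglongrightarrow> 0"
      using ev
    proof eventually_elim
      case (elim \<omega>)
      then have "\<forall>\<^sub>F n in sequentially. indicator (D n) \<omega> = (0 :: real)"
        by (rule eventually_mono) simp
      then show ?case by (rule tendsto_eventually)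
    qed
  qed (use D in \<open>auto simp: indicator_def\<close>)
  then show ?thesis using D by simp
qed

text \<open>A continuous path is nearly constant on the cells of a fine grid.\<close>
lemma alternates_grid_approx:
  fixes X :: "real \<Rightarrow> real"
  assumes cont: "continuous_on {0..T} X" and \<theta>: "\<theta> < L" and alt: "alternates L X {0..T} k"
  shows "\<forall>\<^sub>F q in sequentially. alternates \<theta> (\<lambda>i. X (real i * (1 / real (Suc q)))) {..nat \<lfloor>T / (1 / real (Suc q))\<rfloor>} k"
proof -
  have "uniformly_continuous_on {0..T} X" by (rule compact_uniformly_continuous[OF cont]) simp
  moreover have "0 < (L - \<theta>) / 2" using \<theta> by simp
  ultimately obtain d where d: "0 < d" "\<And>s s'. s \<in> {0..T} \<Longrightarrow> s' \<in> {0..T} \<Longrightarrow> dist s' s < d \<Longrightarrow> dist (X s') (X s) < (L - \<theta>) / 2"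
    unfolding uniformly_continuous_on_def by metis
  have "\<forall>\<^sub>F q in sequentially. 1 / real (Suc q) \<le> d / 2" using d(1) by (intro eventually_inverse_Suc_le) simp
  then show ?thesis
  proof eventually_elim
    case (elim q)
    define g where "g = 1 / real (Suc q)"
    have g: "0 < g" "g < d" using elim d(1) by (auto simp: g_def)
    have "alternates (1 * L - 2 * ((L - \<theta>) / 2)) (\<lambda>i. X (real i * g)) {..nat \<lfloor>T / g\<rfloor>} k"
    proof (rule alternates_transfer[OF alt, where f = "\<lambda>s. nat \<lfloor>s / g\<rfloor>"])
      fix s assume s: "s \<in> {0..T}"
      then have "s / g \<le> T / g" using g by (intro divide_right_mono) auto
      then show "nat \<lfloor>s / g\<rfloor> \<in> {..nat \<lfloor>T / g\<rfloor>}" by (auto intro!: nat_mono floor_mono)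
      have "0 \<le> s / g" using s g by simp
      then have "real (nat \<lfloor>s / g\<rfloor>) \<le> s / g" "s / g < real (nat \<lfloor>s / g\<rfloor>) + 1" by linarith+
      then have 1: "real (nat \<lfloor>s / g\<rfloor>) * g \<le> s" "s < real (nat \<lfloor>s / g\<rfloor>) * g + g"
        using g by (simp_all add: field_simps)
      define x where "x = real (nat \<lfloor>s / g\<rfloor>) * g"
      have "0 \<le> x" using g by (simp add: x_def)
      then have "x \<in> {0..T}" "dist s x < d" using 1[folded x_def] s g by (auto simp: dist_real_def)
      then have "dist (X s) (X x) < (L - \<theta>) / 2" using s by (intro d(2)) auto
      then show "\<bar>1 * X s - X (real (nat \<lfloor>s / g\<rfloor>) * g)\<bar> \<le> (L - \<theta>) / 2"
        by (simp only: x_def[symmetric]) (simp add: dist_real_def)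
    next
      fix s s' assume "s \<in> {0..T}" "s' \<in> {0..T}" "s \<le> s'"
      then have "s / g \<le> s' / g" using g by (intro divide_right_mono) auto
      then show "nat \<lfloor>s / g\<rfloor> \<le> nat \<lfloor>s' / g\<rfloor>" by (intro nat_mono floor_mono)
    qed auto
    then show ?case by (simp only: g_def) (simp add: field_simps)
  qed
qed

lemma brownian_grid_approx:
  fixes \<eta> :: "'j::finite \<Rightarrow> real"
  assumes bm: "standard_brownian_motion N B" and t: "\<And>j. 0 \<le> t j" and \<theta>: "\<And>j. \<theta> j < \<eta> j" and \<epsilon>: "0 < \<epsilon>"
  shows "\<exists>g>0. measure N (brownian_alternates N B \<eta> t k) \<le>
    measure N {\<omega> \<in> space N. \<forall>j. alternates (\<theta> j) (\<lambda>i. B (real i * g) \<omega>) {..nat \<lfloor>t j / g\<rfloor>} (k j)} + \<epsilon>"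
proof -
  interpret N: prob_space N by (rule brownian_prob_space[OF bm])
  define A where "A = brownian_alternates N B \<eta> t k"
  define E where "E q = {\<omega> \<in> space N. \<forall>j. alternates (\<theta> j) (\<lambda>i. B (real i * (1 / real (Suc q))) \<omega>)
    {..nat \<lfloor>t j / (1 / real (Suc q))\<rfloor>} (k j)}" for q
  have A: "A \<in> sets N" unfolding A_def by (rule sets_brownian_alternates[OF bm t])
  have E: "E q \<in> sets N" for q unfolding E_def by (rule sets_brownian_grid[OF bm]) simp
  have "(\<lambda>q. N.prob (A - E q)) \<longlonglongrightarrow> 0"
  proof (rule N.prob_tendsto_0)
    show "AE \<omega> in N. \<forall>\<^sub>F q in sequentially. \<omega> \<notin> A - E q"
    proof (rule AE_I2)
      fix \<omega> assume \<omega>: "\<omega> \<in> space N"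
      show "\<forall>\<^sub>F q in sequentially. \<omega> \<notin> A - E q"
      proof (cases "\<omega> \<in> A")
        case True
        have "\<forall>\<^sub>F q in sequentially. \<forall>j\<in>UNIV. alternates (\<theta> j) (\<lambda>i. B (real i * (1 / real (Suc q))) \<omega>)
            {..nat \<lfloor>t j / (1 / real (Suc q))\<rfloor>} (k j)"
        proof (intro eventually_ball_finite ballI)
          fix j
          show "\<forall>\<^sub>F q in sequentially. alternates (\<theta> j) (\<lambda>i. B (real i * (1 / real (Suc q))) \<omega>)
            {..nat \<lfloor>t j / (1 / real (Suc q))\<rfloor>} (k j)"
          proof (rule alternates_grid_approx[OF _ \<theta>[of j]])
            show "continuous_on {0..t j} (\<lambda>s. B s \<omega>)"
              by (rule continuous_on_subset[OF brownian_continuous[OF bm \<omega>]]) auto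
            show "alternates (\<eta> j) (\<lambda>s. B s \<omega>) {0..t j} (k j)"
              using True by (simp add: A_def brownian_alternates_def)
          qed
        qed simp
        then show ?thesis by (rule eventually_mono) (use \<omega> in \<open>simp add: E_def\<close>)
      qed simp
    qed
  qed (use A E in auto)
  then have "\<forall>\<^sub>F q in sequentially. N.prob (A - E q) < \<epsilon>" using order_tendstoD(2) \<epsilon> by blast
  then obtain q where q: "N.prob (A - E q) < \<epsilon>"
    using eventually_happens'[OF sequentially_bot] by blast
  have "N.prob A \<le> N.prob (E q \<union> (A - E q))" using A E by (intro N.finite_measure_mono) auto
  also have "\<dots> \<le> N.prob (E q) + N.prob (A - E q)" using A E by (intro measure_Un_le) auto
  finally have "N.prob A \<le> N.prob (E q) + \<epsilon>" using q by simp
  then show ?thesis unfolding A_def E_def by (intro exI[of _ "1 / real (Suc q)"]) auto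
qed

context standardized_walk
begin

definition walk_alternates :: "real \<Rightarrow> ('j \<Rightarrow> real) \<Rightarrow> ('j \<Rightarrow> real) \<Rightarrow> ('j \<Rightarrow> nat) \<Rightarrow> 'a set" where
  "walk_alternates r \<eta> t k =
     {\<omega> \<in> space M. \<forall>j. alternates (\<eta> j * sqrt r) (\<lambda>i. walk i \<omega>) {..nat \<lfloor>t j * r\<rfloor>} (k j)}"

lemma sets_walk_alternates:
  fixes \<eta> :: "'j::finite \<Rightarrow> real"
  shows "walk_alternates r \<eta> t k \<in> events"
proof -
  have "{\<omega> \<in> space M. \<forall>j\<in>UNIV. alternates (\<eta> j * sqrt r) (\<lambda>i. walk i \<omega>) {..nat \<lfloor>t j * r\<rfloor>} (k j)} \<in> events"
    by (intro sets.sets_Collect_finite_All sets_alternates_finite) auto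
  then show ?thesis by (simp add: walk_alternates_def)
qed

text \<open>Diffusive scaling: the walk has a scale parameter \<open>r\<close>, so a factor in the levels
  can be traded for its square in the times.\<close>
lemma walk_alternates_scale:
  assumes "0 < c" "0 \<le> r"
  shows "walk_alternates (r / c\<^sup>2) (\<lambda>j. c * \<eta> j) (\<lambda>j. c\<^sup>2 * t j) k = walk_alternates r \<eta> t k"
proof -
  have 1: "c * \<eta> j * sqrt (r / c\<^sup>2) = \<eta> j * sqrt r" for j
    using assms by (simp add: real_sqrt_divide)
  have 2: "c\<^sup>2 * t j * (r / c\<^sup>2) = t j * r" for j using assms by simp
  show ?thesis unfolding walk_alternates_def by (simp only: 1 2)
qed

lemma walk_alternates_mono:
  assumes "0 \<le> r" "\<And>j. t j \<le> t' j" "\<And>j. \<eta>' j \<le> \<eta> j"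
  shows "walk_alternates r \<eta> t k \<subseteq> walk_alternates r \<eta>' t' k"
  unfolding walk_alternates_def
proof safe
  fix \<omega> j assume "\<forall>j. alternates (\<eta> j * sqrt r) (\<lambda>i. walk i \<omega>) {..nat \<lfloor>t j * r\<rfloor>} (k j)"
  then have "alternates (\<eta> j * sqrt r) (\<lambda>i. walk i \<omega>) {..nat \<lfloor>t j * r\<rfloor>} (k j)" by blast
  moreover have "\<eta>' j * sqrt r \<le> \<eta> j * sqrt r" using assms by (intro mult_right_mono) auto
  moreover have "{..nat \<lfloor>t j * r\<rfloor>} \<subseteq> {..nat \<lfloor>t' j * r\<rfloor>}"
    using assms(1) assms(2)[of j] by (auto intro!: nat_mono floor_mono mult_right_mono elim!: order.trans)
  ultimately show "alternates (\<eta>' j * sqrt r) (\<lambda>i. walk i \<omega>) {..nat \<lfloor>t' j * r\<rfloor>} (k j)"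
    by (rule alternates_mono)
qed

text \<open>The walk is compared with its values at block ends (Ottaviani), these with Brownian motion at
  grid times (coupling), and every loss in the level is compensated by running the Brownian motion with a
  grid that is coarser by \<open>u\<^sup>2\<close>, hence with values larger by \<open>u\<close>. The price
  is the longer horizon \<open>u ^ 4 * t\<close>.\<close>
lemma walk_alternates_upper:
  fixes \<eta> t :: "'j::finite \<Rightarrow> real" and B :: "real \<Rightarrow> 'b \<Rightarrow> real"
  assumes bm: "standard_brownian_motion N B" and t: "\<And>j. 0 < t j" and \<eta>: "\<And>j. 0 < \<eta> j"
    and u: "1 < u" and \<epsilon>: "0 < \<epsilon>"
  shows "\<forall>\<^sub>F r in at_top. prob (walk_alternates r \<eta> t k) \<le>
    measure N (brownian_alternates N B \<eta> (\<lambda>j. u ^ 4 * t j) k) + \<epsilon>"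
proof -
  interpret N: prob_space N by (rule brownian_prob_space[OF bm])
  define T where "T = Max (range t)"
  have T: "t j \<le> T" for j by (simp add: T_def)
  have T0: "0 < T" using t T less_le_trans by blast
  define \<eta>0 where "\<eta>0 = Min (range \<eta>)"
  have \<eta>0: "0 < \<eta>0" "\<eta>0 \<le> \<eta> j" for j using \<eta> by (auto simp: \<eta>0_def)
  \<comment> \<open>half of the gain \<open>(u - 1) * \<eta>0\<close> pays for the oscillation inside
    blocks (twice \<open>2 * e\<close>), the other half for the coupling error
    \<open>\<delta>\<close>\<close>
  define e where "e = (u - 1) * \<eta>0 / (8 * u)"
  have e: "0 < e" "4 * e \<le> \<eta> j" "u * (4 * e) = (u - 1) * \<eta>0 / 2" for j
  proof -
    show "0 < e" using u \<eta>0 by (simp add: e_def)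
    have "8 * u * e = (u - 1) * \<eta>0" using u by (simp add: e_def)
    then show ue: "u * (4 * e) = (u - 1) * \<eta>0 / 2" by linarith
    have "u * (4 * e) \<le> u * \<eta>0" unfolding ue using u \<eta>0(1) by (simp add: algebra_simps)
    then have "4 * e \<le> \<eta>0" using u by simp
    then show "4 * e \<le> \<eta> j" using \<eta>0(2)[of j] by simp
  qed
  \<comment> \<open>blocks of Brownian length \<open>h\<close>: short enough for the hypothesis of
    \<open>ottaviani\<close>, and such that \<open>2 * K\<close> times the Gaussian tail bound \<open>48
    * h\<^sup>2 / e ^ 4\<close> is at most \<open>\<epsilon> / 4\<close>\<close>
  define h where "h = min 1 (min (e\<^sup>2 / 2) (\<epsilon> * e ^ 4 / (384 * (u\<^sup>2 * T + 1))))"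
  have h0: "0 < h" using e \<epsilon> T0 u by (auto simp: h_def intro!: divide_pos_pos mult_pos_pos add_nonneg_pos)
  have h: "h \<le> 1" "h \<le> e\<^sup>2 / 2" "h \<le> \<epsilon> * e ^ 4 / (384 * (u\<^sup>2 * T + 1))"
    unfolding h_def
    by (rule min.cobounded1, rule min.coboundedI2[OF min.cobounded1], rule min.coboundedI2[OF min.cobounded2])
  define K where "K = Suc (nat \<lfloor>u\<^sup>2 * T / h\<rfloor>)"
  have K: "real K \<le> (u\<^sup>2 * T + 1) / h"
  proof -
    have "real (nat \<lfloor>u\<^sup>2 * T / h\<rfloor>) \<le> u\<^sup>2 * T / h" using T0 h0 by simp
    moreover have "1 \<le> 1 / h" using h h0 by simp
    ultimately show ?thesis by (simp add: K_def add_divide_distrib)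
  qed
  define \<theta> where "\<theta> = e / sqrt h"
  have \<theta>: "0 < \<theta>" using e h0 by (simp add: \<theta>_def)
  have \<theta>4: "2 * real K * (48 / \<theta> ^ 4) \<le> \<epsilon> / 4"
  proof -
    have "(sqrt h) ^ 4 = ((sqrt h)\<^sup>2)\<^sup>2" by simp
    also have "\<dots> = h\<^sup>2" using h0 by simp
    finally have "48 / \<theta> ^ 4 = 48 * h\<^sup>2 / e ^ 4" by (simp add: \<theta>_def power_divide)
    then have "2 * real K * (48 / \<theta> ^ 4) \<le> 2 * ((u\<^sup>2 * T + 1) / h) * (48 * h\<^sup>2 / e ^ 4)"
      using K e by (simp only:) (intro mult_right_mono mult_left_mono, auto)
    also have "\<dots> = h * (96 * (u\<^sup>2 * T + 1) / e ^ 4)" using h0 by (simp add: power2_eq_square)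
    also have "\<dots> \<le> (\<epsilon> * e ^ 4 / (384 * (u\<^sup>2 * T + 1))) * (96 * (u\<^sup>2 * T + 1) / e ^ 4)"
      using h(3) T0 e(1) by (intro mult_right_mono) auto
    also have "\<dots> = \<epsilon> / 4"
    proof -
      have gen: "(\<epsilon> * x / (384 * y)) * (96 * y / x) = \<epsilon> / 4" if "x \<noteq> 0" "y \<noteq> 0" for x y :: real
        using that by simp
      have "0 \<le> u\<^sup>2 * T" using T0 by simp
      then have "u\<^sup>2 * T + 1 \<noteq> 0" by linarith
      moreover have "e ^ 4 \<noteq> 0" using e(1) by simp
      ultimately show ?thesis by (intro gen)
    qed
    finally show ?thesis .
  qed
  define \<epsilon>1 where "\<epsilon>1 = \<epsilon> / (8 * real K)"
  have K0: "0 < real K" by (simp add: K_def)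
  have \<epsilon>1: "0 < \<epsilon>1" "2 * real K * \<epsilon>1 = \<epsilon> / 4" using \<epsilon> K0 by (simp_all add: \<epsilon>1_def)
  define \<delta> where "\<delta> = (u - 1) * \<eta>0 / (2 * u * sqrt h)"
  have "u * sqrt h \<noteq> 0" using u h0 by simp
  then have \<delta>: "0 < \<delta>" "\<delta> * (u * sqrt h) = (u - 1) * \<eta>0 / 2"
    using u \<eta>0(1) h0 by (simp_all add: \<delta>_def field_simps)
  define m where "m j = nat \<lfloor>u\<^sup>2 * t j / h\<rfloor>" for j
  define L where "L j = (\<eta> j - 4 * e) / sqrt h" for j
  have h': "0 < u\<^sup>2 * h" "sqrt (u\<^sup>2 * h) = u * sqrt h" using u h0 by (simp_all add: real_sqrt_mult)
  have ev1: "\<forall>\<^sub>F b in sequentially.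
      prob {\<omega> \<in> space M. \<forall>j. alternates (L j * sqrt (real b)) (\<lambda>i. walk (i * b) \<omega>) {..m j} (k j)} \<le>
      measure N {\<omega> \<in> space N. \<forall>j. alternates ((L j - \<delta>) * (u * sqrt h)) (\<lambda>i. B (real i * (u\<^sup>2 * h)) \<omega>) {..m j} (k j)} + \<epsilon> / 2"
    using walk_grid_vs_brownian_grid(1)[OF bm h'(1) \<delta>(1), of "\<epsilon> / 2" L m k] \<epsilon> by (simp add: h'(2))
  have Bsub: "{\<omega> \<in> space N. \<forall>j. alternates ((L j - \<delta>) * (u * sqrt h)) (\<lambda>i. B (real i * (u\<^sup>2 * h)) \<omega>) {..m j} (k j)} \<subseteq>
      brownian_alternates N B \<eta> (\<lambda>j. u ^ 4 * t j) k"
    unfolding brownian_alternates_def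
  proof safe
    fix \<omega> j assume "\<forall>j. alternates ((L j - \<delta>) * (u * sqrt h)) (\<lambda>i. B (real i * (u\<^sup>2 * h)) \<omega>) {..m j} (k j)"
    then have "alternates ((L j - \<delta>) * (u * sqrt h)) (\<lambda>i. B (real i * (u\<^sup>2 * h)) \<omega>) {..m j} (k j)" by blast
    then have "alternates (1 * ((L j - \<delta>) * (u * sqrt h)) - 2 * 0) (\<lambda>s. B s \<omega>) {0..u ^ 4 * t j} (k j)"
    proof (rule alternates_transfer[where f = "\<lambda>i. real i * (u\<^sup>2 * h)"])
      fix i assume "i \<in> {..m j}"
      then have "real i \<le> u\<^sup>2 * t j / h"
        using t[of j] h0 by (simp add: m_def le_nat_floor) (smt (verit) of_nat_le_iff of_nat_floor divide_nonneg_pos mult_nonneg_nonneg zero_le_power2)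
      then have "real i * h \<le> u\<^sup>2 * t j" using h0 by (simp add: field_simps)
      then have "u\<^sup>2 * (real i * h) \<le> u\<^sup>2 * (u\<^sup>2 * t j)" by (intro mult_left_mono) auto
      moreover have "u\<^sup>2 * (u\<^sup>2 * t j) = u ^ 4 * t j" by (simp add: power2_eq_square eval_nat_numeral algebra_simps)
      ultimately show "real i * (u\<^sup>2 * h) \<in> {0..u ^ 4 * t j}" using h0 by (simp add: algebra_simps)
    qed (use h'(1) in \<open>auto intro!: mult_right_mono\<close>)
    moreover have "\<eta> j \<le> (L j - \<delta>) * (u * sqrt h)"
    proof -
      have Lh: "L j * sqrt h = \<eta> j - 4 * e" using h0 by (simp add: L_def)
      have "(L j - \<delta>) * (u * sqrt h) = u * (L j * sqrt h) - \<delta> * (u * sqrt h)"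
        by (simp add: algebra_simps)
      also have "\<dots> = u * (\<eta> j - 4 * e) - \<delta> * (u * sqrt h)" by (simp only: Lh)
      also have "\<dots> = u * \<eta> j - (u - 1) * \<eta>0" unfolding \<delta>(2) using e(3) right_diff_distrib[of u "\<eta> j" "4 * e"] by linarith
      also have "\<dots> \<ge> u * \<eta> j - (u - 1) * \<eta> j" using \<eta>0(2)[of j] u by (simp add: mult_left_mono)
      finally show ?thesis by (simp add: algebra_simps)
    qed
    ultimately show "alternates (\<eta> j) (\<lambda>s. B s \<omega>) {0..u ^ 4 * t j} (k j)"
      by (elim alternates_mono) auto
  qed
  have Bsets: "brownian_alternates N B \<eta> (\<lambda>j. u ^ 4 * t j) k \<in> sets N"
    using t u by (intro sets_brownian_alternates[OF bm]) (simp add: less_imp_le)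
  note ev2 = walk_tail[OF \<theta> \<epsilon>1(1)]
  have "1 < u\<^sup>2" using u by simp
  note ev3 = eventually_block_length[OF h0 this]
  show ?thesis
    using ev3 eventually_compose_filterlim[OF ev1 filterlim_block_length[OF h0]]
      eventually_compose_filterlim[OF ev2 filterlim_block_length[OF h0]] eventually_gt_at_top[of 0]
  proof eventually_elim
    case (elim r)
    define b where "b = nat \<lfloor>r * h\<rfloor>"
    have b: "0 < b" "real b \<le> r * h" "r * h \<le> u\<^sup>2 * real b" and r: "0 < r" using elim by (auto simp: b_def)
    define a where "a = e * sqrt r"
    have a: "0 < a" using e r by (simp add: a_def)
    define Osc where "Osc = {\<omega> \<in> space M. \<exists>i<K * b. 2 * a < \<bar>walk i \<omega> - walk (b * (i div b)) \<omega>\<bar>}"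
    define G where "G = {\<omega> \<in> space M. \<forall>j. alternates (L j * sqrt (real b)) (\<lambda>i. walk (i * b) \<omega>) {..m j} (k j)}"
    have Osc_meas: "Osc \<in> events" unfolding Osc_def by measurable
    have G_meas: "G \<in> events"
    proof -
      have "{\<omega> \<in> space M. \<forall>j\<in>UNIV. alternates (L j * sqrt (real b)) (\<lambda>i. walk (i * b) \<omega>) {..m j} (k j)} \<in> events"
        by (intro sets.sets_Collect_finite_All sets_alternates_finite) auto
      then show ?thesis by (simp add: G_def)
    qed
    have sub: "walk_alternates r \<eta> t k \<subseteq> G \<union> Osc"
    proof
      fix \<omega> assume \<omega>: "\<omega> \<in> walk_alternates r \<eta> t k"
      show "\<omega> \<in> G \<union> Osc"
      proof (cases "\<omega> \<in> Osc")
        case False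
        have \<omega>s: "\<omega> \<in> space M" using \<omega> by (simp add: walk_alternates_def)
        have "alternates (L j * sqrt (real b)) (\<lambda>i. walk (i * b) \<omega>) {..m j} (k j)" for j
        proof -
          have idx: "i div b \<le> m j" "i < K * b" if "i \<in> {..nat \<lfloor>t j * r\<rfloor>}" for i
          proof -
            have "real i \<le> t j * r"
              using that t[of j] r by (simp add: le_nat_iff le_floor_iff)
            also have "\<dots> \<le> t j * (u\<^sup>2 * real b / h)" using b(3) h0 t[of j] by (intro mult_left_mono) (auto simp: field_simps)
            finally have "real i \<le> (u\<^sup>2 * t j / h) * real b" by (simp add: field_simps)
            then have 1: "real i / real b \<le> u\<^sup>2 * t j / h" using b(1) by (simp add: field_simps)
            have "real (i div b) \<le> real i / real b" by (rule of_nat_div_le_of_nat)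
            also note 1
            finally have 2: "real (i div b) \<le> u\<^sup>2 * t j / h" .
            then show "i div b \<le> m j" unfolding m_def by (rule le_nat_floor)
            have "u\<^sup>2 * t j / h \<le> u\<^sup>2 * T / h" using T[of j] h0 by (intro divide_right_mono mult_left_mono) auto
            then have "i div b \<le> nat \<lfloor>u\<^sup>2 * T / h\<rfloor>" using 2 by (intro le_nat_floor) linarith
            then have "i div b < K" by (simp add: K_def)
            then show "i < K * b" using b(1) by (simp add: div_less_iff_less_mult)
          qed
          have "alternates (\<eta> j * sqrt r) (\<lambda>i. walk i \<omega>) {..nat \<lfloor>t j * r\<rfloor>} (k j)"
            using \<omega> by (simp add: walk_alternates_def)
          then have "alternates (1 * (\<eta> j * sqrt r) - 2 * (2 * a)) (\<lambda>i. walk (i * b) \<omega>) {..m j} (k j)"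
          proof (rule alternates_transfer[where f = "\<lambda>i. i div b"])
            fix i assume i: "i \<in> {..nat \<lfloor>t j * r\<rfloor>}"
            show "i div b \<in> {..m j}" using idx(1)[OF i] by simp
            have "\<bar>walk i \<omega> - walk (b * (i div b)) \<omega>\<bar> \<le> 2 * a"
            proof (rule ccontr)
              assume "\<not> ?thesis"
              then have "\<omega> \<in> Osc" unfolding Osc_def using \<omega>s idx(2)[OF i]
                by (intro CollectI conjI exI[of _ i]) auto
              then show False using False by simp
            qed
            then show "\<bar>1 * walk i \<omega> - walk (i div b * b) \<omega>\<bar> \<le> 2 * a" by (simp add: mult.commute)
          qed (auto intro: div_le_mono)
          moreover have "L j * sqrt (real b) \<le> 1 * (\<eta> j * sqrt r) - 2 * (2 * a)"
          proof -
            have "sqrt (real b) \<le> sqrt r * sqrt h" using b(2) by (simp add: real_sqrt_mult[symmetric])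
            then have "sqrt (real b) / sqrt h \<le> sqrt r" using h0 by (simp add: field_simps)
            then have "(\<eta> j - 4 * e) * (sqrt (real b) / sqrt h) \<le> (\<eta> j - 4 * e) * sqrt r"
              using e(2)[of j] by (intro mult_left_mono) auto
            moreover have "L j * sqrt (real b) = (\<eta> j - 4 * e) * (sqrt (real b) / sqrt h)" by (simp add: L_def)
            moreover have "1 * (\<eta> j * sqrt r) - 2 * (2 * a) = (\<eta> j - 4 * e) * sqrt r"
              by (simp add: a_def algebra_simps)
            ultimately show ?thesis by (simp only:)
          qed
          ultimately show ?thesis by (elim alternates_mono) auto
        qed
        then show ?thesis using \<omega>s by (simp add: G_def)
      qed simp
    qed
    have probO: "prob Osc \<le> \<epsilon> / 2"
    proof -
      have "real b \<le> a\<^sup>2 / 2"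
      proof -
        have "real b \<le> r * (e\<^sup>2 / 2)" using b(2) h(2) r by (meson order.trans mult_left_mono less_imp_le)
        then show ?thesis using r by (simp add: a_def power_mult_distrib algebra_simps)
      qed
      then have "prob Osc \<le> 2 * real K * prob {\<omega> \<in> space M. a < \<bar>walk b \<omega>\<bar>}"
        unfolding Osc_def by (rule walk_oscillation[OF a b(1)])
      also have "\<dots> \<le> 2 * real K * prob {\<omega> \<in> space M. \<theta> * sqrt (real b) < \<bar>walk b \<omega>\<bar>}"
      proof -
        have "\<theta> * sqrt (real b) \<le> a"
        proof -
          have "sqrt (real b) \<le> sqrt r * sqrt h" using b(2) by (simp add: real_sqrt_mult[symmetric])
          then have "e * (sqrt (real b) / sqrt h) \<le> e * sqrt r" using h0 e(1) by (intro mult_left_mono) (auto simp: field_simps)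
          then show ?thesis by (simp add: \<theta>_def a_def)
        qed
        then show ?thesis by (intro mult_left_mono finite_measure_mono) auto
      qed
      also have "\<dots> \<le> 2 * real K * (48 / \<theta> ^ 4 + \<epsilon>1)" using elim by (intro mult_left_mono) (auto simp: b_def)
      also have "\<dots> \<le> \<epsilon> / 2" using \<theta>4 \<epsilon>1(2) by (simp add: distrib_left)
      finally show ?thesis .
    qed
    have "prob (walk_alternates r \<eta> t k) \<le> prob (G \<union> Osc)"
      using sub Osc_meas G_meas by (intro finite_measure_mono) auto
    also have "\<dots> \<le> prob G + prob Osc" using G_meas Osc_meas by (rule measure_Un_le)
    also have "prob G \<le> measure N (brownian_alternates N B \<eta> (\<lambda>j. u ^ 4 * t j) k) + \<epsilon> / 2"
      using elim(2) N.finite_measure_mono[OF Bsub Bsets] by (simp add: G_def b_def)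
    finally show ?case using probO by simp
  qed
qed

text \<open>No oscillation bound is needed in this direction, since an alternation along a grid is an
  alternation. The losses \<open>v\<^sup>2\<close> from passing to the Brownian grid and \<open>v\<close>
  from the coupling and from rounding are compensated by shorter blocks.\<close>
lemma walk_alternates_lower:
  fixes \<eta> t :: "'j::finite \<Rightarrow> real" and B :: "real \<Rightarrow> 'b \<Rightarrow> real"
  assumes bm: "standard_brownian_motion N B" and t: "\<And>j. 0 < t j" and \<eta>: "\<And>j. 0 < \<eta> j"
    and v: "0 < v" "v < 1" and \<epsilon>: "0 < \<epsilon>"
  shows "\<forall>\<^sub>F r in at_top. measure N (brownian_alternates N B \<eta> (\<lambda>j. v ^ 16 * t j) k) \<le>
    prob (walk_alternates r \<eta> t k) + \<epsilon>"
proof -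
  interpret N: prob_space N by (rule brownian_prob_space[OF bm])
  define \<eta>0 where "\<eta>0 = Min (range \<eta>)"
  have \<eta>0: "0 < \<eta>0" "\<eta>0 \<le> \<eta> j" for j using \<eta> by (auto simp: \<eta>0_def)
  have "v\<^sup>2 * \<eta> j < \<eta> j" for j using v \<eta>[of j] by (simp add: power_less_one_iff)
  then obtain g where g: "0 < g" and Bg: "measure N (brownian_alternates N B \<eta> (\<lambda>j. v ^ 16 * t j) k) \<le>
    measure N {\<omega> \<in> space N. \<forall>j. alternates (v\<^sup>2 * \<eta> j) (\<lambda>i. B (real i * g) \<omega>) {..nat \<lfloor>v ^ 16 * t j / g\<rfloor>} (k j)} + \<epsilon> / 2"
    using brownian_grid_approx[OF bm, of "\<lambda>j. v ^ 16 * t j" "\<lambda>j. v\<^sup>2 * \<eta> j" \<eta> "\<epsilon> / 2" k] t v \<epsilon>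
    by (auto simp: less_imp_le)
  \<comment> \<open>blocks longer than the Brownian grid suggests, so that walk values at block ends
    exceed the Brownian ones by \<open>v\<close> to the power \<open>-4\<close>, which pays for all
    losses\<close>
  define h where "h = g / v ^ 8"
  have h: "0 < h" using g v by (simp add: h_def)
  define m where "m j = nat \<lfloor>v ^ 16 * t j / g\<rfloor>" for j
  define L where "L j = v\<^sup>2 * \<eta> j / sqrt g" for j
  define \<delta> where "\<delta> = (v\<^sup>2 - v ^ 3) * \<eta>0 / sqrt g"
  have v32: "v ^ 3 < v\<^sup>2" using v by (simp add: power3_eq_cube power2_eq_square)
  have \<delta>: "0 < \<delta>" using v32 \<eta>0 g by (simp add: \<delta>_def)
  have ev1: "\<forall>\<^sub>F b in sequentially.
      measure N {\<omega> \<in> space N. \<forall>j. alternates (L j * sqrt g) (\<lambda>i. B (real i * g) \<omega>) {..m j} (k j)} \<le>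
      prob {\<omega> \<in> space M. \<forall>j. alternates ((L j - \<delta>) * sqrt (real b)) (\<lambda>i. walk (i * b) \<omega>) {..m j} (k j)} + \<epsilon> / 2"
    using \<epsilon> by (intro walk_grid_vs_brownian_grid(2)[OF bm g \<delta>]) simp
  have Lg: "L j * sqrt g = v\<^sup>2 * \<eta> j" for j using g by (simp add: L_def)
  have "1 < 1 / v\<^sup>2" using v by (simp add: power_less_one_iff)
  note ev3 = eventually_block_length[OF h this]
  show ?thesis
    using ev3 eventually_compose_filterlim[OF ev1 filterlim_block_length[OF h]] eventually_gt_at_top[of 0]
  proof eventually_elim
    case (elim r)
    define b where "b = nat \<lfloor>r * h\<rfloor>"
    have b: "0 < b" "real b \<le> r * h" "r * h \<le> 1 / v\<^sup>2 * real b" and r: "0 < r" using elim by (auto simp: b_def)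
    have sub: "{\<omega> \<in> space M. \<forall>j. alternates ((L j - \<delta>) * sqrt (real b)) (\<lambda>i. walk (i * b) \<omega>) {..m j} (k j)} \<subseteq>
        walk_alternates r \<eta> t k"
      unfolding walk_alternates_def
    proof safe
      fix \<omega> j assume "\<forall>j. alternates ((L j - \<delta>) * sqrt (real b)) (\<lambda>i. walk (i * b) \<omega>) {..m j} (k j)"
      then have "alternates ((L j - \<delta>) * sqrt (real b)) (\<lambda>i. walk (i * b) \<omega>) {..m j} (k j)" by blast
      then have "alternates (1 * ((L j - \<delta>) * sqrt (real b)) - 2 * 0) (\<lambda>i. walk i \<omega>) {..nat \<lfloor>t j * r\<rfloor>} (k j)"
      proof (rule alternates_transfer[where f = "\<lambda>i. i * b"])
        fix i assume "i \<in> {..m j}"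
        then have "i \<le> nat \<lfloor>v ^ 16 * t j / g\<rfloor>" by (simp add: m_def)
        moreover have "0 \<le> v ^ 16 * t j / g" using t[of j] v g by simp
        ultimately have "real i \<le> v ^ 16 * t j / g" by (simp add: le_nat_iff le_floor_iff)
        then have "real i * real b \<le> (v ^ 16 * t j / g) * (r * h)"
          using b(2) t[of j] v g by (intro mult_mono) auto
        also have "\<dots> = v ^ 8 * (t j * r)" using g v by (simp add: h_def field_simps power_add[symmetric])
        also have "\<dots> \<le> 1 * (t j * r)" using v t[of j] r by (intro mult_right_mono) (auto simp: power_le_one)
        finally show "i * b \<in> {..nat \<lfloor>t j * r\<rfloor>}" by (auto intro!: le_nat_floor)
      qed auto
      moreover have "\<eta> j * sqrt r \<le> (L j - \<delta>) * sqrt (real b)"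
      proof -
        have "v\<^sup>2 * (r * h) \<le> real b" using b(3) v by (simp add: field_simps)
        then have "sqrt (v\<^sup>2 * (r * h)) \<le> sqrt (real b)" by simp
        then have 1: "v * (sqrt r * sqrt h) \<le> sqrt (real b)" using v by (simp add: real_sqrt_mult)
        have "sqrt g = v ^ 4 * sqrt h"
        proof -
          have "(v ^ 4 * sqrt h)\<^sup>2 = v ^ 8 * h"
            using h by (simp add: power_mult_distrib power_mult[symmetric])
          also have "\<dots> = g" using v by (simp add: h_def)
          finally show ?thesis using v h by (intro real_sqrt_unique) auto
        qed
        then have "sqrt r * sqrt g = v ^ 3 * (v * (sqrt r * sqrt h))" by (simp add: eval_nat_numeral)
        also have "\<dots> \<le> v ^ 3 * sqrt (real b)" using 1 v by (intro mult_left_mono) auto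
        finally have "sqrt r \<le> v ^ 3 * sqrt (real b) / sqrt g" using g by (simp add: field_simps)
        then have "\<eta> j * sqrt r \<le> \<eta> j * (v ^ 3 * sqrt (real b) / sqrt g)" using \<eta>[of j] by (intro mult_left_mono) auto
        also have "\<dots> = (v\<^sup>2 * \<eta> j - (v\<^sup>2 - v ^ 3) * \<eta> j) / sqrt g * sqrt (real b)" by (simp add: algebra_simps)
        also have "\<dots> \<le> (v\<^sup>2 * \<eta> j - (v\<^sup>2 - v ^ 3) * \<eta>0) / sqrt g * sqrt (real b)"
          using v32 \<eta>0(2)[of j] g by (intro mult_right_mono divide_right_mono diff_mono mult_left_mono) auto
        also have "\<dots> = (L j - \<delta>) * sqrt (real b)" by (simp add: L_def \<delta>_def diff_divide_distrib)
        finally show ?thesis .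
      qed
      ultimately show "alternates (\<eta> j * sqrt r) (\<lambda>i. walk i \<omega>) {..nat \<lfloor>t j * r\<rfloor>} (k j)"
        by (elim alternates_mono) auto
    qed
    have "measure N (brownian_alternates N B \<eta> (\<lambda>j. v ^ 16 * t j) k) \<le>
      prob {\<omega> \<in> space M. \<forall>j. alternates ((L j - \<delta>) * sqrt (real b)) (\<lambda>i. walk (i * b) \<omega>) {..m j} (k j)} + \<epsilon>"
      using Bg elim(2) unfolding Lg by (simp add: m_def b_def)
    also have "\<dots> \<le> prob (walk_alternates r \<eta> t k) + \<epsilon>"
      using sub sets_walk_alternates by (intro add_right_mono finite_measure_mono) auto
    finally show ?case .
  qed
qed

end

section \<open>Continuity in time of Brownian alternation probabilities\<close>

lemma std_normal_below_2: "measure std_normal_distribution {..<2} < 1"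
proof -
  interpret normal: real_distribution std_normal_distribution by (rule real_dist_normal_dist)
  have "normal.prob {..<2} \<noteq> 1"
  proof
    assume 1: "normal.prob {..<2} = 1"
    have "normal.prob (space std_normal_distribution - {..<2}) = 0"
      using normal.prob_compl[of "{..<2}"] 1 by simp
    moreover have "space std_normal_distribution - {..<2} = {2 :: real..}" by auto
    ultimately have "emeasure std_normal_distribution {2..} = 0"
      by (simp add: normal.emeasure_eq_measure)
    then have "{2..} \<in> null_sets std_normal_distribution" by (intro null_setsI) auto
    then have "AE x in lborel. x \<in> {2..} \<longrightarrow> ennreal (std_normal_density x) = 0"
      by (subst (asm) null_sets_density_iff) auto
    moreover have "\<not> std_normal_density x \<le> 0" for x
      using normal_density_pos[of 1 0 x] by (simp add: not_le)
    ultimately have "AE x in lborel. x \<notin> {2..3 :: real}" by (auto simp: ennreal_eq_0_iff)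
    then have "{2..3 :: real} \<in> null_sets lborel" by (subst AE_iff_null_sets) auto
    then show False by (auto simp: null_sets_def)
  qed
  then show ?thesis using normal.prob_le_1[of "{..<2}"] by linarith
qed

lemma std_normal_tail_le:
  assumes c: "0 < c"
  shows "measure std_normal_distribution {x. c \<le> \<bar>x\<bar>} \<le> 1 / c\<^sup>2"
proof -
  interpret normal: real_distribution std_normal_distribution by (rule real_dist_normal_dist)
  have "normal.prob {x. c \<le> \<bar>x\<bar>} \<le> normal.prob {x \<in> space std_normal_distribution. c\<^sup>2 \<le> x ^ 2}"
  proof (rule normal.finite_measure_mono)
    show "{x. c \<le> \<bar>x\<bar>} \<subseteq> {x \<in> space std_normal_distribution. c\<^sup>2 \<le> x ^ 2}"
    proof (safe)
      fix x :: real assume "c \<le> \<bar>x\<bar>"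
      then have "c ^ 2 \<le> \<bar>x\<bar> ^ 2" using c by (intro power_mono) auto
      then show "c\<^sup>2 \<le> x ^ 2" by simp
    qed simp
  qed simp
  also have "\<dots> \<le> (\<integral>x. x ^ 2 \<partial>std_normal_distribution) / c\<^sup>2"
    using std_normal_distribution_even_moments(2)[of 1] c
    by (intro integral_Markov_inequality_measure[where A = "space std_normal_distribution"]) auto
  also have "(\<integral>x. x ^ 2 \<partial>std_normal_distribution) = 1"
    using std_normal_distribution_even_moments(1)[of 1] by simp
  finally show ?thesis .
qed

text \<open>Look at the times \<open>t - d * \<rho> ^ i\<close>. If \<open>t\<close> were a strict left
  minimum, every normalised increment between consecutive times would be below \<open>2\<close>, unless the
  remaining increment up to \<open>t\<close>, which is smaller by the factor \<open>sqrt \<rho>\<close>, is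
  untypically large. These increments are independent, so the first possibility has probability \<open>q ^
  J\<close> with \<open>q < 1\<close>, and a small \<open>\<rho>\<close> makes the second one
  unlikely.\<close>
lemma brownian_left_minimum_cylinder:
  assumes bm: "standard_brownian_motion N B" and d: "0 < d" "d \<le> t" and \<epsilon>: "0 < \<epsilon>"
  shows "\<exists>C\<in>sets N. measure N C \<le> \<epsilon> \<and> {\<omega> \<in> space N. \<forall>s\<in>{t - d..<t}. B t \<omega> < B s \<omega>} \<subseteq> C"
proof -
  interpret N: prob_space N by (rule brownian_prob_space[OF bm])
  define q where "q = measure std_normal_distribution {..<2}"
  have q: "0 \<le> q" "q < 1" using std_normal_below_2 by (simp_all add: q_def)
  obtain n where n: "q ^ n < \<epsilon> / 2" using real_arch_pow_inv[of "\<epsilon> / 2" q] q \<epsilon> by auto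
  define J where "J = Suc n"
  have J: "0 < J" by (simp add: J_def)
  have "q * q ^ n \<le> 1 * q ^ n" using q by (intro mult_right_mono) auto
  then have qJ: "q ^ J \<le> \<epsilon> / 2" using n by (simp add: J_def)
  \<comment> \<open>by Chebyshev the remaining increment is large with probability at most
    \<open>\<rho>\<close>, for each of the \<open>J\<close> times\<close>
  define \<rho> where "\<rho> = min (1 / 2) (\<epsilon> / (2 * real J))"
  have \<rho>: "0 < \<rho>" "\<rho> \<le> 1 / 2" using \<epsilon> J by (simp_all add: \<rho>_def)
  have "\<rho> \<le> \<epsilon> / (2 * real J)" unfolding \<rho>_def by (rule min.cobounded2)
  then have J\<rho>: "real J * \<rho> \<le> \<epsilon> / 2" using J by (simp add: field_simps)
  define \<tau> where "\<tau> i = t - d * \<rho> ^ i" for i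
  have pow: "0 < d * \<rho> ^ i" "d * \<rho> ^ i \<le> d" for i
    using d(1) \<rho> by (simp_all add: power_le_one)
  have \<tau>_range: "t - d \<le> \<tau> i" "\<tau> i < t" for i using pow[of i] by (simp_all add: \<tau>_def)
  have \<tau>0: "0 \<le> \<tau> i" for i using \<tau>_range(1)[of i] d by linarith
  have \<Delta>: "\<tau> (Suc i) - \<tau> i = d * \<rho> ^ i * (1 - \<rho>)" for i by (simp add: \<tau>_def algebra_simps)
  have \<Delta>_pos: "0 < \<tau> (Suc i) - \<tau> i" for i unfolding \<Delta> using \<rho> by (intro mult_pos_pos[OF pow(1)]) auto
  define Z where "Z i \<omega> = (B (\<tau> (Suc i)) \<omega> - B (\<tau> i) \<omega>) / sqrt (\<tau> (Suc i) - \<tau> i)" for i \<omega>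
  have [measurable]: "B (\<tau> i) \<in> borel_measurable N" for i by (rule brownian_measurable[OF bm \<tau>0])
  have [measurable]: "B t \<in> borel_measurable N" using d by (intro brownian_measurable[OF bm]) auto
  have [measurable]: "Z i \<in> borel_measurable N" for i unfolding Z_def[abs_def] by measurable
  have Z_law: "distr N borel (Z i) = std_normal_distribution" for i
    using brownian_increment_law[OF bm \<tau>0[of i] \<Delta>_pos[of i]] by (simp add: Z_def[abs_def])
  have indep: "\<And>n (\<tau> :: nat \<Rightarrow> real). 0 \<le> \<tau> 0 \<and> (\<forall>i<n. \<tau> i < \<tau> (Suc i)) \<Longrightarrow>
      N.indep_vars (\<lambda>_. borel) (\<lambda>i \<omega>. B (\<tau> (Suc i)) \<omega> - B (\<tau> i) \<omega>) {..<n}"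
    using bm unfolding standard_brownian_motion_def by blast
  have "N.indep_vars (\<lambda>_. borel) (\<lambda>i \<omega>. B (\<tau> (Suc i)) \<omega> - B (\<tau> i) \<omega>) {..<J}"
    by (rule indep) (use \<tau>0 \<Delta>_pos in auto)
  then have "N.indep_vars (\<lambda>_. borel) (\<lambda>i \<omega>. (B (\<tau> (Suc i)) \<omega> - B (\<tau> i) \<omega>) / sqrt (\<tau> (Suc i) - \<tau> i)) {..<J}"
    by (rule N.indep_vars_compose2) measurable
  then have Z_indep: "N.indep_vars (\<lambda>_. borel) Z {..<J}" by (simp add: Z_def[abs_def])
  \<comment> \<open>all increments small, or some remainder large\<close>
  define C1 where "C1 = (\<Inter>i\<in>{..<J}. Z i -` {..<2} \<inter> space N)"
  define C2 where "C2 i = {\<omega> \<in> space N. sqrt (d * \<rho> ^ i) \<le> \<bar>B t \<omega> - B (\<tau> (Suc i)) \<omega>\<bar>}" for i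
  have C2_meas: "C2 i \<in> sets N" for i unfolding C2_def by measurable
  have C1_meas: "C1 \<in> sets N" unfolding C1_def using J by (intro sets.finite_INT) auto
  have prob_C1: "N.prob C1 = q ^ J"
  proof -
    have "N.prob C1 = (\<Prod>i\<in>{..<J}. N.prob (Z i -` {..<2} \<inter> space N))"
      unfolding C1_def by (rule N.indep_varsD[OF Z_indep]) (use J in auto)
    also have "\<dots> = (\<Prod>i\<in>{..<J}. q)"
    proof (rule prod.cong[OF refl])
      fix i
      show "N.prob (Z i -` {..<2} \<inter> space N) = q"
        unfolding q_def Z_law[of i, symmetric] by (rule measure_distr[symmetric]) auto
    qed
    finally show ?thesis by simp
  qed
  have prob_C2: "N.prob (C2 i) \<le> \<rho>" for i
  proof -
    have h: "0 < t - \<tau> (Suc i)" "t - \<tau> (Suc i) = \<rho> * (d * \<rho> ^ i)" using \<tau>_range(2)[of "Suc i"] by (simp_all add: \<tau>_def)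
    define W where "W \<omega> = (B t \<omega> - B (\<tau> (Suc i)) \<omega>) / sqrt (t - \<tau> (Suc i))" for \<omega>
    have [measurable]: "W \<in> borel_measurable N" unfolding W_def[abs_def] by measurable
    have W_law: "distr N borel W = std_normal_distribution"
      using brownian_increment_law[OF bm \<tau>0[of "Suc i"] h(1)] by (simp add: W_def[abs_def])
    have "C2 i \<subseteq> W -` {x. 1 / sqrt \<rho> \<le> \<bar>x\<bar>} \<inter> space N"
    proof
      fix \<omega> assume \<omega>: "\<omega> \<in> C2 i"
      have "1 / sqrt \<rho> * sqrt (t - \<tau> (Suc i)) = sqrt (d * \<rho> ^ i)"
        unfolding h(2) real_sqrt_mult[of \<rho>] using \<rho> by simp
      then have "1 / sqrt \<rho> * sqrt (t - \<tau> (Suc i)) \<le> \<bar>B t \<omega> - B (\<tau> (Suc i)) \<omega>\<bar>"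
        using \<omega> by (simp add: C2_def)
      then have "1 / sqrt \<rho> \<le> \<bar>B t \<omega> - B (\<tau> (Suc i)) \<omega>\<bar> / sqrt (t - \<tau> (Suc i))"
        using h(1) by (subst pos_le_divide_eq) auto
      then have "1 / sqrt \<rho> \<le> \<bar>W \<omega>\<bar>" using h(1) by (simp add: W_def abs_divide)
      then show "\<omega> \<in> W -` {x. 1 / sqrt \<rho> \<le> \<bar>x\<bar>} \<inter> space N" using \<omega> by (simp add: C2_def)
    qed
    then have "N.prob (C2 i) \<le> N.prob (W -` {x. 1 / sqrt \<rho> \<le> \<bar>x\<bar>} \<inter> space N)"
      by (intro N.finite_measure_mono) auto
    also have "\<dots> = measure std_normal_distribution {x. 1 / sqrt \<rho> \<le> \<bar>x\<bar>}"
      unfolding W_law[symmetric] by (rule measure_distr[symmetric]) auto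
    also have "\<dots> \<le> 1 / (1 / sqrt \<rho>)\<^sup>2" using \<rho> by (intro std_normal_tail_le) simp
    also have "\<dots> = \<rho>" using \<rho> by (simp add: power_divide)
    finally show ?thesis .
  qed
  define C where "C = C1 \<union> (\<Union>i\<in>{..<J}. C2 i)"
  have "C \<in> sets N" unfolding C_def using C1_meas C2_meas by auto
  moreover have "N.prob C \<le> \<epsilon>"
  proof -
    have "N.prob C \<le> N.prob C1 + N.prob (\<Union>i\<in>{..<J}. C2 i)"
      unfolding C_def using C1_meas C2_meas by (intro measure_Un_le) auto
    also have "N.prob (\<Union>i\<in>{..<J}. C2 i) \<le> (\<Sum>i\<in>{..<J}. N.prob (C2 i))"
      using C2_meas by (intro N.finite_measure_subadditive_finite) auto
    also have "\<dots> \<le> (\<Sum>i\<in>{..<J}. \<rho>)" using prob_C2 by (intro sum_mono) auto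
    finally show ?thesis using prob_C1 qJ J\<rho> by simp
  qed
  moreover have "{\<omega> \<in> space N. \<forall>s\<in>{t - d..<t}. B t \<omega> < B s \<omega>} \<subseteq> C"
  proof safe
    fix \<omega> assume \<omega>: "\<omega> \<in> space N" "\<forall>s\<in>{t - d..<t}. B t \<omega> < B s \<omega>"
    show "\<omega> \<in> C"
    proof (rule ccontr)
      assume nC: "\<omega> \<notin> C"
      have "Z i \<omega> < 2" if i: "i < J" for i
      proof -
        have "\<omega> \<notin> C2 i" using nC i by (auto simp: C_def)
        then have R: "\<bar>B t \<omega> - B (\<tau> (Suc i)) \<omega>\<bar> < sqrt (d * \<rho> ^ i)" using \<omega>(1) by (simp add: C2_def not_le)
        have "B t \<omega> < B (\<tau> i) \<omega>" using \<omega>(2) \<tau>_range[of i] by auto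
        then have D: "B (\<tau> (Suc i)) \<omega> - B (\<tau> i) \<omega> < sqrt (d * \<rho> ^ i)" using R by linarith
        have "d * \<rho> ^ i \<le> 4 * (\<tau> (Suc i) - \<tau> i)"
        proof -
          have "d * \<rho> ^ i * 1 \<le> d * \<rho> ^ i * (4 * (1 - \<rho>))"
            using pow(1)[of i] \<rho>(2) by (intro mult_left_mono) auto
          then show ?thesis unfolding \<Delta> by (simp add: algebra_simps)
        qed
        then have "sqrt (d * \<rho> ^ i) \<le> sqrt (4 * (\<tau> (Suc i) - \<tau> i))" by simp
        also have "\<dots> = 2 * sqrt (\<tau> (Suc i) - \<tau> i)" by (subst real_sqrt_mult) simp
        finally have "B (\<tau> (Suc i)) \<omega> - B (\<tau> i) \<omega> < 2 * sqrt (\<tau> (Suc i) - \<tau> i)" using D by linarith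
        then show ?thesis unfolding Z_def using \<Delta>_pos[of i] by (subst pos_divide_less_eq) auto
      qed
      then have "\<omega> \<in> C1" using \<omega>(1) by (simp add: C1_def)
      then show False using nC by (simp add: C_def)
    qed
  qed
  ultimately show ?thesis by blast
qed

text \<open>The exceptional event is covered by events of arbitrarily small probability, which avoids
  deciding whether it is measurable.\<close>
lemma brownian_no_strict_left_minimum:
  assumes bm: "standard_brownian_motion N B" and d: "0 < d" "d \<le> t"
  shows "AE \<omega> in N. \<exists>s\<in>{t - d..<t}. B s \<omega> \<le> B t \<omega>"
proof -
  interpret N: prob_space N by (rule brownian_prob_space[OF bm])
  have "\<exists>C. C \<in> sets N \<and> measure N C \<le> 1 / real (Suc n) \<and>
      {\<omega> \<in> space N. \<forall>s\<in>{t - d..<t}. B t \<omega> < B s \<omega>} \<subseteq> C" for n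
    using brownian_left_minimum_cylinder[OF bm d, of "1 / real (Suc n)"] by auto
  then obtain C where C': "\<And>n. C n \<in> sets N \<and> measure N (C n) \<le> 1 / real (Suc n) \<and>
      {\<omega> \<in> space N. \<forall>s\<in>{t - d..<t}. B t \<omega> < B s \<omega>} \<subseteq> C n"
    using choice[of "\<lambda>n C. C \<in> sets N \<and> measure N C \<le> 1 / real (Suc n) \<and>
      {\<omega> \<in> space N. \<forall>s\<in>{t - d..<t}. B t \<omega> < B s \<omega>} \<subseteq> C"] by blast
  have C: "C n \<in> sets N" "measure N (C n) \<le> 1 / real (Suc n)"
    "{\<omega> \<in> space N. \<forall>s\<in>{t - d..<t}. B t \<omega> < B s \<omega>} \<subseteq> C n" for n
    using C'[of n] by blast+
  define D where "D = (\<Inter>n. C n)"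
  have D: "D \<in> sets N" unfolding D_def using C(1) by (intro sets.countable_INT) auto
  have "N.prob D \<le> 1 / real (Suc n)" for n
  proof -
    have "N.prob D \<le> N.prob (C n)" by (rule N.finite_measure_mono[OF _ C(1)]) (auto simp: D_def)
    then show ?thesis using C(2)[of n] by (rule order_trans)
  qed
  then have "N.prob D \<le> 0"
    by (intro LIMSEQ_le_const[OF LIMSEQ_Suc[OF lim_1_over_n]]) auto
  then have "N.prob D = 0" using measure_nonneg[of N D] by linarith
  then have "emeasure N D = 0" by (simp add: N.emeasure_eq_measure)
  moreover have "{\<omega> \<in> space N. \<not> (\<exists>s\<in>{t - d..<t}. B s \<omega> \<le> B t \<omega>)} \<subseteq> D"
    using C(3) by (auto simp: D_def not_le)
  ultimately show ?thesis using D by (intro AE_I[of _ _ D]) auto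
qed

text \<open>Freezing the path at time \<open>T\<close> changes it arbitrarily little on a slightly longer
  interval, and the level condition is closed.\<close>
lemma alternates_right_limit:
  fixes X :: "real \<Rightarrow> real"
  assumes T: "0 \<le> T" "T < T'" and cont: "continuous_on {0..T'} X"
    and alt: "\<And>s. T < s \<Longrightarrow> alternates L X {0..s} k"
  shows "alternates L X {0..T} k"
proof (rule alternates_closed_level[OF T(1)])
  show "continuous_on {0..T} X" using T by (intro continuous_on_subset[OF cont]) auto
  fix e :: real assume e: "0 < e"
  have "uniformly_continuous_on {0..T'} X" by (rule compact_uniformly_continuous[OF cont]) simp
  then obtain d where d: "0 < d" "\<And>s s'. s \<in> {0..T'} \<Longrightarrow> s' \<in> {0..T'} \<Longrightarrow> dist s' s < d \<Longrightarrow> dist (X s') (X s) < e / 2"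
    unfolding uniformly_continuous_on_def using e half_gt_zero by metis
  define S where "S = min T' (T + d / 2)"
  have S: "T < S" "S \<le> T'" "S < T + d" using T d(1) by (auto simp: S_def)
  have "alternates (1 * L - 2 * (e / 2)) X {0..T} k"
  proof (rule alternates_transfer[OF alt[OF S(1)], where f = "\<lambda>s. min s T"])
    fix s assume s: "s \<in> {0..S}"
    then show "min s T \<in> {0..T}" using T by auto
    have "dist (X s) (X (min s T)) < e / 2"
      using s S T by (intro d(2)) (auto simp: dist_real_def min_def)
    then show "\<bar>1 * X s - X (min s T)\<bar> \<le> e / 2" by (simp add: dist_real_def)
  qed auto
  then show "alternates (L - e) X {0..T} k" by simp
qed

text \<open>Only the last point of an alternation can sit at \<open>T\<close>. It is the bottom of a
  descent, so any earlier time with a value not above \<open>X T\<close> can replace it; such times exist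
  arbitrarily close to \<open>T\<close> unless \<open>T\<close> is a strict left minimum.\<close>
lemma alternates_shorten:
  fixes X :: "real \<Rightarrow> real"
  assumes T: "0 < T" and L: "0 < L" and alt: "alternates L X {0..T} k"
    and no_min: "\<And>n::nat. \<exists>s\<in>{T - T / real (Suc n)..<T}. X s \<le> X T"
  shows "\<exists>s\<ge>0. s < T \<and> alternates L X {0..s} k"
proof (cases k)
  case 0
  then show ?thesis using T by (intro exI[of _ 0]) auto
next
  case (Suc k')
  obtain p where p: "\<And>i. i < 2 * k \<Longrightarrow> p i \<in> {0..T}" "\<And>i. Suc i < 2 * k \<Longrightarrow> p i \<le> p (Suc i)"
    "\<And>i. Suc i < 2 * k \<Longrightarrow> L \<le> (-1) ^ i * (X (p i) - X (p (Suc i)))"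
    using alternatesE[OF alt] by blast
  define z where "z = 2 * k' + 1"
  have z: "Suc (2 * k') = z" "Suc z = 2 * k" by (simp_all add: z_def Suc)
  have le: "p i \<le> p (2 * k')" if "i \<le> 2 * k'" for i
  proof -
    have "p i \<le> p j" if "i \<le> j" "j < 2 * k" for j
      using that
    proof (induction j rule: dec_induct)
      case (step n)
      then show ?case using p(2)[of n] by auto
    qed simp
    then show ?thesis using that Suc by simp
  qed
  have "\<exists>s. p (2 * k') \<le> s \<and> s < T \<and> X s \<le> X (p z)"
  proof (cases "p z < T")
    case True
    then show ?thesis using p(2)[of "2 * k'"] z by (intro exI[of _ "p z"]) auto
  next
    case False
    then have pz: "p z = T" using p(1)[of z] z by simp
    have "L \<le> X (p (2 * k')) - X T" using p(3)[of "2 * k'"] z pz by simp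
    then have "p (2 * k') \<noteq> T" using L by auto
    then have lt: "0 < T - p (2 * k')" using p(1)[of "2 * k'"] Suc by (simp add: less_le)
    obtain n where "inverse (real (Suc n)) < (T - p (2 * k')) / T"
      using reals_Archimedean[of "(T - p (2 * k')) / T"] lt T by auto
    then have n: "T / real (Suc n) < T - p (2 * k')" using T by (simp add: field_simps)
    obtain s where "s \<in> {T - T / real (Suc n)..<T}" "X s \<le> X T" using no_min by blast
    then show ?thesis using n pz by (intro exI[of _ s]) auto
  qed
  then obtain s where s: "p (2 * k') \<le> s" "s < T" "X s \<le> X (p z)" by blast
  have "alternates L X {0..s} k"
  proof (rule alternatesI[of k "p(z := s)"])
    fix i assume i: "i < 2 * k"
    show "(p(z := s)) i \<in> {0..s}"
      using p(1)[OF i] p(1)[of 0] le[of i] s(1) i z p(1)[of "2 * k'"] by (cases "i = z") auto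
  next
    fix i assume i: "Suc i < 2 * k"
    then have iz: "i \<noteq> z" using z(2) by linarith
    show "(p(z := s)) i \<le> (p(z := s)) (Suc i)"
    proof (cases "Suc i = z")
      case True
      then have "i = 2 * k'" using z(1) by linarith
      then show ?thesis using True iz s(1) by simp
    next
      case False
      then show ?thesis using iz p(2)[OF i] by simp
    qed
    show "L \<le> (-1) ^ i * (X ((p(z := s)) i) - X ((p(z := s)) (Suc i)))"
    proof (cases "Suc i = z")
      case True
      then have "i = 2 * k'" using z(1) by linarith
      then show ?thesis using True iz p(3)[OF i] s(3) by simp
    next
      case False
      then show ?thesis using iz p(3)[OF i] by simp
    qed
  qed
  moreover have "0 \<le> s" using p(1)[of "2 * k'"] s(1) Suc by simp
  ultimately show ?thesis using s(2) by blast
qed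

text \<open>The events decrease as \<open>c\<close> decreases to \<open>1\<close>, with limit the event for
  \<open>t\<close> by \<open>alternates_right_limit\<close>; by \<open>alternates_shorten\<close> almost
  every path in it already alternates strictly before the times \<open>t j\<close>.\<close>
lemma brownian_alternates_time_continuity:
  fixes \<eta> t :: "'j::finite \<Rightarrow> real"
  assumes bm: "standard_brownian_motion N B" and t: "\<And>j. 0 < t j" and \<eta>: "\<And>j. 0 < \<eta> j" and \<epsilon>: "0 < \<epsilon>"
  shows "\<exists>c>1. measure N (brownian_alternates N B \<eta> (\<lambda>j. c * t j) k) \<le>
    measure N (brownian_alternates N B \<eta> (\<lambda>j. t j / c) k) + \<epsilon>"
proof -
  interpret N: prob_space N by (rule brownian_prob_space[OF bm])
  define c where "c n = 1 + 1 / real (Suc n)" for n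
  have c: "1 < c n" for n by (simp add: c_def)
  define A where "A n = brownian_alternates N B \<eta> (\<lambda>j. c n * t j) k" for n
  define A' where "A' n = brownian_alternates N B \<eta> (\<lambda>j. t j / c n) k" for n
  have ct: "0 \<le> c n * t j" "0 \<le> t j / c n" for n j using t[of j] c[of n] by simp_all
  have A_meas: "A n \<in> sets N" "A' n \<in> sets N" for n
    unfolding A_def A'_def using ct by (auto intro!: sets_brownian_alternates[OF bm])
  have good: "AE \<omega> in N. \<forall>j\<in>UNIV. \<forall>n::nat. \<exists>s\<in>{t j - t j / real (Suc n)..<t j}. B s \<omega> \<le> B (t j) \<omega>"
  proof (intro AE_finite_allI ballI)
    show "finite (UNIV :: 'j set)" by simp
    fix j
    show "AE \<omega> in N. \<forall>n::nat. \<exists>s\<in>{t j - t j / real (Suc n)..<t j}. B s \<omega> \<le> B (t j) \<omega>"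
      unfolding AE_all_countable
    proof
      fix n :: nat
      have "t j * 1 \<le> t j * real (Suc n)" using t[of j] by (intro mult_left_mono) auto
      then show "AE \<omega> in N. \<exists>s\<in>{t j - t j / real (Suc n)..<t j}. B s \<omega> \<le> B (t j) \<omega>"
        using t[of j] by (intro brownian_no_strict_left_minimum[OF bm]) (auto simp: field_simps)
    qed
  qed
  have ev_small: "\<forall>\<^sub>F n in sequentially. c n * x < y" if "0 < x" "x < y" for x y
  proof -
    have "0 < (y - x) / (2 * x)" using that by simp
    from eventually_inverse_Suc_le[OF this] show ?thesis
    proof eventually_elim
      case (elim n)
      then have "c n * x \<le> x + (y - x) / 2" using that by (simp add: c_def field_simps)
      also have "\<dots> < y" using that by (simp add: field_simps)
      finally show ?case .
    qed
  qed
  have "(\<lambda>n. N.prob (A n - A' n)) \<longlonglongrightarrow> 0"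
  proof (rule N.prob_tendsto_0)
    show "AE \<omega> in N. \<forall>\<^sub>F n in sequentially. \<omega> \<notin> A n - A' n"
      using good AE_space
    proof eventually_elim
      case (elim \<omega>)
      have cont: "continuous_on {0..T} (\<lambda>s. B s \<omega>)" for T
        by (rule continuous_on_subset[OF brownian_continuous[OF bm elim(2)]]) auto
      show ?case
      proof (cases "\<forall>n. \<omega> \<in> A n")
        case False
        then obtain n0 where n0: "\<omega> \<notin> A n0" by blast
        have "\<omega> \<notin> A n" if "n0 \<le> n" for n
        proof -
          have "1 / real (Suc n) \<le> 1 / real (Suc n0)" using that by (intro divide_left_mono) auto
          then have "c n \<le> c n0" by (simp add: c_def)
          then have "A n \<subseteq> A n0" unfolding A_def using t
            by (intro brownian_alternates_mono) (auto intro!: mult_right_mono simp: less_imp_le)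
          then show ?thesis using n0 by blast
        qed
        then show ?thesis by (intro eventually_mono[OF eventually_ge_at_top[of n0]]) auto
      next
        case True
        have "\<forall>\<^sub>F n in sequentially. \<forall>j\<in>UNIV. alternates (\<eta> j) (\<lambda>s. B s \<omega>) {0..t j / c n} (k j)"
        proof (intro eventually_ball_finite ballI)
          fix j
          have "alternates (\<eta> j) (\<lambda>s. B s \<omega>) {0..t j} (k j)"
          proof (rule alternates_right_limit[where T' = "t j + 1"])
            fix s assume "t j < s"
            then obtain n where "c n * t j < s"
              using eventually_happens'[OF sequentially_bot ev_small[OF t]] by blast
            moreover have "alternates (\<eta> j) (\<lambda>s. B s \<omega>) {0..c n * t j} (k j)"
              using True by (auto simp: A_def brownian_alternates_def)
            ultimately show "alternates (\<eta> j) (\<lambda>s. B s \<omega>) {0..s} (k j)"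
              by (elim alternates_mono) auto
          qed (use t[of j] cont in auto)
          from alternates_shorten[OF t \<eta> this] elim(1) obtain s where
            s: "0 \<le> s" "s < t j" "alternates (\<eta> j) (\<lambda>s. B s \<omega>) {0..s} (k j)" by blast
          define s' where "s' = max s (t j / 2)"
          have s': "0 < s'" "s' < t j" "s \<le> s'" using s t[of j] by (auto simp: s'_def)
          show "\<forall>\<^sub>F n in sequentially. alternates (\<eta> j) (\<lambda>s. B s \<omega>) {0..t j / c n} (k j)"
            using ev_small[OF s'(1,2)]
          proof eventually_elim
            case (elim n)
            then have "s' \<le> t j / c n" using c[of n] by (simp add: field_simps)
            then show ?case using s(3) s'(3) by (elim alternates_mono) auto
          qed
        qed simp
        then show ?thesis
          by (rule eventually_mono) (use elim(2) in \<open>simp add: A'_def brownian_alternates_def\<close>)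
      qed
    qed
  qed (use A_meas in auto)
  then have "\<forall>\<^sub>F n in sequentially. N.prob (A n - A' n) < \<epsilon>" using order_tendstoD(2) \<epsilon> by blast
  then obtain n where n: "N.prob (A n - A' n) < \<epsilon>" using eventually_happens'[OF sequentially_bot] by blast
  have "N.prob (A n) \<le> N.prob (A' n \<union> (A n - A' n))" using A_meas by (intro N.finite_measure_mono) auto
  also have "\<dots> \<le> N.prob (A' n) + N.prob (A n - A' n)" using A_meas by (intro measure_Un_le) auto
  finally show ?thesis using n c[of n] unfolding A_def A'_def by (intro exI[of _ "c n"]) auto
qed

section \<open>Alternations of the walk against Brownian wells\<close>

definition brownian_wells :: "'b measure \<Rightarrow> (real \<Rightarrow> 'b \<Rightarrow> real) \<Rightarrow> ('j \<Rightarrow> real) \<Rightarrow> ('j \<Rightarrow> real) \<Rightarrow> ('j \<Rightarrow> nat) \<Rightarrow> 'b set" where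
  "brownian_wells N B \<eta> t k = {\<omega> \<in> space N. \<forall>j. k j \<le> max_disjoint_wells (\<lambda>s. B s \<omega>) (t j) (\<eta> j)}"

lemma brownian_wells_vs_alternates:
  fixes \<eta> t :: "'j::finite \<Rightarrow> real"
  assumes bm: "standard_brownian_motion N B" and t: "\<And>j. 0 < t j" and \<eta>: "\<And>j. 0 < \<eta> j" and c: "1 < c"
  shows "brownian_wells N B \<eta> t k \<in> sets N"
    and "brownian_wells N B \<eta> t k \<subseteq> brownian_alternates N B \<eta> t k"
    and "brownian_alternates N B (\<lambda>j. c * \<eta> j) t k \<subseteq> brownian_wells N B \<eta> t k"
proof -
  have cont: "continuous_on {0..T} (\<lambda>s. B s \<omega>)" if "\<omega> \<in> space N" for \<omega> T
    by (rule continuous_on_subset[OF brownian_continuous[OF bm that]]) auto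
  have "{\<omega> \<in> space N. \<forall>j\<in>UNIV. k j \<le> max_disjoint_wells (\<lambda>s. B s \<omega>) (t j) (\<eta> j)} \<in> sets N"
    by (intro sets.sets_Collect_finite_All measurable_max_disjoint_wells_ge less_imp_le[OF t] \<eta>
        brownian_measurable[OF bm] cont) auto
  then show "brownian_wells N B \<eta> t k \<in> sets N" by (simp add: brownian_wells_def)
  show "brownian_wells N B \<eta> t k \<subseteq> brownian_alternates N B \<eta> t k"
    unfolding brownian_wells_def brownian_alternates_def using alternates_of_wells[OF cont \<eta>] by blast
  show "brownian_alternates N B (\<lambda>j. c * \<eta> j) t k \<subseteq> brownian_wells N B \<eta> t k"
    unfolding brownian_wells_def brownian_alternates_def
  proof safe
    fix \<omega> j assume "\<omega> \<in> space N" "\<forall>j. alternates (c * \<eta> j) (\<lambda>s. B s \<omega>) {0..t j} (k j)"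
    moreover have "\<eta> j < c * \<eta> j" using \<eta>[of j] c by simp
    ultimately show "k j \<le> max_disjoint_wells (\<lambda>s. B s \<omega>) (t j) (\<eta> j)"
      using wells_of_alternates[OF cont \<eta>] by blast
  qed
qed

lemma filterlim_divide_const_at_top:
  assumes "0 < (c :: real)"
  shows "filterlim (\<lambda>r. r / c) at_top at_top"
proof -
  have "filterlim (\<lambda>r. (1 / c) * r) at_top at_top"
    by (rule filterlim_tendsto_pos_mult_at_top[OF tendsto_const _ filterlim_ident]) (use assms in simp)
  then show ?thesis by simp
qed

lemma root_gt_1:
  assumes "1 < (c :: real)" "0 < n"
  obtains u where "1 < u" "u ^ n = c"
proof
  show "1 < root n c" using assms by simp
  show "root n c ^ n = c" using assms by (intro real_root_pow_pos2) auto
qed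

context standardized_walk
begin

text \<open>Wells need a level strictly below that of the alternation, and a change of level is not covered
  by the continuity in time. It is absorbed by scaling the walk: for the walk a level \<open>w *
  \<eta>\<close> with times \<open>w\<^sup>2 * s\<close> is the same event as level \<open>\<eta>\<close>
  with times \<open>s\<close>. Passing from Brownian motion to the walk, rescaling it and returning shows
  that the alternation probability at level \<open>\<eta>\<close> and a slightly shortened time is at most
  the one at a larger level and time \<open>t\<close>, up to \<open>\<epsilon>\<close>.\<close>
theorem walk_alternates_le_wells:
  fixes \<eta> t :: "'j::finite \<Rightarrow> real" and B :: "real \<Rightarrow> 'b \<Rightarrow> real"
  assumes bm: "standard_brownian_motion N B" and t: "\<And>j. 0 < t j" and \<eta>: "\<And>j. 0 < \<eta> j" and \<epsilon>: "0 < \<epsilon>"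
  shows "\<exists>c>1. \<forall>\<^sub>F r in at_top. prob (walk_alternates r (\<lambda>j. \<eta> j / c) t k) \<le> measure N (brownian_wells N B \<eta> t k) + \<epsilon>"
proof -
  interpret N: prob_space N by (rule brownian_prob_space[OF bm])
  let ?\<Phi> = "\<lambda>\<eta> t. N.prob (brownian_alternates N B \<eta> t k)"
  have \<epsilon>4: "0 < \<epsilon> / 4" using \<epsilon> by simp
  obtain c0 where c0: "1 < c0" "?\<Phi> \<eta> (\<lambda>j. c0 * t j) \<le> ?\<Phi> \<eta> (\<lambda>j. t j / c0) + \<epsilon> / 4"
    using brownian_alternates_time_continuity[where t = t and \<eta> = \<eta> and k = k, OF bm t \<eta> \<epsilon>4] by blast
  obtain u where u: "1 < u" "u ^ 6 = c0" by (rule root_gt_1[OF c0(1) zero_less_numeral])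
  obtain w where w: "1 < w" "w ^ 22 = c0" by (rule root_gt_1[OF c0(1) zero_less_numeral])
  have 1: "\<forall>\<^sub>F r in at_top. prob (walk_alternates r \<eta> (\<lambda>j. u\<^sup>2 * t j) k) \<le> ?\<Phi> \<eta> (\<lambda>j. c0 * t j) + \<epsilon> / 4"
  proof -
    have "u ^ 4 * u\<^sup>2 = c0" unfolding u(2)[symmetric] by simp
    then have pw: "u ^ 4 * (u\<^sup>2 * x) = c0 * x" for x by (simp only: mult.assoc[symmetric])
    have "\<forall>\<^sub>F r in at_top. prob (walk_alternates r \<eta> (\<lambda>j. u\<^sup>2 * t j) k) \<le> ?\<Phi> \<eta> (\<lambda>j. u ^ 4 * (u\<^sup>2 * t j)) + \<epsilon> / 4"
      using u(1) \<epsilon> t \<eta> by (intro walk_alternates_upper[OF bm]) auto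
    then show ?thesis unfolding pw .
  qed
  have 2: "?\<Phi> \<eta> (\<lambda>j. t j / c0) \<le> N.prob (brownian_wells N B \<eta> t k) + \<epsilon> / 2"
  proof -
    \<comment> \<open>chosen so that the lower comparison starts at \<open>t j / c0\<close> and, as
      \<open>w ^ 22 = c0\<close>, the upper one ends at \<open>t j\<close>\<close>
    define s where "s j = t j * w ^ 16 / c0" for j
    have s: "0 < s j" for j using t[of j] w c0 by (simp add: s_def)
    have "\<forall>\<^sub>F r in at_top. ?\<Phi> \<eta> (\<lambda>j. (1 / w) ^ 16 * s j) \<le> prob (walk_alternates r \<eta> s k) + \<epsilon> / 4"
      using w \<epsilon> by (intro walk_alternates_lower[OF bm s \<eta>]) auto
    moreover have "(\<lambda>j. (1 / w) ^ 16 * s j) = (\<lambda>j. t j / c0)" using w by (simp add: s_def power_divide fun_eq_iff)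
    ultimately have low: "\<forall>\<^sub>F r in at_top. ?\<Phi> \<eta> (\<lambda>j. t j / c0) \<le> prob (walk_alternates r \<eta> s k) + \<epsilon> / 4" by simp
    have "\<forall>\<^sub>F r in at_top. prob (walk_alternates r (\<lambda>j. w * \<eta> j) (\<lambda>j. w\<^sup>2 * s j) k) \<le>
        ?\<Phi> (\<lambda>j. w * \<eta> j) (\<lambda>j. w ^ 4 * (w\<^sup>2 * s j)) + \<epsilon> / 4"
      using w \<epsilon> s \<eta> by (intro walk_alternates_upper[OF bm]) auto
    moreover have "w ^ 4 * (w\<^sup>2 * s j) = t j" for j
    proof -
      have "w ^ 4 * (w\<^sup>2 * w ^ 16) = c0" unfolding w(2)[symmetric] by simp
      moreover have "w ^ 4 * (w\<^sup>2 * s j) = t j * (w ^ 4 * (w\<^sup>2 * w ^ 16)) / c0"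
        by (simp only: s_def times_divide_eq_right mult.assoc mult.commute mult.left_commute)
      ultimately show ?thesis using c0(1) by simp
    qed
    ultimately have "\<forall>\<^sub>F r in at_top. prob (walk_alternates r (\<lambda>j. w * \<eta> j) (\<lambda>j. w\<^sup>2 * s j) k) \<le>
        ?\<Phi> (\<lambda>j. w * \<eta> j) t + \<epsilon> / 4" by simp
    moreover have "filterlim (\<lambda>r. r / w\<^sup>2) at_top at_top"
      using w(1) by (intro filterlim_divide_const_at_top) simp
    ultimately have up: "\<forall>\<^sub>F r in at_top. prob (walk_alternates (r / w\<^sup>2) (\<lambda>j. w * \<eta> j) (\<lambda>j. w\<^sup>2 * s j) k) \<le>
        ?\<Phi> (\<lambda>j. w * \<eta> j) t + \<epsilon> / 4" by (rule eventually_compose_filterlim)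
    obtain r where r: "0 \<le> r" "?\<Phi> \<eta> (\<lambda>j. t j / c0) \<le> prob (walk_alternates r \<eta> s k) + \<epsilon> / 4"
      "prob (walk_alternates (r / w\<^sup>2) (\<lambda>j. w * \<eta> j) (\<lambda>j. w\<^sup>2 * s j) k) \<le> ?\<Phi> (\<lambda>j. w * \<eta> j) t + \<epsilon> / 4"
      using eventually_happens'[OF _ eventually_conj[OF eventually_ge_at_top[of 0] eventually_conj[OF low up]]] by auto
    have "walk_alternates (r / w\<^sup>2) (\<lambda>j. w * \<eta> j) (\<lambda>j. w\<^sup>2 * s j) k = walk_alternates r \<eta> s k"
      using w r(1) by (intro walk_alternates_scale) auto
    then have "?\<Phi> \<eta> (\<lambda>j. t j / c0) \<le> ?\<Phi> (\<lambda>j. w * \<eta> j) t + \<epsilon> / 2" using r by simp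
    also have "?\<Phi> (\<lambda>j. w * \<eta> j) t \<le> N.prob (brownian_wells N B \<eta> t k)"
      by (intro N.finite_measure_mono brownian_wells_vs_alternates[OF bm t \<eta> w(1)])
    finally show ?thesis by simp
  qed
  have "filterlim (\<lambda>r. r / u\<^sup>2) at_top at_top"
    using u(1) by (intro filterlim_divide_const_at_top) simp
  from eventually_conj[OF eventually_ge_at_top[of 0] eventually_compose_filterlim[OF 1 this]]
  have "\<forall>\<^sub>F r in at_top. prob (walk_alternates r (\<lambda>j. \<eta> j / u) t k) \<le> N.prob (brownian_wells N B \<eta> t k) + \<epsilon>"
  proof (rule eventually_mono)
    fix r assume r: "0 \<le> r \<and> prob (walk_alternates (r / u\<^sup>2) \<eta> (\<lambda>j. u\<^sup>2 * t j) k) \<le> ?\<Phi> \<eta> (\<lambda>j. c0 * t j) + \<epsilon> / 4"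
    have "walk_alternates (r / u\<^sup>2) (\<lambda>j. u * (\<eta> j / u)) (\<lambda>j. u\<^sup>2 * t j) k = walk_alternates r (\<lambda>j. \<eta> j / u) t k"
      using u r by (intro walk_alternates_scale) auto
    then show "prob (walk_alternates r (\<lambda>j. \<eta> j / u) t k) \<le> N.prob (brownian_wells N B \<eta> t k) + \<epsilon>"
      using r c0(2) 2 u by simp
  qed
  then show ?thesis using u(1) by blast
qed

text \<open>Wells give alternations with the same level; lengthen the Brownian time at small cost, pass to
  the walk, and trade the spare time for a larger level.\<close>
theorem wells_le_walk_alternates:
  fixes \<eta> t :: "'j::finite \<Rightarrow> real" and B :: "real \<Rightarrow> 'b \<Rightarrow> real"
  assumes bm: "standard_brownian_motion N B" and t: "\<And>j. 0 < t j" and \<eta>: "\<And>j. 0 < \<eta> j" and \<epsilon>: "0 < \<epsilon>"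
  shows "\<exists>c>1. \<forall>\<^sub>F r in at_top. measure N (brownian_wells N B \<eta> t k) \<le> prob (walk_alternates r (\<lambda>j. c * \<eta> j) t k) + \<epsilon>"
proof -
  interpret N: prob_space N by (rule brownian_prob_space[OF bm])
  let ?\<Phi> = "\<lambda>\<eta> t. N.prob (brownian_alternates N B \<eta> t k)"
  have \<epsilon>2: "0 < \<epsilon> / 2" using \<epsilon> by simp
  obtain c0 where c0: "1 < c0" "?\<Phi> \<eta> (\<lambda>j. c0 * t j) \<le> ?\<Phi> \<eta> (\<lambda>j. t j / c0) + \<epsilon> / 2"
    using brownian_alternates_time_continuity[where t = t and \<eta> = \<eta> and k = k, OF bm t \<eta> \<epsilon>2] by blast
  obtain w where w: "1 < w" "w ^ 18 = c0" by (rule root_gt_1[OF c0(1) zero_less_numeral])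
  define s where "s j = t j / w\<^sup>2" for j
  have s: "0 < s j" for j using t[of j] w by (simp add: s_def)
  have "\<forall>\<^sub>F r in at_top. ?\<Phi> \<eta> (\<lambda>j. (1 / w) ^ 16 * s j) \<le> prob (walk_alternates r \<eta> s k) + \<epsilon> / 2"
    using w \<epsilon> by (intro walk_alternates_lower[OF bm s \<eta>]) auto
  moreover have "(\<lambda>j. (1 / w) ^ 16 * s j) = (\<lambda>j. t j / c0)"
    using w by (simp add: s_def power_divide fun_eq_iff)
  ultimately have low: "\<forall>\<^sub>F r in at_top. ?\<Phi> \<eta> (\<lambda>j. t j / c0) \<le> prob (walk_alternates r \<eta> s k) + \<epsilon> / 2" by simp
  have "N.prob (brownian_wells N B \<eta> t k) \<le> ?\<Phi> \<eta> t"
    by (intro N.finite_measure_mono brownian_wells_vs_alternates[OF bm t \<eta> w(1)]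
        sets_brownian_alternates[OF bm] less_imp_le[OF t])
  also have "\<dots> \<le> ?\<Phi> \<eta> (\<lambda>j. c0 * t j)"
    using c0 t by (intro N.finite_measure_mono brownian_alternates_mono sets_brownian_alternates[OF bm])
      (auto simp: less_imp_le)
  also note c0(2)
  finally have le: "N.prob (brownian_wells N B \<eta> t k) \<le> ?\<Phi> \<eta> (\<lambda>j. t j / c0) + \<epsilon> / 2" .
  have "filterlim (\<lambda>r. w\<^sup>2 * r) at_top at_top"
    by (rule filterlim_tendsto_pos_mult_at_top[OF tendsto_const _ filterlim_ident]) (use w(1) in simp)
  from eventually_conj[OF eventually_ge_at_top[of 0] eventually_compose_filterlim[OF low this]]
  have "\<forall>\<^sub>F r in at_top. N.prob (brownian_wells N B \<eta> t k) \<le> prob (walk_alternates r (\<lambda>j. w * \<eta> j) t k) + \<epsilon>"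
  proof (rule eventually_mono)
    fix r assume r: "0 \<le> r \<and> ?\<Phi> \<eta> (\<lambda>j. t j / c0) \<le> prob (walk_alternates (w\<^sup>2 * r) \<eta> s k) + \<epsilon> / 2"
    have "walk_alternates (w\<^sup>2 * r / w\<^sup>2) (\<lambda>j. w * \<eta> j) (\<lambda>j. w\<^sup>2 * s j) k = walk_alternates (w\<^sup>2 * r) \<eta> s k"
      using w r by (intro walk_alternates_scale) auto
    then have "walk_alternates (w\<^sup>2 * r) \<eta> s k = walk_alternates r (\<lambda>j. w * \<eta> j) t k"
      using w by (simp add: s_def)
    then show "N.prob (brownian_wells N B \<eta> t k) \<le> prob (walk_alternates r (\<lambda>j. w * \<eta> j) t k) + \<epsilon>"
      using r le by simp
  qed
  then show ?thesis using w(1) by blast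
qed

end

section \<open>Convergence in distribution of vectors of natural numbers\<close>

text \<open>A bounded observable is determined by finitely many values of the variable up to the probability
  of all the others.\<close>
lemma (in prob_space) expectation_finite_values_approx:
  assumes X: "finite X" and V: "\<And>x. x \<in> X \<Longrightarrow> {\<omega> \<in> space M. V \<omega> = x} \<in> events"
    and g: "(\<lambda>\<omega>. g (V \<omega>)) \<in> borel_measurable M" and C: "\<And>x. \<bar>g x\<bar> \<le> (C :: real)"
  shows "\<bar>expectation (\<lambda>\<omega>. g (V \<omega>)) - (\<Sum>x\<in>X. g x * prob {\<omega> \<in> space M. V \<omega> = x})\<bar> \<le>
    C * (1 - (\<Sum>x\<in>X. prob {\<omega> \<in> space M. V \<omega> = x}))"
proof -
  let ?E = "\<lambda>x. {\<omega> \<in> space M. V \<omega> = x}"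
  let ?I = "\<lambda>\<omega>. \<Sum>x\<in>X. indicator (?E x) \<omega> :: real"
  have int_I: "integrable M (indicator (?E x) :: _ \<Rightarrow> real)" if "x \<in> X" for x
    using V[OF that] by (simp add: integrable_indicator_iff emeasure_eq_measure)
  have int_g: "integrable M (\<lambda>\<omega>. g (V \<omega>))"
    by (rule integrable_const_bound[of _ C]) (use g C in auto)
  have split: "(\<Sum>x\<in>X. g x * indicator (?E x) \<omega>) = (if V \<omega> \<in> X then g (V \<omega>) else 0)"
    "?I \<omega> = (if V \<omega> \<in> X then 1 else 0)" if "\<omega> \<in> space M" for \<omega>
  proof -
    have "(\<Sum>x\<in>X. h x * indicator (?E x) \<omega>) = (\<Sum>x\<in>X. if V \<omega> = x then h x else 0)" for h :: "_ \<Rightarrow> real"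
      using that by (intro sum.cong) (auto simp: indicator_def)
    then have "(\<Sum>x\<in>X. h x * indicator (?E x) \<omega>) = (if V \<omega> \<in> X then h (V \<omega>) else 0)" for h :: "_ \<Rightarrow> real"
      using X by simp
    from this[of g] this[of "\<lambda>_. 1"] show "(\<Sum>x\<in>X. g x * indicator (?E x) \<omega>) = (if V \<omega> \<in> X then g (V \<omega>) else 0)"
      "?I \<omega> = (if V \<omega> \<in> X then 1 else 0)" by simp_all
  qed
  have int_s: "integrable M (\<lambda>\<omega>. \<Sum>x\<in>X. g x * indicator (?E x) \<omega>)" "integrable M ?I"
    using int_I by (auto intro!: Bochner_Integration.integrable_sum integrable_mult_right)
  have ev: "expectation (\<lambda>\<omega>. \<Sum>x\<in>X. h x * indicator (?E x) \<omega>) = (\<Sum>x\<in>X. h x * prob (?E x))" for h :: "_ \<Rightarrow> real"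
  proof -
    have "expectation (\<lambda>\<omega>. \<Sum>x\<in>X. h x * indicator (?E x) \<omega>) = (\<Sum>x\<in>X. expectation (\<lambda>\<omega>. h x * indicator (?E x) \<omega>))"
      using int_I by (intro Bochner_Integration.integral_sum integrable_mult_right) auto
    also have "\<dots> = (\<Sum>x\<in>X. h x * prob (?E x))"
      using V by (intro sum.cong) auto
    finally show ?thesis .
  qed
  have "\<bar>expectation (\<lambda>\<omega>. g (V \<omega>) - (\<Sum>x\<in>X. g x * indicator (?E x) \<omega>))\<bar> \<le>
      expectation (\<lambda>\<omega>. \<bar>g (V \<omega>) - (\<Sum>x\<in>X. g x * indicator (?E x) \<omega>)\<bar>)"
    by (rule integral_abs_bound)
  also have "\<dots> \<le> expectation (\<lambda>\<omega>. C * (1 - ?I \<omega>))"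
  proof (rule integral_mono)
    fix \<omega> assume "\<omega> \<in> space M"
    from split[OF this] show "\<bar>g (V \<omega>) - (\<Sum>x\<in>X. g x * indicator (?E x) \<omega>)\<bar> \<le> C * (1 - ?I \<omega>)"
      using C by (simp split: if_split)
  qed (use int_g int_s in auto)
  also have "\<dots> = C * (1 - (\<Sum>x\<in>X. prob (?E x)))"
    using int_s(2) ev[of "\<lambda>_. 1"] by (simp add: prob_space)
  finally show ?thesis using int_g int_s(1) ev[of g] by simp
qed

text \<open>Inclusion-exclusion one coordinate at a time: \<open>v i = k i\<close> is the difference of
  \<open>k i \<le> v i\<close> and \<open>k i + 1 \<le> v i\<close>. For \<open>J = UNIV\<close> this yields
  convergence of the point probabilities.\<close>
lemma tendsto_prob_mixed_events:
  fixes V :: "nat \<Rightarrow> 'a \<Rightarrow> 'k::finite \<Rightarrow> nat" and W :: "'b \<Rightarrow> 'k \<Rightarrow> nat"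
  assumes M: "prob_space M" and N: "prob_space N"
    and V: "\<And>n j k. {\<omega> \<in> space M. k \<le> V n \<omega> j} \<in> sets M"
    and W: "\<And>j k. {\<omega> \<in> space N. k \<le> W \<omega> j} \<in> sets N"
    and lim: "\<And>k. ((\<lambda>n. measure M {\<omega> \<in> space M. \<forall>j. k j \<le> V n \<omega> j}) \<longlongrightarrow>
      measure N {\<omega> \<in> space N. \<forall>j. k j \<le> W \<omega> j}) F"
  shows "((\<lambda>n. measure M {\<omega> \<in> space M. \<forall>j. k j \<le> V n \<omega> j \<and> (j \<in> J \<longrightarrow> V n \<omega> j = k j)}) \<longlongrightarrow>
      measure N {\<omega> \<in> space N. \<forall>j. k j \<le> W \<omega> j \<and> (j \<in> J \<longrightarrow> W \<omega> j = k j)}) F"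
proof -
  interpret M: prob_space M by (rule M)
  interpret N: prob_space N by (rule N)
  define E where "E J k n = {\<omega> \<in> space M. \<forall>j. k j \<le> V n \<omega> j \<and> (j \<in> J \<longrightarrow> V n \<omega> j = k j)}" for J k n
  define D where "D J k = {\<omega> \<in> space N. \<forall>j. k j \<le> W \<omega> j \<and> (j \<in> J \<longrightarrow> W \<omega> j = k j)}" for J k
  have less: "{\<omega> \<in> space M. V n \<omega> j = c} \<in> sets M" for n j c
  proof -
    have "{\<omega> \<in> space M. V n \<omega> j = c} = {\<omega> \<in> space M. c \<le> V n \<omega> j} - {\<omega> \<in> space M. Suc c \<le> V n \<omega> j}" by auto
    then show ?thesis using V by auto
  qed
  have less': "{\<omega> \<in> space N. W \<omega> j = c} \<in> sets N" for j c
  proof -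
    have "{\<omega> \<in> space N. W \<omega> j = c} = {\<omega> \<in> space N. c \<le> W \<omega> j} - {\<omega> \<in> space N. Suc c \<le> W \<omega> j}" by auto
    then show ?thesis using W by auto
  qed
  have E_meas: "E J k n \<in> sets M" for J k n
  proof -
    have "{\<omega> \<in> space M. \<forall>j\<in>UNIV. k j \<le> V n \<omega> j \<and> (j \<in> J \<longrightarrow> V n \<omega> j = k j)} \<in> sets M"
      using V less by (intro sets.sets_Collect_finite_All sets.sets_Collect_conj sets.sets_Collect_imp) auto
    then show ?thesis by (simp add: E_def)
  qed
  have D_meas: "D J k \<in> sets N" for J k
  proof -
    have "{\<omega> \<in> space N. \<forall>j\<in>UNIV. k j \<le> W \<omega> j \<and> (j \<in> J \<longrightarrow> W \<omega> j = k j)} \<in> sets N"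
      using W less' by (intro sets.sets_Collect_finite_All sets.sets_Collect_conj sets.sets_Collect_imp) auto
    then show ?thesis by (simp add: D_def)
  qed
  have "((\<lambda>n. M.prob (E J k n)) \<longlongrightarrow> N.prob (D J k)) F"
    using finite[of J]
  proof (induction J arbitrary: k rule: finite_induct)
    case empty
    then show ?case using lim[of k] by (simp add: E_def D_def)
  next
    case (insert i J)
    let ?k = "k(i := Suc (k i))"
    let ?P = "\<lambda>J k v. \<forall>j. k j \<le> v j \<and> (j \<in> J \<longrightarrow> v j = k j)"
    have raise: "?P J ?k v \<longleftrightarrow> ?P J k v \<and> Suc (k i) \<le> v i" for v :: "'k \<Rightarrow> nat"
    proof (intro iffI conjI)
      assume P: "?P J ?k v"
      show "?P J k v"
      proof
        fix j show "k j \<le> v j \<and> (j \<in> J \<longrightarrow> v j = k j)"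
          using spec[OF P, of j] insert.hyps by (cases "j = i") auto
      qed
      show "Suc (k i) \<le> v i" using spec[OF P, of i] by simp
    next
      assume P: "?P J k v \<and> Suc (k i) \<le> v i"
      show "?P J ?k v"
      proof
        fix j show "?k j \<le> v j \<and> (j \<in> J \<longrightarrow> v j = ?k j)"
          using P insert.hyps by (cases "j = i") auto
      qed
    qed
    have step: "?P (insert i J) k v \<longleftrightarrow> ?P J k v \<and> \<not> ?P J ?k v" for v :: "'k \<Rightarrow> nat"
    proof -
      have "?P (insert i J) k v \<longleftrightarrow> ?P J k v \<and> v i = k i" by auto
      moreover have "?P J k v \<Longrightarrow> v i = k i \<longleftrightarrow> \<not> Suc (k i) \<le> v i" by (auto simp: not_le less_Suc_eq_le intro: antisym)
      ultimately show ?thesis unfolding raise by blast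
    qed
    have "E (insert i J) k n = E J k n - E J ?k n" for n
      unfolding E_def step by blast
    moreover have "E J ?k n \<subseteq> E J k n" for n unfolding E_def raise by blast
    ultimately have 1: "M.prob (E (insert i J) k n) = M.prob (E J k n) - M.prob (E J ?k n)" for n
      using M.finite_measure_Diff[OF E_meas E_meas] by simp
    have "D (insert i J) k = D J k - D J ?k" unfolding D_def step by blast
    moreover have "D J ?k \<subseteq> D J k" unfolding D_def raise by blast
    ultimately have 2: "N.prob (D (insert i J) k) = N.prob (D J k) - N.prob (D J ?k)"
      using N.finite_measure_Diff[OF D_meas D_meas] by simp
    show ?case unfolding 1 2 by (rule tendsto_diff[OF insert.IH insert.IH])
  qed
  then show ?thesis by (simp add: E_def D_def)
qed

text \<open>Tightness comes for free: the limit puts nearly all its mass on a finite box, so by convergence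
  of the point probabilities the approximating laws do so as well.\<close>
theorem converges_in_distribution_nat_vector:
  fixes V :: "nat \<Rightarrow> 'a \<Rightarrow> 'k::finite \<Rightarrow> nat" and W :: "'b \<Rightarrow> 'k \<Rightarrow> nat"
  assumes M: "prob_space M" and N: "prob_space N"
    and V: "\<And>n j k. {\<omega> \<in> space M. k \<le> V n \<omega> j} \<in> sets M"
    and W: "\<And>j k. {\<omega> \<in> space N. k \<le> W \<omega> j} \<in> sets N"
    and lim: "\<And>k. ((\<lambda>n. measure M {\<omega> \<in> space M. \<forall>j. k j \<le> V n \<omega> j}) \<longlongrightarrow>
      measure N {\<omega> \<in> space N. \<forall>j. k j \<le> W \<omega> j}) F"
  shows "converges_in_distribution M (\<lambda>n \<omega>. (\<chi> j. real (V n \<omega> j)) :: real ^ 'k) N (\<lambda>\<omega>. \<chi> j. real (W \<omega> j)) F"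
proof -
  interpret M: prob_space M by (rule M)
  interpret N: prob_space N by (rule N)
  have V_meas: "(\<lambda>\<omega>. (\<chi> j. real (V n \<omega> j)) :: real ^ 'k) \<in> borel_measurable M" for n
    using borel_measurable_real_of_nat_ge[OF V]
    by (subst borel_measurable_euclidean_space) (auto simp: Basis_vec_def inner_axis)
  have W_meas: "(\<lambda>\<omega>. (\<chi> j. real (W \<omega> j)) :: real ^ 'k) \<in> borel_measurable N"
    using borel_measurable_real_of_nat_ge[OF W]
    by (subst borel_measurable_euclidean_space) (auto simp: Basis_vec_def inner_axis)
  let ?E = "\<lambda>k n. {\<omega> \<in> space M. V n \<omega> = k}" and ?D = "\<lambda>k. {\<omega> \<in> space N. W \<omega> = k}"
  have eq: "(\<forall>j. k j \<le> v j \<and> (j \<in> UNIV \<longrightarrow> v j = k j)) \<longleftrightarrow> v = k" for v k :: "'k \<Rightarrow> nat" by auto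
  have atom: "((\<lambda>n. M.prob (?E k n)) \<longlongrightarrow> N.prob (?D k)) F" for k
    using tendsto_prob_mixed_events[OF M N V W lim, of k UNIV] unfolding eq .
  have E_meas: "?E k n \<in> sets M" for k n
  proof -
    have "{\<omega> \<in> space M. V n \<omega> = k} =
        {\<omega> \<in> space M. \<forall>j\<in>UNIV. k j \<le> V n \<omega> j \<and> \<not> Suc (k j) \<le> V n \<omega> j}"
      by (auto simp: fun_eq_iff not_le less_Suc_eq_le intro: antisym)
    also have "\<dots> \<in> sets M"
      using V by (intro sets.sets_Collect_finite_All sets.sets_Collect_conj sets.sets_Collect_neg) auto
    finally show ?thesis .
  qed
  have D_meas: "?D k \<in> sets N" for k
  proof -
    have "{\<omega> \<in> space N. W \<omega> = k} = {\<omega> \<in> space N. \<forall>j\<in>UNIV. k j \<le> W \<omega> j \<and> \<not> Suc (k j) \<le> W \<omega> j}"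
      by (auto simp: fun_eq_iff not_le less_Suc_eq_le intro: antisym)
    also have "\<dots> \<in> sets N"
      using W by (intro sets.sets_Collect_finite_All sets.sets_Collect_conj sets.sets_Collect_neg) auto
    finally show ?thesis .
  qed
  have "((\<lambda>n. M.expectation (\<lambda>\<omega>. f (\<chi> j. real (V n \<omega> j)))) \<longlongrightarrow> N.expectation (\<lambda>\<omega>. f (\<chi> j. real (W \<omega> j)))) F"
    if f: "continuous_on UNIV f" "bounded (range f)" for f :: "real ^ 'k \<Rightarrow> real"
  proof -
    obtain C where C: "\<And>x. \<bar>f x\<bar> \<le> C" using f(2) by (auto simp: bounded_iff)
    have C0: "0 \<le> C" using C[of 0] by linarith
    have [measurable]: "f \<in> borel_measurable borel" by (rule borel_measurable_continuous_onI[OF f(1)])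
    define g where "g k = f (\<chi> j. real (k j))" for k :: "'k \<Rightarrow> nat"
    have g: "\<bar>g k\<bar> \<le> C" for k using C by (simp add: g_def)
    have gV: "(\<lambda>\<omega>. g (V n \<omega>)) \<in> borel_measurable M" for n
      unfolding g_def by (rule measurable_compose[OF V_meas]) measurable
    have gW: "(\<lambda>\<omega>. g (W \<omega>)) \<in> borel_measurable N"
      unfolding g_def by (rule measurable_compose[OF W_meas]) measurable
    have "((\<lambda>n. M.expectation (\<lambda>\<omega>. g (V n \<omega>))) \<longlongrightarrow> N.expectation (\<lambda>\<omega>. g (W \<omega>))) F"
    proof (rule tendstoI)
      fix e :: real assume e: "0 < e"
      define box where "box K = {k :: 'k \<Rightarrow> nat. \<forall>j. k j < K}" for K
      have fin: "finite (box K)" for K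
      proof -
        have "box K = PiE UNIV (\<lambda>_. {..<K})" by (auto simp: box_def)
        then show ?thesis by (simp add: finite_PiE)
      qed
      define out where "out K = {\<omega> \<in> space N. \<exists>j\<in>UNIV. K \<le> W \<omega> j}" for K
      have out_meas: "out K \<in> sets N" for K
        unfolding out_def using W by (intro sets.sets_Collect_finite_Ex) auto
      have "(\<lambda>K. N.prob (out K)) \<longlonglongrightarrow> 0"
      proof (rule N.prob_tendsto_0)
        show "AE \<omega> in N. \<forall>\<^sub>F K in sequentially. \<omega> \<notin> out K"
        proof (rule AE_I2)
          fix \<omega>
          have "W \<omega> j < K" if "Suc (Max (range (W \<omega>))) \<le> K" for j K
          proof -
            have "W \<omega> j \<le> Max (range (W \<omega>))" by (rule Max_ge) auto
            then show ?thesis using that by linarith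
          qed
          then show "\<forall>\<^sub>F K in sequentially. \<omega> \<notin> out K"
            by (intro eventually_mono[OF eventually_ge_at_top[of "Suc (Max (range (W \<omega>)))"]]) (auto simp: out_def not_le)
        qed
      qed (rule out_meas)
      then have "\<forall>\<^sub>F K in sequentially. N.prob (out K) < e / (3 * (C + 1))"
        using C0 e by (intro order_tendstoD) auto
      then obtain K where K: "N.prob (out K) < e / (3 * (C + 1))"
        using eventually_happens'[OF sequentially_bot] by blast
      have "space N = (\<Union>k\<in>box K. ?D k) \<union> out K" by (force simp: box_def out_def not_less)
      then have "1 \<le> N.prob (\<Union>k\<in>box K. ?D k) + N.prob (out K)"
        using measure_Un_le[of "\<Union>k\<in>box K. ?D k" N "out K"] D_meas out_meas fin N.prob_space by auto
      also have "N.prob (\<Union>k\<in>box K. ?D k) \<le> (\<Sum>k\<in>box K. N.prob (?D k))"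
        using D_meas fin by (intro N.finite_measure_subadditive_finite) auto
      finally have out_ge: "1 - (\<Sum>k\<in>box K. N.prob (?D k)) \<le> N.prob (out K)" by simp
      have tail: "C * (1 - (\<Sum>k\<in>box K. N.prob (?D k))) < e / 3"
      proof -
        have "C * (1 - (\<Sum>k\<in>box K. N.prob (?D k))) \<le> C * (e / (3 * (C + 1)))"
          using out_ge K C0 by (intro mult_left_mono) auto
        also have "\<dots> < (C + 1) * (e / (3 * (C + 1)))" using e C0 by (intro mult_strict_right_mono) auto
        also have "\<dots> = e / 3"
        proof -
          have cancel: "c * (e / (3 * c)) = e / 3" if "c \<noteq> 0" for c using that by simp
          show ?thesis by (rule cancel) (use C0 in simp)
        qed
        finally show ?thesis .
      qed
      have "((\<lambda>n. C * (1 - (\<Sum>k\<in>box K. M.prob (?E k n)))) \<longlongrightarrow> C * (1 - (\<Sum>k\<in>box K. N.prob (?D k)))) F"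
        by (intro tendsto_mult tendsto_diff tendsto_const tendsto_sum atom)
      from order_tendstoD(2)[OF this tail] have ev1: "\<forall>\<^sub>F n in F. C * (1 - (\<Sum>k\<in>box K. M.prob (?E k n))) < e / 3" .
      have "((\<lambda>n. \<Sum>k\<in>box K. g k * M.prob (?E k n)) \<longlongrightarrow> (\<Sum>k\<in>box K. g k * N.prob (?D k))) F"
        by (intro tendsto_mult tendsto_const tendsto_sum atom)
      from tendstoD[OF this, of "e / 3"] e
      have ev2: "\<forall>\<^sub>F n in F. \<bar>(\<Sum>k\<in>box K. g k * M.prob (?E k n)) - (\<Sum>k\<in>box K. g k * N.prob (?D k))\<bar> < e / 3"
        by (simp add: dist_real_def)
      have approxN: "\<bar>N.expectation (\<lambda>\<omega>. g (W \<omega>)) - (\<Sum>k\<in>box K. g k * N.prob (?D k))\<bar> \<le>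
          C * (1 - (\<Sum>k\<in>box K. N.prob (?D k)))"
        by (rule N.expectation_finite_values_approx[where g = g and V = W]) (rule fin D_meas gW g)+
      show "\<forall>\<^sub>F n in F. dist (M.expectation (\<lambda>\<omega>. g (V n \<omega>))) (N.expectation (\<lambda>\<omega>. g (W \<omega>))) < e"
        using ev1 ev2
      proof eventually_elim
        case (elim n)
        have "\<bar>M.expectation (\<lambda>\<omega>. g (V n \<omega>)) - (\<Sum>k\<in>box K. g k * M.prob (?E k n))\<bar> \<le>
            C * (1 - (\<Sum>k\<in>box K. M.prob (?E k n)))"
          by (rule M.expectation_finite_values_approx[where g = g and V = "V n"]) (rule fin E_meas gV g)+
        then show ?case using elim approxN tail unfolding dist_real_def by linarith
      qed
    qed
    then show ?thesis by (simp add: g_def)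
  qed
  then show ?thesis unfolding converges_in_distribution_def using V_meas W_meas by blast
qed

section \<open>The walk of logarithms of the off-diagonal entries\<close>

lemma max_disjoint_wells_scale:
  assumes "0 < \<sigma>"
  shows "max_disjoint_wells (\<lambda>s. \<sigma> * X s) t \<eta> = max_disjoint_wells X t (\<eta> / \<sigma>)"
proof -
  have "\<eta> \<le> \<sigma> * X x - \<sigma> * X y \<longleftrightarrow> \<eta> / \<sigma> \<le> X x - X y" for x y
    using assms by (subst pos_divide_le_eq) (auto simp: algebra_simps)
  then have "is_well \<eta> t (\<lambda>s. \<sigma> * X s) a b \<longleftrightarrow> is_well (\<eta> / \<sigma>) t X a b" for a b
    using assms by (simp add: is_well_def)
  then show ?thesis by (simp add: max_disjoint_wells_def wells_def)
qed

lemma max_disjoint_wells_const: "max_disjoint_wells (\<lambda>s. c) t \<eta> = 0" if "0 < \<eta>"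
proof -
  have "wells \<eta> t (\<lambda>s. c) = {}" using that by (auto simp: wells_def is_well_def)
  then have "{W. W \<subseteq> wells \<eta> t (\<lambda>s. c) \<and> finite W \<and> disjoint W} = {{}}" by auto
  then show ?thesis by (simp add: max_disjoint_wells_def)
qed

text \<open>A union bound over about \<open>C * n\<close> terms, each of which is \<open>o(1 / n)\<close>
  since the second moment is finite.\<close>
lemma (in prob_space) max_of_identical_negligible:
  fixes Y :: "nat \<Rightarrow> 'a \<Rightarrow> real"
  assumes Y [measurable]: "\<And>i. Y i \<in> borel_measurable M" and law: "\<And>i. distr M borel (Y i) = distr M borel (Y 0)"
    and sq: "integrable M (\<lambda>\<omega>. (Y 0 \<omega>)\<^sup>2)" and C: "0 \<le> C" and \<epsilon>: "0 < \<epsilon>"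
  shows "(\<lambda>n. prob {\<omega> \<in> space M. \<exists>i\<in>{..<nat \<lfloor>C * real n\<rfloor>}. \<epsilon> * sqrt (real n) < \<bar>Y i \<omega>\<bar>}) \<longlonglongrightarrow> 0"
proof -
  define H where "H n \<omega> = (if \<epsilon> * sqrt (real n) < \<bar>Y 0 \<omega>\<bar> then (Y 0 \<omega>)\<^sup>2 else 0)" for n \<omega>
  have [measurable]: "H n \<in> borel_measurable M" for n unfolding H_def[abs_def] by measurable
  have "(\<lambda>n. expectation (H n)) \<longlonglongrightarrow> expectation (\<lambda>_. 0)"
  proof (rule integral_dominated_convergence[OF _ _ sq])
    show "AE \<omega> in M. (\<lambda>n. H n \<omega>) \<longlonglongrightarrow> 0"
    proof (rule AE_I2)
      fix \<omega>
      have "filterlim (\<lambda>n. \<epsilon> * sqrt (real n)) at_top sequentially"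
        using \<epsilon> by (intro filterlim_tendsto_pos_mult_at_top[OF tendsto_const _
              filterlim_compose[OF sqrt_at_top filterlim_real_sequentially]])
      then have "\<forall>\<^sub>F n in sequentially. \<bar>Y 0 \<omega>\<bar> \<le> \<epsilon> * sqrt (real n)"
        unfolding filterlim_at_top by blast
      then have "\<forall>\<^sub>F n in sequentially. H n \<omega> = 0" by eventually_elim (simp add: H_def)
      then show "(\<lambda>n. H n \<omega>) \<longlonglongrightarrow> 0" by (rule tendsto_eventually)
    qed
    show "AE \<omega> in M. norm (H n \<omega>) \<le> (Y 0 \<omega>)\<^sup>2" for n by (rule AE_I2) (simp add: H_def)
  qed auto
  then have lim: "(\<lambda>n. C / \<epsilon>\<^sup>2 * expectation (H n)) \<longlonglongrightarrow> 0"
    by (intro tendsto_mult_right_zero) simp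
  have bound: "prob {\<omega> \<in> space M. \<exists>i\<in>{..<nat \<lfloor>C * real n\<rfloor>}. \<epsilon> * sqrt (real n) < \<bar>Y i \<omega>\<bar>} \<le> C / \<epsilon>\<^sup>2 * expectation (H n)" for n
  proof -
    define p where "p = prob {\<omega> \<in> space M. \<epsilon> * sqrt (real n) < \<bar>Y 0 \<omega>\<bar>}"
    have same: "prob {\<omega> \<in> space M. \<epsilon> * sqrt (real n) < \<bar>Y i \<omega>\<bar>} = p" for i
    proof -
      have "measure (distr M borel (Y i)) {y. \<epsilon> * sqrt (real n) < \<bar>y\<bar>} = prob {\<omega> \<in> space M. \<epsilon> * sqrt (real n) < \<bar>Y i \<omega>\<bar>}" for i
        by (subst measure_distr) (auto intro!: arg_cong[where f = prob])
      from this[of i] this[of 0] show ?thesis by (simp add: p_def law[of i])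
    qed
    have "{\<omega> \<in> space M. \<exists>i\<in>{..<nat \<lfloor>C * real n\<rfloor>}. \<epsilon> * sqrt (real n) < \<bar>Y i \<omega>\<bar>} =
        (\<Union>i\<in>{..<nat \<lfloor>C * real n\<rfloor>}. {\<omega> \<in> space M. \<epsilon> * sqrt (real n) < \<bar>Y i \<omega>\<bar>})" by auto
    also have "prob \<dots> \<le> (\<Sum>i\<in>{..<nat \<lfloor>C * real n\<rfloor>}. prob {\<omega> \<in> space M. \<epsilon> * sqrt (real n) < \<bar>Y i \<omega>\<bar>})"
      by (rule finite_measure_subadditive_finite) auto
    also have "\<dots> = real (nat \<lfloor>C * real n\<rfloor>) * p" by (simp add: same)
    also have "\<dots> \<le> C * real n * p"
      using C by (intro mult_right_mono) (auto simp: p_def)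
    also have "\<dots> = C * (real n * p)" by simp
    also have "\<dots> \<le> C * (expectation (H n) / \<epsilon>\<^sup>2)"
    proof (rule mult_left_mono[OF _ C])
      have "\<epsilon>\<^sup>2 * real n * p = expectation (\<lambda>\<omega>. \<epsilon>\<^sup>2 * real n * indicator {\<omega> \<in> space M. \<epsilon> * sqrt (real n) < \<bar>Y 0 \<omega>\<bar>} \<omega>)"
        by (simp add: p_def)
      also have "\<dots> \<le> expectation (H n)"
      proof (rule integral_mono)
        show "integrable M (H n)"
          by (rule Bochner_Integration.integrable_bound[OF sq]) (auto simp: H_def)
        fix \<omega> assume \<omega>: "\<omega> \<in> space M"
        show "\<epsilon>\<^sup>2 * real n * indicator {\<omega> \<in> space M. \<epsilon> * sqrt (real n) < \<bar>Y 0 \<omega>\<bar>} \<omega> \<le> H n \<omega>"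
        proof (cases "\<epsilon> * sqrt (real n) < \<bar>Y 0 \<omega>\<bar>")
          case True
          then have "(\<epsilon> * sqrt (real n))\<^sup>2 \<le> \<bar>Y 0 \<omega>\<bar>\<^sup>2" using \<epsilon> by (intro power_mono) auto
          then show ?thesis using True \<omega> by (simp add: H_def power_mult_distrib)
        qed (simp add: H_def)
      qed (auto simp: integrable_indicator_iff emeasure_eq_measure intro!: integrable_mult_right)
      finally show "real n * p \<le> expectation (H n) / \<epsilon>\<^sup>2"
        using \<epsilon> by (simp add: pos_le_divide_eq mult.commute mult.left_commute)
    qed
    finally show ?thesis by (simp add: mult.assoc)
  qed
  show ?thesis
    by (rule tendsto_sandwich[OF _ _ tendsto_const lim]) (use bound in auto)
qed

locale iid_off_diagonal = prob_space +
  fixes a :: "nat \<Rightarrow> 'a \<Rightarrow> real"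
  assumes indep_a: "indep_vars (\<lambda>_. borel) a {1..}"
    and identical: "\<And>i. 1 \<le> i \<Longrightarrow> distr M borel (a i) = distr M borel (a 1)"
    and nonzero: "\<And>i. 1 \<le> i \<Longrightarrow> AE \<omega> in M. a i \<omega> \<noteq> 0"
    and ln_square_integrable: "integrable M (\<lambda>\<omega>. (ln \<bar>a 1 \<omega>\<bar>)\<^sup>2)"
begin

lemma rv_a: "1 \<le> i \<Longrightarrow> a i \<in> borel_measurable M"
  using indep_a by (auto simp: indep_vars_def)

lemma rv_odd [measurable]: "a (Suc (2 * i)) \<in> borel_measurable M"
  by (rule rv_a) simp

lemma rv_even [measurable]: "a (Suc (Suc (2 * i))) \<in> borel_measurable M"
  by (rule rv_a) simp

lemma AE_all_nonzero: "AE \<omega> in M. \<forall>i\<ge>1. a i \<omega> \<noteq> 0"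
  unfolding AE_all_countable using nonzero by (auto simp: AE_all_countable)

lemma expectation_a:
  fixes f :: "real \<Rightarrow> real"
  assumes [measurable]: "f \<in> borel_measurable borel" and i: "1 \<le> i"
  shows "integrable M (\<lambda>\<omega>. f (a i \<omega>)) \<longleftrightarrow> integrable M (\<lambda>\<omega>. f (a 1 \<omega>))"
    and "expectation (\<lambda>\<omega>. f (a i \<omega>)) = expectation (\<lambda>\<omega>. f (a 1 \<omega>))"
  using integrable_distr_eq[OF rv_a[OF i], of f] integrable_distr_eq[OF rv_a[of 1], of f]
    integral_distr[OF rv_a[OF i], of f] integral_distr[OF rv_a[of 1], of f] identical[OF i] by simp_all

abbreviation "m \<equiv> expectation (\<lambda>\<omega>. ln \<bar>a 1 \<omega>\<bar>)"

lemma ln_integrable: "integrable M (\<lambda>\<omega>. ln \<bar>a 1 \<omega>\<bar>)"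
proof (rule square_integrable_imp_integrable[OF _ ln_square_integrable])
  have [measurable]: "a 1 \<in> borel_measurable M" by (rule rv_a) simp
  show "(\<lambda>\<omega>. ln \<bar>a 1 \<omega>\<bar>) \<in> borel_measurable M" by measurable
qed

lemma centred_ln:
  assumes i: "1 \<le> i"
  shows "integrable M (\<lambda>\<omega>. ln \<bar>a i \<omega>\<bar> - m)" "integrable M (\<lambda>\<omega>. (ln \<bar>a i \<omega>\<bar> - m)\<^sup>2)"
    "expectation (\<lambda>\<omega>. ln \<bar>a i \<omega>\<bar> - m) = 0"
    "expectation (\<lambda>\<omega>. (ln \<bar>a i \<omega>\<bar> - m)\<^sup>2) = variance (\<lambda>\<omega>. ln \<bar>a 1 \<omega>\<bar>)"
proof -
  have "integrable M (\<lambda>\<omega>. (ln \<bar>a 1 \<omega>\<bar>)\<^sup>2 - 2 * m * ln \<bar>a 1 \<omega>\<bar> + m\<^sup>2)"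
    using ln_square_integrable ln_integrable by simp
  then have sq: "integrable M (\<lambda>\<omega>. (ln \<bar>a 1 \<omega>\<bar> - m)\<^sup>2)"
    by (simp add: power2_diff algebra_simps)
  show "integrable M (\<lambda>\<omega>. ln \<bar>a i \<omega>\<bar> - m)"
    using expectation_a(1)[of "\<lambda>x. ln \<bar>x\<bar> - m" i] i ln_integrable by simp
  show "integrable M (\<lambda>\<omega>. (ln \<bar>a i \<omega>\<bar> - m)\<^sup>2)"
    using expectation_a(1)[of "\<lambda>x. (ln \<bar>x\<bar> - m)\<^sup>2" i] i sq by simp
  show "expectation (\<lambda>\<omega>. ln \<bar>a i \<omega>\<bar> - m) = 0"
    using expectation_a(2)[of "\<lambda>x. ln \<bar>x\<bar> - m" i] i ln_integrable by (simp add: prob_space)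
  show "expectation (\<lambda>\<omega>. (ln \<bar>a i \<omega>\<bar> - m)\<^sup>2) = variance (\<lambda>\<omega>. ln \<bar>a 1 \<omega>\<bar>)"
    using expectation_a(2)[of "\<lambda>x. (ln \<bar>x\<bar> - m)\<^sup>2" i] i by simp
qed

text \<open>Twice the variance of \<open>ln |a 1|\<close> is the variance of one difference, hence the
  factor \<open>sqrt 2 * \<sigma>\<close>.\<close>
definition step :: "real \<Rightarrow> nat \<Rightarrow> 'a \<Rightarrow> real" where
  "step \<sigma> j \<omega> = (ln \<bar>a (2 * j + 1) \<omega>\<bar> - ln \<bar>a (2 * j + 2) \<omega>\<bar>) / (sqrt 2 * \<sigma>)"

lemma indep_pair: "indep_var borel (a (2 * j + 1)) borel (a (2 * j + 2))"
proof -
  have "indep_var (PiM {2 * j + 1} (\<lambda>_. borel)) (\<lambda>\<omega>. restrict (\<lambda>i. a i \<omega>) {2 * j + 1})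
      (PiM {2 * j + 2} (\<lambda>_. borel)) (\<lambda>\<omega>. restrict (\<lambda>i. a i \<omega>) {2 * j + 2})"
    by (rule indep_var_restrict[OF indep_a]) auto
  from indep_var_compose[OF this, of "\<lambda>x. x (2 * j + 1)" borel "\<lambda>x. x (2 * j + 2)" borel]
  show ?thesis by (simp add: comp_def)
qed

lemma indep_step: "indep_vars (\<lambda>_. borel) (step \<sigma>) UNIV"
proof -
  define K where "K j = {2 * j + 1, 2 * j + 2}" for j :: nat
  have "disjoint_family_on K UNIV"
    unfolding disjoint_family_on_def K_def by (intro ballI impI) (auto, (presburger+)?)
  then have "indep_vars (\<lambda>j. PiM (K j) (\<lambda>_. borel)) (\<lambda>j \<omega>. restrict (\<lambda>i. a i \<omega>) (K j)) UNIV"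
    by (rule indep_vars_restrict[OF indep_a, rotated]) (auto simp: K_def)
  then have "indep_vars (\<lambda>_. borel) (\<lambda>j \<omega>. (\<lambda>x. (ln \<bar>x (2 * j + 1)\<bar> - ln \<bar>x (2 * j + 2)\<bar>) / (sqrt 2 * \<sigma>))
      (restrict (\<lambda>i. a i \<omega>) (K j))) UNIV"
  proof (rule indep_vars_compose2)
    fix j :: nat
    have [measurable]: "(\<lambda>x. x i) \<in> borel_measurable (PiM (K j) (\<lambda>_. borel :: real measure))" if "i \<in> K j" for i
      using that by (rule measurable_component_singleton)
    have "2 * j + 1 \<in> K j" "2 * j + 2 \<in> K j" by (simp_all add: K_def)
    then show "(\<lambda>x. (ln \<bar>x (2 * j + 1)\<bar> - ln \<bar>x (2 * j + 2)\<bar>) / (sqrt 2 * \<sigma>)) \<in>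
        borel_measurable (PiM (K j) (\<lambda>_. borel))" by measurable
  qed
  then show ?thesis by (simp add: step_def[abs_def] K_def)
qed

lemma step_law: "distr M borel (step \<sigma> j) = distr M borel (step \<sigma> 0)"
proof -
  define h where "h = (\<lambda>(x, y). (ln \<bar>x\<bar> - ln \<bar>y\<bar>) / (sqrt 2 * \<sigma>) :: real)"
  have h [measurable]: "h \<in> borel_measurable (borel \<Otimes>\<^sub>M borel)" unfolding h_def by measurable
  have "distr M borel (step \<sigma> j) = distr (distr M borel (a 1) \<Otimes>\<^sub>M distr M borel (a 1)) borel h" for j
  proof -
    have "distr M borel (step \<sigma> j) = distr (distr M (borel \<Otimes>\<^sub>M borel) (\<lambda>\<omega>. (a (2 * j + 1) \<omega>, a (2 * j + 2) \<omega>))) borel h"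
      using rv_a[of "2 * j + 1"] rv_a[of "2 * j + 2"]
      by (subst distr_distr) (auto simp: h_def step_def[abs_def] comp_def)
    also have "distr M (borel \<Otimes>\<^sub>M borel) (\<lambda>\<omega>. (a (2 * j + 1) \<omega>, a (2 * j + 2) \<omega>)) =
        distr M borel (a (2 * j + 1)) \<Otimes>\<^sub>M distr M borel (a (2 * j + 2))"
      using indep_pair[of j] unfolding indep_var_distribution_eq by simp
    finally show ?thesis using identical[of "2 * j + 1"] identical[of "2 * j + 2"] by simp
  qed
  then show ?thesis by simp
qed

lemma step_moments:
  assumes \<sigma>: "0 < \<sigma>" "\<sigma>\<^sup>2 = variance (\<lambda>\<omega>. ln \<bar>a 1 \<omega>\<bar>)"
  shows "expectation (step \<sigma> j) = 0" "integrable M (\<lambda>\<omega>. (step \<sigma> j \<omega>)\<^sup>2)"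
    "expectation (\<lambda>\<omega>. (step \<sigma> j \<omega>)\<^sup>2) = 1"
proof -
  define U where "U \<omega> = ln \<bar>a (2 * j + 1) \<omega>\<bar> - m" for \<omega>
  define V where "V \<omega> = ln \<bar>a (2 * j + 2) \<omega>\<bar> - m" for \<omega>
  have step: "step \<sigma> j = (\<lambda>\<omega>. (U \<omega> - V \<omega>) / (sqrt 2 * \<sigma>))" by (simp add: step_def[abs_def] U_def V_def)
  have "indep_var borel ((\<lambda>x. ln \<bar>x\<bar> - m) \<circ> a (2 * j + 1)) borel ((\<lambda>x. ln \<bar>x\<bar> - m) \<circ> a (2 * j + 2))"
    by (rule indep_var_compose[OF indep_pair]) measurable
  then have ind: "indep_var borel U borel V" by (simp add: comp_def U_def[abs_def] V_def[abs_def])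
  have U': "integrable M U" "integrable M (\<lambda>\<omega>. (U \<omega>)\<^sup>2)" "expectation U = 0" "expectation (\<lambda>\<omega>. (U \<omega>)\<^sup>2) = \<sigma>\<^sup>2"
    using centred_ln[of "2 * j + 1"] \<sigma>(2) by (simp_all add: U_def[abs_def])
  have V': "integrable M V" "integrable M (\<lambda>\<omega>. (V \<omega>)\<^sup>2)" "expectation V = 0" "expectation (\<lambda>\<omega>. (V \<omega>)\<^sup>2) = \<sigma>\<^sup>2"
    using centred_ln[of "2 * j + 2"] \<sigma>(2) by (simp_all add: V_def[abs_def])
  have UV: "integrable M (\<lambda>\<omega>. U \<omega> * V \<omega>)" "expectation (\<lambda>\<omega>. U \<omega> * V \<omega>) = 0"
    using indep_var_integrable[OF ind U'(1) V'(1)] indep_var_lebesgue_integral[OF ind U'(1) V'(1)] U'(3) by simp_all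
  show "expectation (step \<sigma> j) = 0" unfolding step using U' V' by simp
  have sq: "(step \<sigma> j \<omega>)\<^sup>2 = ((U \<omega>)\<^sup>2 + (V \<omega>)\<^sup>2 - 2 * (U \<omega> * V \<omega>)) / (2 * \<sigma>\<^sup>2)" for \<omega>
    by (simp add: step power_divide power_mult_distrib power2_diff)
  show "integrable M (\<lambda>\<omega>. (step \<sigma> j \<omega>)\<^sup>2)" unfolding sq using U' V' UV by simp
  show "expectation (\<lambda>\<omega>. (step \<sigma> j \<omega>)\<^sup>2) = 1" unfolding sq using U' V' UV \<sigma>(1) by simp
qed

lemma standardized_walk_step:
  assumes \<sigma>: "0 < \<sigma>" "\<sigma>\<^sup>2 = variance (\<lambda>\<omega>. ln \<bar>a 1 \<omega>\<bar>)"
  shows "standardized_walk M (step \<sigma>) (distr M borel (step \<sigma> 0))"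
  using indep_step step_law step_moments[OF \<sigma>] prob_space_axioms
  by (auto simp: standardized_walk_def standardized_walk_axioms_def)

end

section \<open>Eigenvalue counts at scale square root of n\<close>

lemma ln_le_sqrt_eventually:
  assumes \<delta>: "0 < \<delta>" and t: "0 < t"
  shows "\<forall>\<^sub>F n in sequentially. \<forall>m. 0 < m \<and> real m \<le> t * real n \<longrightarrow> ln (real m) \<le> \<delta> * sqrt (real n)"
proof -
  have fl: "filterlim (\<lambda>n. sqrt (real n)) at_top sequentially"
    by (rule filterlim_compose[OF sqrt_at_top filterlim_real_sequentially])
  have A: "(\<lambda>n. inverse (sqrt (real n))) \<longlonglongrightarrow> 0" by (rule tendsto_inverse_0_at_top[OF fl])
  have B: "(\<lambda>n. ln (sqrt (real n)) / sqrt (real n)) \<longlonglongrightarrow> 0" by (rule filterlim_compose[OF ln_x_over_x_tendsto_0 fl])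
  have "(\<lambda>n. ln t * inverse (sqrt (real n)) + 2 * (ln (sqrt (real n)) / sqrt (real n))) \<longlonglongrightarrow> ln t * 0 + 2 * 0"
    by (rule tendsto_add[OF tendsto_mult[OF tendsto_const A] tendsto_mult[OF tendsto_const B]])
  then have "\<forall>\<^sub>F n in sequentially. ln t * inverse (sqrt (real n)) + 2 * (ln (sqrt (real n)) / sqrt (real n)) < \<delta>"
    by (rule order_tendstoD(2)) (use \<delta> in simp)
  then show ?thesis using eventually_gt_at_top[of 0]
  proof eventually_elim
    case (elim n)
    have s: "0 < sqrt (real n)" using elim by simp
    have "ln t + 2 * ln (sqrt (real n)) = (ln t * inverse (sqrt (real n)) + 2 * (ln (sqrt (real n)) / sqrt (real n))) * sqrt (real n)"
      using s elim(2) by (simp add: field_simps)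
    also have "\<dots> \<le> \<delta> * sqrt (real n)" using elim s by (intro mult_right_mono) auto
    finally have le: "ln t + 2 * ln (sqrt (real n)) \<le> \<delta> * sqrt (real n)" .
    have "ln (t * real n) = ln t + 2 * ln (sqrt (real n))" using t elim(2) by (simp add: ln_mult ln_sqrt)
    then have ln_tn: "ln (t * real n) \<le> \<delta> * sqrt (real n)" using le by simp
    show ?case
    proof (intro allI impI)
      fix m assume "0 < m \<and> real m \<le> t * real n"
      then have "ln (real m) \<le> ln (t * real n)" using t elim(2) by (subst ln_le_cancel_iff) auto
      then show "ln (real m) \<le> \<delta> * sqrt (real n)" using ln_tn by linarith
    qed
  qed
qed

text \<open>For odd \<open>m\<close> the matrix has even size \<open>m + 1 = 2 * N\<close>, and the walk is
  used at the times \<open>0, \<dots>, N - 1\<close>, the last of which is \<open>\<lfloor>x /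
  2\<rfloor>\<close>.\<close>
lemma half_of_odd_floor:
  fixes x :: real
  assumes "0 \<le> x" "odd \<lfloor>x\<rfloor>"
  obtains N where "Suc (nat \<lfloor>x\<rfloor>) = 2 * N" "{..<N} = {..nat \<lfloor>x / 2\<rfloor>}" "0 < N" "N \<le> nat \<lfloor>x\<rfloor>"
proof -
  define m where "m = nat \<lfloor>x\<rfloor>"
  have x0: "0 \<le> \<lfloor>x\<rfloor>" using assms(1) by simp
  have m: "int m = \<lfloor>x\<rfloor>" using x0 by (simp add: m_def)
  have odd: "odd m" using assms(2) unfolding m[symmetric] by simp
  have "\<lfloor>x / 2\<rfloor> = \<lfloor>x\<rfloor> div 2" using floor_divide_real_eq_div[of 2 x] by simp
  then have half: "nat \<lfloor>x / 2\<rfloor> = m div 2" unfolding m[symmetric] by (simp add: nat_div_distrib)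
  have "Suc m = 2 * Suc (m div 2)" using odd by presburger
  moreover have "{..<Suc (m div 2)} = {..nat \<lfloor>x / 2\<rfloor>}" unfolding half by (rule lessThan_Suc_atMost)
  moreover have "Suc (m div 2) \<le> m" using odd by presburger
  ultimately show thesis using that[of "Suc (m div 2)"] by (simp add: m_def)
qed

text \<open>The errors \<open>ln N\<close>, \<open>ln 2\<close> and the largest logarithm of an entry are
  each at most \<open>\<delta> * sqrt n\<close>.\<close>
lemma eigenvalue_count_vs_alternates:
  fixes a :: "nat \<Rightarrow> real"
  assumes nz: "\<And>i. 1 \<le> i \<Longrightarrow> a i \<noteq> 0" and t: "0 < t" and odd: "odd \<lfloor>t * real n\<rfloor>" and \<eta>: "0 \<le> \<eta>"
    and d: "\<And>i. i < nat \<lfloor>t * real n\<rfloor> \<Longrightarrow> \<bar>ln \<bar>a (2 * i + 1)\<bar>\<bar> \<le> \<delta> * sqrt (real n)"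
    and ln_t: "\<And>m. 0 < m \<and> real m \<le> t * real n \<Longrightarrow> ln (real m) \<le> \<delta> * sqrt (real n)"
    and ln_2: "ln 2 \<le> \<delta> * sqrt (real n)"
  shows "k \<le> eigenvalue_count a n t \<eta> \<Longrightarrow>
      alternates ((\<eta> - 2 * \<delta>) * sqrt (real n)) (log_walk a) {..nat \<lfloor>t * (real n / 2)\<rfloor>} k"
    and "alternates ((\<eta> + 2 * \<delta>) * sqrt (real n)) (log_walk a) {..nat \<lfloor>t * (real n / 2)\<rfloor>} k \<Longrightarrow>
      k \<le> eigenvalue_count a n t \<eta>"
proof -
  have tn: "0 \<le> t * real n" using t by simp
  obtain N where N: "Suc (nat \<lfloor>t * real n\<rfloor>) = 2 * N" "{..<N} = {..nat \<lfloor>t * real n / 2\<rfloor>}" "0 < N" "N \<le> nat \<lfloor>t * real n\<rfloor>"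
    by (rule half_of_odd_floor[OF tn odd])
  have I: "{..<N} = {..nat \<lfloor>t * (real n / 2)\<rfloor>}" using N(2) by simp
  have "int N \<le> \<lfloor>t * real n\<rfloor>" using N(3,4) by linarith
  then have "real N \<le> t * real n" by (simp add: le_floor_iff)
  then have lnN: "ln (real N) \<le> \<delta> * sqrt (real n)" using ln_t N(3) by blast
  have dN: "\<bar>ln \<bar>a (2 * i + 1)\<bar>\<bar> \<le> \<delta> * sqrt (real n)" if "i < N" for i using d that N(4) by force
  have count: "eigenvalue_count a n t \<eta> =
      num_eigenvalues_in (schroedinger_mat a (nat \<lfloor>t * real n\<rfloor>)) {0<..<exp (- (\<eta> * sqrt (real n)))}"
    by (simp add: eigenvalue_count_def)
  show "alternates ((\<eta> - 2 * \<delta>) * sqrt (real n)) (log_walk a) {..nat \<lfloor>t * (real n / 2)\<rfloor>} k"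
    if "k \<le> eigenvalue_count a n t \<eta>"
  proof -
    have "alternates (\<eta> * sqrt (real n) - ln (real N) - \<delta> * sqrt (real n)) (log_walk a) {..<N} k"
      by (rule alternates_of_num_eigenvalues[where a = a and d = "\<delta> * sqrt (real n)", OF _ N(1) dN that[unfolded count]]) (use nz in auto)
    moreover have "(\<eta> - 2 * \<delta>) * sqrt (real n) \<le> \<eta> * sqrt (real n) - ln (real N) - \<delta> * sqrt (real n)"
      using lnN by (simp add: algebra_simps)
    ultimately show ?thesis unfolding I by (elim alternates_mono) auto
  qed
  show "k \<le> eigenvalue_count a n t \<eta>"
    if "alternates ((\<eta> + 2 * \<delta>) * sqrt (real n)) (log_walk a) {..nat \<lfloor>t * (real n / 2)\<rfloor>} k"
  proof -
    have "\<eta> * sqrt (real n) + ln 2 + \<delta> * sqrt (real n) \<le> (\<eta> + 2 * \<delta>) * sqrt (real n)"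
      using ln_2 by (simp add: algebra_simps)
    then have "alternates (\<eta> * sqrt (real n) + ln 2 + \<delta> * sqrt (real n)) (log_walk a) {..<N} k"
      using that unfolding I by (elim alternates_mono) auto
    then show ?thesis unfolding count
      by (intro num_eigenvalues_ge_of_alternates[where a = a and d = "\<delta> * sqrt (real n)", OF _ N(1) dN]) (use nz \<eta> in auto)
  qed
qed

lemma alternates_constant_path:
  assumes "alternates L X I k" "0 < k" "\<And>i. X i = c"
  shows "L \<le> 0"
proof -
  from assms(1) obtain p where "\<forall>i. Suc i < 2 * k \<longrightarrow> p i \<le> p (Suc i) \<and> L \<le> (-1) ^ i * (X (p i) - X (p (Suc i)))"
    unfolding alternates_def by blast
  from spec[OF this, of 0] show ?thesis using assms(2) by (simp add: assms(3))
qed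

context iid_off_diagonal
begin

definition counts_ge :: "nat \<Rightarrow> ('j \<Rightarrow> real) \<Rightarrow> ('j \<Rightarrow> real) \<Rightarrow> ('j \<Rightarrow> nat) \<Rightarrow> 'a set" where
  "counts_ge n t \<eta> k = {\<omega> \<in> space M. \<forall>j. k j \<le> eigenvalue_count (\<lambda>i. a i \<omega>) n (t j) (\<eta> j)}"

definition log_walk_alternates :: "nat \<Rightarrow> ('j \<Rightarrow> real) \<Rightarrow> ('j \<Rightarrow> real) \<Rightarrow> ('j \<Rightarrow> nat) \<Rightarrow> 'a set" where
  "log_walk_alternates n t \<eta> k = {\<omega> \<in> space M. \<forall>j. alternates (\<eta> j * sqrt (real n)) (log_walk (\<lambda>i. a i \<omega>))
     {..nat \<lfloor>t j * (real n / 2)\<rfloor>} (k j)}"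

text \<open>The exceptional event that some logarithm of an entry is visible at the scale \<open>sqrt
  n\<close>.\<close>
definition large_step :: "real \<Rightarrow> nat \<Rightarrow> ('j \<Rightarrow> real) \<Rightarrow> 'a set" where
  "large_step \<delta> n t = {\<omega> \<in> space M. \<exists>j. \<exists>i\<in>{..<nat \<lfloor>t j * real n\<rfloor>}. \<delta> * sqrt (real n) < \<bar>ln \<bar>a (2 * i + 1) \<omega>\<bar>\<bar>}"

lemma sets_eigenvalue_count_ge: "{\<omega> \<in> space M. k \<le> eigenvalue_count (\<lambda>i. a i \<omega>) n t \<eta>} \<in> events"
  unfolding eigenvalue_count_def by (intro measurable_num_eigenvalues_ge rv_a)

lemma sets_counts_ge:
  fixes t :: "'j::finite \<Rightarrow> real"
  shows "counts_ge n t \<eta> k \<in> events"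
proof -
  have "{\<omega> \<in> space M. \<forall>j\<in>UNIV. k j \<le> eigenvalue_count (\<lambda>i. a i \<omega>) n (t j) (\<eta> j)} \<in> events"
    by (intro sets.sets_Collect_finite_All sets_eigenvalue_count_ge) auto
  then show ?thesis by (simp add: counts_ge_def)
qed

lemma sets_log_walk_alternates:
  fixes t :: "'j::finite \<Rightarrow> real"
  shows "log_walk_alternates n t \<eta> k \<in> events"
proof -
  have meas: "(\<lambda>\<omega>. log_walk (\<lambda>i. a i \<omega>) j) \<in> borel_measurable M" for j
    unfolding log_walk_def by simp
  have "{\<omega> \<in> space M. \<forall>j\<in>UNIV. alternates (\<eta> j * sqrt (real n)) (log_walk (\<lambda>i. a i \<omega>))
     {..nat \<lfloor>t j * (real n / 2)\<rfloor>} (k j)} \<in> events"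
    by (intro sets.sets_Collect_finite_All sets_alternates_finite meas) auto
  then show ?thesis by (simp add: log_walk_alternates_def)
qed

lemma large_step_negligible:
  fixes t :: "'j::finite \<Rightarrow> real"
  assumes \<delta>: "0 < \<delta>" and t: "\<And>j. 0 < t j"
  shows "large_step \<delta> n t \<in> events" "(\<lambda>n. prob (large_step \<delta> n t)) \<longlonglongrightarrow> 0"
proof -
  define Y where "Y i \<omega> = ln \<bar>a (2 * i + 1) \<omega>\<bar>" for i \<omega>
  have [measurable]: "Y i \<in> borel_measurable M" for i unfolding Y_def[abs_def] by simp
  define E where "E n j = {\<omega> \<in> space M. \<exists>i\<in>{..<nat \<lfloor>t j * real n\<rfloor>}. \<delta> * sqrt (real n) < \<bar>Y i \<omega>\<bar>}" for n j
  have E: "E n j \<in> events" for n j unfolding E_def by measurable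
  have eq: "large_step \<delta> n t = (\<Union>j\<in>UNIV. E n j)" for n by (auto simp: large_step_def E_def Y_def)
  show "large_step \<delta> n t \<in> events" unfolding eq using E by (intro sets.finite_UN) auto
  have law: "distr M borel (Y i) = distr (distr M borel (a 1)) borel (\<lambda>x. ln \<bar>x\<bar>)" for i
  proof -
    have "distr M borel (Y i) = distr (distr M borel (a (2 * i + 1))) borel (\<lambda>x. ln \<bar>x\<bar>)"
      by (subst distr_distr) (auto simp: Y_def[abs_def] comp_def)
    also have "distr M borel (a (2 * i + 1)) = distr M borel (a 1)" by (rule identical) simp
    finally show ?thesis .
  qed
  have sq: "integrable M (\<lambda>\<omega>. (Y 0 \<omega>)\<^sup>2)" using ln_square_integrable by (simp add: Y_def)
  have "(\<lambda>n. prob (E n j)) \<longlonglongrightarrow> 0" for j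
    unfolding E_def using law t[of j] \<delta> by (intro max_of_identical_negligible sq) (auto simp: law)
  then have "(\<lambda>n. \<Sum>j\<in>UNIV. prob (E n j)) \<longlonglongrightarrow> (\<Sum>j\<in>(UNIV :: 'j set). 0)" by (rule tendsto_sum)
  then have lim: "(\<lambda>n. \<Sum>j\<in>UNIV. prob (E n j)) \<longlonglongrightarrow> 0" by simp
  have le: "prob (large_step \<delta> n t) \<le> (\<Sum>j\<in>UNIV. prob (E n j))" for n
    unfolding eq using E by (intro finite_measure_subadditive_finite) auto
  show "(\<lambda>n. prob (large_step \<delta> n t)) \<longlonglongrightarrow> 0"
    by (rule tendsto_sandwich[OF _ _ tendsto_const lim]) (use le in auto)
qed

lemma counts_vs_log_walk:
  fixes t \<eta> :: "'j::finite \<Rightarrow> real"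
  assumes \<delta>: "0 < \<delta>" and t: "\<And>j. 0 < t j" and \<eta>: "\<And>j. 0 < \<eta> j"
  shows "\<forall>\<^sub>F n in sequentially. (\<forall>j. odd \<lfloor>t j * real n\<rfloor>) \<longrightarrow>
    prob (counts_ge n t \<eta> k) \<le> prob (log_walk_alternates n t (\<lambda>j. \<eta> j - 2 * \<delta>) k) + prob (large_step \<delta> n t) \<and>
    prob (log_walk_alternates n t (\<lambda>j. \<eta> j + 2 * \<delta>) k) \<le> prob (counts_ge n t \<eta> k) + prob (large_step \<delta> n t)"
proof -
  have "\<forall>\<^sub>F n in sequentially. \<forall>j\<in>UNIV. \<forall>m. 0 < m \<and> real m \<le> t j * real n \<longrightarrow> ln (real m) \<le> \<delta> * sqrt (real n)"
    by (rule eventually_ball_finite) (use ln_le_sqrt_eventually[OF \<delta> t] in auto)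
  moreover have "\<forall>\<^sub>F n in sequentially. \<forall>m. 0 < m \<and> real m \<le> 2 * real n \<longrightarrow> ln (real m) \<le> \<delta> * sqrt (real n)"
    by (rule ln_le_sqrt_eventually[OF \<delta>]) simp
  ultimately show ?thesis using eventually_gt_at_top[of 0]
  proof eventually_elim
    case (elim n)
    have ln2: "ln 2 \<le> \<delta> * sqrt (real n)" using elim(2)[rule_format, of 2] elim(3) by simp
    have small: "\<bar>ln \<bar>a (2 * i + 1) \<omega>\<bar>\<bar> \<le> \<delta> * sqrt (real n)"
      if "\<omega> \<in> space M" "\<omega> \<notin> large_step \<delta> n t" "i < nat \<lfloor>t j * real n\<rfloor>" for \<omega> i j
      using that by (force simp: large_step_def not_less)
    note L = sets_log_walk_alternates sets_counts_ge large_step_negligible(1)[where t = t, OF \<delta> t]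
    show ?case
    proof (intro impI conjI)
      assume odd: "\<forall>j. odd \<lfloor>t j * real n\<rfloor>"
      have "prob (counts_ge n t \<eta> k) \<le> prob (log_walk_alternates n t (\<lambda>j. \<eta> j - 2 * \<delta>) k \<union> large_step \<delta> n t)"
      proof (rule finite_measure_mono_AE)
        show "AE \<omega> in M. \<omega> \<in> counts_ge n t \<eta> k \<longrightarrow>
            \<omega> \<in> log_walk_alternates n t (\<lambda>j. \<eta> j - 2 * \<delta>) k \<union> large_step \<delta> n t"
          using AE_all_nonzero
        proof eventually_elim
          case (elim \<omega>)
          show ?case
          proof (intro impI UnCI)
            assume \<omega>: "\<omega> \<in> counts_ge n t \<eta> k" "\<omega> \<notin> large_step \<delta> n t"
            then have \<omega>s: "\<omega> \<in> space M" by (simp add: counts_ge_def)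
            show "\<omega> \<in> log_walk_alternates n t (\<lambda>j. \<eta> j - 2 * \<delta>) k"
              unfolding log_walk_alternates_def
            proof (intro CollectI conjI allI \<omega>s)
              fix j
              have "k j \<le> eigenvalue_count (\<lambda>i. a i \<omega>) n (t j) (\<eta> j)" using \<omega>(1) by (simp add: counts_ge_def)
              then show "alternates ((\<eta> j - 2 * \<delta>) * sqrt (real n)) (log_walk (\<lambda>i. a i \<omega>)) {..nat \<lfloor>t j * (real n / 2)\<rfloor>} (k j)"
                by (rule eigenvalue_count_vs_alternates(1)[rotated -1])
                  (use elim odd t \<eta>[of j] small[OF \<omega>s \<omega>(2)] ln2 \<open>\<forall>j\<in>UNIV. \<forall>m. 0 < m \<and> real m \<le> t j * real n \<longrightarrow> ln (real m) \<le> \<delta> * sqrt (real n)\<close> in \<open>auto simp: less_imp_le\<close>)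
            qed
          qed
        qed
      qed (intro sets.Un L)
      also have "\<dots> \<le> prob (log_walk_alternates n t (\<lambda>j. \<eta> j - 2 * \<delta>) k) + prob (large_step \<delta> n t)"
        by (intro measure_Un_le L)
      finally show "prob (counts_ge n t \<eta> k) \<le> \<dots>" .
      have "prob (log_walk_alternates n t (\<lambda>j. \<eta> j + 2 * \<delta>) k) \<le> prob (counts_ge n t \<eta> k \<union> large_step \<delta> n t)"
      proof (rule finite_measure_mono_AE)
        show "AE \<omega> in M. \<omega> \<in> log_walk_alternates n t (\<lambda>j. \<eta> j + 2 * \<delta>) k \<longrightarrow>
            \<omega> \<in> counts_ge n t \<eta> k \<union> large_step \<delta> n t"
          using AE_all_nonzero
        proof eventually_elim
          case (elim \<omega>)
          show ?case
          proof (intro impI UnCI)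
            assume \<omega>: "\<omega> \<in> log_walk_alternates n t (\<lambda>j. \<eta> j + 2 * \<delta>) k" "\<omega> \<notin> large_step \<delta> n t"
            then have \<omega>s: "\<omega> \<in> space M" by (simp add: log_walk_alternates_def)
            show "\<omega> \<in> counts_ge n t \<eta> k"
              unfolding counts_ge_def
            proof (intro CollectI conjI allI \<omega>s)
              fix j
              have "alternates ((\<eta> j + 2 * \<delta>) * sqrt (real n)) (log_walk (\<lambda>i. a i \<omega>)) {..nat \<lfloor>t j * (real n / 2)\<rfloor>} (k j)"
                using \<omega>(1) by (simp add: log_walk_alternates_def)
              then show "k j \<le> eigenvalue_count (\<lambda>i. a i \<omega>) n (t j) (\<eta> j)"
                by (rule eigenvalue_count_vs_alternates(2)[rotated -1])
                  (use elim odd t \<eta>[of j] small[OF \<omega>s \<omega>(2)] ln2 \<open>\<forall>j\<in>UNIV. \<forall>m. 0 < m \<and> real m \<le> t j * real n \<longrightarrow> ln (real m) \<le> \<delta> * sqrt (real n)\<close> in \<open>auto simp: less_imp_le\<close>)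
            qed
          qed
        qed
      qed (intro sets.Un L)
      also have "\<dots> \<le> prob (counts_ge n t \<eta> k) + prob (large_step \<delta> n t)"
        by (intro measure_Un_le L)
      finally show "prob (log_walk_alternates n t (\<lambda>j. \<eta> j + 2 * \<delta>) k) \<le> \<dots>" .
    qed
  qed
qed

text \<open>The walk \<open>log_walk\<close> is \<open>sqrt 2 * \<sigma>\<close> times the standardized one,
  and \<open>sqrt n = sqrt 2 * sqrt (n / 2)\<close>, so the factor \<open>sqrt 2\<close> cancels when the
  standardized walk is run with scale \<open>n / 2\<close>.\<close>
lemma log_walk_alternates_step:
  assumes \<sigma>: "0 < \<sigma>" "\<sigma>\<^sup>2 = variance (\<lambda>\<omega>. ln \<bar>a 1 \<omega>\<bar>)"
  shows "log_walk_alternates n t \<eta> k =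
    standardized_walk.walk_alternates M (step \<sigma>) (real n / 2) (\<lambda>j. \<eta> j / \<sigma>) t k"
proof -
  interpret W: standardized_walk M "step \<sigma>" "distr M borel (step \<sigma> 0)" by (rule standardized_walk_step[OF \<sigma>])
  have "log_walk (\<lambda>i. a i \<omega>) = (\<lambda>j. (sqrt 2 * \<sigma>) * W.walk j \<omega>)" for \<omega>
    using \<sigma>(1) by (simp add: fun_eq_iff log_walk_def W.walk_def step_def sum_divide_distrib[symmetric])
  moreover have "\<eta> j * sqrt (real n) / (sqrt 2 * \<sigma>) = \<eta> j / \<sigma> * sqrt (real n / 2)" for j
    by (simp add: real_sqrt_divide)
  moreover have "0 < sqrt 2 * \<sigma>" using \<sigma> by simp
  ultimately show ?thesis
    unfolding log_walk_alternates_def W.walk_alternates_def by (simp only: alternates_scale)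
qed

text \<open>If the variance vanishes, all \<open>|a i|\<close> are almost surely one and the same
  constant.\<close>
lemma log_walk_zero_variance:
  assumes "variance (\<lambda>\<omega>. ln \<bar>a 1 \<omega>\<bar>) = 0"
  shows "AE \<omega> in M. \<forall>j. log_walk (\<lambda>i. a i \<omega>) j = 0"
proof -
  have const: "AE \<omega> in M. ln \<bar>a i \<omega>\<bar> = m" if i: "1 \<le> i" for i
  proof -
    have "AE \<omega> in M. (ln \<bar>a i \<omega>\<bar> - m)\<^sup>2 = 0"
      by (subst integral_nonneg_eq_0_iff_AE[symmetric]) (use centred_ln(2,4)[OF i] assms in auto)
    then show ?thesis by eventually_elim simp
  qed
  have "AE \<omega> in M. \<forall>i\<in>{1..}. ln \<bar>a i \<omega>\<bar> = m"
    by (rule AE_ball_countable') (use const in auto)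
  then show ?thesis
  proof eventually_elim
    case (elim \<omega>)
    have "ln \<bar>a (2 * i + 1) \<omega>\<bar> - ln \<bar>a (2 * i + 2) \<omega>\<bar> = 0" for i
      using bspec[OF elim, of "2 * i + 1"] bspec[OF elim, of "2 * i + 2"] by simp
    then show ?case by (simp add: log_walk_def del: One_nat_def)
  qed
qed

text \<open>With a vanishing walk there is no descent at all, so eigenvalues can only come from the
  negligible errors.\<close>
lemma tendsto_counts_ge_degenerate:
  fixes t \<eta> :: "'j::finite \<Rightarrow> real"
  assumes var: "variance (\<lambda>\<omega>. ln \<bar>a 1 \<omega>\<bar>) = 0" and t: "\<And>j. 0 < t j" and \<eta>: "\<And>j. 0 < \<eta> j"
    and S: "\<And>n j. n \<in> S \<Longrightarrow> odd \<lfloor>t j * real n\<rfloor>" and k: "0 < k j"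
  shows "((\<lambda>n. prob (counts_ge n t \<eta> k)) \<longlongrightarrow> 0) (inf sequentially (principal S))"
proof -
  define \<delta> where "\<delta> = \<eta> j / 4"
  have \<delta>: "0 < \<delta>" "0 < \<eta> j - 2 * \<delta>" using \<eta>[of j] by (simp_all add: \<delta>_def)
  have zero: "prob (log_walk_alternates n t (\<lambda>j. \<eta> j - 2 * \<delta>) k) \<le> 0" if "0 < n" for n
  proof -
    have "prob (log_walk_alternates n t (\<lambda>j. \<eta> j - 2 * \<delta>) k) \<le> prob {}"
    proof (rule finite_measure_mono_AE)
      show "AE \<omega> in M. \<omega> \<in> log_walk_alternates n t (\<lambda>j. \<eta> j - 2 * \<delta>) k \<longrightarrow> \<omega> \<in> {}"
        using log_walk_zero_variance[OF var]
      proof eventually_elim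
        case (elim \<omega>)
        show ?case
        proof
          assume "\<omega> \<in> log_walk_alternates n t (\<lambda>j. \<eta> j - 2 * \<delta>) k"
          then have "alternates ((\<eta> j - 2 * \<delta>) * sqrt (real n)) (log_walk (\<lambda>i. a i \<omega>)) {..nat \<lfloor>t j * (real n / 2)\<rfloor>} (k j)"
            by (simp add: log_walk_alternates_def)
          then have "(\<eta> j - 2 * \<delta>) * sqrt (real n) \<le> 0"
            by (rule alternates_constant_path[OF _ k]) (use elim in auto)
          moreover have "0 < (\<eta> j - 2 * \<delta>) * sqrt (real n)" using \<delta>(2) that by (intro mult_pos_pos) auto
          ultimately show "\<omega> \<in> {}" by linarith
        qed
      qed
    qed simp
    then show ?thesis by simp
  qed
  have "\<forall>\<^sub>F n in sequentially. n \<in> S \<longrightarrow> prob (counts_ge n t \<eta> k) \<le> prob (large_step \<delta> n t)"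
    using counts_vs_log_walk[where t = t and \<eta> = \<eta> and k = k, OF \<delta>(1) t \<eta>] eventually_gt_at_top[of 0]
  proof eventually_elim
    case (elim n)
    show ?case using elim(1) S zero[OF elim(2)] by force
  qed
  then have le: "\<forall>\<^sub>F n in inf sequentially (principal S). prob (counts_ge n t \<eta> k) \<le> prob (large_step \<delta> n t)"
    by (simp add: eventually_inf_principal)
  have lim: "((\<lambda>n. prob (large_step \<delta> n t)) \<longlongrightarrow> 0) (inf sequentially (principal S))"
    by (rule tendsto_mono[OF inf_le1 large_step_negligible(2)[where t = t, OF \<delta>(1) t]])
  show ?thesis by (rule tendsto_sandwich[OF _ le tendsto_const lim]) simp
qed

end

section \<open>The limit theorem\<close>

context iid_off_diagonal
begin

text \<open>The factors \<open>c1\<close> and \<open>c2\<close> between the levels of walk and wells leave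
  room for the error \<open>2 * \<delta>\<close> made when eigenvalue counts are replaced by
  alternations.\<close>
theorem tendsto_counts_ge:
  fixes t \<eta> :: "'j::finite \<Rightarrow> real" and B :: "real \<Rightarrow> 'b \<Rightarrow> real"
  assumes bm: "standard_brownian_motion N B" and \<sigma>: "0 \<le> \<sigma>" "\<sigma>\<^sup>2 = variance (\<lambda>\<omega>. ln \<bar>a 1 \<omega>\<bar>)"
    and t: "\<And>j. 0 < t j" and \<eta>: "\<And>j. 0 < \<eta> j" and S: "\<And>n j. n \<in> S \<Longrightarrow> odd \<lfloor>t j * real n\<rfloor>"
  shows "((\<lambda>n. prob (counts_ge n t \<eta> k)) \<longlongrightarrow>
    measure N {\<omega> \<in> space N. \<forall>j. k j \<le> max_disjoint_wells (\<lambda>s. \<sigma> * B s \<omega>) (t j) (\<eta> j)})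
    (inf sequentially (principal S))"
proof (cases "\<sigma> = 0")
  case True
  interpret N: prob_space N by (rule brownian_prob_space[OF bm])
  have wells: "max_disjoint_wells (\<lambda>s. \<sigma> * B s \<omega>) (t j) (\<eta> j) = 0" for \<omega> j
    using max_disjoint_wells_const[OF \<eta>, of 0 "t j" j] True by simp
  show ?thesis
  proof (cases "\<forall>j. k j = 0")
    case True
    then have "counts_ge n t \<eta> k = space M" for n by (simp add: counts_ge_def)
    then show ?thesis using True by (simp add: prob_space N.prob_space)
  next
    case False
    then obtain j where j: "0 < k j" by auto
    then have empty: "{\<omega> \<in> space N. \<forall>j. k j \<le> max_disjoint_wells (\<lambda>s. \<sigma> * B s \<omega>) (t j) (\<eta> j)} = {}"
      unfolding wells by (auto simp: not_le)
    have var: "variance (\<lambda>\<omega>. ln \<bar>a 1 \<omega>\<bar>) = 0" using \<sigma>(2) True by simp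
    show ?thesis unfolding empty measure_empty
      by (rule tendsto_counts_ge_degenerate[where t = t and \<eta> = \<eta> and k = k and S = S, OF var t \<eta> S j])
  qed
next
  case False
  then have \<sigma>0: "0 < \<sigma>" using \<sigma>(1) by simp
  interpret W: standardized_walk M "step \<sigma>" "distr M borel (step \<sigma> 0)"
    by (rule standardized_walk_step[OF \<sigma>0 \<sigma>(2)])
  have \<eta>\<sigma>: "0 < \<eta> j / \<sigma>" for j using \<eta>[of j] \<sigma>0 by simp
  let ?A = "measure N (brownian_wells N B (\<lambda>j. \<eta> j / \<sigma>) t k)"
  have A: "{\<omega> \<in> space N. \<forall>j. k j \<le> max_disjoint_wells (\<lambda>s. \<sigma> * B s \<omega>) (t j) (\<eta> j)} =
      brownian_wells N B (\<lambda>j. \<eta> j / \<sigma>) t k"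
    by (simp add: brownian_wells_def max_disjoint_wells_scale[OF \<sigma>0])
  show ?thesis unfolding A
  proof (rule tendstoI)
    fix e :: real assume e: "0 < e"
    then have e3: "0 < e / 3" by simp
    obtain c1 where c1: "1 < c1"
      "\<forall>\<^sub>F r in at_top. prob (W.walk_alternates r (\<lambda>j. \<eta> j / \<sigma> / c1) t k) \<le> ?A + e / 3"
      using W.walk_alternates_le_wells[where t = t and \<eta> = "\<lambda>j. \<eta> j / \<sigma>" and k = k, OF bm t \<eta>\<sigma> e3] by blast
    obtain c2 where c2: "1 < c2"
      "\<forall>\<^sub>F r in at_top. ?A \<le> prob (W.walk_alternates r (\<lambda>j. c2 * (\<eta> j / \<sigma>)) t k) + e / 3"
      using W.wells_le_walk_alternates[where t = t and \<eta> = "\<lambda>j. \<eta> j / \<sigma>" and k = k, OF bm t \<eta>\<sigma> e3] by blast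
    \<comment> \<open>the room between the levels, halved because the error is \<open>2 *
      \<delta>\<close>\<close>
    define \<theta> where "\<theta> j = min ((\<eta> j - \<eta> j / c1) / 2) ((c2 * \<eta> j - \<eta> j) / 2)" for j
    have \<theta>: "0 < \<theta> j" for j
      using \<eta>[of j] c1(1) c2(1) by (simp add: \<theta>_def divide_less_eq)
    define \<delta> where "\<delta> = Min (range \<theta>)"
    have \<delta>: "0 < \<delta>" unfolding \<delta>_def using \<theta> by (subst Min_gr_iff) auto
    have le: "\<delta> \<le> \<theta> j" for j unfolding \<delta>_def by (rule Min_le) auto
    have below: "\<eta> j / \<sigma> / c1 \<le> (\<eta> j - 2 * \<delta>) / \<sigma>" for j
    proof -
      have "\<eta> j / c1 \<le> \<eta> j - 2 * \<delta>" using le[of j] by (simp add: \<theta>_def)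
      then have "\<eta> j / c1 / \<sigma> \<le> (\<eta> j - 2 * \<delta>) / \<sigma>" using \<sigma>0 by (intro divide_right_mono) auto
      then show ?thesis by (simp add: mult.commute)
    qed
    have above: "(\<eta> j + 2 * \<delta>) / \<sigma> \<le> c2 * (\<eta> j / \<sigma>)" for j
    proof -
      have "\<eta> j + 2 * \<delta> \<le> c2 * \<eta> j" using le[of j] by (simp add: \<theta>_def)
      then have "(\<eta> j + 2 * \<delta>) / \<sigma> \<le> c2 * \<eta> j / \<sigma>" using \<sigma>0 by (intro divide_right_mono) auto
      then show ?thesis by simp
    qed
    have half: "filterlim (\<lambda>n. real n / 2) at_top sequentially"
      by (rule filterlim_compose[OF filterlim_divide_const_at_top filterlim_real_sequentially]) simp
    have "(\<lambda>n. prob (large_step \<delta> n t)) \<longlonglongrightarrow> 0" by (rule large_step_negligible(2)[OF \<delta> t])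
    from order_tendstoD(2)[OF this e3]
    have "\<forall>\<^sub>F n in sequentially. (\<forall>j. odd \<lfloor>t j * real n\<rfloor>) \<longrightarrow> dist (prob (counts_ge n t \<eta> k)) ?A < e"
      using counts_vs_log_walk[where t = t and \<eta> = \<eta> and k = k, OF \<delta> t \<eta>]
        eventually_compose_filterlim[OF c1(2) half] eventually_compose_filterlim[OF c2(2) half]
    proof eventually_elim
      case (elim n)
      show ?case
      proof
        assume "\<forall>j. odd \<lfloor>t j * real n\<rfloor>"
        then have up: "prob (counts_ge n t \<eta> k) \<le> prob (log_walk_alternates n t (\<lambda>j. \<eta> j - 2 * \<delta>) k) + prob (large_step \<delta> n t)"
          and low: "prob (log_walk_alternates n t (\<lambda>j. \<eta> j + 2 * \<delta>) k) \<le> prob (counts_ge n t \<eta> k) + prob (large_step \<delta> n t)"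
          using elim(2) by blast+
        have "prob (log_walk_alternates n t (\<lambda>j. \<eta> j - 2 * \<delta>) k) \<le> prob (W.walk_alternates (real n / 2) (\<lambda>j. \<eta> j / \<sigma> / c1) t k)"
          unfolding log_walk_alternates_step[OF \<sigma>0 \<sigma>(2)]
          by (intro finite_measure_mono W.walk_alternates_mono W.sets_walk_alternates below) auto
        moreover have "prob (W.walk_alternates (real n / 2) (\<lambda>j. c2 * (\<eta> j / \<sigma>)) t k) \<le> prob (log_walk_alternates n t (\<lambda>j. \<eta> j + 2 * \<delta>) k)"
          unfolding log_walk_alternates_step[OF \<sigma>0 \<sigma>(2)]
          by (intro finite_measure_mono W.walk_alternates_mono W.sets_walk_alternates above) auto
        ultimately show "dist (prob (counts_ge n t \<eta> k)) ?A < e"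
          using up low elim(1,3,4) unfolding dist_real_def by linarith
      qed
    qed
    then have "\<forall>\<^sub>F n in sequentially. n \<in> S \<longrightarrow> dist (prob (counts_ge n t \<eta> k)) ?A < e"
      by (rule eventually_mono) (use S in blast)
    then show "\<forall>\<^sub>F n in inf sequentially (principal S). dist (prob (counts_ge n t \<eta> k)) ?A < e"
      by (simp add: eventually_inf_principal)
  qed
qed

end

theorem theorem1p3:
  fixes M :: "'a measure" and a :: "nat \<Rightarrow> 'a \<Rightarrow> real"
    and N :: "'b measure" and B :: "real \<Rightarrow> 'b \<Rightarrow> real"
    and \<sigma> :: real and t \<eta> :: "'k::finite \<Rightarrow> real" and S :: "nat set"
  assumes "prob_space M"
    and "prob_space.indep_vars M (\<lambda>_. borel) a {1..}"
    and "\<forall>i\<ge>1. distr M borel (a i) = distr M borel (a 1)"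
    and "\<forall>i\<ge>1. AE \<omega> in M. a i \<omega> \<noteq> 0"
    and "integrable M (\<lambda>\<omega>. (ln \<bar>a 1 \<omega>\<bar>)\<^sup>2)"
    and "\<sigma> \<ge> 0" and "\<sigma>\<^sup>2 = prob_space.variance M (\<lambda>\<omega>. ln \<bar>a 1 \<omega>\<bar>)"
    and "standard_brownian_motion N B"
    and "\<forall>j. t j > 0 \<and> \<eta> j > 0"
    and "infinite S" and "\<forall>n\<in>S. \<forall>j. odd \<lfloor>t j * real n\<rfloor>"
  shows "converges_in_distribution
           M (\<lambda>n \<omega>. (\<chi> j. real (eigenvalue_count (\<lambda>i. a i \<omega>) n (t j) (\<eta> j))) :: real ^ 'k)
           N (\<lambda>\<omega>. (\<chi> j. real (max_disjoint_wells (\<lambda>s. \<sigma> * B s \<omega>) (t j) (\<eta> j))))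
           (inf sequentially (principal S))"
proof -
  interpret iid_off_diagonal M a
    unfolding iid_off_diagonal_def iid_off_diagonal_axioms_def using assms(1-5) by blast
  have t: "0 < t j" and \<eta>: "0 < \<eta> j" for j using assms(9) by auto
  have cont: "continuous_on {0..T} (\<lambda>s. \<sigma> * B s \<omega>)" if "\<omega> \<in> space N" for \<omega> T
    by (rule continuous_on_mult_left[OF continuous_on_subset[OF brownian_continuous[OF assms(8) that]]]) auto
  have meas: "(\<lambda>\<omega>. \<sigma> * B s \<omega>) \<in> borel_measurable N" if "0 \<le> s" for s
    by (rule borel_measurable_times[OF borel_measurable_const brownian_measurable[OF assms(8) that]])
  have wells: "{\<omega> \<in> space N. k \<le> max_disjoint_wells (\<lambda>s. \<sigma> * B s \<omega>) (t j) (\<eta> j)} \<in> sets N" for k j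
    by (rule measurable_max_disjoint_wells_ge[where X = "\<lambda>s \<omega>. \<sigma> * B s \<omega>", OF less_imp_le[OF t] \<eta> meas cont])
  have lim: "((\<lambda>n. measure M {\<omega> \<in> space M. \<forall>j. k j \<le> eigenvalue_count (\<lambda>i. a i \<omega>) n (t j) (\<eta> j)}) \<longlongrightarrow>
      measure N {\<omega> \<in> space N. \<forall>j. k j \<le> max_disjoint_wells (\<lambda>s. \<sigma> * B s \<omega>) (t j) (\<eta> j)})
      (inf sequentially (principal S))" for k
    unfolding counts_ge_def[symmetric]
    by (rule tendsto_counts_ge[where t = t and \<eta> = \<eta> and S = S, OF assms(8,6,7) t \<eta>]) (use assms(11) in blast)
  show ?thesis
    by (rule converges_in_distribution_nat_vector[
          where V = "\<lambda>n \<omega> j. eigenvalue_count (\<lambda>i. a i \<omega>) n (t j) (\<eta> j)"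
            and W = "\<lambda>\<omega> j. max_disjoint_wells (\<lambda>s. \<sigma> * B s \<omega>) (t j) (\<eta> j)",
          OF assms(1) brownian_prob_space[OF assms(8)] sets_eigenvalue_count_ge wells lim])
qed

end
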